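(* Suppose that the set $\{x\in\Omega:\ |\bar\Phi(x)|=\alpha\}$ is finite, with elements $\bar x^1,\dots,\bar x^m$ ($m=0$ meaning that it is empty), and that $\bar z'(\bar x^i)\neq 0$ for $i=1,\dots,m$. Then there exist constants $C,h_0>0$ such that for all $h\in(0,h_0]$ the optimal state $\bar u$ of Problem (P) and the optimal state $\bar u_h$ of the variationally discretized Problem (P$_{\rm vd}$) satisfy $$\|\bar u_h-\bar u\|_{L^2(\Omega)}\le C h^2 .$$
   Context: Continuous problem (P). Let $\Omega=(0,1)$, $V=H^1_0(\Omega)$, and let $Q=BV(\Omega)$ be the space of all $q\in L^1(\Omega)$ whose distributional derivative $q'$ is a finite signed Radon measure on $\Omega$, normed by $\|q\|_{BV(\Omega)}=\|q\|_{L^1(\Omega)}+\|q'\|_{\mathcal M(\Omega)}$, where $\|\cdot\|_{\mathcal M(\Omega)}$ is the total variation norm on the space $\mathcal M(\Omega)$ of finite signed Radon measures on $\Omega$. Fix $\alpha>0$, $u_d\in L^\infty(\Omega)$, $a\in C^{0,1}(\bar\Omega)$ with $a(x)\ge\nu>0$ on $\bar\Omega$, and $d_0\in L^\infty(\Omega)$ with $d_0\ge 0$ a.e. Let $\mathfrak a(v,w)=(av',w')_{L^2(\Omega)}+(d_0v,w)_{L^2(\Omega)}$ for $v,w\in V$. For $q\in Q$ let $Sq\in V$ be the unique solution of $\mathfrak a(Sq,w)=(q,w)_{L^2(\Omega)}$ for all $w\in V$. Problem (P) is $\min_{q\in Q}j(q)$ with $j(q)=\frac12\|Sq-u_d\|_{L^2(\Omega)}^2+\alpha\|q'\|_{\mathcal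 M(\Omega)}$. It has a unique solution $\bar q$; $\bar u=S\bar q$ is the optimal state, the adjoint state $\bar z\in V\cap W^{2,\infty}(\Omega)$ is the solution of $\mathfrak a(w,\bar z)=(w,\bar u-u_d)_{L^2(\Omega)}$ for all $w\in V$, and $\bar\Phi(x)=\int_0^x\bar z(s)\,ds$ for $x\in[0,1]$. Variational discretization (P$_{\rm vd}$). Take a partition $0=x_0<x_1<\dots<x_l=1$, $l>1$, with mesh width $h=\max_i (x_i-x_{i-1})$, and let $V_h\subset V$ be the space of continuous functions on $[0,1]$ that vanish at $0$ and $1$ and are affine on each $(x_{i-1},x_i)$. For $q\in Q$ let $S_hq\in V_h$ be the unique solution of $\mathfrak a(S_hq,w_h)=(q,w_h)_{L^2(\Omega)}$ for all $w_h\in V_h$. Problem (P$_{\rm vd}$) is $\min_{q\in Q}j_h(q)$ with $j_h(q)=\frac12\|S_hq-u_d\|_{L^2(\Omega)}^2+\alpha\|q'\|_{\mathcal M(\Omega)}$. $\bar q_h\in Q$ denotes an optimal control and $\bar u_h=S_h\bar q_h$ the optimal state. "For all $h\in(0,h_0]$" means for all partitions with mesh width $h\le h_0$; the constants $C$ and $h_0$ do not depend on the partition. *)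

theory Defs
  imports "HOL-Analysis.Analysis"
begin

text \<open>Elements of Lebesgue and Sobolev spaces on \<open>\<Omega> = (0,1)\<close> are represented by functions
  \<open>real \<Rightarrow> real\<close>; only their values on \<open>\<Omega>\<close>, up to null sets, matter.\<close>

abbreviation Om :: "real set" ("\<Omega>")
  where "\<Omega> \<equiv> {0<..<1}"

subsection \<open>Function spaces\<close>

definition L1 :: "(real \<Rightarrow> real) set"
  where "L1 = {f. integrable (lebesgue_on \<Omega>) f}"

definition L2 :: "(real \<Rightarrow> real) set"
  where "L2 = {f \<in> borel_measurable (lebesgue_on \<Omega>). integrable (lebesgue_on \<Omega>) (\<lambda>x. (f x)\<^sup>2)}"

definition Linf :: "(real \<Rightarrow> real) set"
  where "Linf = {f \<in> borel_measurable (lebesgue_on \<Omega>). \<exists>B. AE x in lebesgue_on \<Omega>. \<bar>f x\<bar> \<le> B}"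

definition L2_inner :: "(real \<Rightarrow> real) \<Rightarrow> (real \<Rightarrow> real) \<Rightarrow> real"
  where "L2_inner f g = (LINT x|lebesgue_on \<Omega>. f x * g x)"

definition norm_L2 :: "(real \<Rightarrow> real) \<Rightarrow> real"
  where "norm_L2 f = sqrt (LINT x|lebesgue_on \<Omega>. (f x)\<^sup>2)"

text \<open>The test functions \<open>C\<^sub>c\<^sup>\<infinity>(\<Omega>)\<close>, extended by zero to the real line.\<close>

definition test_funs :: "(real \<Rightarrow> real) set"
  where "test_funs = {\<phi>. (\<forall>n x. ((deriv ^^ n) \<phi>) differentiable (at x)) \<and>
    (\<exists>c d. 0 < c \<and> c \<le> d \<and> d < 1 \<and> (\<forall>x. x \<notin> {c..d} \<longrightarrow> \<phi> x = 0))}"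

definition has_weak_deriv :: "(real \<Rightarrow> real) \<Rightarrow> (real \<Rightarrow> real) \<Rightarrow> bool"
  where "has_weak_deriv f g \<longleftrightarrow> f \<in> L1 \<and> g \<in> L1 \<and>
    (\<forall>\<phi>\<in>test_funs. L2_inner f (deriv \<phi>) = - L2_inner g \<phi>)"

text \<open>The weak derivative is unique up to null sets.\<close>

definition weak_deriv :: "(real \<Rightarrow> real) \<Rightarrow> real \<Rightarrow> real"
  where "weak_deriv f = (SOME g. has_weak_deriv f g)"

text \<open>\<open>H\<^sup>1\<^sub>0(\<Omega>)\<close> is the closure of the test functions in the norm of \<open>H\<^sup>1(\<Omega>)\<close>.\<close>

definition H1 :: "(real \<Rightarrow> real) set"
  where "H1 = {v \<in> L2. \<exists>g\<in>L2. has_weak_deriv v g}"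

definition norm_H1 :: "(real \<Rightarrow> real) \<Rightarrow> real"
  where "norm_H1 v = sqrt ((norm_L2 v)\<^sup>2 + (norm_L2 (weak_deriv v))\<^sup>2)"

definition H10 :: "(real \<Rightarrow> real) set"
  where "H10 = {v \<in> H1. \<exists>\<phi>. (\<forall>n::nat. \<phi> n \<in> test_funs) \<and>
    (\<lambda>n. norm_H1 (\<lambda>x. \<phi> n x - v x)) \<longlonglongrightarrow> 0}"

subsection \<open>Functions of bounded variation\<close>

text \<open>A finite signed Radon measure on \<open>\<Omega>\<close> is given as a difference \<open>M - N\<close> of two finite
  Borel measures on \<open>\<Omega>\<close> (finite Borel measures on an interval are Radon). The pair
  \<open>(M, N)\<close> is not unique, the set function \<open>E \<mapsto> measure M E - measure N E\<close> is what matters.\<close>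

definition finite_borel_measure_on_Om :: "real measure \<Rightarrow> bool"
  where "finite_borel_measure_on_Om M \<longleftrightarrow>
    finite_measure M \<and> sets M = sets (restrict_space borel \<Omega>)"

definition has_deriv_measure :: "(real \<Rightarrow> real) \<Rightarrow> real measure \<Rightarrow> real measure \<Rightarrow> bool"
  where "has_deriv_measure q M N \<longleftrightarrow>
    finite_borel_measure_on_Om M \<and> finite_borel_measure_on_Om N \<and>
    (\<forall>\<phi>\<in>test_funs. L2_inner q (deriv \<phi>) = - ((LINT x|M. \<phi> x) - (LINT x|N. \<phi> x)))"

definition BV :: "(real \<Rightarrow> real) set"
  where "BV = {q \<in> L1. \<exists>M N. has_deriv_measure q M N}"

text \<open>The total variation norm of the signed measure \<open>M - N\<close>: the supremum over all finite
  partitions of \<open>\<Omega>\<close> into Borel sets.\<close>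

definition total_variation :: "real measure \<Rightarrow> real measure \<Rightarrow> real"
  where "total_variation M N =
    (SUP P \<in> {P. finite P \<and> partition_on \<Omega> P \<and> P \<subseteq> sets (restrict_space borel \<Omega>)}.
      \<Sum>E\<in>P. \<bar>measure M E - measure N E\<bar>)"

text \<open>\<open>\<parallel>q'\<parallel>\<close> in the space of measures, for \<open>q \<in> BV\<close>; the signed measure \<open>q'\<close> is determined by
  \<open>q\<close>.\<close>

definition norm_deriv_M :: "(real \<Rightarrow> real) \<Rightarrow> real"
  where "norm_deriv_M q = (THE t. \<exists>M N. has_deriv_measure q M N \<and> t = total_variation M N)"

subsection \<open>State equation and optimal control problems\<close>

definition bform :: "(real \<Rightarrow> real) \<Rightarrow> (real \<Rightarrow> real) \<Rightarrow> (real \<Rightarrow> real) \<Rightarrow> (real \<Rightarrow> real) \<Rightarrow> real"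
  where "bform a d\<^sub>0 v w =
    L2_inner (\<lambda>x. a x * weak_deriv v x) (weak_deriv w) + L2_inner (\<lambda>x. d\<^sub>0 x * v x) w"

text \<open>The solution operator with trial and test space \<open>W\<close>: \<open>W = H10\<close> gives \<open>S\<close>, and \<open>W = V\<^sub>h\<close>
  gives \<open>S\<^sub>h\<close>. The solution is unique up to null sets, whence the choice operator.\<close>

definition sol_op ::
  "(real \<Rightarrow> real) set \<Rightarrow> (real \<Rightarrow> real) \<Rightarrow> (real \<Rightarrow> real) \<Rightarrow> (real \<Rightarrow> real) \<Rightarrow> real \<Rightarrow> real"
  where "sol_op W a d\<^sub>0 q = (SOME u. u \<in> W \<and> (\<forall>w\<in>W. bform a d\<^sub>0 u w = L2_inner q w))"

definition cost ::
  "(real \<Rightarrow> real) set \<Rightarrow> (real \<Rightarrow> real) \<Rightarrow> (real \<Rightarrow> real) \<Rightarrow> (real \<Rightarrow> real) \<Rightarrow> real \<Rightarrow> (real \<Rightarrow> real) \<Rightarrow> real"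
  where "cost W a d\<^sub>0 u\<^sub>d \<alpha> q =
    1/2 * (norm_L2 (\<lambda>x. sol_op W a d\<^sub>0 q x - u\<^sub>d x))\<^sup>2 + \<alpha> * norm_deriv_M q"

definition optimal_control ::
  "(real \<Rightarrow> real) set \<Rightarrow> (real \<Rightarrow> real) \<Rightarrow> (real \<Rightarrow> real) \<Rightarrow> (real \<Rightarrow> real) \<Rightarrow> real \<Rightarrow> (real \<Rightarrow> real) \<Rightarrow> bool"
  where "optimal_control W a d\<^sub>0 u\<^sub>d \<alpha> q\<^sub>o \<longleftrightarrow>
    q\<^sub>o \<in> BV \<and> (\<forall>q\<in>BV. cost W a d\<^sub>0 u\<^sub>d \<alpha> q\<^sub>o \<le> cost W a d\<^sub>0 u\<^sub>d \<alpha> q)"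

text \<open>\<open>z\<close> is the continuous representative of the adjoint state belonging to the state \<open>u\<close>.
  Since the adjoint state lies in \<open>W\<^sup>2\<^sup>,\<^sup>\<infinity>(\<Omega>)\<close>, this representative is continuously
  differentiable, so that \<open>deriv z\<close> is its derivative at every point of \<open>\<Omega>\<close>.\<close>

definition adjoint_state ::
  "(real \<Rightarrow> real) \<Rightarrow> (real \<Rightarrow> real) \<Rightarrow> (real \<Rightarrow> real) \<Rightarrow> (real \<Rightarrow> real) \<Rightarrow> (real \<Rightarrow> real) \<Rightarrow> bool"
  where "adjoint_state a d\<^sub>0 u\<^sub>d u z \<longleftrightarrow> continuous_on {0..1} z \<and> z \<in> H10 \<and>
    (\<forall>w\<in>H10. bform a d\<^sub>0 w z = L2_inner w (\<lambda>x. u x - u\<^sub>d x))"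

subsection \<open>Finite elements\<close>

definition is_partition :: "nat \<Rightarrow> (nat \<Rightarrow> real) \<Rightarrow> bool"
  where "is_partition l x \<longleftrightarrow> 1 < l \<and> x 0 = 0 \<and> x l = 1 \<and> (\<forall>i\<in>{1..l}. x (i - 1) < x i)"

definition mesh_width :: "nat \<Rightarrow> (nat \<Rightarrow> real) \<Rightarrow> real"
  where "mesh_width l x = (MAX i\<in>{1..l}. x i - x (i - 1))"

definition FE_space :: "nat \<Rightarrow> (nat \<Rightarrow> real) \<Rightarrow> (real \<Rightarrow> real) set"
  where "FE_space l x = {v. continuous_on {0..1} v \<and> v 0 = 0 \<and> v 1 = 0 \<and>
    (\<forall>i\<in>{1..l}. \<exists>b c. \<forall>t\<in>{x (i - 1)<..<x i}. v t = b * t + c)}"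

end

theory Submission
  imports Defs
begin

text \<open>
  The proof compares the optimality conditions of the two problems. With \<open>z\<close> the adjoint state
  and \<open>\<Phi>\<close> its primitive, optimality of \<open>q\<close> means that \<open>\<Phi>\<close> vanishes at both ends, that \<open>\<bar>\<Phi>\<bar> \<le> \<alpha>\<close>, and that the
  pairing of \<open>\<Phi>\<close> with the measure \<open>q'\<close> attains the value \<open>\<alpha> \<parallel>q'\<parallel>\<close> (\<open>optimality\<close>). Hence \<open>q\<close> is constant on every interval
  on which \<open>\<bar>\<Phi>\<bar> < \<alpha>\<close> (\<open>opt_constant\<close>). The same holds for the discrete problem, with the discrete
  adjoint state, because these conditions are derived for any space in which the state equation
  is solved.

  Write \<open>e\<close> for the \<open>L\<^sup>2\<close> error of the states, \<open>h\<close> for the mesh width and \<open>r = q\<^sub>h - q\<close>. Testing each of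
  the two variational inequalities with the solution of the other problem and adding them gives
  \<open>e\<^sup>2 \<le> C h\<^sup>2 e + C h\<^sup>2 \<parallel>r\<parallel>\<close>, with the \<open>L\<^sup>1\<close> norm of \<open>r\<close> (\<open>basic_estimate\<close>). The factors \<open>h\<^sup>2\<close> come from a pointwise
  estimate of the finite element error for bounded right-hand sides (\<open>FE_error\<close>). Since the discrete
  controls are uniformly bounded (\<open>control_bound\<close>), this alone yields \<open>e \<le> C h\<close>. The assumption on the active set improves
  it to \<open>\<parallel>r\<parallel> \<le> C (e + h\<^sup>2)\<close>, from which \<open>e \<le> C h\<^sup>2\<close> follows at once. The improvement has two parts. The adjoint states differ
  by at most \<open>\<delta> = C (e + h\<^sup>2)\<close> uniformly, and \<open>z\<close> has simple zeros at the finitely many points where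
  \<open>\<bar>\<Phi>\<bar> = \<alpha>\<close>; so all jumps of \<open>q\<^sub>h\<close> lie within a distance \<open>C \<delta>\<close> of these points (\<open>active_set_stability\<close>).
  Away from these neighbourhoods \<open>r\<close> is constant between neighbouring points, and testing the state
  equation with a suitable function supported there bounds this constant by the \<open>L\<^sup>2\<close> difference
  of the states, again by \<open>C (e + h\<^sup>2)\<close> (\<open>local_constant_bound\<close>).

  Sobolev functions are handled as primitives: every element of \<open>H\<^sup>1\<^sub>0\<close> is the primitive of a square
  integrable function with mean zero (\<open>H10_ac0\<close>), and conversely every such primitive with bounded derivative
  belongs to \<open>H\<^sup>1\<^sub>0\<close> (\<open>ac0_H10\<close>). In one dimension the state equation, integrated once, is a Volterra integral equation, whose
  solution by a Neumann series brings existence, the regularity of the states and Green's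
  functions at the same time (\<open>bvp_exists\<close>).\<close>


section \<open>Smooth functions and test functions\<close>

definition smooth :: "(real \<Rightarrow> real) \<Rightarrow> bool"
  where "smooth f \<longleftrightarrow> (\<forall>n x. ((deriv ^^ n) f) differentiable (at x))"

text \<open>Smoothness is proved by exhibiting a family of functions that is closed under differentiation.\<close>

lemma smooth_coinduct:
  assumes "f \<in> F" and "\<And>g. g \<in> F \<Longrightarrow> (\<exists>g'\<in>F. \<forall>x. (g has_real_derivative g' x) (at x))"
  shows "smooth f"
proof -
  have cl: "deriv g \<in> F" "g differentiable (at x)" if g: "g \<in> F" for g x
  proof -
    obtain g' where g': "g' \<in> F" "\<forall>x. (g has_real_derivative g' x) (at x)"
      using assms(2)[OF g] by blast
    then have "deriv g = g'" by (auto intro: DERIV_imp_deriv)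
    then show "deriv g \<in> F" using g' by simp
    show "g differentiable (at x)"
      using g' real_differentiable_def by blast
  qed
  have "(deriv ^^ n) f \<in> F" for n
    by (induction n) (auto simp: assms(1) cl)
  then show ?thesis unfolding smooth_def using cl by blast
qed

lemma smooth_deriv: "smooth f \<Longrightarrow> smooth (deriv f)"
  unfolding smooth_def by (metis funpow_swap1 funpow.simps(2) o_apply)

lemma smooth_has_deriv: "smooth f \<Longrightarrow> (f has_real_derivative deriv f x) (at x)"
  unfolding smooth_def
  by (metis DERIV_deriv_iff_real_differentiable funpow_0)

lemma smooth_continuous: "smooth f \<Longrightarrow> continuous_on S f"
  by (meson DERIV_continuous_on has_field_derivative_at_within smooth_has_deriv)

lemma smooth_const: "smooth (\<lambda>x. c)"
  by (rule smooth_coinduct[where F="range (\<lambda>c x. c)"]) (auto intro!: exI[of _ 0])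

lemma smooth_add: assumes "smooth f" "smooth g" shows "smooth (\<lambda>x. f x + g x)"
proof (rule smooth_coinduct[where F="{\<lambda>x. f x + g x |f g. smooth f \<and> smooth g}"])
  show "(\<lambda>x. f x + g x) \<in> {\<lambda>x. f x + g x |f g. smooth f \<and> smooth g}" using assms by blast
  fix k assume "k \<in> {\<lambda>x. f x + g x |f g. smooth f \<and> smooth g}"
  then obtain f g where k: "k = (\<lambda>x. f x + g x)" "smooth f" "smooth g" by blast
  then show "\<exists>g'\<in>{\<lambda>x. f x + g x |f g. smooth f \<and> smooth g}. \<forall>x. (k has_real_derivative g' x) (at x)"
    by (intro bexI[of _ "\<lambda>x. deriv f x + deriv g x"])
      (auto intro!: derivative_eq_intros smooth_has_deriv smooth_deriv)
qed

text \<open>Products of smooth functions alone are not closed under differentiation; their sums are.\<close>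

inductive_set product_sums :: "(real \<Rightarrow> real) set" where
  prod: "smooth f \<Longrightarrow> smooth g \<Longrightarrow> (\<lambda>x. f x * g x) \<in> product_sums"
| sum: "f \<in> product_sums \<Longrightarrow> g \<in> product_sums \<Longrightarrow> (\<lambda>x. f x + g x) \<in> product_sums"

lemma smooth_mult: assumes "smooth f" "smooth g" shows "smooth (\<lambda>x. f x * g x)"
proof (rule smooth_coinduct[where F="product_sums"])
  show "(\<lambda>x. f x * g x) \<in> product_sums" using assms by (rule product_sums.prod)
  fix k assume "k \<in> product_sums"
  then show "\<exists>g'\<in>product_sums. \<forall>x. (k has_real_derivative g' x) (at x)"
  proof induction
    case (prod f g)
    show ?case
      by (intro bexI[of _ "\<lambda>x. deriv f x * g x + f x * deriv g x"] allI product_sums.intros prod smooth_deriv)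
        (auto intro!: derivative_eq_intros smooth_has_deriv prod)
  next
    case (sum f g)
    then obtain f' g' where "f' \<in> product_sums" "\<forall>x. (f has_real_derivative f' x) (at x)"
      "g' \<in> product_sums" "\<forall>x. (g has_real_derivative g' x) (at x)" by blast
    then show ?case
      by (intro bexI[of _ "\<lambda>x. f' x + g' x"] allI product_sums.intros)
        (auto intro!: derivative_eq_intros)
  qed
qed

lemma smooth_cmult: "smooth f \<Longrightarrow> smooth (\<lambda>x. c * f x)"
  by (rule smooth_mult[OF smooth_const])

lemma smooth_diff: assumes "smooth f" "smooth g" shows "smooth (\<lambda>x. f x - g x)"
  using smooth_add[OF assms(1) smooth_cmult[OF assms(2), of "-1"]] by simp

lemma smooth_power: "smooth f \<Longrightarrow> smooth (\<lambda>x. f x ^ n)"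
  by (induction n) (auto intro: smooth_const smooth_mult)

lemma smooth_affine: assumes "smooth f" shows "smooth (\<lambda>x. f (s * x + t))"
proof (rule smooth_coinduct[where F="{\<lambda>x. k * f (s * x + t) |f k. smooth f}"])
  have "(\<lambda>x. f (s * x + t)) = (\<lambda>x. 1 * f (s * x + t))" by simp
  then show "(\<lambda>x. f (s * x + t)) \<in> {\<lambda>x. k * f (s * x + t) |f k. smooth f}"
    using assms by blast
  fix g assume "g \<in> {\<lambda>x. k * f (s * x + t) |f k. smooth f}"
  then obtain f k where k: "g = (\<lambda>x. k * f (s * x + t))" "smooth f" by blast
  show "\<exists>g'\<in>{\<lambda>x. k * f (s * x + t) |f k. smooth f}. \<forall>x. (g has_real_derivative g' x) (at x)"
  proof (intro bexI[of _ "\<lambda>x. (k * s) * deriv f (s * x + t)"] allI)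
    fix x
    have "((\<lambda>x. f (s * x + t)) has_real_derivative deriv f (s * x + t) * s) (at x)"
      by (rule DERIV_chain2[OF smooth_has_deriv[OF k(2)]]) (auto intro!: derivative_eq_intros)
    from DERIV_cmult[OF this, of k] show "(g has_real_derivative (k * s) * deriv f (s * x + t)) (at x)"
      unfolding k by (simp add: mult_ac)
  qed (use k smooth_deriv in blast)
qed

lemma smooth_ident: "smooth (\<lambda>x. x)"
proof (rule smooth_coinduct[where F="insert (\<lambda>x. x) (range (\<lambda>c x. c))"])
  fix g :: "real \<Rightarrow> real" assume "g \<in> insert (\<lambda>x. x) (range (\<lambda>c x. c))"
  then consider "g = (\<lambda>x. x)" | c where "g = (\<lambda>x. c)" by blast
  then show "\<exists>g'\<in>insert (\<lambda>x. x) (range (\<lambda>c x. c)). \<forall>x. (g has_real_derivative g' x) (at x)"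
  proof cases
    case 1
    then show ?thesis by (intro bexI[of _ "\<lambda>x. 1"]) auto
  next
    case 2
    then show ?thesis by (intro bexI[of _ "\<lambda>x. 0"]) auto
  qed
qed simp

lemma smooth_real_polynomial: "real_polynomial_function p \<Longrightarrow> smooth p"
proof (induction rule: real_polynomial_function.induct)
  case (linear f)
  then obtain c where "f = (\<lambda>x. x * c)"
    using real_bounded_linear by blast
  then show ?case using smooth_mult[OF smooth_ident smooth_const] by simp
qed (auto intro: smooth_const smooth_add smooth_mult)

lemma poly_exp_tendsto_0: "((\<lambda>y::real. poly p y * exp (- y)) \<longlongrightarrow> 0) at_top"
proof -
  have "((\<lambda>y::real. \<Sum>i\<le>degree p. coeff p i * (y ^ i / exp y)) \<longlongrightarrow> (\<Sum>i\<le>degree p. coeff p i * 0)) at_top"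
    by (intro tendsto_sum tendsto_mult tendsto_const tendsto_power_div_exp_0)
  then show ?thesis
    by (simp add: poly_altdef sum_distrib_left exp_minus divide_inverse mult_ac)
qed

text \<open>The functions \<open>p (1/x) exp (-1/x)\<close> on the positive half-axis, for polynomials \<open>p\<close>.\<close>

definition flat_exp :: "real poly \<Rightarrow> real \<Rightarrow> real"
  where "flat_exp p x = (if x > 0 then poly p (inverse x) * exp (- inverse x) else 0)"

text \<open>All derivatives of \<open>exp (-1/x)\<close> are of the form \<open>p (1/x) exp (-1/x)\<close>, and each of these
  functions vanishes to first order at \<open>0\<close>, so that continuation by zero keeps the family closed
  under differentiation.\<close>

lemma flat_exp_deriv:
  "(flat_exp p has_real_derivative flat_exp (pCons 0 (pCons 0 (p - pderiv p))) x) (at x)"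
proof -
  consider "x > 0" | "x < 0" | "x = 0" by linarith
  then show ?thesis
  proof cases
    case 1
    have "((\<lambda>x. poly p (inverse x) * exp (- inverse x)) has_real_derivative
        flat_exp (pCons 0 (pCons 0 (p - pderiv p))) x) (at x)"
      using 1 by (auto intro!: derivative_eq_intros simp: flat_exp_def field_simps power2_eq_square)
    then show ?thesis
      by (rule has_field_derivative_transform_within_open[where S="{0<..}"])
        (use 1 in \<open>auto simp: flat_exp_def\<close>)
  next
    case 2
    have "((\<lambda>x. 0) has_real_derivative flat_exp (pCons 0 (pCons 0 (p - pderiv p))) x) (at x)"
      using 2 by (auto simp: flat_exp_def)
    then show ?thesis
      by (rule has_field_derivative_transform_within_open[where S="{..<0}"])
        (use 2 in \<open>auto simp: flat_exp_def\<close>)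
  next
    case 3
    have l: "((\<lambda>h. (flat_exp p (0 + h) - flat_exp p 0) / h) \<longlongrightarrow> 0) (at_left 0)"
      by (rule tendsto_eventually) (auto simp: flat_exp_def eventually_at_left_field intro: exI[of _ "-1"])
    have "((\<lambda>h. poly (pCons 0 p) (inverse h) * exp (- inverse h)) \<longlongrightarrow> 0) (at_right (0::real))"
      using filterlim_compose[OF poly_exp_tendsto_0 filterlim_inverse_at_top_right] by blast
    moreover have "\<forall>\<^sub>F h in at_right 0. poly (pCons 0 p) (inverse h) * exp (- inverse h)
        = (flat_exp p (0 + h) - flat_exp p 0) / h"
      unfolding eventually_at_right_field
      by (intro exI[of _ 1]) (auto simp: flat_exp_def field_simps)
    ultimately have r: "((\<lambda>h. (flat_exp p (0 + h) - flat_exp p 0) / h) \<longlongrightarrow> 0) (at_right 0)"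
      by (rule Lim_transform_eventually)
    have "((\<lambda>h. (flat_exp p (0 + h) - flat_exp p 0) / h) \<longlongrightarrow> 0) (at 0)"
      using l r by (simp add: filterlim_split_at_real)
    moreover have "flat_exp (pCons 0 (pCons 0 (p - pderiv p))) 0 = 0" by (simp add: flat_exp_def)
    ultimately show ?thesis unfolding 3 by (simp add: DERIV_def)
  qed
qed

lemma smooth_flat_exp: "smooth (flat_exp p)"
  by (rule smooth_coinduct[where F="range flat_exp"]) (auto intro: flat_exp_deriv)

definition bump :: "real \<Rightarrow> real \<Rightarrow> real \<Rightarrow> real"
  where "bump c d x = flat_exp 1 (x - c) * flat_exp 1 (d - x)"

lemma smooth_bump: "smooth (bump c d)"
  using smooth_mult[OF smooth_affine[OF smooth_flat_exp, of 1 1 "-c"] smooth_affine[OF smooth_flat_exp, of 1 "-1" d]]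
  by (simp add: bump_def[abs_def])

lemma bump_bounds: "0 \<le> bump c d x" "bump c d x \<le> 1"
  and bump_pos: "c < x \<Longrightarrow> x < d \<Longrightarrow> 0 < bump c d x"
  and bump_zero: "x \<le> c \<or> d \<le> x \<Longrightarrow> bump c d x = 0"
  by (auto simp: bump_def flat_exp_def intro!: mult_le_one)

text \<open>The polynomial \<open>1 - (1 - y)\<^sup>n\<close> vanishes at \<open>0\<close> and tends to \<open>1\<close> for \<open>0 < y \<le> 1\<close>; applied to a bump
  function it yields smooth approximations of the indicator function of an interval.\<close>

definition cutoff :: "nat \<Rightarrow> real \<Rightarrow> real \<Rightarrow> real \<Rightarrow> real"
  where "cutoff n c d x = 1 - (1 - bump c d x) ^ n"

lemma smooth_cutoff: "smooth (cutoff n c d)"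
  unfolding cutoff_def[abs_def]
  by (intro smooth_diff smooth_const smooth_power smooth_bump)

lemma cutoff_bounds: "0 \<le> cutoff n c d x" "cutoff n c d x \<le> 1"
  using bump_bounds[of c d x] by (auto simp: cutoff_def power_le_one)

lemma cutoff_zero: "x \<le> c \<or> d \<le> x \<Longrightarrow> cutoff n c d x = 0"
  by (simp add: cutoff_def bump_zero)

lemma test_funs_iff:
  "\<phi> \<in> test_funs \<longleftrightarrow> smooth \<phi> \<and> (\<exists>c d. 0 < c \<and> c \<le> d \<and> d < 1 \<and> (\<forall>x. x \<notin> {c..d} \<longrightarrow> \<phi> x = 0))"
  by (simp add: test_funs_def smooth_def)

lemma test_funs_smooth: "\<phi> \<in> test_funs \<Longrightarrow> smooth \<phi>"
  by (simp add: test_funs_iff)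

lemma test_fun_cutoff:
  assumes "0 < c" "c \<le> d" "d < 1" shows "cutoff n c d \<in> test_funs"
proof -
  have "\<forall>x. x \<notin> {c..d} \<longrightarrow> cutoff n c d x = 0" by (auto intro: cutoff_zero)
  then show ?thesis using assms unfolding test_funs_iff by (blast intro: smooth_cutoff)
qed

lemma test_funs_smooth_mult:
  assumes "\<phi> \<in> test_funs" "smooth g" shows "(\<lambda>x. \<phi> x * g x) \<in> test_funs"
  using assms by (fastforce simp: test_funs_iff smooth_mult)

lemma test_funs_cmult: "\<phi> \<in> test_funs \<Longrightarrow> (\<lambda>x. c * \<phi> x) \<in> test_funs"
  using test_funs_smooth_mult[OF _ smooth_const[of c]] by (simp add: mult.commute)

lemma test_funs_add:
  assumes "\<phi> \<in> test_funs" "\<psi> \<in> test_funs" shows "(\<lambda>x. \<phi> x + \<psi> x) \<in> test_funs"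
proof -
  obtain c d where 1: "0 < c" "c \<le> d" "d < 1" "\<forall>x. x \<notin> {c..d} \<longrightarrow> \<phi> x = 0"
    using assms by (auto simp: test_funs_iff)
  obtain c' d' where 2: "0 < c'" "c' \<le> d'" "d' < 1" "\<forall>x. x \<notin> {c'..d'} \<longrightarrow> \<psi> x = 0"
    using assms by (auto simp: test_funs_iff)
  show ?thesis unfolding test_funs_iff
    using 1 2 assms
    by (intro conjI smooth_add exI[of _ "min c c'"] exI[of _ "max d d'"]) (auto simp: test_funs_iff min_le_iff_disj le_max_iff_disj)
qed

lemma deriv_zero_outside:
  assumes "\<forall>x. x \<notin> {c..d} \<longrightarrow> \<phi> x = 0" "x \<notin> {c..d::real}" shows "deriv \<phi> x = (0::real)"
proof -
  have "((\<lambda>x. 0::real) has_real_derivative 0) (at x)" by simp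
  then have "(\<phi> has_real_derivative 0) (at x)"
    by (rule has_field_derivative_transform_within_open[where S="-{c..d}"]) (use assms in \<open>auto intro!: open_Compl\<close>)
  then show ?thesis by (rule DERIV_imp_deriv)
qed

lemma test_funs_deriv: "\<phi> \<in> test_funs \<Longrightarrow> deriv \<phi> \<in> test_funs"
  unfolding test_funs_iff using smooth_deriv deriv_zero_outside by blast

lemma test_funs_outside: "\<phi> \<in> test_funs \<Longrightarrow> x \<le> 0 \<or> 1 \<le> x \<Longrightarrow> \<phi> x = 0"
  unfolding test_funs_iff by force

lemma test_funs_continuous: "\<phi> \<in> test_funs \<Longrightarrow> continuous_on S \<phi>"
  by (auto simp: test_funs_iff smooth_continuous)

lemma test_funs_borel: "\<phi> \<in> test_funs \<Longrightarrow> \<phi> \<in> borel_measurable borel"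
  using test_funs_continuous borel_measurable_continuous_onI by blast

lemma test_funs_bounded: assumes "\<phi> \<in> test_funs" obtains B where "B \<ge> 0" "\<And>x. \<bar>\<phi> x\<bar> \<le> B"
proof -
  have "compact (\<phi> ` {0..1})" using assms test_funs_continuous compact_continuous_image by blast
  then obtain B where B: "\<forall>y\<in>\<phi> ` {0..1}. norm y \<le> B" using compact_imp_bounded bounded_iff by metis
  show thesis
  proof (rule that[of "max B 0"])
    fix x show "\<bar>\<phi> x\<bar> \<le> max B 0"
      using B test_funs_outside[OF assms, of x] by (cases "x \<in> {0..1}") (auto simp: le_max_iff_disj)
  qed simp
qed

text \<open>The antiderivative is the building block of the lemma of du Bois-Reymond: a test function is
  the derivative of a test function exactly if its integral vanishes.\<close>

lemma test_funs_antideriv: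
  assumes \<rho>: "smooth \<rho>" and cd: "0 < c" "c \<le> d" "d < 1" and supp: "\<And>x. x \<notin> {c..d} \<Longrightarrow> \<rho> x = 0"
    and int0: "integral {0..1} \<rho> = 0"
  obtains \<phi> where "\<phi> \<in> test_funs" "deriv \<phi> = \<rho>" "\<And>x. x \<notin> {c..d} \<Longrightarrow> \<phi> x = 0"
proof -
  define \<phi> where "\<phi> x = (if x < 0 then 0 else integral {0..x} \<rho>)" for x
  have cont: "continuous_on S \<rho>" for S using \<rho> smooth_continuous by blast
  have low: "\<phi> x = 0" if "x < c" for x
  proof (cases "x < 0")
    case False
    have "integral {0..x} \<rho> = integral {0..x} (\<lambda>_. 0)"
      by (rule integral_cong) (use that supp in auto)
    then show ?thesis using False by (simp add: \<phi>_def)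
  qed (simp add: \<phi>_def)
  have high: "\<phi> x = 0" if "x > d" for x
  proof -
    have z: "integral {s..t} \<rho> = 0" if "s > d" for s t
    proof -
      have "integral {s..t} \<rho> = integral {s..t} (\<lambda>_. 0)"
        by (rule integral_cong) (use that supp in auto)
      then show ?thesis by simp
    qed
    define m where "m = min x 1"
    have m: "m > d" "m \<ge> 0" "m \<le> 1" "m \<le> x" using that cd by (auto simp: m_def)
    have "integral {0..m} \<rho> + integral {m..1} \<rho> = integral {0..1} \<rho>"
      by (rule Henstock_Kurzweil_Integration.integral_combine) (use m cont integrable_continuous_real in auto)
    then have "integral {0..m} \<rho> = 0" using z[of m 1] m int0 by simp
    moreover have "integral {0..m} \<rho> + integral {m..x} \<rho> = integral {0..x} \<rho>"
      by (rule Henstock_Kurzweil_Integration.integral_combine) (use m cont integrable_continuous_real in auto)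
    ultimately show ?thesis using z[of m x] m by (simp add: \<phi>_def)
  qed
  have D: "(\<phi> has_real_derivative \<rho> x) (at x)" for x
  proof (cases "x \<le> 0")
    case True
    have "((\<lambda>x. 0) has_real_derivative \<rho> x) (at x)" using supp[of x] True cd by simp
    then show ?thesis
      by (rule has_field_derivative_transform_within_open[where S="{..<c}"])
        (use True cd low in auto)
  next
    case False
    have "((\<lambda>x. integral {0..x} \<rho>) has_real_derivative \<rho> x) (at x within {0..x+1})"
      using cont False by (intro integral_has_real_derivative) auto
    then have "((\<lambda>x. integral {0..x} \<rho>) has_real_derivative \<rho> x) (at x)"
      using False by (simp add: at_within_Icc_at)
    then show ?thesis
      by (rule has_field_derivative_transform_within_open[where S="{0<..}"])
        (use False in \<open>auto simp: \<phi>_def\<close>)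
  qed
  then have der: "deriv \<phi> = \<rho>" by (auto intro: DERIV_imp_deriv)
  have z: "\<phi> x = 0" if "x \<notin> {c..d}" for x using low high that by force
  have "smooth \<phi>"
  proof (rule smooth_coinduct[where F="insert \<phi> (Collect smooth)"])
    fix g assume "g \<in> insert \<phi> (Collect smooth)"
    then show "\<exists>g'\<in>insert \<phi> (Collect smooth). \<forall>x. (g has_real_derivative g' x) (at x)"
      using D \<rho> smooth_has_deriv smooth_deriv by blast
  qed simp
  then have "\<phi> \<in> test_funs" using z cd by (auto simp: test_funs_iff)
  then show thesis using that der z by blast
qed

section \<open>Integration on the unit interval\<close>

abbreviation lebO :: "real measure" where "lebO \<equiv> lebesgue_on \<Omega>"

lemma space_lebO [simp]: "space lebO = \<Omega>"
  by (simp add: space_restrict_space)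

lemma finite_lebO: "finite_measure lebO"
proof
  have "emeasure lebesgue \<Omega> = 1" by simp
  then show "emeasure lebO (space lebO) \<noteq> \<infinity>" by (simp add: emeasure_restrict_space)
qed

interpretation lebO: finite_measure "lebesgue_on {0<..<1::real}"
  by (rule finite_lebO)

lemma measure_lebO_UNIV [simp]: "measure lebO \<Omega> = 1"
  by (simp add: measure_restrict_space)

lemma lebO_const [simp]: "(LINT x|lebO. c) = (c::real)"
  by (simp add: measure_lebO_UNIV)

lemma AE_lebO_I: "(\<And>x. x \<in> \<Omega> \<Longrightarrow> P x) \<Longrightarrow> AE x in lebO. P x"
  by (rule AE_I2) simp

lemma lebO_measurable_continuous:
  "continuous_on \<Omega> f \<Longrightarrow> f \<in> borel_measurable lebO" for f :: "real \<Rightarrow> real"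
  by (rule continuous_imp_measurable_on_sets_lebesgue) auto

lemma lebO_measurable_borel:
  "f \<in> borel_measurable borel \<Longrightarrow> f \<in> borel_measurable lebO" for f :: "real \<Rightarrow> real"
  by (intro measurable_restrict_space1 measurable_completion) (simp add: measurable_lborel1)

lemma lebO_ident [measurable]: "(\<lambda>x. x) \<in> borel_measurable lebO"
  by (rule lebO_measurable_borel) simp

lemma lebO_integrable_bounded:
  "f \<in> borel_measurable lebO \<Longrightarrow> (AE x in lebO. \<bar>f x\<bar> \<le> B) \<Longrightarrow> integrable lebO f" for f :: "real \<Rightarrow> real"
  by (rule lebO.integrable_const_bound[where B=B]) auto

lemma lebO_integral_eq:
  fixes f :: "real \<Rightarrow> real"
  assumes "integrable lebO f" shows "(LINT x|lebO. f x) = integral {0..1} f"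
proof -
  have "(LINT x|lebO. f x) = integral \<Omega> f"
    by (rule lebesgue_integral_eq_integral) (use assms in auto)
  then show ?thesis by (simp add: integral_open_interval_real)
qed

lemma lebO_ae_neq: "AE x in lebO. x \<noteq> (c::real)"
proof -
  have "AE x in lebesgue. x \<noteq> c"
    by (rule AE_completion) (rule AE_lborel_singleton)
  then show ?thesis by (subst AE_restrict_space_iff) auto
qed

lemma lebO_ae_finite: "finite S \<Longrightarrow> AE x in lebO. x \<notin> S"
  using eventually_ball_finite[of S "\<lambda>x s. x \<noteq> s" "ae_filter lebO"] lebO_ae_neq
  by (auto elim: eventually_mono)

text \<open>A nonnegative continuous function with vanishing integral is zero. This passes from statements
  almost everywhere to point values of continuous representatives.\<close>

lemma lebO_ae_eq_continuous:
  fixes f g :: "real \<Rightarrow> real"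
  assumes "continuous_on {0..1} f" "continuous_on {0..1} g" "AE x in lebO. f x = g x" "x \<in> {0..1}"
  shows "f x = g x"
proof -
  have c: "continuous_on {0..1} (\<lambda>x. \<bar>f x - g x\<bar>)" using assms by (intro continuous_intros)
  have i: "integrable lebO (\<lambda>x. \<bar>f x - g x\<bar>)"
    by (rule absolutely_integrable_imp_integrable)
      (use absolutely_integrable_continuous_real[OF c]
         absolutely_integrable_on_open_interval[of 0 "1::real" "\<lambda>x. \<bar>f x - g x\<bar>"] in \<open>auto simp: cbox_interval box_real\<close>)
  have "integral {0..1} (\<lambda>x. \<bar>f x - g x\<bar>) = (LINT x|lebO. \<bar>f x - g x\<bar>)"
    by (rule lebO_integral_eq[symmetric, OF i])
  also have "\<dots> = 0"
    by (rule integral_eq_zero_AE) (use assms(3) in auto)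
  finally have "integral {0..1} (\<lambda>x. \<bar>f x - g x\<bar>) = 0" .
  then show ?thesis
    using integral_eq_0_iff[of 0 1 "\<lambda>x. \<bar>f x - g x\<bar>"] c assms(4) by auto
qed

subsection \<open>Bounded and square integrable functions\<close>

lemma LinfI:
  "f \<in> borel_measurable lebO \<Longrightarrow> (\<And>x. x \<in> \<Omega> \<Longrightarrow> \<bar>f x\<bar> \<le> B) \<Longrightarrow> f \<in> Linf"
  unfolding Linf_def by (auto intro!: exI[of _ B] AE_lebO_I)

lemma LinfE: assumes "f \<in> Linf" obtains B where "B \<ge> 0" "AE x in lebO. \<bar>f x\<bar> \<le> B"
proof -
  obtain B where "AE x in lebO. \<bar>f x\<bar> \<le> B" using assms by (auto simp: Linf_def)
  then have "AE x in lebO. \<bar>f x\<bar> \<le> max B 0" by eventually_elim auto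
  then show thesis using that[of "max B 0"] by auto
qed

lemma Linf_measurable: "f \<in> Linf \<Longrightarrow> f \<in> borel_measurable lebO" by (simp add: Linf_def)
lemma L2_measurable: "f \<in> L2 \<Longrightarrow> f \<in> borel_measurable lebO" by (simp add: L2_def)

lemma Linf_continuous: assumes "continuous_on {0..1} f" shows "f \<in> Linf"
proof -
  have "compact (f ` {0..1})" using assms compact_continuous_image by blast
  then obtain B where "\<forall>y\<in>f ` {0..1}. norm y \<le> B" using compact_imp_bounded bounded_iff by metis
  then show ?thesis
    by (intro LinfI[where B=B] lebO_measurable_continuous continuous_on_subset[OF assms]) auto
qed

lemma Linf_add: assumes "f \<in> Linf" "g \<in> Linf" shows "(\<lambda>x. f x + g x) \<in> Linf"
proof -
  obtain B C where "AE x in lebO. \<bar>f x\<bar> \<le> B" "AE x in lebO. \<bar>g x\<bar> \<le> C"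
    using assms LinfE by metis
  then have "AE x in lebO. \<bar>f x + g x\<bar> \<le> B + C" by eventually_elim auto
  then show ?thesis using assms by (auto simp: Linf_def)
qed

lemma Linf_mult: assumes "f \<in> Linf" "g \<in> Linf" shows "(\<lambda>x. f x * g x) \<in> Linf"
proof -
  obtain B C where "B \<ge> 0" "AE x in lebO. \<bar>f x\<bar> \<le> B" "AE x in lebO. \<bar>g x\<bar> \<le> C"
    using assms LinfE by metis
  then have "AE x in lebO. \<bar>f x * g x\<bar> \<le> B * C"
    by (auto simp: abs_mult elim!: eventually_elim2 intro!: mult_mono)
  then show ?thesis using assms by (auto simp: Linf_def)
qed

lemma Linf_const [simp]: "(\<lambda>x. c) \<in> Linf" by (auto simp: Linf_def)

lemma Linf_cmult: "f \<in> Linf \<Longrightarrow> (\<lambda>x. c * f x) \<in> Linf"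
  by (rule Linf_mult[OF Linf_const])

lemma Linf_diff: assumes "f \<in> Linf" "g \<in> Linf" shows "(\<lambda>x. f x - g x) \<in> Linf"
  using Linf_add[OF assms(1) Linf_cmult[OF assms(2), of "-1"]] by simp

lemma Linf_integrable: "f \<in> Linf \<Longrightarrow> integrable lebO f"
  using lebO_integrable_bounded[OF Linf_measurable] LinfE by metis

lemma Linf_L2: "f \<in> Linf \<Longrightarrow> f \<in> L2"
  using Linf_integrable[OF Linf_mult[of f f]] by (auto simp: L2_def Linf_def power2_eq_square)

lemma L2_mult_integrable: assumes "f \<in> L2" "g \<in> L2" shows "integrable lebO (\<lambda>x. f x * g x)"
proof (rule Bochner_Integration.integrable_bound[where f="\<lambda>x. (f x)\<^sup>2 + (g x)\<^sup>2"])
  have "\<bar>s * t\<bar> \<le> s\<^sup>2 + t\<^sup>2" for s t :: real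
    using zero_le_power2[of "\<bar>s\<bar> - \<bar>t\<bar>"] zero_le_power2[of s] zero_le_power2[of t]
      abs_ge_zero[of "s * t"] by (simp add: power2_diff abs_mult[symmetric] mult.assoc)
  then show "AE x in lebO. norm (f x * g x) \<le> norm ((f x)\<^sup>2 + (g x)\<^sup>2)" by auto
qed (use assms in \<open>auto simp: L2_def\<close>)

lemma L2_add: assumes "f \<in> L2" "g \<in> L2" shows "(\<lambda>x. f x + g x) \<in> L2"
proof -
  have "integrable lebO (\<lambda>x. (f x)\<^sup>2 + 2 * (f x * g x) + (g x)\<^sup>2)"
    using assms L2_mult_integrable[OF assms] by (auto simp: L2_def)
  then have "integrable lebO (\<lambda>x. (f x + g x)\<^sup>2)" by (simp add: power2_sum algebra_simps)
  then show ?thesis using assms by (auto simp: L2_def)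
qed

lemma L2_cmult: "f \<in> L2 \<Longrightarrow> (\<lambda>x. c * f x) \<in> L2"
  by (auto simp: L2_def power_mult_distrib)

lemma L2_diff: assumes "f \<in> L2" "g \<in> L2" shows "(\<lambda>x. f x - g x) \<in> L2"
  using L2_add[OF assms(1) L2_cmult[OF assms(2), of "-1"]] by simp

lemma L2_Linf_mult: assumes "f \<in> Linf" "g \<in> L2" shows "(\<lambda>x. f x * g x) \<in> L2"
proof -
  obtain B where B: "B \<ge> 0" "AE x in lebO. \<bar>f x\<bar> \<le> B" using assms LinfE by metis
  have m: "f \<in> borel_measurable lebO" "g \<in> borel_measurable lebO"
    using assms by (auto simp: L2_def Linf_def)
  have "integrable lebO (\<lambda>x. (f x * g x)\<^sup>2)"
  proof (rule Bochner_Integration.integrable_bound[where f="\<lambda>x. B\<^sup>2 * (g x)\<^sup>2"])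
    show "AE x in lebO. norm ((f x * g x)\<^sup>2) \<le> norm (B\<^sup>2 * (g x)\<^sup>2)"
      using B(2)
    proof eventually_elim
      case (elim x)
      then have "(f x)\<^sup>2 \<le> B\<^sup>2" using B(1) by (simp add: abs_le_square_iff[symmetric])
      then show ?case by (simp add: power_mult_distrib mult_right_mono)
    qed
  qed (use assms m in \<open>auto simp: L2_def\<close>)
  then show ?thesis using m by (auto simp: L2_def)
qed

lemma L2_integrable: "f \<in> L2 \<Longrightarrow> integrable lebO f"
  using L2_mult_integrable[OF _ Linf_L2[OF Linf_const[of 1]]] by simp

lemma norm_L2_nonneg [simp]: "0 \<le> norm_L2 f" by (simp add: norm_L2_def)

lemma norm_L2_square: "(norm_L2 f)\<^sup>2 = L2_inner f f"
  by (simp add: norm_L2_def L2_inner_def power2_eq_square[symmetric])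

lemma L2_inner_commute: "L2_inner f g = L2_inner g f"
  by (simp add: L2_inner_def mult.commute)

lemma L2_inner_add: "f \<in> L2 \<Longrightarrow> g \<in> L2 \<Longrightarrow> k \<in> L2 \<Longrightarrow>
    L2_inner (\<lambda>x. f x + g x) k = L2_inner f k + L2_inner g k"
  by (simp add: L2_inner_def distrib_right L2_mult_integrable)

lemma L2_inner_diff: "f \<in> L2 \<Longrightarrow> g \<in> L2 \<Longrightarrow> k \<in> L2 \<Longrightarrow>
    L2_inner (\<lambda>x. f x - g x) k = L2_inner f k - L2_inner g k"
  by (simp add: L2_inner_def left_diff_distrib L2_mult_integrable)

lemma L2_inner_cmult: "L2_inner (\<lambda>x. c * f x) k = c * L2_inner f k"
  by (simp add: L2_inner_def mult.assoc)

lemma L2_inner_add_right: "f \<in> L2 \<Longrightarrow> g \<in> L2 \<Longrightarrow> k \<in> L2 \<Longrightarrow>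
    L2_inner k (\<lambda>x. f x + g x) = L2_inner k f + L2_inner k g"
  by (simp add: L2_inner_def distrib_left L2_mult_integrable)

lemma L2_inner_diff_right: "f \<in> L2 \<Longrightarrow> g \<in> L2 \<Longrightarrow> k \<in> L2 \<Longrightarrow>
    L2_inner k (\<lambda>x. f x - g x) = L2_inner k f - L2_inner k g"
  by (simp add: L2_inner_def right_diff_distrib L2_mult_integrable)

lemma L2_inner_cmult_right: "L2_inner k (\<lambda>x. c * f x) = c * L2_inner k f"
  by (simp add: L2_inner_commute[of k] L2_inner_cmult)

lemma L2_inner_cong:
  assumes "AE x in lebO. f x = f' x" "AE x in lebO. g x = g' x"
    "f \<in> borel_measurable lebO" "f' \<in> borel_measurable lebO"
    "g \<in> borel_measurable lebO" "g' \<in> borel_measurable lebO"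
  shows "L2_inner f g = L2_inner f' g'"
  unfolding L2_inner_def
  by (rule integral_cong_AE)
    (use assms in \<open>auto elim: eventually_elim2\<close>)

lemma norm_L2_cong:
  assumes "AE x in lebO. f x = f' x" "f \<in> borel_measurable lebO" "f' \<in> borel_measurable lebO"
  shows "norm_L2 f = norm_L2 f'"
  using L2_inner_cong[OF assms(1,1,2,3,2,3)] norm_L2_square[of f] norm_L2_square[of f']
  by (metis norm_L2_nonneg power2_eq_imp_eq)

lemma L2_inner_CS: assumes "f \<in> L2" "g \<in> L2" shows "\<bar>L2_inner f g\<bar> \<le> norm_L2 f * norm_L2 g"
proof -
  define A B C where "A = L2_inner f f" and "B = L2_inner f g" and "C = L2_inner g g"
  have q: "0 \<le> A - 2 * t * B + t\<^sup>2 * C" for t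
  proof -
    have "0 \<le> L2_inner (\<lambda>x. f x - t * g x) (\<lambda>x. f x - t * g x)"
      by (simp add: L2_inner_def)
    also have "\<dots> = A - 2 * t * B + t\<^sup>2 * C"
      using assms unfolding A_def B_def C_def
      by (simp add: L2_inner_diff L2_inner_diff_right L2_diff L2_cmult L2_inner_cmult L2_inner_cmult_right
        L2_inner_commute[of g f] power2_eq_square algebra_simps)
    finally show ?thesis .
  qed
  have AC: "A \<ge> 0" "C \<ge> 0" by (auto simp: A_def C_def L2_inner_def)
  have "B\<^sup>2 \<le> A * C"
  proof (cases "C = 0")
    case True
    have "B = 0"
    proof (rule ccontr)
      assume "B \<noteq> 0"
      then show False using q[of "(A + 1) / (2 * B)"] True by (simp add: field_simps)
    qed
    then show ?thesis using True by simp
  next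
    case False
    then show ?thesis using q[of "B / C"] AC by (simp add: field_simps power2_eq_square)
  qed
  then have "\<bar>B\<bar> \<le> sqrt A * sqrt C"
    by (metis real_sqrt_abs real_sqrt_le_mono real_sqrt_mult)
  then show ?thesis
    using norm_L2_square[of f] norm_L2_square[of g] unfolding A_def B_def C_def
    by (metis norm_L2_nonneg real_sqrt_unique)
qed

lemma norm_L2_triangle:
  assumes "f \<in> L2" "g \<in> L2" shows "norm_L2 (\<lambda>x. f x + g x) \<le> norm_L2 f + norm_L2 g"
proof (rule power2_le_imp_le)
  have "(norm_L2 (\<lambda>x. f x + g x))\<^sup>2 = L2_inner f f + 2 * L2_inner f g + L2_inner g g"
    unfolding norm_L2_square using assms
    by (simp add: L2_inner_add L2_inner_add_right L2_add L2_inner_commute[of g f])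
  also have "\<dots> \<le> (norm_L2 f + norm_L2 g)\<^sup>2"
    using L2_inner_CS[OF assms] by (simp add: power2_sum norm_L2_square)
  finally show "(norm_L2 (\<lambda>x. f x + g x))\<^sup>2 \<le> (norm_L2 f + norm_L2 g)\<^sup>2" .
qed simp

lemma norm_L2_cmult: "norm_L2 (\<lambda>x. c * f x) = \<bar>c\<bar> * norm_L2 f"
  by (simp add: norm_L2_def power_mult_distrib real_sqrt_mult)

lemma norm_L2_minus: "norm_L2 (\<lambda>x. f x - g x) = norm_L2 (\<lambda>x. g x - f x)"
  by (simp add: norm_L2_def power2_commute)

lemma norm_L2_bounded:
  assumes "f \<in> borel_measurable lebO" "AE x in lebO. \<bar>f x\<bar> \<le> B" "B \<ge> 0" shows "norm_L2 f \<le> B"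
proof (rule power2_le_imp_le)
  have *: "AE x in lebO. (f x)\<^sup>2 \<le> B\<^sup>2"
    using assms(2) by eventually_elim (use assms(3) abs_le_square_iff[of _ B] in auto)
  have "f \<in> L2" using assms by (intro Linf_L2) (auto simp: Linf_def)
  then have "(LINT x|lebO. (f x)\<^sup>2) \<le> (LINT x|lebO. B\<^sup>2)"
    using * by (intro integral_mono_AE) (auto simp: L2_def)
  then show "(norm_L2 f)\<^sup>2 \<le> B\<^sup>2" by (simp add: norm_L2_def)
qed fact

lemma L1_le_L2: assumes "f \<in> L2" shows "(LINT x|lebO. \<bar>f x\<bar>) \<le> norm_L2 f"
proof -
  have a: "(\<lambda>x. \<bar>f x\<bar>) \<in> L2" using assms by (auto simp: L2_def)
  have "L2_inner (\<lambda>x. \<bar>f x\<bar>) (\<lambda>x. 1) \<le> norm_L2 (\<lambda>x. \<bar>f x\<bar>) * norm_L2 (\<lambda>x. 1)"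
    using L2_inner_CS[OF a Linf_L2[OF Linf_const[of 1]]] by linarith
  then show ?thesis by (simp add: L2_inner_def norm_L2_def) 
qed

lemma norm_L2_zero_imp:
  assumes "f \<in> L2" "norm_L2 f = 0" shows "AE x in lebO. f x = 0"
proof -
  have "(LINT x|lebO. (f x)\<^sup>2) = 0" using assms(2) by (simp add: norm_L2_def)
  then have "AE x in lebO. (f x)\<^sup>2 = 0"
    using integral_nonneg_eq_0_iff_AE[of lebO "\<lambda>x. (f x)\<^sup>2"] assms(1) by (simp add: L2_def)
  then show ?thesis by simp
qed

subsection \<open>Primitives\<close>

text \<open>Absolutely continuous functions appear as primitives throughout. The Henstock-Kurzweil integral
  is the one of the multiplier in the theorem; on integrable functions it agrees with the Lebesgue integral.\<close>

definition prim :: "(real \<Rightarrow> real) \<Rightarrow> real \<Rightarrow> real"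
  where "prim g x = integral {0..x} g"

lemma lebO_int_on: fixes g :: "real \<Rightarrow> real" assumes "integrable lebO g" "{s..t} \<subseteq> {0..1}" shows "g integrable_on {s..t::real}"
proof -
  have "g integrable_on {0..1}"
    using integrable_on_lebesgue_on[OF assms(1)] by (simp add: integrable_on_open_interval_real)
  then show ?thesis using assms(2) integrable_on_subinterval by blast
qed

lemma prim_0 [simp]: "prim g 0 = 0" by (simp add: prim_def)

lemma prim_1: "integrable lebO g \<Longrightarrow> prim g 1 = (LINT x|lebO. g x)"
  by (simp add: prim_def lebO_integral_eq)

lemma prim_diff: assumes "integrable lebO g" "0 \<le> s" "s \<le> t" "t \<le> 1"
  shows "prim g t - prim g s = integral {s..t} g"
  using Henstock_Kurzweil_Integration.integral_combine[OF assms(2,3) lebO_int_on[OF assms(1)]] assms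
  by (simp add: prim_def)

lemma prim_lebO: assumes "integrable lebO g" "0 \<le> x" "x \<le> 1"
  shows "prim g x = (LINT t|lebO. indicator {..<x} t * g t)"
proof -
  have i: "integrable lebO (\<lambda>t. indicator {..<x} t * g t)"
    by (rule Bochner_Integration.integrable_bound[OF assms(1)])
      (use assms(1) in \<open>auto simp: indicator_def borel_measurable_integrable intro!: borel_measurable_times\<close>)
  have "(LINT t|lebO. indicator {..<x} t * g t) = integral {0..1} (\<lambda>t. indicator {..<x} t * g t)"
    by (rule lebO_integral_eq[OF i])
  also have "\<dots> = integral {0..1} (\<lambda>t. if t \<in> {0..x} then g t else 0)"
    by (rule integral_spike[of "{x}"]) (auto simp: indicator_def)
  also have "\<dots> = integral ({0..x} \<inter> {0..1}) g"
    by (rule integral_restrict_Int)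
  also have "{0..x} \<inter> {0..1} = {0..x}" using assms by auto
  finally show ?thesis by (simp add: prim_def)
qed

lemma prim_continuous: "integrable lebO g \<Longrightarrow> continuous_on {0..1} (prim g)"
  unfolding prim_def by (rule indefinite_integral_continuous_1) (rule lebO_int_on, auto)

lemma prim_Linf: "integrable lebO g \<Longrightarrow> prim g \<in> Linf"
  by (intro Linf_continuous prim_continuous)

lemma prim_add: assumes "integrable lebO g" "integrable lebO k" "x \<le> 1"
  shows "prim (\<lambda>t. g t + k t) x = prim g x + prim k x"
  unfolding prim_def by (rule integral_add) (use assms lebO_int_on in auto)

lemma prim_minus: assumes "integrable lebO g" "integrable lebO k" "x \<le> 1"
  shows "prim (\<lambda>t. g t - k t) x = prim g x - prim k x"
  unfolding prim_def by (rule integral_diff) (use assms lebO_int_on in auto)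

lemma prim_cmult: "prim (\<lambda>t. c * g t) x = c * prim g x"
  unfolding prim_def by simp

lemma prim_cong_AE:
  assumes "AE x in lebO. g x = k x" "integrable lebO g" "integrable lebO k" "0 \<le> x" "x \<le> 1"
  shows "prim g x = prim k x"
  unfolding prim_lebO[OF assms(2,4,5)] prim_lebO[OF assms(3,4,5)]
  by (rule integral_cong_AE)
    (use assms in \<open>auto intro!: borel_measurable_times borel_measurable_indicator elim: eventually_mono\<close>)

lemma prim_abs_le: assumes "integrable lebO g" "0 \<le> x" "x \<le> 1"
  shows "\<bar>prim g x\<bar> \<le> (LINT t|lebO. \<bar>g t\<bar>)"
proof -
  have i: "integrable lebO (\<lambda>t. indicator {..<x} t * g t)"
    by (rule Bochner_Integration.integrable_bound[OF assms(1)])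
      (use assms(1) in \<open>auto simp: indicator_def borel_measurable_integrable intro!: borel_measurable_times\<close>)
  have "\<bar>prim g x\<bar> \<le> (LINT t|lebO. \<bar>indicator {..<x} t * g t\<bar>)"
    unfolding prim_lebO[OF assms] using integral_norm_bound[of lebO "\<lambda>t. indicator {..<x} t * g t"] by simp
  also have "\<dots> \<le> (LINT t|lebO. \<bar>g t\<bar>)"
    by (rule integral_mono) (use i assms in \<open>auto simp: indicator_def\<close>)
  finally show ?thesis .
qed

lemma prim_le_L2: "g \<in> L2 \<Longrightarrow> 0 \<le> x \<Longrightarrow> x \<le> 1 \<Longrightarrow> \<bar>prim g x\<bar> \<le> norm_L2 g"
  using prim_abs_le[OF L2_integrable] L1_le_L2 by fastforce

lemma prim_Lipschitz:
  assumes g: "g \<in> borel_measurable lebO" "AE x in lebO. \<bar>g x\<bar> \<le> B" and st: "0 \<le> s" "s \<le> t" "t \<le> 1"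
  shows "\<bar>prim g t - prim g s\<bar> \<le> B * (t - s)"
proof -
  define k where "k x = max (-B) (min B (g x))" for x
  have B: "B \<ge> 0"
  proof (rule ccontr)
    assume "\<not> B \<ge> 0"
    from g(2) have "AE x in lebO. False"
      by (rule eventually_mono) (use \<open>\<not> B \<ge> 0\<close> in auto)
    then have "emeasure lebO \<Omega> = 0"
      using AE_iff_measurable[of \<Omega> lebO "\<lambda>x. False"] sets.top[of lebO] by (simp add: greaterThanLessThan_def greaterThan_def lessThan_def Int_def)
    then show False by (simp add: lebO.emeasure_eq_measure)
  qed
  have k: "k \<in> borel_measurable lebO" "\<And>x. \<bar>k x\<bar> \<le> B" using g B by (auto simp: k_def[abs_def])
  have ki: "integrable lebO k" by (rule lebO_integrable_bounded[of _ B]) (use k in auto)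
  have gi: "integrable lebO g" by (rule lebO_integrable_bounded[of _ B]) (use g in auto)
  have eq: "AE x in lebO. g x = k x" using g(2) by eventually_elim (auto simp: k_def)
  have "prim g t - prim g s = prim k t - prim k s"
    using prim_cong_AE[OF eq gi ki] st by simp
  also have "\<dots> = integral {s..t} k" by (rule prim_diff[OF ki st])
  finally have eq: "prim g t - prim g s = integral {s..t} k" .
  have "norm (integral {s..t} k) \<le> B * measure lborel {s..t}"
    by (rule has_integral_bound_real[where S="{}", OF B])
      (use k lebO_int_on[OF ki, of s t] st in \<open>auto intro: integrable_integral\<close>)
  then show ?thesis using eq st by simp
qed

lemma prim_FTC:
  assumes "continuous_on {0..1} v" "\<And>x. x \<in> \<Omega> \<Longrightarrow> (v has_real_derivative g x) (at x)"
    and "v 0 = 0" "0 \<le> x" "x \<le> 1"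
  shows "prim g x = v x"
proof -
  have "(g has_integral v x - v 0) {0..x}"
    by (rule fundamental_theorem_of_calculus_interior)
      (use assms in \<open>auto intro: continuous_on_subset simp: has_real_derivative_iff_has_vector_derivative[symmetric]\<close>)
  then show ?thesis using assms(3) by (simp add: prim_def integral_unique)
qed

lemma prim_deriv_test: assumes "\<phi> \<in> test_funs" "0 \<le> x" "x \<le> 1" shows "prim (deriv \<phi>) x = \<phi> x"
  by (rule prim_FTC)
    (use assms test_funs_continuous test_funs_outside[of \<phi> 0] in \<open>auto simp: smooth_has_deriv test_funs_smooth\<close>)

text \<open>Fubini's theorem on the triangle \<open>t < x\<close>. The inner measure is Lebesgue measure in the
  integration by parts of absolutely continuous functions, and a derivative of a function of
  bounded variation in the representation of such functions.\<close>

lemma triangle_Fubini: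
  fixes M :: "real measure" and g k :: "real \<Rightarrow> real"
  assumes M: "finite_measure M" and [measurable]: "(\<lambda>t. t) \<in> borel_measurable M"
    and g: "integrable M g" and k: "integrable lebO k"
  shows "(LINT x|lebO. (LINT t|M. indicator {..<x} t * g t) * k x)
       = (LINT t|M. g t * (LINT x|lebO. indicator {t<..} x * k x))"
proof -
  interpret M: finite_measure M by fact
  interpret P: pair_sigma_finite lebO M ..
  have [measurable]: "g \<in> borel_measurable M" "k \<in> borel_measurable lebO"
    using g k by auto
  have i0: "integrable (lebO \<Otimes>\<^sub>M M) (\<lambda>(x, t). k x * g t)"
  proof (rule P.Fubini_integrable)
    show "(\<lambda>(x, t). k x * g t) \<in> borel_measurable (lebO \<Otimes>\<^sub>M M)" by measurable
    have "(\<lambda>x. LINT y|M. norm (case (x, y) of (x, t) \<Rightarrow> k x * g t)) = (\<lambda>x. \<bar>k x\<bar> * (LINT y|M. \<bar>g y\<bar>))"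
      by (simp add: abs_mult)
    then show "integrable lebO (\<lambda>x. LINT y|M. norm (case (x, y) of (x, t) \<Rightarrow> k x * g t))"
      using k by simp
    show "AE x in lebO. integrable M (\<lambda>y. case (x, y) of (x, t) \<Rightarrow> k x * g t)"
      using g by simp
  qed
  define f where "f x t = (if t < x then 1 else 0) * (k x * g t)" for x t :: real
  have i: "integrable (lebO \<Otimes>\<^sub>M M) (case_prod f)"
  proof (rule Bochner_Integration.integrable_bound[OF i0])
    show "case_prod f \<in> borel_measurable (lebO \<Otimes>\<^sub>M M)" unfolding f_def by measurable
  qed (auto simp: f_def)
  have "(LINT x|lebO. (LINT t|M. f x t)) = (LINT t|M. (LINT x|lebO. f x t))"
    using P.integral_fst[OF i] P.integral_snd[OF i] by simp
  moreover have "(LINT t|M. f x t) = (LINT t|M. indicator {..<x} t * g t) * k x" for x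
  proof -
    have "(LINT t|M. f x t) = (LINT t|M. k x * (indicator {..<x} t * g t))"
      by (rule Bochner_Integration.integral_cong) (auto simp: f_def)
    then show ?thesis by simp
  qed
  moreover have "(LINT x|lebO. f x t) = g t * (LINT x|lebO. indicator {t<..} x * k x)" for t
  proof -
    have "(LINT x|lebO. f x t) = (LINT x|lebO. g t * (indicator {t<..} x * k x))"
      by (rule Bochner_Integration.integral_cong) (auto simp: f_def)
    then show ?thesis by simp
  qed
  ultimately show ?thesis by simp
qed

lemma upper_integral:
  assumes "integrable lebO k" "0 \<le> t" "t \<le> 1"
  shows "(LINT x|lebO. indicator {t<..} x * k x) = (LINT x|lebO. k x) - prim k t"
proof -
  have i: "integrable lebO (\<lambda>x. indicator {..<t} x * k x)"
    by (rule Bochner_Integration.integrable_bound[OF assms(1)])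
      (use assms(1) in \<open>auto simp: indicator_def borel_measurable_integrable intro!: borel_measurable_times\<close>)
  have "(LINT x|lebO. indicator {t<..} x * k x) = (LINT x|lebO. k x - indicator {..<t} x * k x)"
  proof (rule integral_cong_AE)
    show "AE x in lebO. indicator {t<..} x * k x = k x - indicator {..<t} x * k x"
      using lebO_ae_neq[of t] by eventually_elim (auto simp: indicator_def)
  qed (use assms in \<open>auto intro!: borel_measurable_times borel_measurable_diff borel_measurable_indicator\<close>)
  also have "\<dots> = (LINT x|lebO. k x) - prim k t"
    using assms i by (simp add: prim_lebO)
  finally show ?thesis .
qed

lemma prim_mult_integrable:
  assumes "integrable lebO g" "integrable lebO k"
  shows "integrable lebO (\<lambda>x. prim g x * k x)"
proof (rule Bochner_Integration.integrable_bound[where f="\<lambda>x. (LINT t|lebO. \<bar>g t\<bar>) * k x"])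
  show "AE x in lebO. norm (prim g x * k x) \<le> norm ((LINT t|lebO. \<bar>g t\<bar>) * k x)"
    by (rule AE_lebO_I) (use prim_abs_le[OF assms(1)] in \<open>auto simp: abs_mult intro!: mult_right_mono\<close>)
qed (use assms prim_Linf[OF assms(1)] in \<open>auto simp: Linf_def intro!: borel_measurable_times\<close>)

text \<open>Integration by parts for absolutely continuous functions; no smoothness is available, since \<open>g\<close> and \<open>k\<close>
  are merely integrable.\<close>

lemma prim_by_parts:
  assumes g: "integrable lebO g" and k: "integrable lebO k"
  shows "(LINT x|lebO. prim g x * k x) = (LINT x|lebO. g x) * (LINT x|lebO. k x) - (LINT x|lebO. g x * prim k x)"
proof -
  have "(LINT x|lebO. prim g x * k x) = (LINT x|lebO. (LINT t|lebO. indicator {..<x} t * g t) * k x)"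
    by (rule Bochner_Integration.integral_cong) (auto simp: prim_lebO[OF g])
  also have "\<dots> = (LINT t|lebO. g t * (LINT x|lebO. indicator {t<..} x * k x))"
    by (rule triangle_Fubini[OF finite_lebO _ g k]) simp
  also have "\<dots> = (LINT t|lebO. g t * (LINT x|lebO. k x) - g t * prim k t)"
    by (rule Bochner_Integration.integral_cong) (auto simp: upper_integral[OF k] right_diff_distrib)
  also have "\<dots> = (LINT x|lebO. g x) * (LINT x|lebO. k x) - (LINT x|lebO. g x * prim k x)"
    using g prim_mult_integrable[OF k g] by (simp add: mult.commute[of "g _" "prim k _"])
  finally show ?thesis .
qed

section \<open>Test functions separate points\<close>

lemma flat_exp_mono: "x \<le> y \<Longrightarrow> flat_exp 1 x \<le> flat_exp 1 y"
  by (auto simp: flat_exp_def intro: le_imp_inverse_le)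

lemma bump_mono: "c' \<le> c \<Longrightarrow> d \<le> d' \<Longrightarrow> bump c d x \<le> bump c' d' x"
  unfolding bump_def by (intro mult_mono flat_exp_mono) (auto simp: flat_exp_def)

text \<open>The supports increase to the open interval, so that each cut-off function has compact support
  in it.\<close>

lemma cutoff_shrink_tendsto:
  assumes "c < d"
  shows "(\<lambda>n. cutoff n (c + (d - c) / (real n + 3)) (d - (d - c) / (real n + 3)) x) \<longlonglongrightarrow> indicat_real {c<..<d} x"
proof (cases "c < x \<and> x < d")
  case True
  define s where "s n = (d - c) / (real n + 3)" for n
  have "s \<longlonglongrightarrow> 0" unfolding s_def by real_asymp
  then have "\<forall>\<^sub>F n in sequentially. s n < min (x - c) (d - x)"
    using True by (intro order_tendstoD) auto
  then obtain k where k: "s k < min (x - c) (d - x)" by (auto simp: eventually_sequentially)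
  define b where "b = bump (c + s k) (d - s k) x"
  have b: "0 < b" "b \<le> 1" unfolding b_def using k by (auto intro!: bump_pos bump_bounds)
  have mono: "b \<le> bump (c + s n) (d - s n) x" if "n \<ge> k" for n
  proof -
    have "s n \<le> s k" unfolding s_def using that assms by (intro divide_left_mono) auto
    then show ?thesis unfolding b_def by (intro bump_mono) auto
  qed
  have "(\<lambda>n. (1 - bump (c + s n) (d - s n) x) ^ n) \<longlonglongrightarrow> 0"
  proof (rule tendsto_sandwich[of "\<lambda>n. 0" _ _ "\<lambda>n. (1 - b) ^ n"])
    show "\<forall>\<^sub>F n in sequentially. (1 - bump (c + s n) (d - s n) x) ^ n \<le> (1 - b) ^ n"
      using eventually_ge_at_top[of k]
      by eventually_elim (use mono bump_bounds in \<open>auto intro!: power_mono\<close>)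
    show "(\<lambda>n. (1 - b) ^ n) \<longlonglongrightarrow> 0" using b by (intro LIMSEQ_realpow_zero) auto
  qed (use bump_bounds in auto)
  from tendsto_diff[OF tendsto_const[of 1] this] True show ?thesis
    by (simp add: cutoff_def s_def)
next
  case False
  have "cutoff n (c + (d - c) / (real n + 3)) (d - (d - c) / (real n + 3)) x = 0" for n
  proof (rule cutoff_zero)
    have "0 \<le> (d - c) / (real n + 3)" using assms by simp
    then show "x \<le> c + (d - c) / (real n + 3) \<or> d - (d - c) / (real n + 3) \<le> x"
      using False by linarith
  qed
  then show ?thesis using False by (auto simp: indicator_def)
qed

text \<open>Test functions with compact support in a subinterval, to localise the two lemmas of the calculus
  of variations.\<close>

definition test_in :: "real \<Rightarrow> real \<Rightarrow> (real \<Rightarrow> real) set"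
  where "test_in c d = {\<phi>. smooth \<phi> \<and> (\<exists>c' d'. c < c' \<and> c' \<le> d' \<and> d' < d \<and> (\<forall>x. x \<notin> {c'..d'} \<longrightarrow> \<phi> x = 0))}"

lemma test_funs_eq: "test_funs = test_in 0 1"
  unfolding test_in_def set_eq_iff test_funs_iff mem_Collect_eq by blast

lemma test_in_mono: "c' \<le> c \<Longrightarrow> d \<le> d' \<Longrightarrow> test_in c d \<subseteq> test_in c' d'"
  by (force simp: test_in_def)

lemma test_in_test_funs: "0 \<le> c \<Longrightarrow> d \<le> 1 \<Longrightarrow> \<phi> \<in> test_in c d \<Longrightarrow> \<phi> \<in> test_funs"
  using test_in_mono[of 0 c d 1] by (auto simp: test_funs_eq)

lemma test_in_smooth: "\<phi> \<in> test_in c d \<Longrightarrow> smooth \<phi>" by (simp add: test_in_def)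

lemma test_in_cmult: "\<phi> \<in> test_in c d \<Longrightarrow> (\<lambda>x. k * \<phi> x) \<in> test_in c d"
  by (fastforce simp: test_in_def intro: smooth_cmult)

lemma test_in_diff:
  assumes "\<phi> \<in> test_in c d" "\<psi> \<in> test_in c d" shows "(\<lambda>x. \<phi> x - \<psi> x) \<in> test_in c d"
proof -
  obtain a b where 1: "c < a" "a \<le> b" "b < d" "\<forall>x. x \<notin> {a..b} \<longrightarrow> \<phi> x = 0"
    using assms by (auto simp: test_in_def)
  obtain a' b' where 2: "c < a'" "a' \<le> b'" "b' < d" "\<forall>x. x \<notin> {a'..b'} \<longrightarrow> \<psi> x = 0"
    using assms by (auto simp: test_in_def)
  have "smooth (\<lambda>x. \<phi> x - \<psi> x)" using assms by (auto simp: test_in_def intro: smooth_diff)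
  moreover have "c < min a a' \<and> min a a' \<le> max b b' \<and> max b b' < d" using 1 2 by auto
  moreover have "\<forall>x. x \<notin> {min a a'..max b b'} \<longrightarrow> \<phi> x - \<psi> x = 0"
    using 1(4) 2(4) by (auto simp: min_le_iff_disj le_max_iff_disj)
  ultimately show ?thesis unfolding test_in_def by blast
qed

lemma test_in_bump: "c < d \<Longrightarrow> bump (c + (d - c) / 3) (d - (d - c) / 3) \<in> test_in c d"
proof -
  assume "c < d"
  then have "c < c + (d - c) / 3 \<and> c + (d - c) / 3 \<le> d - (d - c) / 3 \<and> d - (d - c) / 3 < d"
    by (simp add: field_simps)
  moreover have "\<forall>x. x \<notin> {c + (d - c) / 3..d - (d - c) / 3} \<longrightarrow> bump (c + (d - c) / 3) (d - (d - c) / 3) x = 0"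
    by (auto intro: bump_zero)
  ultimately show ?thesis unfolding test_in_def using smooth_bump by blast
qed

lemma test_in_antideriv:
  assumes "\<rho> \<in> test_in c d" "0 \<le> c" "d \<le> 1" "integral {0..1} \<rho> = 0"
  obtains \<phi> where "\<phi> \<in> test_in c d" "deriv \<phi> = \<rho>"
proof -
  obtain c' d' where *: "c < c'" "c' \<le> d'" "d' < d" "\<And>x. x \<notin> {c'..d'} \<Longrightarrow> \<rho> x = 0" "smooth \<rho>"
    using assms(1) unfolding test_in_def by blast
  obtain \<phi> where "\<phi> \<in> test_funs" "deriv \<phi> = \<rho>" "\<And>x. x \<notin> {c'..d'} \<Longrightarrow> \<phi> x = 0"
    using test_funs_antideriv[of \<rho> c' d'] * assms by auto
  then show thesis using that * by (auto simp: test_in_def test_funs_iff)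
qed

lemma test_funs_Linf: "\<phi> \<in> test_funs \<Longrightarrow> \<phi> \<in> Linf"
  by (intro Linf_continuous test_funs_continuous)

lemma Linf_mult_integrable:
  assumes "integrable lebO f" "g \<in> Linf" shows "integrable lebO (\<lambda>x. f x * g x)"
proof -
  obtain B where B: "AE x in lebO. \<bar>g x\<bar> \<le> B" using assms(2) LinfE by metis
  show ?thesis
  proof (rule Bochner_Integration.integrable_bound[where f="\<lambda>x. B * f x"])
    show "AE x in lebO. norm (f x * g x) \<le> norm (B * f x)"
      using B by eventually_elim (auto simp: abs_mult mult.commute[of "\<bar>f _\<bar>"] intro!: mult_right_mono)
  qed (use assms in \<open>auto simp: Linf_def\<close>)
qed

text \<open>Every bounded measurable function is the boundedly almost everywhere limit of test functions:
  it is a limit of continuous functions, these are uniform limits of polynomials, and polynomials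
  are made compactly supported by the cut-off functions.\<close>

lemma test_approx:
  assumes cd: "0 \<le> c" "c < d" "d \<le> 1" and g: "g \<in> borel_measurable lebO" "\<And>x. \<bar>g x\<bar> \<le> B"
  obtains \<phi> where "\<And>n::nat. \<phi> n \<in> test_in c d" "\<And>n x. \<bar>\<phi> n x\<bar> \<le> B + 1"
    "AE x in lebO. (\<lambda>n. \<phi> n x) \<longlonglongrightarrow> g x * indicator {c<..<d} x"
proof -
  have B: "B \<ge> 0" using g(2)[of 0] by linarith
  have "(\<lambda>x. if x \<in> \<Omega> then g x else 0) \<in> borel_measurable lebesgue"
    using g(1) by (subst borel_measurable_if) auto
  then have "(\<lambda>x. if x \<in> \<Omega> then g x else 0) measurable_on \<Omega>"
    by (rule lebesgue_measurable_imp_measurable_on_real) auto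
  then obtain N G where N: "negligible N" and G: "\<And>n. continuous_on UNIV (G n)"
    and lim: "\<And>x. x \<notin> N \<Longrightarrow> (\<lambda>n. G n x) \<longlonglongrightarrow> (if x \<in> \<Omega> then g x else 0)"
    unfolding measurable_on_def by (auto simp: if_distrib cong: if_cong)
  have "\<exists>p. real_polynomial_function p \<and>
      (\<forall>x\<in>{0..1}. \<bar>max (- B) (min B (G n x)) - p x\<bar> < 1 / (real n + 1))" for n
  proof (rule Stone_Weierstrass_real_polynomial_function[of "{0..1::real}" "\<lambda>x. max (- B) (min B (G n x))" "1 / (real n + 1)"])
    show "continuous_on {0..1} (\<lambda>x. max (- B) (min B (G n x)))"
      by (intro continuous_intros continuous_on_subset[OF G]) auto
  qed auto
  then obtain P where P: "\<And>n. real_polynomial_function (P n)"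
    "\<And>n x. x \<in> {0..1} \<Longrightarrow> \<bar>max (- B) (min B (G n x)) - P n x\<bar> < 1 / (real n + 1)"
    by metis
  define s where "s n = (d - c) / (real n + 3)" for n
  have s: "0 < s n" "s n \<le> (d - c) / 3" for n
    unfolding s_def using cd by (simp, intro divide_left_mono) auto
  define \<phi> where "\<phi> n x = cutoff n (c + s n) (d - s n) x * P n x" for n x
  show thesis
  proof
    fix n x
    have "\<forall>x. x \<notin> {c + s n..d - s n} \<longrightarrow> \<phi> n x = 0" by (auto simp: \<phi>_def cutoff_zero)
    moreover have "c < c + s n \<and> c + s n \<le> d - s n \<and> d - s n < d" 
    proof -
      have "2 * s n \<le> d - c" using s(2)[of n] cd(2) by simp
      then show ?thesis using s(1)[of n] by simp
    qed
    moreover have "smooth (\<phi> n)" unfolding \<phi>_def[abs_def]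
      by (intro smooth_mult smooth_cutoff smooth_real_polynomial P)
    ultimately show "\<phi> n \<in> test_in c d" unfolding test_in_def by blast
    show "\<bar>\<phi> n x\<bar> \<le> B + 1"
    proof (cases "x \<in> {0..1}")
      case True
      have "1 / (real n + 1) \<le> 1" by simp
      then have "\<bar>P n x\<bar> \<le> B + 1" using P(2)[OF True, of n] B by linarith
      then have "\<bar>cutoff n (c + s n) (d - s n) x\<bar> * \<bar>P n x\<bar> \<le> 1 * (B + 1)"
        using cutoff_bounds by (intro mult_mono) auto
      then show ?thesis by (simp add: \<phi>_def abs_mult)
    next
      case False
      then have "x \<le> c + s n \<or> d - s n \<le> x" using s(1)[of n] cd by auto
      then show ?thesis using B by (simp add: \<phi>_def cutoff_zero)
    qed
  next
    have "AE x in lebesgue. x \<notin> N"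
      using N by (simp add: negligible_iff_null_sets AE_not_in)
    then have "AE x in lebO. x \<notin> N"
      by (subst AE_restrict_space_iff) auto
    then show "AE x in lebO. (\<lambda>n. \<phi> n x) \<longlonglongrightarrow> g x * indicator {c<..<d} x"
      using AE_space
    proof eventually_elim
      case (elim x)
      have "(\<lambda>n. max (- B) (min B (G n x))) \<longlonglongrightarrow> max (- B) (min B (g x))"
        using lim[of x] elim by (intro tendsto_intros) auto
      then have 1: "(\<lambda>n. max (- B) (min B (G n x))) \<longlonglongrightarrow> g x"
        using g(2)[of x] by (simp add: max_def min_def abs_le_iff split: if_splits)
      have 2: "(\<lambda>n. max (- B) (min B (G n x)) - P n x) \<longlonglongrightarrow> 0"
      proof (rule tendsto_rabs_zero_cancel, rule tendsto_sandwich[of "\<lambda>n. 0" _ _ "\<lambda>n. 1 / (real n + 1)"])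
        show "(\<lambda>n. 1 / (real n + 1)) \<longlonglongrightarrow> 0" by real_asymp
        show "\<forall>\<^sub>F n in sequentially. \<bar>max (- B) (min B (G n x)) - P n x\<bar> \<le> 1 / (real n + 1)"
          using P(2)[of x] elim by (auto intro!: always_eventually less_imp_le)
      qed auto
      have "(\<lambda>n. P n x) \<longlonglongrightarrow> g x" using tendsto_diff[OF 1 2] by simp
      from tendsto_mult[OF cutoff_shrink_tendsto[OF cd(2), of x] this]
      show ?case by (simp add: \<phi>_def s_def mult.commute)
    qed
  qed
qed

text \<open>The fundamental lemma of the calculus of variations, by testing with approximations of
  the sign of the function.\<close>

lemma fundamental_lemma:
  assumes cd: "0 \<le> c" "c < d" "d \<le> 1" and f: "integrable lebO f"
    and test: "\<And>\<phi>. \<phi> \<in> test_in c d \<Longrightarrow> L2_inner f \<phi> = 0"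
  shows "AE x in lebO. x \<in> {c<..<d} \<longrightarrow> f x = 0"
proof -
  have [measurable]: "f \<in> borel_measurable lebO" using f by simp
  have s1: "(\<lambda>x. sgn (f x)) \<in> borel_measurable lebO" by measurable
  have s2: "\<bar>sgn (f x)\<bar> \<le> 1" for x by (simp add: sgn_real_def)
  obtain \<phi> where \<phi>: "\<And>n::nat. \<phi> n \<in> test_in c d" "\<And>n x. \<bar>\<phi> n x\<bar> \<le> 1 + 1"
    "AE x in lebO. (\<lambda>n. \<phi> n x) \<longlonglongrightarrow> sgn (f x) * indicator {c<..<d} x"
    by (rule test_approx[OF cd s1 s2]) (rule that)
  have [measurable]: "\<phi> n \<in> borel_measurable lebO" for n
    using test_funs_Linf[OF test_in_test_funs[OF cd(1,3) \<phi>(1)]] by (rule Linf_measurable)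
  have [measurable]: "indicat_real {c<..<d} \<in> borel_measurable lebO"
    by (rule lebO_measurable_borel) simp
  have "(\<lambda>n. LINT x|lebO. f x * \<phi> n x) \<longlonglongrightarrow> (LINT x|lebO. f x * (sgn (f x) * indicator {c<..<d} x))"
  proof (rule integral_dominated_convergence[where w="\<lambda>x. 2 * \<bar>f x\<bar>"])
    show "AE x in lebO. (\<lambda>n. f x * \<phi> n x) \<longlonglongrightarrow> f x * (sgn (f x) * indicator {c<..<d} x)"
      using \<phi>(3) by eventually_elim (intro tendsto_intros)
    show "AE x in lebO. norm (f x * \<phi> n x) \<le> 2 * \<bar>f x\<bar>" for n
      using \<phi>(2)[of n] by (auto simp: abs_mult mult.commute[of 2] intro!: mult_left_mono)
  qed (use f in auto)
  moreover have "(\<lambda>n. LINT x|lebO. f x * \<phi> n x) = (\<lambda>n. 0)"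
    using test[OF \<phi>(1)] by (simp add: L2_inner_def)
  ultimately have "(LINT x|lebO. f x * (sgn (f x) * indicator {c<..<d} x)) = 0"
    using LIMSEQ_unique tendsto_const by metis
  moreover have "f x * (sgn (f x) * indicator {c<..<d} x) = \<bar>f x\<bar> * indicator {c<..<d} x" for x
    by (simp add: abs_sgn)
  ultimately have 0: "(LINT x|lebO. \<bar>f x\<bar> * indicator {c<..<d} x) = 0" by simp
  have "integrable lebO (\<lambda>x. \<bar>f x\<bar> * indicator {c<..<d} x)"
    by (rule Bochner_Integration.integrable_bound[OF f]) (auto simp: indicator_def)
  then have "AE x in lebO. \<bar>f x\<bar> * indicator {c<..<d} x = 0"
    using 0 by (subst (asm) integral_nonneg_eq_0_iff_AE) auto
  then show ?thesis by eventually_elim (auto simp: indicator_def)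
qed

lemma integral_bump_pos:
  assumes "0 \<le> c" "c < d" "d \<le> 1" shows "0 < integral {0..1} (bump c d)"
proof -
  have c: "continuous_on {0..1} (bump c d)" by (rule smooth_continuous[OF smooth_bump])
  have "integral {0..1} (bump c d) \<ge> 0"
    by (rule integral_nonneg) (use c integrable_continuous_real bump_bounds in auto)
  moreover have "integral {0..1} (bump c d) \<noteq> 0"
    using integral_eq_0_iff[OF c] bump_bounds bump_pos[of c "(c + d) / 2" d] assms
    by (auto dest!: bspec[of _ _ "(c + d) / 2"])
  ultimately show ?thesis by linarith
qed

text \<open>Subtracting a multiple of a fixed bump gives any test function a vanishing integral and makes it
  a derivative; the constant is the weighted mean of \<open>f\<close> against the normalised bump.\<close>

lemma du_Bois_Reymond:
  assumes cd: "0 \<le> c" "c < d" "d \<le> 1" and f: "integrable lebO f"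
    and test: "\<And>\<phi>. \<phi> \<in> test_in c d \<Longrightarrow> L2_inner f (deriv \<phi>) = 0"
  obtains k where "AE x in lebO. x \<in> {c<..<d} \<longrightarrow> f x = k"
proof -
  define \<rho>0 where "\<rho>0 = bump (c + (d - c) / 3) (d - (d - c) / 3)"
  define m where "m = integral {0..1} \<rho>0"
  have \<rho>0: "\<rho>0 \<in> test_in c d" unfolding \<rho>0_def by (rule test_in_bump[OF cd(2)])
  have m: "m > 0" unfolding m_def \<rho>0_def
    by (rule integral_bump_pos) (use cd in \<open>auto simp: field_simps\<close>)
  define k where "k = L2_inner f \<rho>0 / m"
  note Li = test_funs_Linf[OF test_in_test_funs[OF cd(1,3)]]
  have "AE x in lebO. x \<in> {c<..<d} \<longrightarrow> f x - k = 0"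
  proof (rule fundamental_lemma[OF cd])
    show "integrable lebO (\<lambda>x. f x - k)" using f by simp
    fix \<rho> assume \<rho>: "\<rho> \<in> test_in c d"
    define t where "t = integral {0..1} \<rho> / m"
    have ci: "\<psi> integrable_on {0..1}" if "\<psi> \<in> test_in c d" for \<psi>
      by (intro integrable_continuous_real smooth_continuous test_in_smooth[OF that])
    have "(\<lambda>x. \<rho> x - t * \<rho>0 x) \<in> test_in c d" by (intro test_in_diff test_in_cmult \<rho> \<rho>0)
    moreover have "integral {0..1} (\<lambda>x. \<rho> x - t * \<rho>0 x) = 0"
      using m ci[OF \<rho>] ci[OF test_in_cmult[OF \<rho>0, of t]]
      by (simp add: Henstock_Kurzweil_Integration.integral_diff t_def m_def[symmetric])
    ultimately obtain \<phi> where \<phi>: "\<phi> \<in> test_in c d" "deriv \<phi> = (\<lambda>x. \<rho> x - t * \<rho>0 x)"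
      using test_in_antideriv[OF _ cd(1,3)] by metis
    have i: "integrable lebO (\<lambda>x. f x * \<psi> x)" "integrable lebO \<psi>" if "\<psi> \<in> test_in c d" for \<psi>
      using Linf_mult_integrable[OF f Li[OF that]] Linf_integrable[OF Li[OF that]] by auto
    have "L2_inner f \<rho> = t * L2_inner f \<rho>0"
    proof -
      have "0 = (LINT x|lebO. f x * (\<rho> x - t * \<rho>0 x))"
        using test[OF \<phi>(1)] \<phi>(2) by (simp add: L2_inner_def)
      also have "\<dots> = (LINT x|lebO. f x * \<rho> x - t * (f x * \<rho>0 x))"
        by (simp add: algebra_simps)
      also have "\<dots> = L2_inner f \<rho> - t * L2_inner f \<rho>0"
        using i(1)[OF \<rho>] i(1)[OF \<rho>0] by (simp add: L2_inner_def)
      finally show ?thesis by simp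
    qed
    also have "\<dots> = k * (LINT x|lebO. \<rho> x)"
      using lebO_integral_eq[OF i(2)[OF \<rho>]] m by (simp add: k_def t_def)
    finally show "L2_inner (\<lambda>x. f x - k) \<rho> = 0"
      using i[OF \<rho>] by (simp add: L2_inner_def left_diff_distrib)
  qed
  then show thesis using that[of k] by simp
qed

section \<open>Weak derivatives and the space of the state equation\<close>

lemma has_weak_deriv_unique:
  assumes "has_weak_deriv f g" "has_weak_deriv f g'" shows "AE x in lebO. g x = g' x"
proof -
  have i: "integrable lebO g" "integrable lebO g'" using assms by (auto simp: has_weak_deriv_def L1_def)
  have "AE x in lebO. x \<in> {0<..<1} \<longrightarrow> g x - g' x = 0"
  proof (rule fundamental_lemma)
    fix \<phi> assume "\<phi> \<in> test_in 0 1"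
    then have \<phi>: "\<phi> \<in> test_funs" by (simp add: test_funs_eq)
    then have "L2_inner g \<phi> = L2_inner g' \<phi>"
      using assms unfolding has_weak_deriv_def by (metis minus_equation_iff)
    then show "L2_inner (\<lambda>x. g x - g' x) \<phi> = 0"
      using Linf_mult_integrable[OF i(1) test_funs_Linf[OF \<phi>]] Linf_mult_integrable[OF i(2) test_funs_Linf[OF \<phi>]]
      by (simp add: L2_inner_def left_diff_distrib)
  qed (use i in auto)
  then show ?thesis using AE_space by eventually_elim auto
qed

lemma weak_deriv_has: "has_weak_deriv f g \<Longrightarrow> has_weak_deriv f (weak_deriv f)"
  unfolding weak_deriv_def by (rule someI[of "has_weak_deriv f"])

lemma weak_deriv_AE: "has_weak_deriv f g \<Longrightarrow> AE x in lebO. weak_deriv f x = g x"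
  using has_weak_deriv_unique weak_deriv_has by blast

lemma weak_deriv_measurable: "has_weak_deriv f g \<Longrightarrow> weak_deriv f \<in> borel_measurable lebO"
  using weak_deriv_has unfolding has_weak_deriv_def L1_def by blast

lemma has_weak_deriv_diff:
  assumes "has_weak_deriv f f'" "has_weak_deriv g g'"
  shows "has_weak_deriv (\<lambda>x. f x - g x) (\<lambda>x. f' x - g' x)"
proof -
  have i: "integrable lebO f" "integrable lebO g" "integrable lebO f'" "integrable lebO g'"
    using assms by (auto simp: has_weak_deriv_def L1_def)
  have "L2_inner (\<lambda>x. f x - g x) (deriv \<phi>) = - L2_inner (\<lambda>x. f' x - g' x) \<phi>"
    if \<phi>: "\<phi> \<in> test_funs" for \<phi>
  proof -
    have "L2_inner f (deriv \<phi>) = - L2_inner f' \<phi>" "L2_inner g (deriv \<phi>) = - L2_inner g' \<phi>"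
      using assms \<phi> by (auto simp: has_weak_deriv_def)
    then show ?thesis
      using i[THEN Linf_mult_integrable, OF test_funs_Linf[OF \<phi>]]
        i[THEN Linf_mult_integrable, OF test_funs_Linf[OF test_funs_deriv[OF \<phi>]]]
      by (simp add: L2_inner_def left_diff_distrib)
  qed
  then show ?thesis using i by (auto simp: has_weak_deriv_def L1_def)
qed

lemma has_weak_deriv_test: assumes "\<phi> \<in> test_funs" shows "has_weak_deriv \<phi> (deriv \<phi>)"
proof -
  have "L2_inner \<phi> (deriv \<psi>) = - L2_inner (deriv \<phi>) \<psi>" if \<psi>: "\<psi> \<in> test_funs" for \<psi>
  proof -
    have i: "integrable lebO (deriv \<phi>)" "integrable lebO (deriv \<psi>)"
      using assms \<psi> by (auto intro: Linf_integrable test_funs_Linf test_funs_deriv)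
    have "L2_inner \<phi> (deriv \<psi>) = (LINT x|lebO. prim (deriv \<phi>) x * deriv \<psi> x)"
      unfolding L2_inner_def by (rule Bochner_Integration.integral_cong) (use assms in \<open>auto simp: prim_deriv_test\<close>)
    also have "\<dots> = - (LINT x|lebO. deriv \<phi> x * prim (deriv \<psi>) x)"
      using prim_by_parts[OF i] prim_1[OF i(1)] prim_deriv_test[OF assms, of 1] test_funs_outside[OF assms, of 1] by simp
    also have "(LINT x|lebO. deriv \<phi> x * prim (deriv \<psi>) x) = L2_inner (deriv \<phi>) \<psi>"
      unfolding L2_inner_def by (rule Bochner_Integration.integral_cong) (use \<psi> in \<open>auto simp: prim_deriv_test\<close>)
    finally show ?thesis .
  qed
  then show ?thesis
    using assms by (auto simp: has_weak_deriv_def L1_def intro: Linf_integrable test_funs_Linf test_funs_deriv)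
qed

text \<open>The absolutely continuous functions with square integrable derivative \<open>g\<close> and zero boundary values, up to
  a null set. Carrying the derivative along avoids the choice hidden in \<open>weak_deriv\<close>.\<close>

definition ac0 :: "(real \<Rightarrow> real) \<Rightarrow> (real \<Rightarrow> real) \<Rightarrow> bool"
  where "ac0 v g \<longleftrightarrow> g \<in> L2 \<and> prim g 1 = 0 \<and> v \<in> borel_measurable lebO \<and> (AE x in lebO. v x = prim g x)"

lemma ac0_Linf: "ac0 v g \<Longrightarrow> v \<in> Linf"
proof -
  assume v: "ac0 v g"
  obtain B where "AE x in lebO. \<bar>prim g x\<bar> \<le> B"
    using v prim_Linf[OF L2_integrable, of g] LinfE[of "prim g"] by (auto simp: ac0_def)
  moreover have "AE x in lebO. v x = prim g x" using v by (simp add: ac0_def)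
  ultimately have "AE x in lebO. \<bar>v x\<bar> \<le> B" by eventually_elim simp
  then show ?thesis using v by (auto simp: ac0_def Linf_def)
qed

lemma ac0_L2: "ac0 v g \<Longrightarrow> v \<in> L2" by (intro Linf_L2 ac0_Linf)

lemma ac0_add: assumes "ac0 v g" "ac0 w k" shows "ac0 (\<lambda>x. v x + w x) (\<lambda>x. g x + k x)"
proof -
  have i: "integrable lebO g" "integrable lebO k" using assms by (auto simp: ac0_def L2_integrable)
  have "AE x in lebO. v x = prim g x" "AE x in lebO. w x = prim k x" using assms by (auto simp: ac0_def)
  then have "AE x in lebO. v x + w x = prim (\<lambda>x. g x + k x) x"
    using AE_space by eventually_elim (auto simp: prim_add[OF i])
  then show ?thesis using assms by (auto simp: ac0_def prim_add[OF i] L2_add)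
qed

lemma ac0_cmult: "ac0 v g \<Longrightarrow> ac0 (\<lambda>x. c * v x) (\<lambda>x. c * g x)"
  by (auto simp: ac0_def prim_cmult L2_cmult)

lemma ac0_diff: assumes "ac0 v g" "ac0 w k" shows "ac0 (\<lambda>x. v x - w x) (\<lambda>x. g x - k x)"
  using ac0_add[OF assms(1) ac0_cmult[OF assms(2), of "-1"]] by simp

lemma ac0_weak_deriv: assumes "ac0 v g" shows "has_weak_deriv v g"
proof -
  have g: "integrable lebO g" and v: "integrable lebO v"
    using assms ac0_Linf[OF assms] by (auto simp: ac0_def L2_integrable Linf_integrable)
  have "L2_inner v (deriv \<psi>) = - L2_inner g \<psi>" if \<psi>: "\<psi> \<in> test_funs" for \<psi>
  proof -
    have i: "integrable lebO (deriv \<psi>)"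
      using \<psi> by (auto intro: Linf_integrable test_funs_Linf test_funs_deriv)
    have "L2_inner v (deriv \<psi>) = (LINT x|lebO. prim g x * deriv \<psi> x)"
      unfolding L2_inner_def
    proof (rule integral_cong_AE)
      show "AE x in lebO. v x * deriv \<psi> x = prim g x * deriv \<psi> x"
        using assms unfolding ac0_def by (auto elim: eventually_mono)
    qed (use i v prim_Linf[OF g] in \<open>auto simp: Linf_def\<close>)
    also have "\<dots> = - (LINT x|lebO. g x * prim (deriv \<psi>) x)"
      using prim_by_parts[OF g i] prim_1[OF g] assms by (simp add: ac0_def)
    also have "(LINT x|lebO. g x * prim (deriv \<psi>) x) = L2_inner g \<psi>"
      unfolding L2_inner_def by (rule Bochner_Integration.integral_cong) (use \<psi> in \<open>auto simp: prim_deriv_test\<close>)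
    finally show ?thesis .
  qed
  then show ?thesis using g v by (auto simp: has_weak_deriv_def L1_def)
qed

lemma ac0_unique: assumes "ac0 v g" "ac0 v' g'" "AE x in lebO. v x = v' x"
  shows "AE x in lebO. g x = g' x"
proof -
  have "AE x in lebO. v' x = prim g' x" using assms(2) by (simp add: ac0_def)
  with assms(3) have "AE x in lebO. v x = prim g' x" by eventually_elim simp
  then have "ac0 v g'" using assms unfolding ac0_def by blast
  then show ?thesis using assms(1) ac0_weak_deriv has_weak_deriv_unique by blast
qed

lemma test_funs_ac0: assumes "\<phi> \<in> test_funs" shows "ac0 \<phi> (deriv \<phi>)"
  using assms prim_deriv_test[OF assms] test_funs_outside[OF assms, of 1]
  by (auto simp: ac0_def intro!: Linf_L2 test_funs_Linf test_funs_deriv Linf_measurable AE_lebO_I)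

text \<open>\<open>H\<^sup>1\<^sub>0\<close> consists of primitives because the values of a primitive are bounded by the \<open>L\<^sup>2\<close> norm of
  its derivative, so that limits of test functions are primitives of the limits of their
  derivatives.\<close>

lemma H10_ac0: assumes "v \<in> H10" obtains g where "ac0 v g"
proof -
  obtain g \<phi> where v: "v \<in> L2" and g: "g \<in> L2" "has_weak_deriv v g"
    and \<phi>: "\<And>n::nat. \<phi> n \<in> test_funs" and lim: "(\<lambda>n. norm_H1 (\<lambda>x. \<phi> n x - v x)) \<longlonglongrightarrow> 0"
    using assms by (auto simp: H10_def H1_def)
  define e where "e n = norm_H1 (\<lambda>x. \<phi> n x - v x)" for n
  have e0: "e n \<ge> 0" for n by (simp add: e_def norm_H1_def)
  have \<phi>': "deriv (\<phi> n) \<in> L2" "\<phi> n \<in> L2" for n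
    by (auto intro: Linf_L2 test_funs_Linf test_funs_deriv \<phi>)
  have b1: "norm_L2 (\<lambda>x. \<phi> n x - v x) \<le> e n" for n
    unfolding e_def norm_H1_def by (rule real_le_rsqrt) simp
  have b2: "norm_L2 (\<lambda>x. deriv (\<phi> n) x - g x) \<le> e n" for n
  proof -
    have w: "has_weak_deriv (\<lambda>x. \<phi> n x - v x) (\<lambda>x. deriv (\<phi> n) x - g x)"
      by (intro has_weak_deriv_diff has_weak_deriv_test \<phi> g)
    have "norm_L2 (\<lambda>x. deriv (\<phi> n) x - g x) = norm_L2 (weak_deriv (\<lambda>x. \<phi> n x - v x))"
      by (rule norm_L2_cong[symmetric, OF weak_deriv_AE[OF w] weak_deriv_measurable[OF w]])
        (use \<phi>' g in \<open>auto intro: L2_measurable L2_diff\<close>)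
    also have "\<dots> \<le> e n"
      unfolding e_def norm_H1_def by (rule real_le_rsqrt) simp
    finally show ?thesis .
  qed
  have pw: "\<bar>\<phi> n x - prim g x\<bar> \<le> e n" if "0 \<le> x" "x \<le> 1" for n x
  proof -
    have "\<phi> n x - prim g x = prim (\<lambda>x. deriv (\<phi> n) x - g x) x"
      using prim_minus[OF L2_integrable[OF \<phi>'(1)] L2_integrable[OF g(1)] that(2)] prim_deriv_test[OF \<phi> that] by simp
    then show ?thesis using prim_le_L2[OF L2_diff[OF \<phi>'(1) g(1)] that] b2[of n] by (metis order_trans)
  qed
  have pg: "prim g \<in> L2" by (intro Linf_L2 prim_Linf L2_integrable g)
  have vp: "(\<lambda>x. v x - prim g x) \<in> L2" by (intro L2_diff v pg)
  have "norm_L2 (\<lambda>x. v x - prim g x) \<le> 2 * e n" for n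
  proof -
    have "norm_L2 (\<lambda>x. v x - prim g x) = norm_L2 (\<lambda>x. (v x - \<phi> n x) + (\<phi> n x - prim g x))" by simp
    also have "\<dots> \<le> norm_L2 (\<lambda>x. v x - \<phi> n x) + norm_L2 (\<lambda>x. \<phi> n x - prim g x)"
      by (intro norm_L2_triangle L2_diff v \<phi>' pg)
    also have "norm_L2 (\<lambda>x. \<phi> n x - prim g x) \<le> e n"
      by (rule norm_L2_bounded) (use pw e0 \<phi>' pg in \<open>auto intro!: L2_measurable L2_diff AE_lebO_I\<close>)
    also have "norm_L2 (\<lambda>x. v x - \<phi> n x) \<le> e n" using b1 by (simp add: norm_L2_minus[of v])
    finally show ?thesis by simp
  qed
  then have "norm_L2 (\<lambda>x. v x - prim g x) \<le> 2 * 0"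
    using lim by (intro tendsto_lowerbound[where F=sequentially and f="\<lambda>n. 2 * e n"] tendsto_mult tendsto_const)
      (auto simp: e_def intro!: always_eventually)
  then have "AE x in lebO. v x - prim g x = 0"
    by (intro norm_L2_zero_imp vp) (simp add: order_antisym)
  moreover have "prim g 1 = 0"
  proof -
    have "\<bar>prim g 1\<bar> \<le> e n" for n using pw[of 1 n] test_funs_outside[OF \<phi>, of 1] by simp
    then have "\<bar>prim g 1\<bar> \<le> 0"
      using lim by (intro tendsto_lowerbound[where F=sequentially and f="e"])
        (auto simp: e_def[abs_def] intro!: always_eventually)
    then show ?thesis by simp
  qed
  ultimately have "ac0 v g" using g v by (auto simp: ac0_def L2_measurable)
  then show thesis by (rule that)
qed

text \<open>The derivative is approximated by test functions with a correction of their mean, and these are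
  integrated. Bounded derivatives suffice for piecewise affine functions and for all solutions of
  the state equation.\<close>

lemma ac0_H10: assumes vg: "ac0 v g" and g: "g \<in> Linf" shows "v \<in> H10"
proof -
  obtain B where B: "B \<ge> 0" "AE x in lebO. \<bar>g x\<bar> \<le> B" using g LinfE by metis
  define k where "k x = max (-B) (min B (g x))" for x
  have km: "k \<in> borel_measurable lebO" using g by (auto simp: k_def[abs_def] Linf_def)
  have kB: "\<bar>k x\<bar> \<le> B" for x using B(1) by (auto simp: k_def)
  have kg: "AE x in lebO. k x = g x" using B(2) by eventually_elim (auto simp: k_def)
  obtain \<phi> where \<phi>: "\<And>n::nat. \<phi> n \<in> test_in 0 1" "\<And>n x. \<bar>\<phi> n x\<bar> \<le> B + 1"
    and lim: "AE x in lebO. (\<lambda>n. \<phi> n x) \<longlonglongrightarrow> k x * indicator {0<..<1} x"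
    using test_approx[of 0 1 k B] km kB by auto
  have \<phi>L: "\<phi> n \<in> Linf" for n using \<phi>(1) test_funs_Linf test_funs_eq by blast
  have lim': "AE x in lebO. (\<lambda>n. \<phi> n x) \<longlonglongrightarrow> g x"
    using lim kg AE_space by eventually_elim auto
  define \<rho>0 where "\<rho>0 = bump (0 + (1 - 0) / 3) (1 - (1 - 0) / 3)"
  define m where "m = integral {0..1} \<rho>0"
  have \<rho>0: "\<rho>0 \<in> test_in 0 1" unfolding \<rho>0_def by (rule test_in_bump) simp
  have m: "m > 0" unfolding m_def \<rho>0_def by (rule integral_bump_pos) auto
  have \<rho>0L: "\<rho>0 \<in> Linf" using \<rho>0 test_funs_Linf test_funs_eq by blast
  define t where "t n = integral {0..1} (\<phi> n) / m" for n
  define w where "w n x = \<phi> n x - t n * \<rho>0 x" for n x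
  have gi: "integrable lebO g" by (rule Linf_integrable[OF g])
  have "(\<lambda>n. LINT x|lebO. \<phi> n x) \<longlonglongrightarrow> (LINT x|lebO. g x)"
    by (rule integral_dominated_convergence[where w="\<lambda>x. B + 1"])
      (use lim' \<phi>(2) \<phi>L gi in \<open>auto intro: Linf_measurable\<close>)
  then have "(\<lambda>n. integral {0..1} (\<phi> n)) \<longlonglongrightarrow> 0"
    using lebO_integral_eq[OF Linf_integrable[OF \<phi>L]] prim_1[OF gi] vg by (simp add: ac0_def)
  then have t0: "t \<longlonglongrightarrow> 0" unfolding t_def using tendsto_divide[OF _ tendsto_const[of m]] m by fastforce
  have wt: "w n \<in> test_in 0 1" for n unfolding w_def[abs_def] by (intro test_in_diff test_in_cmult \<phi> \<rho>0)
  have wL: "w n \<in> Linf" for n using wt test_funs_Linf test_funs_eq by blast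
  have ci: "\<psi> integrable_on {0..1}" if "\<psi> \<in> test_in c d" for \<psi> c d
    by (intro integrable_continuous_real smooth_continuous test_in_smooth[OF that])
  have "integral {0..1} (w n) = 0" for n
    unfolding w_def[abs_def] using m ci[OF \<phi>(1)] ci[OF test_in_cmult[OF \<rho>0, of "t n"]]
    by (simp add: Henstock_Kurzweil_Integration.integral_diff t_def m_def[symmetric])
  then have "\<exists>\<psi>. \<psi> \<in> test_in 0 1 \<and> deriv \<psi> = w n" for n
    using test_in_antideriv[OF wt, of n] by (metis order_refl)
  then obtain \<psi> where \<psi>: "\<And>n. \<psi> n \<in> test_funs" "\<And>n. deriv (\<psi> n) = w n"
    unfolding test_funs_eq by metis
  obtain T where T: "\<And>n. \<bar>t n\<bar> \<le> T" using convergent_imp_Bseq[OF convergentI[OF t0]] unfolding Bseq_def by auto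
  have wlim: "AE x in lebO. (\<lambda>n. (w n x - g x)\<^sup>2) \<longlonglongrightarrow> 0"
    using lim'
  proof eventually_elim
    case (elim x)
    have "(\<lambda>n. w n x - g x) \<longlonglongrightarrow> (g x - 0 * \<rho>0 x) - g x"
      unfolding w_def by (intro tendsto_intros elim t0)
    from tendsto_power[OF this, of 2] show ?case by simp
  qed
  have "(\<lambda>n. LINT x|lebO. (w n x - g x)\<^sup>2) \<longlonglongrightarrow> (LINT x|lebO. 0)"
  proof (rule integral_dominated_convergence[where w="\<lambda>x. ((B + 1) + T + B)\<^sup>2"])
    fix n
    have wg: "\<bar>w n x - g x\<bar> \<le> (B + 1) + T + B" if "\<bar>g x\<bar> \<le> B" for x
    proof -
      have "\<bar>t n * \<rho>0 x\<bar> \<le> T * 1" unfolding abs_mult using T[of n] bump_bounds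
        by (intro mult_mono) (auto simp: \<rho>0_def)
      then show ?thesis using that \<phi>(2)[of n x] unfolding w_def by linarith
    qed
    show "AE x in lebO. norm ((w n x - g x)\<^sup>2) \<le> ((B + 1) + T + B)\<^sup>2"
      using B(2)
    proof eventually_elim
      case (elim x)
      then have "\<bar>w n x - g x\<bar> \<le> \<bar>(B + 1) + T + B\<bar>"
        using wg[of x] by linarith
      then show ?case by (simp add: abs_le_square_iff)
    qed
  qed (use wlim Linf_measurable[OF wL] Linf_measurable[OF g] in auto)
  then have "(\<lambda>n. sqrt (2 * (LINT x|lebO. (w n x - g x)\<^sup>2))) \<longlonglongrightarrow> sqrt (2 * 0)"
    by (intro tendsto_intros) auto
  then have lim2: "(\<lambda>n. sqrt (2 * (LINT x|lebO. (w n x - g x)\<^sup>2))) \<longlonglongrightarrow> 0" by simp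
  have bd: "norm_H1 (\<lambda>x. \<psi> n x - v x) \<le> sqrt (2 * (LINT x|lebO. (w n x - g x)\<^sup>2))" for n
  proof -
    have a: "ac0 (\<lambda>x. \<psi> n x - v x) (\<lambda>x. w n x - g x)"
      using ac0_diff[OF test_funs_ac0[OF \<psi>(1)] vg] \<psi>(2) by simp
    note wd = ac0_weak_deriv[OF a]
    have 1: "norm_L2 (weak_deriv (\<lambda>x. \<psi> n x - v x)) = norm_L2 (\<lambda>x. w n x - g x)"
      by (rule norm_L2_cong[OF weak_deriv_AE[OF wd] weak_deriv_measurable[OF wd]])
        (use wL g in \<open>auto intro: Linf_measurable Linf_diff\<close>)
    have 2: "norm_L2 (\<lambda>x. \<psi> n x - v x) \<le> norm_L2 (\<lambda>x. w n x - g x)"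
    proof (rule norm_L2_bounded)
      have "AE x in lebO. \<psi> n x - v x = prim (\<lambda>x. w n x - g x) x" using a by (simp add: ac0_def)
      then show "AE x in lebO. \<bar>\<psi> n x - v x\<bar> \<le> norm_L2 (\<lambda>x. w n x - g x)"
        using AE_space
      proof eventually_elim
        case (elim x)
        then show ?case using prim_le_L2[of "\<lambda>x. w n x - g x" x] a by (simp add: ac0_def)
      qed
      show "(\<lambda>x. \<psi> n x - v x) \<in> borel_measurable lebO" using a by (simp add: ac0_def)
    qed simp
    have "(norm_L2 (\<lambda>x. \<psi> n x - v x))\<^sup>2 \<le> (norm_L2 (\<lambda>x. w n x - g x))\<^sup>2"
      using 2 by (intro power_mono) auto
    then have "norm_H1 (\<lambda>x. \<psi> n x - v x) \<le> sqrt (2 * (norm_L2 (\<lambda>x. w n x - g x))\<^sup>2)"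
      unfolding norm_H1_def 1 by simp
    then show ?thesis by (simp add: norm_L2_def)
  qed
  have "(\<lambda>n. norm_H1 (\<lambda>x. \<psi> n x - v x)) \<longlonglongrightarrow> 0"
    by (rule tendsto_sandwich[OF _ _ tendsto_const lim2])
      (use bd in \<open>auto intro!: always_eventually simp del: real_sqrt_le_iff, simp add: norm_H1_def\<close>)
  then show ?thesis
    using \<psi>(1) ac0_L2[OF vg] ac0_weak_deriv[OF vg] Linf_L2[OF g] by (auto simp: H10_def H1_def)
qed

section \<open>Functions of bounded variation\<close>

subsection \<open>Finite measures on the interval\<close>

lemma finite_borel_space:
  assumes "finite_borel_measure_on_Om M"
  shows "space M = \<Omega>" "sets M = sets (restrict_space borel \<Omega>)" "finite_measure M"
  using assms sets_eq_imp_space_eq[of M "restrict_space borel \<Omega>"]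
  by (auto simp: finite_borel_measure_on_Om_def space_restrict_space)

lemma finite_borel_measurable:
  fixes f :: "real \<Rightarrow> 'a::topological_space"
  assumes "finite_borel_measure_on_Om M" "f \<in> borel_measurable borel"
  shows "f \<in> borel_measurable M"
proof -
  have "f \<in> borel_measurable (restrict_space borel \<Omega>)"
    by (rule measurable_restrict_space1[OF assms(2)])
  then show ?thesis
    using measurable_cong_sets[OF finite_borel_space(2)[OF assms(1)] refl] by blast
qed

lemma finite_borel_sets: "finite_borel_measure_on_Om M \<Longrightarrow> A \<in> sets borel \<Longrightarrow> A \<inter> \<Omega> \<in> sets M"
  by (auto simp: finite_borel_space sets_restrict_space)

lemma finite_borel_setsD: "finite_borel_measure_on_Om M \<Longrightarrow> A \<in> sets M \<Longrightarrow> A \<in> sets borel \<and> A \<subseteq> \<Omega>"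
  by (auto simp: finite_borel_space sets_restrict_space)

lemma finite_borel_integrable:
  fixes f :: "real \<Rightarrow> real"
  assumes "finite_borel_measure_on_Om M" "f \<in> borel_measurable M" "\<And>x. x \<in> \<Omega> \<Longrightarrow> \<bar>f x\<bar> \<le> B"
  shows "integrable M f"
proof -
  interpret finite_measure M by (rule finite_borel_space[OF assms(1)])
  show ?thesis
    by (rule integrable_const_bound[where B=B]) (use assms finite_borel_space[OF assms(1)] in \<open>auto intro: AE_I2\<close>)
qed

definition measure_add :: "real measure \<Rightarrow> real measure \<Rightarrow> real measure"
  where "measure_add M N = measure_of (space M) (sets M) (\<lambda>A. emeasure M A + emeasure N A)"

lemma measure_add:
  assumes M: "finite_borel_measure_on_Om M" and N: "finite_borel_measure_on_Om N"
  shows sets_measure_add: "sets (measure_add M N) = sets M"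
    and emeasure_measure_add: "A \<in> sets M \<Longrightarrow> emeasure (measure_add M N) A = emeasure M A + emeasure N A"
    and finite_borel_measure_add: "finite_borel_measure_on_Om (measure_add M N)"
proof -
  show s: "sets (measure_add M N) = sets M"
    by (simp add: measure_add_def sets.sigma_sets_eq)
  have sN: "sets N = sets M" using finite_borel_space[OF M] finite_borel_space[OF N] by simp
  have "emeasure (measure_add M N) A = emeasure M A + emeasure N A" if "A \<in> sets M" for A
  proof (rule emeasure_measure_of[of _ "space M" "sets M" "\<lambda>A. emeasure M A + emeasure N A"])
    show "measure_add M N = measure_of (space M) (sets M) (\<lambda>A. emeasure M A + emeasure N A)"
      by (rule measure_add_def)
    show "sets M \<subseteq> Pow (space M)" by (rule sets.space_closed)
    show "A \<in> sets (measure_add M N)" using that s by simp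
    show "positive (sets (measure_add M N)) (\<lambda>A. emeasure M A + emeasure N A)"
      by (simp add: positive_def)
    show "countably_additive (sets (measure_add M N)) (\<lambda>A. emeasure M A + emeasure N A)"
      unfolding s countably_additive_def
    proof safe
      fix A :: "nat \<Rightarrow> real set" assume A: "range A \<subseteq> sets M" "disjoint_family A"
      have "(\<Sum>i. emeasure M (A i) + emeasure N (A i)) = (\<Sum>i. emeasure M (A i)) + (\<Sum>i. emeasure N (A i))"
        by (rule suminf_add[symmetric]) auto
      then show "(\<Sum>i. emeasure M (A i) + emeasure N (A i)) = emeasure M (\<Union>(range A)) + emeasure N (\<Union>(range A))"
        using suminf_emeasure[OF A] suminf_emeasure[of A N] A sN by simp
    qed
  qed
  then show e: "A \<in> sets M \<Longrightarrow> emeasure (measure_add M N) A = emeasure M A + emeasure N A" by blast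
  have "space (measure_add M N) = space M" using s by (rule sets_eq_imp_space_eq)
  moreover have "emeasure M (space M) \<noteq> \<infinity>" "emeasure N (space M) \<noteq> \<infinity>"
    using finite_borel_space[OF M] finite_borel_space[OF N]
      finite_measure.finite_emeasure_space[of M] finite_measure.finite_emeasure_space[of N] by auto
  ultimately have "finite_measure (measure_add M N)"
    by (intro finite_measureI) (simp add: \<open>\<And>A. A \<in> sets M \<Longrightarrow> emeasure (measure_add M N) A = emeasure M A + emeasure N A\<close>)
  then show "finite_borel_measure_on_Om (measure_add M N)"
    using s finite_borel_space[OF M] by (simp add: finite_borel_measure_on_Om_def)
qed

lemma nn_integral_measure_add:
  assumes M: "finite_borel_measure_on_Om M" and N: "finite_borel_measure_on_Om N"
    and f: "f \<in> borel_measurable M"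
  shows "(\<integral>\<^sup>+x. f x \<partial>measure_add M N) = (\<integral>\<^sup>+x. f x \<partial>M) + (\<integral>\<^sup>+x. f x \<partial>N)"
proof -
  note sA = sets_measure_add[OF M N]
  note mA = measurable_cong_sets[OF sA refl]
  have sN: "sets N = sets M" using finite_borel_space[OF M] finite_borel_space[OF N] by simp
  note mN = measurable_cong_sets[OF sN refl]
  have spA: "space (measure_add M N) = space M" using sA by (rule sets_eq_imp_space_eq)
  have spN: "space N = space M" using sN by (rule sets_eq_imp_space_eq)
  show ?thesis using f
  proof (induction rule: borel_measurable_induct)
    case (cong f g)
    then show ?case
      using nn_integral_cong[of M f g] nn_integral_cong[of N f g] nn_integral_cong[of "measure_add M N" f g]
      by (simp add: spA spN)
  next
    case (set A)
    then show ?case by (simp add: sA sN emeasure_measure_add[OF M N])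
  next
    case (mult u c)
    then show ?case by (simp add: nn_integral_cmult mA mN distrib_left)
  next
    case (add u v)
    then show ?case by (simp add: nn_integral_add mA mN algebra_simps)
  next
    case (seq U)
    have i: "incseq (\<lambda>i. \<integral>\<^sup>+x. U i x \<partial>M)" "incseq (\<lambda>i. \<integral>\<^sup>+x. U i x \<partial>N)"
      using seq(3) by (auto simp: incseq_def le_fun_def intro!: nn_integral_mono)
    have "(\<integral>\<^sup>+x. (SUP i. U i x) \<partial>measure_add M N) = (SUP i. (\<integral>\<^sup>+x. U i x \<partial>M) + (\<integral>\<^sup>+x. U i x \<partial>N))"
      using seq by (subst nn_integral_monotone_convergence_SUP) (auto simp: mA)
    also have "\<dots> = (SUP i. \<integral>\<^sup>+x. U i x \<partial>M) + (SUP i. \<integral>\<^sup>+x. U i x \<partial>N)"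
      by (rule ennreal_SUP_add[OF i])
    also have "\<dots> = (\<integral>\<^sup>+x. (SUP i. U i x) \<partial>M) + (\<integral>\<^sup>+x. (SUP i. U i x) \<partial>N)"
      using seq by (simp add: nn_integral_monotone_convergence_SUP mN)
    finally show ?case by (simp add: image_comp)
  qed
qed

lemma integral_measure_add:
  fixes f :: "real \<Rightarrow> real"
  assumes M: "finite_borel_measure_on_Om M" and N: "finite_borel_measure_on_Om N"
    and f: "f \<in> borel_measurable M" "\<And>x. x \<in> \<Omega> \<Longrightarrow> \<bar>f x\<bar> \<le> B"
  shows "(LINT x|measure_add M N. f x) = (LINT x|M. f x) + (LINT x|N. f x)"
proof -
  have sN: "sets N = sets M" using finite_borel_space[OF M] finite_borel_space[OF N] by simp
  have fN: "f \<in> borel_measurable N" "f \<in> borel_measurable (measure_add M N)"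
    using f(1) measurable_cong_sets[OF sN refl] measurable_cong_sets[OF sets_measure_add[OF M N] refl] by auto
  have iM: "integrable M f" and iN: "integrable N f" and iA: "integrable (measure_add M N) f"
    using finite_borel_integrable[OF M f] finite_borel_integrable[OF N fN(1) f(2)]
      finite_borel_integrable[OF finite_borel_measure_add[OF M N] fN(2) f(2)] by auto
  have a: "(\<integral>\<^sup>+x. ennreal (f x) \<partial>measure_add M N) = (\<integral>\<^sup>+x. ennreal (f x) \<partial>M) + (\<integral>\<^sup>+x. ennreal (f x) \<partial>N)"
    "(\<integral>\<^sup>+x. ennreal (- f x) \<partial>measure_add M N) = (\<integral>\<^sup>+x. ennreal (- f x) \<partial>M) + (\<integral>\<^sup>+x. ennreal (- f x) \<partial>N)"
    using f by (auto intro!: nn_integral_measure_add M N)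
  have fin: "(\<integral>\<^sup>+x. ennreal (f x) \<partial>M) < top" "(\<integral>\<^sup>+x. ennreal (- f x) \<partial>M) < top"
    "(\<integral>\<^sup>+x. ennreal (f x) \<partial>N) < top" "(\<integral>\<^sup>+x. ennreal (- f x) \<partial>N) < top"
    using iM iN by (auto simp: real_integrable_def less_top)
  show ?thesis
    unfolding real_lebesgue_integral_def[OF iM] real_lebesgue_integral_def[OF iN] real_lebesgue_integral_def[OF iA] a
    using fin by (simp add: enn2real_plus)
qed

lemma measure_measure_add:
  assumes M: "finite_borel_measure_on_Om M" and N: "finite_borel_measure_on_Om N" and A: "A \<in> sets M"
  shows "measure (measure_add M N) A = measure M A + measure N A"
proof -
  interpret M: finite_measure M by (rule finite_borel_space[OF M])
  interpret N: finite_measure N by (rule finite_borel_space[OF N])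
  show ?thesis unfolding measure_def emeasure_measure_add[OF M N A]
    by (simp add: M.emeasure_eq_measure N.emeasure_eq_measure enn2real_plus)
qed

definition measure_scale :: "real \<Rightarrow> real measure \<Rightarrow> real measure"
  where "measure_scale c M = density M (\<lambda>_. ennreal c)"

lemma measure_scale:
  assumes M: "finite_borel_measure_on_Om M" and c: "c \<ge> 0"
  shows finite_borel_measure_scale: "finite_borel_measure_on_Om (measure_scale c M)"
    and measure_measure_scale: "A \<in> sets M \<Longrightarrow> measure (measure_scale c M) A = c * measure M A"
    and integral_measure_scale: "f \<in> borel_measurable M \<Longrightarrow> (LINT x|measure_scale c M. f x) = c * (LINT x|M. f x :: real)"
proof -
  interpret M: finite_measure M by (rule finite_borel_space[OF M])
  have e: "emeasure (measure_scale c M) A = ennreal c * emeasure M A" if "A \<in> sets M" for A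
    unfolding measure_scale_def using that by (simp add: emeasure_density nn_integral_cmult_indicator)
  show "finite_borel_measure_on_Om (measure_scale c M)"
    unfolding finite_borel_measure_on_Om_def
  proof
    show "finite_measure (measure_scale c M)"
    proof
      have "space (measure_scale c M) = space M" by (simp add: measure_scale_def)
      then show "emeasure (measure_scale c M) (space (measure_scale c M)) \<noteq> \<infinity>"
        by (simp add: e ennreal_mult_eq_top_iff M.emeasure_eq_measure)
    qed
    show "sets (measure_scale c M) = sets (restrict_space borel \<Omega>)"
      using finite_borel_space[OF M] by (simp add: measure_scale_def)
  qed
  show "measure (measure_scale c M) A = c * measure M A" if "A \<in> sets M"
    unfolding measure_def e[OF that] using c by (simp add: enn2real_mult)
  show "(LINT x|measure_scale c M. f x) = c * (LINT x|M. f x)" if "f \<in> borel_measurable M"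
    unfolding measure_scale_def using that c by (simp add: integral_density)
qed

text \<open>The Dirac measure, as image of the Lebesgue measure of total mass one.\<close>

definition point_mass :: "real \<Rightarrow> real measure"
  where "point_mass y = distr lebO (restrict_space borel \<Omega>) (\<lambda>_. y)"

lemma point_mass:
  assumes "y \<in> \<Omega>"
  shows finite_borel_point_mass: "finite_borel_measure_on_Om (point_mass y)"
    and measure_point_mass_UNIV: "measure (point_mass y) \<Omega> = 1"
    and integral_point_mass: "f \<in> borel_measurable borel \<Longrightarrow> (LINT x|point_mass y. f x :: real) = f y"
proof -
  have sp: "space (restrict_space borel \<Omega>) = \<Omega>" by (simp add: space_restrict_space)
  have t: "\<Omega> \<in> sets (restrict_space borel \<Omega>)" using sets.top[of "restrict_space borel \<Omega>"] sp by simp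
  have m: "(\<lambda>_. y) \<in> measurable lebO (restrict_space borel \<Omega>)" using assms sp by simp
  have e: "emeasure (point_mass y) \<Omega> = 1"
    unfolding point_mass_def using emeasure_distr[OF m t] assms lebO.emeasure_eq_measure[of \<Omega>] by simp
  have "finite_measure (point_mass y)"
    by (rule finite_measureI) (simp add: point_mass_def sp e[unfolded point_mass_def])
  then show "finite_borel_measure_on_Om (point_mass y)"
    by (simp add: finite_borel_measure_on_Om_def point_mass_def)
  show "measure (point_mass y) \<Omega> = 1" by (simp add: measure_def e)
  show "(LINT x|point_mass y. f x) = f y" if "f \<in> borel_measurable borel"
    unfolding point_mass_def
    using integral_distr[OF m measurable_restrict_space1[OF that]] by simp
qed

subsection \<open>The total variation\<close>

abbreviation borel_partitions :: "real set set set"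
  where "borel_partitions \<equiv> {P. finite P \<and> partition_on \<Omega> P \<and> P \<subseteq> sets (restrict_space borel \<Omega>)}"

lemma sum_measure_partition:
  assumes M: "finite_borel_measure_on_Om M" and P: "P \<in> borel_partitions"
  shows "(\<Sum>E\<in>P. measure M E) = measure M \<Omega>"
proof -
  interpret M: finite_measure M by (rule finite_borel_space[OF M])
  have "measure M (\<Union>E\<in>P. E) = (\<Sum>E\<in>P. measure M E)"
    by (rule M.finite_measure_finite_Union)
      (use P finite_borel_space[OF M] in \<open>auto simp: disjoint_family_on_def partition_on_def disjoint_def\<close>)
  then show ?thesis using P by (simp add: partition_on_def)
qed

lemma total_variation_upper:
  assumes M: "finite_borel_measure_on_Om M" and N: "finite_borel_measure_on_Om N" and P: "P \<in> borel_partitions"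
  shows "(\<Sum>E\<in>P. \<bar>measure M E - measure N E\<bar>) \<le> total_variation M N"
  unfolding total_variation_def
proof (rule cSUP_upper[OF P])
  show "bdd_above ((\<lambda>P. \<Sum>E\<in>P. \<bar>measure M E - measure N E\<bar>) ` borel_partitions)"
  proof (rule bdd_aboveI2)
    fix P assume P: "P \<in> borel_partitions"
    have "(\<Sum>E\<in>P. \<bar>measure M E - measure N E\<bar>) \<le> (\<Sum>E\<in>P. measure M E + measure N E)"
      by (rule sum_mono) (smt (verit) measure_nonneg)
    then show "(\<Sum>E\<in>P. \<bar>measure M E - measure N E\<bar>) \<le> measure M \<Omega> + measure N \<Omega>"
      by (simp add: sum.distrib sum_measure_partition[OF M P] sum_measure_partition[OF N P])
  qed
qed

lemma total_variation_least:
  assumes "\<And>P. P \<in> borel_partitions \<Longrightarrow> (\<Sum>E\<in>P. \<bar>measure M E - measure N E\<bar>) \<le> c"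
  shows "total_variation M N \<le> c"
  unfolding total_variation_def
proof (rule cSUP_least)
  have "space (restrict_space borel \<Omega>) = \<Omega>" by (simp add: space_restrict_space)
  then have "{\<Omega>} \<in> borel_partitions"
    using sets.top[of "restrict_space borel \<Omega>"] by (auto simp: partition_on_def disjoint_def)
  then show "borel_partitions \<noteq> {}" by blast
qed (use assms in blast)

text \<open>The partition into a set and its complement; one of the two may be empty, and is then not a
  block.\<close>

lemma total_variation_two:
  assumes M: "finite_borel_measure_on_Om M" and N: "finite_borel_measure_on_Om N" and Y: "Y \<in> sets M"
  shows "\<bar>measure M Y - measure N Y\<bar> + \<bar>measure M (\<Omega> - Y) - measure N (\<Omega> - Y)\<bar> \<le> total_variation M N"
proof -
  let ?f = "\<lambda>E. \<bar>measure M E - measure N E\<bar>"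
  have YO: "Y \<subseteq> \<Omega>" using finite_borel_setsD[OF M Y] by simp
  have YC: "\<Omega> - Y \<in> sets M" using sets.compl_sets[OF Y] finite_borel_space[OF M] by simp
  define P where "P = {Y, \<Omega> - Y} - {{}}"
  have ne: "Y \<noteq> \<Omega> - Y"
  proof
    assume "Y = \<Omega> - Y"
    then have "(1/2::real) \<in> Y \<longleftrightarrow> (1/2 \<in> \<Omega> \<and> 1/2 \<notin> Y)" by blast
    then show False by simp
  qed
  have "partition_on \<Omega> P"
  proof (rule partition_onI)
    show "\<Union>P = \<Omega>" using YO by (auto simp: P_def)
    fix A B assume "A \<in> P" "B \<in> P" "A \<noteq> B"
    then show "disjnt A B" by (auto simp: P_def disjnt_def)
  qed (auto simp: P_def)
  moreover have "P \<subseteq> sets (restrict_space borel \<Omega>)"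
    unfolding P_def using Y YC finite_borel_space(2)[OF M] by blast
  ultimately have "P \<in> borel_partitions" by (simp add: P_def)
  from total_variation_upper[OF M N this]
  have "sum ?f P \<le> total_variation M N" .
  moreover have "sum ?f P = sum ?f {Y, \<Omega> - Y}"
    unfolding P_def by (rule sum.mono_neutral_left) auto
  ultimately show ?thesis using ne by simp
qed

lemma integral_mono_dominated:
  fixes f :: "real \<Rightarrow> real"
  assumes M: "finite_borel_measure_on_Om M" and N: "finite_borel_measure_on_Om N"
    and Y: "Y \<in> sets M" and le: "\<And>X. X \<in> sets M \<Longrightarrow> X \<subseteq> Y \<Longrightarrow> emeasure N X \<le> emeasure M X"
    and f: "f \<in> borel_measurable M" "\<And>x. 0 \<le> f x" "\<And>x. \<bar>f x\<bar> \<le> B"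
  shows "(LINT x|N. f x * indicator Y x) \<le> (LINT x|M. f x * indicator Y x)"
proof -
  have sN: "sets N = sets M" using finite_borel_space[OF M] finite_borel_space[OF N] by simp
  have fN: "f \<in> borel_measurable N" using f(1) measurable_cong_sets[OF sN refl] by auto
  have ds: "sets (density N (indicator Y)) = sets (density M (indicator Y))" using sN by simp
  have "density N (indicator Y) \<le> density M (indicator Y)"
  proof (subst le_measure[OF ds], rule ballI)
    fix X
    show "emeasure (density N (indicator Y)) X \<le> emeasure (density M (indicator Y)) X"
    proof (cases "X \<in> sets M")
      case True
      have "emeasure N (Y \<inter> X) \<le> emeasure M (Y \<inter> X)" using True Y le by auto
      then show ?thesis
        using True Y sN by (simp add: emeasure_density nn_integral_indicator indicator_inter_arith[symmetric])
    next
      case False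
      then show ?thesis using sN by (simp add: emeasure_notin_sets)
    qed
  qed
  then have "(\<integral>\<^sup>+x. ennreal (f x) \<partial>density N (indicator Y)) \<le> (\<integral>\<^sup>+x. ennreal (f x) \<partial>density M (indicator Y))"
    using ds f(1) by (intro nn_integral_mono_measure) auto
  then have le': "(\<integral>\<^sup>+x. ennreal (f x * indicator Y x) \<partial>N) \<le> (\<integral>\<^sup>+x. ennreal (f x * indicator Y x) \<partial>M)"
    using f(1) fN Y sN
    by (simp add: nn_integral_density ennreal_mult'' ennreal_indicator mult.commute)
  have i: "integrable M (\<lambda>x. f x * indicator Y x)" "integrable N (\<lambda>x. f x * indicator Y x)"
    using f fN Y sN
    by (auto intro!: finite_borel_integrable[OF M, of _ B] finite_borel_integrable[OF N, of _ B]
        simp: indicator_def order_trans[OF f(2) f(3)[unfolded abs_of_nonneg[OF f(2)]]])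
  show ?thesis
    using le' i f(2) by (simp add: nn_integral_eq_integral integral_nonneg_AE)
qed

text \<open>By the Hahn decomposition, the total variation dominates the pairing with bounded functions:
  on each of the two parts one measure dominates the other.\<close>

lemma pairing_le_total_variation:
  fixes f :: "real \<Rightarrow> real"
  assumes M: "finite_borel_measure_on_Om M" and N: "finite_borel_measure_on_Om N"
    and f: "f \<in> borel_measurable borel" "\<And>x. \<bar>f x\<bar> \<le> s"
  shows "\<bar>(LINT x|M. f x) - (LINT x|N. f x)\<bar> \<le> s * total_variation M N"
proof -
  have s: "s \<ge> 0" using f(2)[of 0] by linarith
  have part: "\<bar>(LINT x|M. f x * indicator Y x) - (LINT x|N. f x * indicator Y x)\<bar> \<le> s * (measure M Y - measure N Y)"
    if M: "finite_borel_measure_on_Om M" and N: "finite_borel_measure_on_Om N" and Y: "Y \<in> sets M"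
      and le: "\<And>X. X \<in> sets M \<Longrightarrow> X \<subseteq> Y \<Longrightarrow> emeasure N X \<le> emeasure M X" for M N Y
  proof -
    have sN: "sets N = sets M" using finite_borel_space[OF M] finite_borel_space[OF N] by simp
    interpret M: finite_measure M by (rule finite_borel_space[OF M])
    interpret N: finite_measure N by (rule finite_borel_space[OF N])
    have fm: "f \<in> borel_measurable M" "f \<in> borel_measurable N"
      using finite_borel_measurable M N f(1) by auto
    have i: "integrable M (\<lambda>x. f x * indicator Y x)" "integrable N (\<lambda>x. f x * indicator Y x)"
      using fm Y sN f(2) s
      by (auto intro!: finite_borel_integrable[OF M, of _ s] finite_borel_integrable[OF N, of _ s] simp: indicator_def)
    have ic: "(LINT x|M. s * indicator Y x) = s * measure M Y" "(LINT x|N. s * indicator Y x) = s * measure N Y"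
      "integrable M (\<lambda>x. s * indicator Y x)" "integrable N (\<lambda>x. s * indicator Y x)"
      using Y sN by (auto simp: less_top[symmetric])
    have b: "\<bar>s - f x\<bar> \<le> 2 * s" "\<bar>s + f x\<bar> \<le> 2 * s" "0 \<le> s - f x" "0 \<le> s + f x" for x
      using f(2)[of x] by auto
    have "(LINT x|N. (s - f x) * indicator Y x) \<le> (LINT x|M. (s - f x) * indicator Y x)"
      by (rule integral_mono_dominated[OF M N Y le, of _ "2 * s"]) (use b fm in auto)
    moreover have "(LINT x|N. (s + f x) * indicator Y x) \<le> (LINT x|M. (s + f x) * indicator Y x)"
      by (rule integral_mono_dominated[OF M N Y le, of _ "2 * s"]) (use b fm in auto)
    ultimately show ?thesis
      using i ic Y sN
      by (simp add: left_diff_distrib distrib_right abs_le_iff right_diff_distrib sets.Int_space_eq2)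
  qed
  have sN: "sets N = sets M" using finite_borel_space[OF M] finite_borel_space[OF N] by simp
  obtain Y where Y1: "Y \<in> sets M" and Y2: "\<forall>X\<in>sets M. X \<subseteq> Y \<longrightarrow> emeasure N X \<le> emeasure M X"
    and Y3: "\<forall>X\<in>sets M. X \<inter> Y = {} \<longrightarrow> emeasure M X \<le> emeasure N X"
    using finite_unsigned_Hahn_decomposition[OF finite_borel_space(3)[OF M] finite_borel_space(3)[OF N] sN]
    by (elim bexE conjE)
  note Y = Y1 Y2[rule_format] Y3[rule_format]
  define Z where "Z = \<Omega> - Y"
  have Z: "Z \<in> sets M" using sets.compl_sets[OF Y(1)] finite_borel_space[OF M] by (simp add: Z_def)
  have p1: "\<bar>(LINT x|M. f x * indicator Y x) - (LINT x|N. f x * indicator Y x)\<bar> \<le> s * (measure M Y - measure N Y)"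
    by (rule part[OF M N Y(1,2)])
  have p2: "\<bar>(LINT x|N. f x * indicator Z x) - (LINT x|M. f x * indicator Z x)\<bar> \<le> s * (measure N Z - measure M Z)"
    by (rule part[OF N M]) (use Z Y(3) sN in \<open>auto simp: Z_def\<close>)
  have split: "(LINT x|K. f x) = (LINT x|K. f x * indicator Y x) + (LINT x|K. f x * indicator Z x)"
    if K: "finite_borel_measure_on_Om K" and sK: "sets K = sets M" for K
  proof -
    have fm: "f \<in> borel_measurable K" using finite_borel_measurable K f(1) by auto
    have i: "integrable K (\<lambda>x. f x * indicator Y x)" "integrable K (\<lambda>x. f x * indicator Z x)"
      using fm Y(1) Z sK f(2) s
      by (auto intro!: finite_borel_integrable[OF K, of _ s] simp: indicator_def)
    have "(LINT x|K. f x) = (LINT x|K. f x * indicator Y x + f x * indicator Z x)"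
      by (rule Bochner_Integration.integral_cong) (auto simp: indicator_def Z_def finite_borel_space[OF K])
    then show ?thesis using i by simp
  qed
  have "\<bar>(LINT x|M. f x) - (LINT x|N. f x)\<bar>
      \<le> s * (measure M Y - measure N Y) + s * (measure N Z - measure M Z)"
    unfolding split[OF M refl] split[OF N sN] using p1 p2 by linarith
  also have "\<dots> \<le> s * (\<bar>measure M Y - measure N Y\<bar> + \<bar>measure M Z - measure N Z\<bar>)"
    unfolding distrib_left[symmetric] using s by (intro mult_left_mono) auto
  also have "\<dots> \<le> s * total_variation M N"
    using total_variation_two[OF M N Y(1)] s unfolding Z_def by (intro mult_left_mono) auto
  finally show ?thesis .
qed

subsection \<open>The derivative measure is unique\<close>

text \<open>The representing pair is determined up to adding a common measure: test functions converge to the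
  indicator functions of intervals, which generate the Borel sets. Moving the negative parts
  to the other side turns the comparison of signed measures into one of measures.\<close>

lemma deriv_measure_unique:
  assumes q: "has_deriv_measure q M N" and q': "has_deriv_measure q M' N'" and E: "E \<in> sets M"
  shows "measure M E - measure N E = measure M' E - measure N' E"
proof -
  have fb: "finite_borel_measure_on_Om M" "finite_borel_measure_on_Om N"
    "finite_borel_measure_on_Om M'" "finite_borel_measure_on_Om N'"
    using q q' by (auto simp: has_deriv_measure_def)
  define L R where "L = measure_add M N'" and "R = measure_add M' N"
  have fLR: "finite_borel_measure_on_Om L" "finite_borel_measure_on_Om R"
    unfolding L_def R_def by (auto intro!: finite_borel_measure_add fb)
  interpret L: finite_measure L by (rule finite_borel_space[OF fLR(1)])
  interpret R: finite_measure R by (rule finite_borel_space[OF fLR(2)])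
  have test: "(LINT x|L. \<phi> x) = (LINT x|R. \<phi> x)" if "\<phi> \<in> test_funs" for \<phi>
  proof -
    obtain B where "\<And>x. \<bar>\<phi> x\<bar> \<le> B" using test_funs_bounded[OF \<open>\<phi> \<in> test_funs\<close>] by metis
    then have "(LINT x|L. \<phi> x) = (LINT x|M. \<phi> x) + (LINT x|N'. \<phi> x)"
      "(LINT x|R. \<phi> x) = (LINT x|M'. \<phi> x) + (LINT x|N. \<phi> x)"
      unfolding L_def R_def
      by (auto intro!: integral_measure_add fb finite_borel_measurable test_funs_borel that)
    moreover have "(LINT x|M. \<phi> x) - (LINT x|N. \<phi> x) = (LINT x|M'. \<phi> x) - (LINT x|N'. \<phi> x)"
      using q q' that unfolding has_deriv_measure_def by (metis neg_equal_iff_equal)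
    ultimately show ?thesis by simp
  qed
  have int: "measure L {c<..<d} = measure R {c<..<d}" if "0 \<le> c" "c < d" "d \<le> 1" for c d
  proof -
    have squeeze: "0 < c + e \<and> d - e < 1 \<and> c + e \<le> d - e" if "0 < e" "e \<le> (d - c) / 3" for e
      using that \<open>0 \<le> c\<close> \<open>c < d\<close> \<open>d \<le> 1\<close> by auto
    define \<phi> where "\<phi> n = cutoff n (c + (d - c) / (real n + 3)) (d - (d - c) / (real n + 3))" for n
    have \<phi>t: "\<phi> n \<in> test_funs" for n
    proof -
      have "0 < (d - c) / (real n + 3)" "(d - c) / (real n + 3) \<le> (d - c) / 3"
        using that by (simp, intro divide_left_mono) auto
      then have "0 < c + (d - c) / (real n + 3) \<and> d - (d - c) / (real n + 3) < 1 \<and>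
          c + (d - c) / (real n + 3) \<le> d - (d - c) / (real n + 3)"
        using that by (intro squeeze) auto
      then show ?thesis unfolding \<phi>_def by (intro test_fun_cutoff) auto
    qed
    have lim: "(\<lambda>n. LINT x|K. \<phi> n x) \<longlonglongrightarrow> measure K {c<..<d}" if K: "finite_borel_measure_on_Om K" for K
    proof -
      interpret K: finite_measure K by (rule finite_borel_space[OF K])
      have "{c<..<d} \<inter> \<Omega> \<in> sets K" by (rule finite_borel_sets[OF K]) simp
      then have m: "{c<..<d} \<in> sets K" using \<open>0 \<le> c\<close> \<open>d \<le> 1\<close>
        by (simp add: greaterThanLessThan_subseteq_greaterThanLessThan Int_absorb2)
      have "(\<lambda>n. LINT x|K. \<phi> n x) \<longlonglongrightarrow> (LINT x|K. indicator {c<..<d} x)"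
        by (rule integral_dominated_convergence[where w="\<lambda>x. 1"])
          (use m cutoff_shrink_tendsto[OF \<open>c < d\<close>] cutoff_bounds in
           \<open>auto simp: \<phi>_def intro!: AE_I2 finite_borel_measurable[OF K] test_funs_borel \<phi>t[unfolded \<phi>_def]\<close>)
      then show ?thesis using m by simp
    qed
    show ?thesis
      using LIMSEQ_unique[OF lim[OF fLR(1)]] lim[OF fLR(2)] by (simp add: test[OF \<phi>t])
  qed
  define D where "D K = distr K borel (\<lambda>x::real. x)" for K
  have D: "emeasure (D K) A = emeasure K (A \<inter> \<Omega>)" if "finite_borel_measure_on_Om K" "A \<in> sets borel" for K A
    unfolding D_def using that finite_borel_space[OF that(1)]
    by (subst emeasure_distr) (auto intro: finite_borel_measurable)
  have "D L = D R"
  proof (rule measure_eqI_lessThan)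
    show "sets (D L) = sets borel" "sets (D R) = sets borel" by (auto simp: D_def)
    fix x :: real
    show "emeasure (D L) {x<..} < \<infinity>"
      by (simp add: D[OF fLR(1)] L.emeasure_eq_measure)
    have "emeasure L ({x<..} \<inter> \<Omega>) = emeasure R ({x<..} \<inter> \<Omega>)"
    proof (cases "x < 1")
      case True
      then have "{x<..} \<inter> \<Omega> = {max x 0<..<1}" by auto
      then show ?thesis using int[of "max x 0" 1] True by (simp add: L.emeasure_eq_measure R.emeasure_eq_measure)
    next
      case False
      then have "{x<..} \<inter> \<Omega> = {}" by auto
      then show ?thesis by simp
    qed
    then show "emeasure (D L) {x<..} = emeasure (D R) {x<..}" by (simp add: D fLR)
  qed
  then have "emeasure (D L) E = emeasure (D R) E" by simp
  moreover have E': "E \<in> sets borel" "E \<inter> \<Omega> = E" using finite_borel_setsD[OF fb(1) E] by auto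
  ultimately have "measure L E = measure R E" by (simp add: D fLR measure_def)
  moreover have "E \<in> sets M'" using E finite_borel_space(2)[OF fb(1)] finite_borel_space(2)[OF fb(3)] by simp
  ultimately show ?thesis
    unfolding L_def R_def using measure_measure_add[OF fb(1,4) E] measure_measure_add[OF fb(3,2)] by simp
qed

lemma norm_deriv_M_eq:
  assumes q: "has_deriv_measure q M N" shows "norm_deriv_M q = total_variation M N"
  unfolding norm_deriv_M_def
proof (rule the_equality)
  show "\<exists>M' N'. has_deriv_measure q M' N' \<and> total_variation M N = total_variation M' N'" using q by blast
  fix t assume "\<exists>M' N'. has_deriv_measure q M' N' \<and> t = total_variation M' N'"
  then obtain M' N' where q': "has_deriv_measure q M' N'" and t: "t = total_variation M' N'" by blast
  have "sets M = sets (restrict_space borel \<Omega>)" using q by (auto simp: has_deriv_measure_def finite_borel_space)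
  then show "t = total_variation M N"
    unfolding t total_variation_def
    by (intro SUP_cong sum.cong) (use deriv_measure_unique[OF q q'] in auto)
qed

subsection \<open>Pairings and competitors\<close>

text \<open>A function of bounded variation is almost everywhere a constant plus the distribution
  function of its derivative, by the lemma of du Bois-Reymond.\<close>

lemma BV_oscillation:
  assumes "q \<in> BV" obtains k where "AE x in lebO. \<bar>q x - k\<bar> \<le> norm_deriv_M q"
proof -
  obtain M N where q: "has_deriv_measure q M N" and qi: "integrable lebO q"
    using assms by (auto simp: BV_def L1_def)
  have fb: "finite_borel_measure_on_Om M" "finite_borel_measure_on_Om N"
    using q by (auto simp: has_deriv_measure_def)
  define F where "F K x = measure K ({..<x} \<inter> \<Omega>)" for K :: "real measure" and x
  have Fm: "F K \<in> borel_measurable lebO" "\<And>x. \<bar>F K x\<bar> \<le> measure K \<Omega>"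
    if K: "finite_borel_measure_on_Om K" for K
  proof -
    interpret K: finite_measure K by (rule finite_borel_space[OF K])
    have "mono (F K)" unfolding F_def
      by (intro monoI K.finite_measure_mono finite_borel_sets[OF K]) auto
    then show "F K \<in> borel_measurable lebO" by (intro lebO_measurable_borel borel_measurable_mono)
    show "\<bar>F K x\<bar> \<le> measure K \<Omega>" for x
      unfolding F_def using K.bounded_measure finite_borel_space[OF K] by auto
  qed
  have Fi: "integrable lebO (F K)" if K: "finite_borel_measure_on_Om K" for K
    by (rule lebO_integrable_bounded[of _ "measure K \<Omega>"]) (use Fm[OF K] in auto)
  have FL: "F K \<in> Linf" if K: "finite_borel_measure_on_Om K" for K
    by (rule LinfI[of _ "measure K \<Omega>"]) (use Fm[OF K] in auto)
  have F: "L2_inner (F K) (deriv \<phi>) = - (LINT x|K. \<phi> x)"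
    if K: "finite_borel_measure_on_Om K" and \<phi>: "\<phi> \<in> test_funs" for K \<phi>
  proof -
    interpret K: finite_measure K by (rule finite_borel_space[OF K])
    have i: "integrable lebO (deriv \<phi>)" by (intro Linf_integrable test_funs_Linf test_funs_deriv \<phi>)
    have "F K x = (LINT t|K. indicator {..<x} t * 1)" for x
    proof -
      have "(LINT t|K. indicat_real {..<x} t * 1) = (LINT t|K. indicat_real ({..<x} \<inter> \<Omega>) t)"
        by (rule Bochner_Integration.integral_cong) (auto simp: finite_borel_space[OF K] indicator_def)
      then show ?thesis using finite_borel_sets[OF K, of "{..<x}"] by (simp add: F_def)
    qed
    then have "L2_inner (F K) (deriv \<phi>) = (LINT x|lebO. (LINT t|K. indicator {..<x} t * 1) * deriv \<phi> x)"
      by (simp add: L2_inner_def)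
    also have "\<dots> = (LINT t|K. 1 * (LINT x|lebO. indicator {t<..} x * deriv \<phi> x))"
      by (rule triangle_Fubini) (use i finite_borel_measurable[OF K, of "\<lambda>t. t"] K.finite_measure_axioms in auto)
    also have "\<dots> = (LINT t|K. - \<phi> t)"
    proof (rule Bochner_Integration.integral_cong[OF refl])
      fix t assume "t \<in> space K"
      then have t: "0 \<le> t" "t \<le> 1" using finite_borel_space[OF K] by auto
      show "1 * (LINT x|lebO. indicator {t<..} x * deriv \<phi> x) = - \<phi> t"
        using upper_integral[OF i t] prim_1[OF i] prim_deriv_test[OF \<phi>] test_funs_outside[OF \<phi>, of 1] t by simp
    qed
    finally show ?thesis by simp
  qed
  define f where "f x = q x - (F M x - F N x)" for x
  obtain k where k: "AE x in lebO. x \<in> {0<..<1} \<longrightarrow> f x = k"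
  proof (rule du_Bois_Reymond[of 0 1 f])
    show "integrable lebO f" unfolding f_def[abs_def] using qi Fi fb by auto
    fix \<phi> assume "\<phi> \<in> test_in 0 1"
    then have \<phi>: "\<phi> \<in> test_funs" by (simp add: test_funs_eq)
    note dL = test_funs_Linf[OF test_funs_deriv[OF \<phi>]]
    have "L2_inner f (deriv \<phi>) = L2_inner q (deriv \<phi>) - (L2_inner (F M) (deriv \<phi>) - L2_inner (F N) (deriv \<phi>))"
      unfolding L2_inner_def f_def
      using Linf_mult_integrable[OF qi dL] Linf_mult_integrable[OF Fi[OF fb(1)] dL] Linf_mult_integrable[OF Fi[OF fb(2)] dL]
      by (simp add: left_diff_distrib)
    also have "\<dots> = 0"
      using q \<phi> F[OF fb(1) \<phi>] F[OF fb(2) \<phi>] by (simp add: has_deriv_measure_def)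
    finally show "L2_inner f (deriv \<phi>) = 0" .
  qed auto
  have FMN: "\<bar>F M x - F N x\<bar> \<le> norm_deriv_M q" for x
    unfolding norm_deriv_M_eq[OF q] F_def
    using total_variation_two[OF fb finite_borel_sets[OF fb(1), of "{..<x}"]] by simp
  have "AE x in lebO. \<bar>q x - k\<bar> \<le> norm_deriv_M q"
    using k AE_space
  proof eventually_elim
    case (elim x)
    then have "q x - k = F M x - F N x" by (simp add: f_def)
    then show ?case using FMN[of x] by simp
  qed
  then show thesis by (rule that)
qed

lemma BV_Linf: assumes "q \<in> BV" shows "q \<in> Linf"
proof -
  obtain k where "AE x in lebO. \<bar>q x - k\<bar> \<le> norm_deriv_M q" using BV_oscillation[OF assms] .
  then have "AE x in lebO. \<bar>q x\<bar> \<le> norm_deriv_M q + \<bar>k\<bar>" by eventually_elim auto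
  then show ?thesis using assms by (auto simp: Linf_def BV_def L1_def)
qed

lemma norm_deriv_M_nonneg: assumes "q \<in> BV" shows "norm_deriv_M q \<ge> 0"
proof -
  obtain M N where q: "has_deriv_measure q M N" using assms by (auto simp: BV_def)
  then have fb: "finite_borel_measure_on_Om M" "finite_borel_measure_on_Om N"
    by (auto simp: has_deriv_measure_def)
  show ?thesis unfolding norm_deriv_M_eq[OF q] using total_variation_two[OF fb sets.empty_sets] by simp
qed

text \<open>The pairing of \<open>q'\<close> with a Lipschitz function, not only with a test function: the latter
  approximate it uniformly, with derivatives converging in \<open>L\<^sup>2\<close>.\<close>

lemma BV_pairing:
  assumes q: "q \<in> BV" and g: "g \<in> Linf" "prim g 1 = 0" and s: "\<And>x. x \<in> {0..1} \<Longrightarrow> \<bar>prim g x\<bar> \<le> s"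
  shows "\<bar>L2_inner q g\<bar> \<le> s * norm_deriv_M q"
proof -
  obtain M N where qM: "has_deriv_measure q M N" using q by (auto simp: BV_def)
  then have fb: "finite_borel_measure_on_Om M" "finite_borel_measure_on_Om N"
    by (auto simp: has_deriv_measure_def)
  have a: "ac0 (prim g) g" using g by (auto simp: ac0_def Linf_L2 intro!: Linf_measurable prim_Linf Linf_integrable)
  obtain \<phi> where \<phi>: "\<And>n::nat. \<phi> n \<in> test_funs" and lim: "(\<lambda>n. norm_H1 (\<lambda>x. \<phi> n x - prim g x)) \<longlonglongrightarrow> 0"
    using ac0_H10[OF a g(1)] by (auto simp: H10_def)
  define e where "e n = norm_H1 (\<lambda>x. \<phi> n x - prim g x)" for n
  have e0: "e n \<ge> 0" for n by (simp add: e_def norm_H1_def)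
  have gL: "g \<in> L2" "q \<in> L2" "deriv (\<phi> n) \<in> L2" for n
    using g BV_Linf[OF q] by (auto intro: Linf_L2 test_funs_Linf test_funs_deriv \<phi>)
  have w: "ac0 (\<lambda>x. \<phi> n x - prim g x) (\<lambda>x. deriv (\<phi> n) x - g x)" for n
    by (rule ac0_diff[OF test_funs_ac0[OF \<phi>] a])
  have b2: "norm_L2 (\<lambda>x. deriv (\<phi> n) x - g x) \<le> e n" for n
  proof -
    note w' = ac0_weak_deriv[OF w]
    have "norm_L2 (\<lambda>x. deriv (\<phi> n) x - g x) = norm_L2 (weak_deriv (\<lambda>x. \<phi> n x - prim g x))"
      by (rule norm_L2_cong[symmetric, OF weak_deriv_AE[OF w'] weak_deriv_measurable[OF w']])
        (auto intro: L2_measurable L2_diff gL)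
    also have "\<dots> \<le> e n" unfolding e_def norm_H1_def by (rule real_le_rsqrt) simp
    finally show ?thesis .
  qed
  have pw: "\<bar>\<phi> n x\<bar> \<le> s + e n" for n x
  proof (cases "x \<in> {0..1}")
    case True
    have "\<phi> n x - prim g x = prim (\<lambda>x. deriv (\<phi> n) x - g x) x"
      using True prim_minus[OF L2_integrable[OF gL(3)] L2_integrable[OF gL(1)]] prim_deriv_test[OF \<phi>] by simp
    moreover have "\<bar>prim (\<lambda>x. deriv (\<phi> n) x - g x) x\<bar> \<le> norm_L2 (\<lambda>x. deriv (\<phi> n) x - g x)"
      using True by (intro prim_le_L2 L2_diff gL) auto
    ultimately show ?thesis using s[OF True] b2[of n] by linarith
  next
    case False
    then show ?thesis using test_funs_outside[OF \<phi>, of x n] s[of 0] e0[of n] by auto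
  qed
  have bound: "\<bar>L2_inner q g\<bar> \<le> (s + e n) * norm_deriv_M q + norm_L2 q * e n" for n
  proof -
    have "\<bar>L2_inner q (deriv (\<phi> n))\<bar> \<le> (s + e n) * norm_deriv_M q"
      using pairing_le_total_variation[OF fb test_funs_borel[OF \<phi>] pw, of n] qM \<phi>
      by (simp add: has_deriv_measure_def norm_deriv_M_eq[OF qM])
    moreover have "\<bar>L2_inner q (\<lambda>x. deriv (\<phi> n) x - g x)\<bar> \<le> norm_L2 q * e n"
      using L2_inner_CS[OF gL(2) L2_diff[OF gL(3) gL(1)]] b2[of n]
      by (meson mult_left_mono norm_L2_nonneg order_trans)
    ultimately show ?thesis by (simp add: L2_inner_diff_right gL)
  qed
  have "(\<lambda>n. (s + e n) * norm_deriv_M q + norm_L2 q * e n) \<longlonglongrightarrow> (s + 0) * norm_deriv_M q + norm_L2 q * 0"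
    using lim unfolding e_def by (intro tendsto_intros)
  then have "\<bar>L2_inner q g\<bar> \<le> (s + 0) * norm_deriv_M q + norm_L2 q * 0"
    by (rule tendsto_lowerbound) (auto intro!: always_eventually bound)
  then show ?thesis by simp
qed

lemma BV_zero: "(\<lambda>x. 0) \<in> BV" "norm_deriv_M (\<lambda>x. 0) = 0"
proof -
  have fb: "finite_borel_measure_on_Om (point_mass (1/2))" by (rule finite_borel_point_mass) simp
  then have d: "has_deriv_measure (\<lambda>x. 0) (point_mass (1/2)) (point_mass (1/2))"
    by (simp add: has_deriv_measure_def L2_inner_def)
  then show "(\<lambda>x. 0) \<in> BV" by (auto simp: BV_def L1_def)
  have "total_variation (point_mass (1/2)) (point_mass (1/2)) \<le> 0"
    by (rule total_variation_least) simp
  then show "norm_deriv_M (\<lambda>x. 0) = 0"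
    using norm_deriv_M_nonneg[OF \<open>(\<lambda>x. 0) \<in> BV\<close>] norm_deriv_M_eq[OF d] by simp
qed

lemma BV_scale:
  assumes q: "q \<in> BV" and c: "c \<ge> 0"
  shows "(\<lambda>x. c * q x) \<in> BV" "norm_deriv_M (\<lambda>x. c * q x) \<le> c * norm_deriv_M q"
proof -
  obtain M N where qM: "has_deriv_measure q M N" using q by (auto simp: BV_def)
  then have fb: "finite_borel_measure_on_Om M" "finite_borel_measure_on_Om N"
    by (auto simp: has_deriv_measure_def)
  have sN: "sets N = sets M" "sets M = sets (restrict_space borel \<Omega>)"
    using finite_borel_space[OF fb(1)] finite_borel_space[OF fb(2)] by auto
  have d: "has_deriv_measure (\<lambda>x. c * q x) (measure_scale c M) (measure_scale c N)"
    using qM fb c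
    by (auto simp: has_deriv_measure_def finite_borel_measure_scale L2_inner_cmult right_diff_distrib
        integral_measure_scale finite_borel_measurable test_funs_borel)
  then show "(\<lambda>x. c * q x) \<in> BV" using q by (auto simp: BV_def L1_def)
  show "norm_deriv_M (\<lambda>x. c * q x) \<le> c * norm_deriv_M q"
    unfolding norm_deriv_M_eq[OF d] norm_deriv_M_eq[OF qM]
  proof (rule total_variation_least)
    fix P assume P: "P \<in> borel_partitions"
    have "(\<Sum>E\<in>P. \<bar>measure (measure_scale c M) E - measure (measure_scale c N) E\<bar>)
        = (\<Sum>E\<in>P. c * \<bar>measure M E - measure N E\<bar>)"
    proof (rule sum.cong[OF refl])
      fix E assume "E \<in> P"
      then have "E \<in> sets M" "E \<in> sets N" using P sN by auto
      then have "measure (measure_scale c M) E - measure (measure_scale c N) E = c * (measure M E - measure N E)"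
        using fb c by (simp add: measure_measure_scale right_diff_distrib)
      then show "\<bar>measure (measure_scale c M) E - measure (measure_scale c N) E\<bar> = c * \<bar>measure M E - measure N E\<bar>"
        using c by (simp add: abs_mult)
    qed
    then show "(\<Sum>E\<in>P. \<bar>measure (measure_scale c M) E - measure (measure_scale c N) E\<bar>) \<le> c * total_variation M N"
      using total_variation_upper[OF fb P] c by (simp add: sum_distrib_left[symmetric] mult_left_mono)
  qed
qed

lemma BV_add_const:
  assumes q: "q \<in> BV" shows "(\<lambda>x. q x + c) \<in> BV" "norm_deriv_M (\<lambda>x. q x + c) = norm_deriv_M q"
proof -
  obtain M N where qM: "has_deriv_measure q M N" using q by (auto simp: BV_def)
  have qi: "integrable lebO q" using q by (simp add: BV_def L1_def)
  have "L2_inner (\<lambda>x. q x + c) (deriv \<phi>) = L2_inner q (deriv \<phi>)" if \<phi>: "\<phi> \<in> test_funs" for \<phi>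
  proof -
    note dL = test_funs_Linf[OF test_funs_deriv[OF \<phi>]]
    note i = Linf_integrable[OF dL]
    have "(LINT x|lebO. deriv \<phi> x) = 0"
      using prim_1[OF i] prim_deriv_test[OF \<phi>, of 1] test_funs_outside[OF \<phi>, of 1] by simp
    then show ?thesis
      using Linf_mult_integrable[OF qi dL] i by (simp add: L2_inner_def distrib_right)
  qed
  then have d: "has_deriv_measure (\<lambda>x. q x + c) M N" using qM by (simp add: has_deriv_measure_def)
  then show "(\<lambda>x. q x + c) \<in> BV" using q by (auto simp: BV_def L1_def)
  show "norm_deriv_M (\<lambda>x. q x + c) = norm_deriv_M q"
    by (simp add: norm_deriv_M_eq[OF d] norm_deriv_M_eq[OF qM])
qed

lemma total_variation_add_left:
  assumes fb: "finite_borel_measure_on_Om M" "finite_borel_measure_on_Om N" "finite_borel_measure_on_Om K"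
  shows "total_variation (measure_add M K) N \<le> total_variation M N + measure K \<Omega>"
    and "total_variation M (measure_add N K) \<le> total_variation M N + measure K \<Omega>"
proof -
  have s: "sets M = sets (restrict_space borel \<Omega>)" "sets N = sets (restrict_space borel \<Omega>)"
    using finite_borel_space fb by blast+
  have "(\<Sum>E\<in>P. \<bar>measure (measure_add M K) E - measure N E\<bar>) \<le> total_variation M N + measure K \<Omega>
     \<and> (\<Sum>E\<in>P. \<bar>measure M E - measure (measure_add N K) E\<bar>) \<le> total_variation M N + measure K \<Omega>"
    if P: "P \<in> borel_partitions" for P
  proof -
    have tri: "\<bar>r + k - t\<bar> \<le> \<bar>r - t\<bar> + k" "\<bar>r - (t + k)\<bar> \<le> \<bar>r - t\<bar> + k" if "k \<ge> 0" for r t k :: real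
      using that by auto
    have m: "measure (measure_add M K) E = measure M E + measure K E" 
      "measure (measure_add N K) E = measure N E + measure K E" "measure K E \<ge> 0" if "E \<in> P" for E
      using that P s fb by (auto intro!: measure_measure_add)
    have "(\<Sum>E\<in>P. \<bar>measure (measure_add M K) E - measure N E\<bar>) \<le> (\<Sum>E\<in>P. \<bar>measure M E - measure N E\<bar> + measure K E)"
      by (intro sum_mono) (simp add: m tri)
    moreover have "(\<Sum>E\<in>P. \<bar>measure M E - measure (measure_add N K) E\<bar>) \<le> (\<Sum>E\<in>P. \<bar>measure M E - measure N E\<bar> + measure K E)"
      by (intro sum_mono) (simp add: m tri)
    ultimately show ?thesis
      using total_variation_upper[OF fb(1,2) P] sum_measure_partition[OF fb(3) P] by (simp add: sum.distrib)
  qed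
  then show "total_variation (measure_add M K) N \<le> total_variation M N + measure K \<Omega>"
    "total_variation M (measure_add N K) \<le> total_variation M N + measure K \<Omega>"
    by (auto intro!: total_variation_least)
qed

text \<open>A jump adds a point mass to the positive or the negative part of the derivative, according to
  its sign.\<close>

lemma BV_add_jump:
  fixes y s :: real
  assumes q: "q \<in> BV" and y: "0 < y" "y < 1"
  shows "(\<lambda>x. q x + s * indicator {y<..} x) \<in> BV"
    and "norm_deriv_M (\<lambda>x. q x + s * indicator {y<..} x) \<le> norm_deriv_M q + \<bar>s\<bar>"
proof -
  obtain M N where qM: "has_deriv_measure q M N" using q by (auto simp: BV_def)
  then have fb: "finite_borel_measure_on_Om M" "finite_borel_measure_on_Om N"
    by (auto simp: has_deriv_measure_def)
  have qi: "integrable lebO q" using q by (simp add: BV_def L1_def)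
  have Hm: "indicat_real {y<..} \<in> borel_measurable lebO" by (rule lebO_measurable_borel) simp
  have HL: "indicat_real {y<..} \<in> Linf" by (rule LinfI[OF Hm, of 1]) (auto simp: indicator_def)
  note Hi = Linf_integrable[OF HL]
  define K where "K = measure_scale \<bar>s\<bar> (point_mass y)"
  have yO: "y \<in> \<Omega>" using y by simp
  have fK: "finite_borel_measure_on_Om K"
    unfolding K_def by (intro finite_borel_measure_scale finite_borel_point_mass yO) simp
  have "\<Omega> \<in> sets (point_mass y)"
    using sets.top[of "point_mass y"] finite_borel_space(1)[OF finite_borel_point_mass[OF yO]] by simp
  then have mK: "measure K \<Omega> = \<bar>s\<bar>"
    unfolding K_def using measure_measure_scale[OF finite_borel_point_mass[OF yO], of "\<bar>s\<bar>" \<Omega>]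
      measure_point_mass_UNIV[OF yO] by simp
  have iK: "(LINT x|K. \<phi> x) = \<bar>s\<bar> * \<phi> y" if "\<phi> \<in> test_funs" for \<phi>
    unfolding K_def using integral_measure_scale[OF finite_borel_point_mass[OF yO] _
        finite_borel_measurable[OF finite_borel_point_mass[OF yO] test_funs_borel[OF that]], of "\<bar>s\<bar>"]
      integral_point_mass[OF yO test_funs_borel[OF that]] by simp
  have L: "L2_inner (\<lambda>x. q x + s * indicator {y<..} x) (deriv \<phi>) = L2_inner q (deriv \<phi>) - s * \<phi> y"
    if \<phi>: "\<phi> \<in> test_funs" for \<phi>
  proof -
    note dL = test_funs_Linf[OF test_funs_deriv[OF \<phi>]]
    note i = Linf_integrable[OF dL]
    have "(LINT x|lebO. indicator {y<..} x * deriv \<phi> x) = - \<phi> y"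
      using upper_integral[OF i, of y] prim_1[OF i] prim_deriv_test[OF \<phi>] test_funs_outside[OF \<phi>, of 1] y by simp
    then show ?thesis
      using Linf_mult_integrable[OF qi dL] Linf_mult_integrable[OF Hi dL]
      by (simp add: L2_inner_def distrib_right mult.assoc)
  qed
  have iA: "(LINT x|measure_add M' K. \<phi> x) = (LINT x|M'. \<phi> x) + \<bar>s\<bar> * \<phi> y"
    if \<phi>: "\<phi> \<in> test_funs" and M': "finite_borel_measure_on_Om M'" for \<phi> M'
  proof -
    obtain B where "\<And>x. \<bar>\<phi> x\<bar> \<le> B" using test_funs_bounded[OF \<phi>] by metis
    then show ?thesis
      using integral_measure_add[OF M' fK finite_borel_measurable[OF M' test_funs_borel[OF \<phi>]], of B]
        iK[OF \<phi>] by simp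
  qed
  have "\<exists>M' N'. has_deriv_measure (\<lambda>x. q x + s * indicator {y<..} x) M' N' \<and>
      total_variation M' N' \<le> total_variation M N + \<bar>s\<bar>"
  proof (cases "s \<ge> 0")
    case True
    have "has_deriv_measure (\<lambda>x. q x + s * indicator {y<..} x) (measure_add M K) N"
      using qM fb fK True L iA[OF _ fb(1)]
      by (auto simp: has_deriv_measure_def finite_borel_measure_add)
    then show ?thesis using total_variation_add_left(1)[OF fb fK] mK by auto
  next
    case False
    have "has_deriv_measure (\<lambda>x. q x + s * indicator {y<..} x) M (measure_add N K)"
      using qM fb fK False L iA[OF _ fb(2)]
      by (auto simp: has_deriv_measure_def finite_borel_measure_add)
    then show ?thesis using total_variation_add_left(2)[OF fb fK] mK by auto
  qed
  then obtain M' N' where d: "has_deriv_measure (\<lambda>x. q x + s * indicator {y<..} x) M' N'"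
    and tv: "total_variation M' N' \<le> total_variation M N + \<bar>s\<bar>" by blast
  show "(\<lambda>x. q x + s * indicator {y<..} x) \<in> BV" using d qi Hi by (auto simp: BV_def L1_def)
  show "norm_deriv_M (\<lambda>x. q x + s * indicator {y<..} x) \<le> norm_deriv_M q + \<bar>s\<bar>"
    using tv by (simp add: norm_deriv_M_eq[OF d] norm_deriv_M_eq[OF qM])
qed

section \<open>The state equation\<close>

lemma prim_mono:
  assumes "integrable lebO g" "integrable lebO k" "0 \<le> x" "x \<le> 1"
    and le: "AE t in lebO. t < x \<longrightarrow> g t \<le> k t"
  shows "prim g x \<le> prim k x"
proof -
  have i: "integrable lebO (\<lambda>t. indicator {..<x} t * f t)" if "integrable lebO f" for f :: "real \<Rightarrow> real"
    by (rule Bochner_Integration.integrable_bound[OF that])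
      (use that in \<open>auto simp: indicator_def borel_measurable_integrable intro!: borel_measurable_times\<close>)
  show ?thesis
    unfolding prim_lebO[OF assms(1,3,4)] prim_lebO[OF assms(2,3,4)]
    by (rule integral_mono_AE[OF i[OF assms(1)] i[OF assms(2)]])
      (use le in \<open>auto simp: indicator_def elim: eventually_mono\<close>)
qed

lemma prim_abs_mono:
  assumes "integrable lebO g" "integrable lebO k" "0 \<le> x" "x \<le> 1"
    and le: "AE t in lebO. t < x \<longrightarrow> \<bar>g t\<bar> \<le> k t"
  shows "\<bar>prim g x\<bar> \<le> prim k x"
proof -
  have "prim g x \<le> prim k x"
    by (rule prim_mono) (use assms in \<open>auto elim: eventually_mono\<close>)
  moreover have "prim (\<lambda>t. - 1 * g t) x \<le> prim k x"
    by (rule prim_mono) (use assms in \<open>auto elim: eventually_mono\<close>)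
  ultimately show ?thesis unfolding prim_cmult by linarith
qed

lemma prim_const: "0 \<le> x \<Longrightarrow> prim (\<lambda>_. c) x = c * x"
  by (simp add: prim_def)

lemma prim_abs_bound:
  assumes "integrable lebO g" "0 \<le> x" "x \<le> 1" and "AE t in lebO. t < x \<longrightarrow> \<bar>g t\<bar> \<le> B"
  shows "\<bar>prim g x\<bar> \<le> B * x"
  using prim_abs_mono[of g "\<lambda>_. B" x] assms by (simp add: prim_const)

lemma prim_nonneg:
  assumes "integrable lebO g" "0 \<le> x" "x \<le> 1" and "AE t in lebO. 0 \<le> g t"
  shows "0 \<le> prim g x"
proof -
  have "AE t in lebO. t < x \<longrightarrow> 0 \<le> g t" using assms(4) by eventually_elim simp
  then show ?thesis using prim_mono[of "\<lambda>_. 0" g x] assms by (simp add: prim_const)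
qed

lemma prim_cong: "(\<And>t. t \<in> {0..x} \<Longrightarrow> g t = k t) \<Longrightarrow> prim g x = prim k x"
  unfolding prim_def by (rule integral_cong)

lemma prim_power:
  assumes "0 \<le> x" "x \<le> 1" shows "prim (\<lambda>s. c * s ^ n / fact n) x = c * x ^ Suc n / fact (Suc n)"
proof (rule prim_FTC)
  fix x :: real
  have "((\<lambda>x. x ^ Suc n) has_real_derivative real (Suc n) * x ^ n) (at x)"
    using DERIV_pow[of "Suc n" x] by simp
  then have "((\<lambda>x. c * x ^ Suc n / fact (Suc n)) has_real_derivative c * (real (Suc n) * x ^ n) / fact (Suc n)) (at x)"
    by (intro DERIV_cdivide DERIV_cmult)
  moreover have "c * (real (Suc n) * x ^ n) / fact (Suc n) = c * x ^ n / fact n"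
    by (simp add: fact_Suc field_simps del: of_nat_Suc)
  ultimately show "((\<lambda>x. c * x ^ Suc n / fact (Suc n)) has_real_derivative c * x ^ n / fact n) (at x)" by simp
qed (use assms in \<open>auto intro!: continuous_intros\<close>)

locale elliptic =
  fixes a d\<^sub>0 :: "real \<Rightarrow> real" and \<nu> L D :: real
  assumes nu: "\<nu> > 0" and a_ge: "\<And>x. x \<in> {0..1} \<Longrightarrow> a x \<ge> \<nu>"
    and a_lip: "L-lipschitz_on {0..1} a"
    and d0_measurable: "d\<^sub>0 \<in> borel_measurable lebO"
    and d0_nonneg: "AE x in lebO. 0 \<le> d\<^sub>0 x" and D: "D \<ge> 0" and d0_le: "AE x in lebO. \<bar>d\<^sub>0 x\<bar> \<le> D"
begin

lemma a_continuous: "continuous_on {0..1} a"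
  using a_lip lipschitz_on_continuous_on by blast

lemma a_Linf: "a \<in> Linf" by (rule Linf_continuous[OF a_continuous])

lemma d0_Linf: "d\<^sub>0 \<in> Linf" using d0_measurable d0_le by (auto simp: Linf_def)

lemma a_pos: "x \<in> {0..1} \<Longrightarrow> a x > 0" using a_ge nu by force

lemma inv_a_continuous: "continuous_on {0..1} (\<lambda>x. 1 / a x)"
  by (intro continuous_intros a_continuous) (use a_pos in force)

lemma inv_a_Linf: "(\<lambda>x. 1 / a x) \<in> Linf" by (rule Linf_continuous[OF inv_a_continuous])

lemma div_a_Linf: "f \<in> Linf \<Longrightarrow> (\<lambda>x. f x / a x) \<in> Linf"
  using Linf_mult[OF _ inv_a_Linf, of f] by simp

lemma L_nonneg: "L \<ge> 0" using a_lip lipschitz_on_nonneg by blast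

lemma d0_mult_bound:
  assumes "continuous_on {0..1} v" "\<And>x. x \<in> \<Omega> \<Longrightarrow> \<bar>v x\<bar> \<le> C"
  shows "AE x in lebO. \<bar>d\<^sub>0 x * v x\<bar> \<le> D * C"
  using d0_le AE_space
proof eventually_elim
  case (elim x)
  then show ?case using assms(2)[of x] D by (auto simp: abs_mult intro!: mult_mono)
qed

lemma d0_mult_Linf: "continuous_on {0..1} v \<Longrightarrow> (\<lambda>x. d\<^sub>0 x * v x) \<in> Linf"
  by (intro Linf_mult d0_Linf Linf_continuous)

subsection \<open>The Volterra equation\<close>

definition volt :: "(real \<Rightarrow> real) \<Rightarrow> real \<Rightarrow> real"
  where "volt v = prim (\<lambda>s. prim (\<lambda>t. d\<^sub>0 t * v t) s / a s)"

lemma volt_integrand_Linf: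
  assumes "continuous_on {0..1} v" shows "(\<lambda>s. prim (\<lambda>t. d\<^sub>0 t * v t) s / a s) \<in> Linf"
  by (intro div_a_Linf prim_Linf Linf_integrable d0_mult_Linf assms)

lemma volt_continuous: "continuous_on {0..1} v \<Longrightarrow> continuous_on {0..1} (volt v)"
  unfolding volt_def by (intro prim_continuous Linf_integrable volt_integrand_Linf)

lemma volt_add:
  assumes "continuous_on {0..1} v" "continuous_on {0..1} w" "x \<in> {0..1}"
  shows "volt (\<lambda>x. v x + w x) x = volt v x + volt w x"
proof -
  have "prim (\<lambda>t. d\<^sub>0 t * (v t + w t)) s / a s = prim (\<lambda>t. d\<^sub>0 t * v t) s / a s + prim (\<lambda>t. d\<^sub>0 t * w t) s / a s"
    if "s \<in> {0..x}" for s
    unfolding distrib_left add_divide_distrib[symmetric]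
    by (subst prim_add) (use assms that in \<open>auto intro!: Linf_integrable d0_mult_Linf\<close>)
  then have "volt (\<lambda>x. v x + w x) x = prim (\<lambda>s. prim (\<lambda>t. d\<^sub>0 t * v t) s / a s + prim (\<lambda>t. d\<^sub>0 t * w t) s / a s) x"
    unfolding volt_def by (intro prim_cong)
  also have "\<dots> = volt v x + volt w x"
    unfolding volt_def by (rule prim_add) (use assms in \<open>auto intro!: Linf_integrable volt_integrand_Linf\<close>)
  finally show ?thesis .
qed

lemma volt_cmult: "volt (\<lambda>x. c * v x) x = c * volt v x"
proof -
  have e: "(\<lambda>t. d\<^sub>0 t * (c * v t)) = (\<lambda>t. c * (d\<^sub>0 t * v t))" by auto
  show ?thesis unfolding volt_def e prim_cmult times_divide_eq_right[symmetric] by (rule refl)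
qed

text \<open>Each application of the operator gains a factor \<open>x / n\<close>, so that the Neumann series converges
  like the exponential series.\<close>

lemma volt_power_bound:
  assumes c: "continuous_on {0..1} v" and K: "K \<ge> 0"
    and v: "\<And>x. x \<in> {0..1} \<Longrightarrow> \<bar>v x\<bar> \<le> K * x ^ n / fact n" and x: "x \<in> {0..1}"
  shows "\<bar>volt v x\<bar> \<le> (D / \<nu> * K) * x ^ Suc n / fact (Suc n)"
proof -
  have inner: "\<bar>prim (\<lambda>t. d\<^sub>0 t * v t) s\<bar> \<le> D * (K * s ^ n / fact n)" if s: "s \<in> {0..1}" for s
  proof -
    have "\<bar>prim (\<lambda>t. d\<^sub>0 t * v t) s\<bar> \<le> (D * (K * s ^ n / fact n)) * s"
    proof (rule prim_abs_bound)
      show "AE t in lebO. t < s \<longrightarrow> \<bar>d\<^sub>0 t * v t\<bar> \<le> D * (K * s ^ n / fact n)"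
        using d0_le AE_space
      proof eventually_elim
        case (elim t)
        have "\<bar>v t\<bar> \<le> K * s ^ n / fact n" if "t < s"
        proof -
          have "\<bar>v t\<bar> \<le> K * t ^ n / fact n" using v[of t] elim by auto
          also have "\<dots> \<le> K * s ^ n / fact n"
            using that elim K by (intro divide_right_mono mult_left_mono power_mono) auto
          finally show ?thesis .
        qed
        then show ?case
          using elim D unfolding abs_mult by (intro impI mult_mono) auto
      qed
    qed (use s c in \<open>auto intro!: Linf_integrable d0_mult_Linf\<close>)
    also have "\<dots> \<le> D * (K * s ^ n / fact n) * 1"
      using s D K by (intro mult_left_mono) auto
    finally show ?thesis by simp
  qed
  have "\<bar>volt v x\<bar> \<le> prim (\<lambda>s. (D / \<nu> * K) * s ^ n / fact n) x"
    unfolding volt_def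
  proof (rule prim_abs_mono)
    show "integrable lebO (\<lambda>s. (D / \<nu> * K) * s ^ n / fact n)"
      by (intro Linf_integrable Linf_continuous continuous_intros) auto
    show "AE s in lebO. s < x \<longrightarrow> \<bar>prim (\<lambda>t. d\<^sub>0 t * v t) s / a s\<bar> \<le> (D / \<nu> * K) * s ^ n / fact n"
    proof (intro AE_lebO_I impI)
      fix s :: real assume s: "s \<in> \<Omega>"
      have "\<bar>prim (\<lambda>t. d\<^sub>0 t * v t) s\<bar> / a s \<le> D * (K * s ^ n / fact n) / \<nu>"
        using s inner[of s] a_ge[of s] nu D K by (intro frac_le) auto
      also have "\<dots> = (D / \<nu> * K) * s ^ n / fact n" by (simp add: mult_ac)
      finally show "\<bar>prim (\<lambda>t. d\<^sub>0 t * v t) s / a s\<bar> \<le> (D / \<nu> * K) * s ^ n / fact n"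
        using a_pos[of s] s by (simp add: abs_divide)
    qed
  qed (use x c in \<open>auto intro!: Linf_integrable volt_integrand_Linf\<close>)
  then show ?thesis using prim_power[of x "D / \<nu> * K" n] x by (metis atLeastAtMost_iff)
qed

lemma volt_bound:
  assumes "continuous_on {0..1} v" "\<And>x. x \<in> {0..1} \<Longrightarrow> \<bar>v x\<bar> \<le> K" "x \<in> {0..1}"
  shows "\<bar>volt v x\<bar> \<le> D / \<nu> * K"
proof -
  have K: "K \<ge> 0" using assms(2)[of 0] by auto
  have "\<bar>volt v x\<bar> \<le> (D / \<nu> * K) * x ^ Suc 0 / fact (Suc 0)"
    by (rule volt_power_bound) (use assms K in auto)
  also have "\<dots> \<le> D / \<nu> * K" using assms(3) D nu K by (simp add: divide_right_mono mult_left_le)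
  finally show ?thesis .
qed

lemma volt_nonneg:
  assumes "continuous_on {0..1} v" "\<And>x. x \<in> {0..1} \<Longrightarrow> 0 \<le> v x" "x \<in> {0..1}"
  shows "0 \<le> volt v x"
  unfolding volt_def
proof (rule prim_nonneg)
  have "0 \<le> prim (\<lambda>t. d\<^sub>0 t * v t) s" if "s \<in> {0..1}" for s
  proof (rule prim_nonneg)
    show "AE t in lebO. 0 \<le> d\<^sub>0 t * v t"
      using d0_nonneg AE_space by eventually_elim (use assms(2) in auto)
  qed (use that assms in \<open>auto intro!: Linf_integrable d0_mult_Linf\<close>)
  then show "AE s in lebO. 0 \<le> prim (\<lambda>t. d\<^sub>0 t * v t) s / a s"
    by (intro AE_lebO_I) (use a_pos in \<open>auto intro!: divide_nonneg_pos\<close>)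
qed (use assms in \<open>auto intro!: Linf_integrable volt_integrand_Linf\<close>)

text \<open>The sum of the Neumann series. The operator preserves nonnegativity because \<open>d\<^sub>0 \<ge> 0\<close>, whence the lower
  bound.\<close>

lemma volt_solution:
  assumes G: "continuous_on {0..1} G"
  obtains u where "continuous_on {0..1} u" "\<forall>x\<in>{0..1}. u x = G x + volt u x"
    "(\<forall>x\<in>{0..1}. 0 \<le> G x) \<longrightarrow> (\<forall>x\<in>{0..1}. G x \<le> u x)"
proof -
  define c where "c n = (volt ^^ n) G" for n
  have c0: "c 0 = G" and cS: "c (Suc n) = volt (c n)" for n by (auto simp: c_def)
  have cc: "continuous_on {0..1} (c n)" for n
    by (induction n) (auto simp: c0 cS G volt_continuous)
  have "compact (G ` {0..1})" using G compact_continuous_image by blast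
  then obtain A0 where A0: "\<forall>y\<in>G ` {0..1}. norm y \<le> A0" using compact_imp_bounded bounded_iff by metis
  define A where "A = max A0 0"
  define C where "C = D / \<nu>"
  have A: "A \<ge> 0" "\<And>x. x \<in> {0..1} \<Longrightarrow> \<bar>G x\<bar> \<le> A" using A0 by (auto simp: A_def le_max_iff_disj)
  have C: "C \<ge> 0" unfolding C_def using D nu by simp
  have bd: "\<bar>c n x\<bar> \<le> (C ^ n * A) * x ^ n / fact n" if "x \<in> {0..1}" for n x
    using that
  proof (induction n arbitrary: x)
    case 0
    then show ?case using A by (simp add: c0)
  next
    case (Suc n)
    have "\<bar>volt (c n) x\<bar> \<le> (D / \<nu> * (C ^ n * A)) * x ^ Suc n / fact (Suc n)"
      by (rule volt_power_bound) (use Suc cc A C in auto)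
    then show ?case by (simp only: cS power_Suc C_def[symmetric] mult.assoc)
  qed
  have bd2: "\<bar>c n x\<bar> \<le> A * (C ^ n / fact n)" if "x \<in> {0..1}" for n x
  proof -
    have "(C ^ n * A) * x ^ n / fact n \<le> (C ^ n * A) * 1 / fact n"
      using that A C by (intro divide_right_mono mult_left_mono power_le_one) auto
    then show ?thesis using bd[OF that, of n] by (simp add: mult_ac)
  qed
  have sm: "summable (\<lambda>n. A * (C ^ n / fact n))"
    using summable_exp[of C] by (intro summable_mult) (simp add: divide_inverse mult.commute)
  define u where "u x = (\<Sum>n. c n x)" for x
  define s where "s N x = (\<Sum>n<N. c n x)" for N x
  have ul: "uniform_limit {0..1} s u sequentially"
    unfolding u_def[abs_def] s_def[abs_def]
    by (rule Weierstrass_m_test[where M="\<lambda>n. A * (C ^ n / fact n)"]) (use bd2 sm in auto)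
  have sc: "continuous_on {0..1} (s N)" for N
    unfolding s_def[abs_def] by (intro continuous_on_sum cc)
  have uc: "continuous_on {0..1} u"
    by (rule uniform_limit_theorem[OF _ ul]) (auto simp: sc)
  have Ks: "volt (s N) x = s (Suc N) x - G x" if "x \<in> {0..1}" for N x
  proof (induction N)
    case 0
    have "volt (\<lambda>_. 0) x = 0" using volt_cmult[of 0 G x] by simp
    then show ?case by (simp add: s_def[abs_def] c0)
  next
    case (Suc N)
    have "s (Suc N) = (\<lambda>x. s N x + c N x)" by (auto simp: s_def)
    then have "volt (s (Suc N)) x = volt (s N) x + volt (c N) x"
      by (simp only: volt_add[OF sc cc that])
    moreover have "s (Suc (Suc N)) x = s (Suc N) x + volt (c N) x" by (simp add: s_def cS)
    ultimately show ?case using Suc by linarith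
  qed
  have pt: "(\<lambda>N. s N x) \<longlonglongrightarrow> u x" if "x \<in> {0..1}" for x
    using tendsto_uniform_limitI[OF ul that] .
  have eq: "u x = G x + volt u x" if x: "x \<in> {0..1}" for x
  proof -
    have "(\<lambda>N. volt (s N) x) \<longlonglongrightarrow> volt u x"
    proof (rule LIMSEQ_I)
      fix r :: real assume r: "0 < r"
      define e where "e = r / (2 * (C + 1))"
      have e: "e > 0" using r C by (simp add: e_def)
      obtain N0 where "\<forall>N\<ge>N0. \<forall>y\<in>{0..1}. dist (s N y) (u y) < e"
        using uniform_limitD[OF ul e] unfolding eventually_sequentially by blast
      note N0 = this[rule_format]
      show "\<exists>no. \<forall>N\<ge>no. norm (volt (s N) x - volt u x) < r"
      proof (intro exI allI impI)
        fix N assume N: "N \<ge> N0"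
        have cd: "continuous_on {0..1} (\<lambda>y. s N y + - 1 * u y)" by (intro continuous_intros sc uc)
        have "volt (\<lambda>y. s N y + - 1 * u y) x = volt (s N) x - volt u x"
          by (subst volt_add) (use sc uc x in \<open>auto simp: volt_cmult[of "-1" u, simplified] intro!: continuous_intros\<close>)
        moreover have "\<bar>volt (\<lambda>y. s N y + - 1 * u y) x\<bar> \<le> D / \<nu> * e"
          by (rule volt_bound[OF cd]) (use N0[OF N] x in \<open>auto simp: dist_real_def intro: less_imp_le\<close>)
        ultimately have "norm (volt (s N) x - volt u x) \<le> C * e" by (simp add: C_def)
        also have "\<dots> < r" using r C e by (simp add: e_def field_simps add_nonneg_pos)
        finally show "norm (volt (s N) x - volt u x) < r" .
      qed
    qed
    moreover have "(\<lambda>N. volt (s N) x) \<longlonglongrightarrow> u x - G x"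
      unfolding Ks[OF x] by (rule tendsto_diff[OF LIMSEQ_Suc[OF pt[OF x]] tendsto_const])
    ultimately show ?thesis using LIMSEQ_unique by force
  qed
  have pos: "G x \<le> u x" if G0: "\<And>x. x \<in> {0..1} \<Longrightarrow> 0 \<le> G x" and x: "x \<in> {0..1}" for x
  proof -
    have cn: "0 \<le> c n y" if "y \<in> {0..1}" for n y
      using that
    proof (induction n arbitrary: y)
      case 0
      then show ?case using G0 by (simp add: c0)
    next
      case (Suc n)
      then show ?case unfolding cS by (intro volt_nonneg[OF cc])
    qed
    have "summable (\<lambda>n. c n x)"
      by (rule summable_comparison_test[OF _ sm]) (use bd2[OF x] in auto)
    then have "sum (\<lambda>n. c n x) {0} \<le> u x"
      unfolding u_def by (rule sum_le_suminf) (use cn x in auto)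
    then show ?thesis by (simp add: c0)
  qed
  show thesis by (rule that[OF uc]) (use eq pos in auto)
qed

subsection \<open>The boundary value problem\<close>

definition flux :: "(real \<Rightarrow> real) \<Rightarrow> (real \<Rightarrow> real) \<Rightarrow> real \<Rightarrow> real \<Rightarrow> real"
  where "flux R u c s = c + R s + prim (\<lambda>t. d\<^sub>0 t * u t) s"

text \<open>The distributional equation \<open>-(a u')' + d\<^sub>0 u = -R'\<close> with zero boundary values, integrated once. If \<open>R\<close> is minus a
  primitive of the right-hand side, this is the state equation; if \<open>R\<close> is minus a Heaviside function, the solution
  is Green's function.\<close>

definition bvp :: "(real \<Rightarrow> real) \<Rightarrow> (real \<Rightarrow> real) \<Rightarrow> real \<Rightarrow> bool"
  where "bvp R u c \<longleftrightarrow> continuous_on {0..1} u \<and> u 1 = 0 \<and> (\<forall>x\<in>{0..1}. u x = prim (\<lambda>s. flux R u c s / a s) x)"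

text \<open>Shooting: the solution of the initial value problem is corrected by a multiple of the homogeneous
  solution \<open>y\<close> with \<open>a y' = 1\<close> at the left end, which is positive at the right end.\<close>

lemma bvp_exists: assumes R: "R \<in> Linf" obtains u c where "bvp R u c"
proof -
  have RL: "(\<lambda>s. R s / a s) \<in> Linf" "(\<lambda>s. 1 / a s) \<in> Linf"
    using div_a_Linf R inv_a_Linf by auto
  obtain v where v: "continuous_on {0..1} v" "\<forall>x\<in>{0..1}. v x = prim (\<lambda>s. R s / a s) x + volt v x"
    by (rule volt_solution[OF prim_continuous[OF Linf_integrable[OF RL(1)]]]) (rule that)
  have G0: "0 \<le> prim (\<lambda>s. 1 / a s) x" if "x \<in> {0..1}" for x
  proof (rule prim_nonneg[OF Linf_integrable[OF RL(2)]])
    show "AE s in lebO. 0 \<le> 1 / a s" by (rule AE_lebO_I) (use a_pos in \<open>simp add: less_imp_le\<close>)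
  qed (use that in auto)
  obtain y where y: "continuous_on {0..1} y" "\<forall>x\<in>{0..1}. y x = prim (\<lambda>s. 1 / a s) x + volt y x"
    and y_imp: "(\<forall>x\<in>{0..1}. 0 \<le> prim (\<lambda>s. 1 / a s) x) \<longrightarrow> (\<forall>x\<in>{0..1}. prim (\<lambda>s. 1 / a s) x \<le> y x)"
    by (rule volt_solution[OF prim_continuous[OF Linf_integrable[OF RL(2)]]]) (rule that)
  have y3: "prim (\<lambda>s. 1 / a s) 1 \<le> y 1"
    using mp[OF y_imp ballI[OF G0]] by auto
  have "prim (\<lambda>s. 1 / a s) 1 \<noteq> 0"
    using integral_eq_0_iff[OF inv_a_continuous] a_pos
    by (force simp: prim_def less_imp_le)
  then have y1: "y 1 > 0" using G0[of 1] y3 by auto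
  define c where "c = - v 1 / y 1"
  define u where "u x = v x + c * y x" for x
  have uc: "continuous_on {0..1} u" unfolding u_def[abs_def] by (intro continuous_intros v y)
  have "u x = prim (\<lambda>s. flux R u c s / a s) x" if x: "x \<in> {0..1}" for x
  proof -
    have vu: "volt u x = volt v x + c * volt y x"
      unfolding u_def[abs_def] using volt_add[OF v(1) continuous_on_mult[OF continuous_on_const y(1)] x, of c]
      by (simp add: volt_cmult)
    have "prim (\<lambda>s. flux R u c s / a s) x
        = prim (\<lambda>s. (R s / a s + c * (1 / a s)) + prim (\<lambda>t. d\<^sub>0 t * u t) s / a s) x"
      by (simp add: flux_def add_divide_distrib add_ac)
    also have "\<dots> = prim (\<lambda>s. R s / a s + c * (1 / a s)) x + volt u x"
      unfolding volt_def
      by (rule prim_add) (use x uc RL in \<open>auto intro!: Linf_integrable volt_integrand_Linf Linf_add Linf_cmult[of "\<lambda>s. 1 / a s", simplified]\<close>)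
    also have "prim (\<lambda>s. R s / a s + c * (1 / a s)) x = prim (\<lambda>s. R s / a s) x + prim (\<lambda>s. c * (1 / a s)) x"
      by (rule prim_add) (use x RL in \<open>auto intro!: Linf_integrable Linf_cmult[of "\<lambda>s. 1 / a s", simplified]\<close>)
    also have "prim (\<lambda>s. c * (1 / a s)) x = c * prim (\<lambda>s. 1 / a s) x" by (rule prim_cmult)
    finally have "prim (\<lambda>s. flux R u c s / a s) x = v x + c * y x"
      using bspec[OF v(2) x] bspec[OF y(2) x] vu by (simp add: distrib_left)
    then show ?thesis by (simp add: u_def[of x])
  qed
  moreover have "u 1 = 0" using y1 by (simp add: u_def c_def)
  ultimately have "bvp R u c" using uc by (simp add: bvp_def)
  then show thesis by (rule that)
qed

lemma flux_Linf: "R \<in> Linf \<Longrightarrow> continuous_on {0..1} u \<Longrightarrow> flux R u c \<in> Linf"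
  unfolding flux_def[abs_def]
  by (intro Linf_add Linf_const prim_Linf Linf_integrable d0_mult_Linf)

lemma bvp_ac0:
  assumes "bvp R u c" "R \<in> Linf"
  shows "ac0 u (\<lambda>s. flux R u c s / a s)" "(\<lambda>s. flux R u c s / a s) \<in> Linf" "u \<in> H10"
proof -
  show g: "(\<lambda>s. flux R u c s / a s) \<in> Linf"
    using assms by (intro div_a_Linf flux_Linf) (auto simp: bvp_def)
  have "prim (\<lambda>s. flux R u c s / a s) 1 = 0"
    using assms unfolding bvp_def by (metis atLeastAtMost_iff order_refl zero_le_one)
  then show ac: "ac0 u (\<lambda>s. flux R u c s / a s)"
    using assms g unfolding ac0_def bvp_def
    by (auto intro!: Linf_L2 AE_lebO_I Linf_measurable[OF Linf_continuous])
  show "u \<in> H10" by (rule ac0_H10[OF ac g])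
qed

text \<open>The bilinear form of the state equation with explicit derivatives.\<close>

definition form :: "(real \<Rightarrow> real) \<Rightarrow> (real \<Rightarrow> real) \<Rightarrow> (real \<Rightarrow> real) \<Rightarrow> (real \<Rightarrow> real) \<Rightarrow> real"
  where "form v g w k = L2_inner (\<lambda>x. a x * g x) k + L2_inner (\<lambda>x. d\<^sub>0 x * v x) w"

lemma form_L2:
  assumes "ac0 v g" shows "(\<lambda>x. a x * g x) \<in> L2" "(\<lambda>x. d\<^sub>0 x * v x) \<in> L2" "g \<in> L2" "v \<in> L2"
  using assms ac0_L2[OF assms] by (auto intro: L2_Linf_mult a_Linf d0_Linf simp: ac0_def)

lemma bform_eq: assumes "ac0 v g" "ac0 w k" shows "bform a d\<^sub>0 v w = form v g w k"
proof -
  note v = ac0_weak_deriv[OF assms(1)] and w = ac0_weak_deriv[OF assms(2)]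
  have "L2_inner (\<lambda>x. a x * weak_deriv v x) (weak_deriv w) = L2_inner (\<lambda>x. a x * g x) k"
    by (rule L2_inner_cong)
      (use weak_deriv_AE[OF v] weak_deriv_AE[OF w] weak_deriv_measurable[OF v] weak_deriv_measurable[OF w]
        Linf_measurable[OF a_Linf] assms in \<open>auto simp: ac0_def dest!: L2_measurable elim: eventually_mono\<close>)
  then show ?thesis by (simp add: bform_def form_def)
qed

lemma form_commute: "form v g w k = form w k v g"
  by (simp add: form_def L2_inner_def mult_ac)

lemma form_diff:
  assumes "ac0 v g" "ac0 v' g'" "ac0 w k"
  shows "form (\<lambda>x. v x - v' x) (\<lambda>x. g x - g' x) w k = form v g w k - form v' g' w k"
  unfolding form_def right_diff_distrib
  using form_L2[OF assms(1)] form_L2[OF assms(2)] form_L2[OF assms(3)] by (simp add: L2_inner_diff)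

lemma form_add:
  assumes "ac0 v g" "ac0 v' g'" "ac0 w k"
  shows "form (\<lambda>x. v x + v' x) (\<lambda>x. g x + g' x) w k = form v g w k + form v' g' w k"
  unfolding form_def distrib_left
  using form_L2[OF assms(1)] form_L2[OF assms(2)] form_L2[OF assms(3)] by (simp add: L2_inner_add)

lemma form_cmult: "form (\<lambda>x. t * v x) (\<lambda>x. t * g x) w k = t * form v g w k"
  unfolding form_def mult.left_commute[of _ t] by (simp add: L2_inner_cmult distrib_left)

lemma form_coercive: assumes "ac0 v g" shows "\<nu> * (norm_L2 g)\<^sup>2 \<le> form v g v g"
proof -
  note l = form_L2[OF assms]
  have "\<nu> * (norm_L2 g)\<^sup>2 = (LINT x|lebO. \<nu> * (g x * g x))"
    by (simp add: norm_L2_square L2_inner_def)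
  also have "\<dots> \<le> L2_inner (\<lambda>x. a x * g x) g"
    unfolding L2_inner_def
  proof (rule integral_mono_AE)
    show "AE x in lebO. \<nu> * (g x * g x) \<le> a x * g x * g x"
      by (rule AE_lebO_I) (use a_ge in \<open>auto simp: mult.assoc intro!: mult_right_mono\<close>)
  qed (use l L2_mult_integrable in auto)
  also have "0 \<le> L2_inner (\<lambda>x. d\<^sub>0 x * v x) v"
    unfolding L2_inner_def by (rule integral_nonneg_AE) (use d0_nonneg in \<open>auto simp: mult.assoc elim!: eventually_mono\<close>)
  ultimately show ?thesis by (simp add: form_def)
qed

lemma ac0_norm_le: assumes "ac0 v g" shows "norm_L2 v \<le> norm_L2 g"
proof (rule norm_L2_bounded)
  have "AE x in lebO. v x = prim g x" using assms by (simp add: ac0_def)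
  then show "AE x in lebO. \<bar>v x\<bar> \<le> norm_L2 g"
    using AE_space
  proof eventually_elim
    case (elim x)
    then show ?case using prim_le_L2[of g x] assms by (simp add: ac0_def)
  qed
qed (use assms in \<open>auto simp: ac0_def\<close>)

lemma norm_mult_bounded:
  assumes f: "f \<in> borel_measurable lebO" "AE x in lebO. \<bar>f x\<bar> \<le> B" "B \<ge> 0" and g: "g \<in> L2"
  shows "norm_L2 (\<lambda>x. f x * g x) \<le> B * norm_L2 g"
proof -
  have fL: "f \<in> Linf" using f by (auto simp: Linf_def)
  have "(LINT x|lebO. (f x * g x)\<^sup>2) \<le> (LINT x|lebO. (B * g x)\<^sup>2)"
  proof (rule integral_mono_AE)
    show "AE x in lebO. (f x * g x)\<^sup>2 \<le> (B * g x)\<^sup>2"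
      using f(2)
    proof eventually_elim
      case (elim x)
      then have "\<bar>f x * g x\<bar> \<le> \<bar>B * g x\<bar>" using f(3) by (simp add: abs_mult mult_right_mono)
      then show ?case by (simp only: abs_le_square_iff)
    qed
  qed (use L2_Linf_mult[OF fL g] L2_cmult[OF g] in \<open>auto simp: L2_def\<close>)
  then have "norm_L2 (\<lambda>x. f x * g x) \<le> norm_L2 (\<lambda>x. B * g x)" unfolding norm_L2_def by simp
  then show ?thesis using f(3) by (simp add: norm_L2_cmult)
qed

lemma a_bounded: obtains A where "A \<ge> 0" "\<And>x. x \<in> {0..1} \<Longrightarrow> \<bar>a x\<bar> \<le> A"
proof -
  have "compact (a ` {0..1})" using a_continuous compact_continuous_image by blast
  then obtain A where "\<forall>y\<in>a ` {0..1}. norm y \<le> A" using compact_imp_bounded bounded_iff by metis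
  then show thesis by (intro that[of "max A 0"]) (auto simp: le_max_iff_disj)
qed

lemma form_bounded:
  obtains M where "M > 0" "\<And>v g w k. ac0 v g \<Longrightarrow> ac0 w k \<Longrightarrow> \<bar>form v g w k\<bar> \<le> M * norm_L2 g * norm_L2 k"
proof -
  obtain A where A: "A \<ge> 0" "\<And>x. x \<in> {0..1} \<Longrightarrow> \<bar>a x\<bar> \<le> A" using a_bounded by blast
  have "\<bar>form v g w k\<bar> \<le> (A + D + 1) * norm_L2 g * norm_L2 k" if v: "ac0 v g" and w: "ac0 w k" for v g w k
  proof -
    note lv = form_L2[OF v] and lw = form_L2[OF w]
    have "\<bar>L2_inner (\<lambda>x. a x * g x) k\<bar> \<le> norm_L2 (\<lambda>x. a x * g x) * norm_L2 k" by (rule L2_inner_CS) (use lv lw in auto)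
    also have "\<dots> \<le> (A * norm_L2 g) * norm_L2 k"
      by (intro mult_right_mono norm_mult_bounded) (use A lv a_Linf in \<open>auto intro!: AE_lebO_I Linf_measurable\<close>)
    finally have 1: "\<bar>L2_inner (\<lambda>x. a x * g x) k\<bar> \<le> A * norm_L2 g * norm_L2 k" .
    have "\<bar>L2_inner (\<lambda>x. d\<^sub>0 x * v x) w\<bar> \<le> norm_L2 (\<lambda>x. d\<^sub>0 x * v x) * norm_L2 w" by (rule L2_inner_CS) (use lv lw in auto)
    also have "\<dots> \<le> (D * norm_L2 v) * norm_L2 w"
      by (intro mult_right_mono norm_mult_bounded) (use D lv d0_measurable d0_le in auto)
    also have "\<dots> \<le> (D * norm_L2 g) * norm_L2 k"
      using D ac0_norm_le[OF v] ac0_norm_le[OF w] by (intro mult_mono) auto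
    finally have 2: "\<bar>L2_inner (\<lambda>x. d\<^sub>0 x * v x) w\<bar> \<le> D * norm_L2 g * norm_L2 k" .
    have "0 \<le> norm_L2 g * norm_L2 k" by (intro mult_nonneg_nonneg norm_L2_nonneg)
    then show ?thesis unfolding form_def
      using 1 2 abs_triangle_ineq[of "L2_inner (\<lambda>x. a x * g x) k" "L2_inner (\<lambda>x. d\<^sub>0 x * v x) w"]
      unfolding distrib_right by linarith
  qed
  then show thesis using A D by (intro that[of "A + D + 1"]) auto
qed

lemma bvp_weak:
  assumes u: "bvp R u c" and R: "R \<in> Linf" and w: "ac0 w k"
  shows "form u (\<lambda>s. flux R u c s / a s) w k = L2_inner R k"
proof -
  have uc: "continuous_on {0..1} u" using u by (simp add: bvp_def)
  have k: "k \<in> L2" "integrable lebO k" using w by (auto simp: ac0_def L2_integrable)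
  have du: "(\<lambda>t. d\<^sub>0 t * u t) \<in> Linf" by (rule d0_mult_Linf[OF uc])
  have k0: "(LINT x|lebO. k x) = 0" using w prim_1[OF k(2)] by (simp add: ac0_def)
  have "L2_inner (\<lambda>x. a x * (flux R u c x / a x)) k = L2_inner (flux R u c) k"
    unfolding L2_inner_def
  proof (rule Bochner_Integration.integral_cong[OF refl])
    fix x assume "x \<in> space lebO"
    then have "a x \<noteq> 0" using a_pos[of x] by auto
    then show "a x * (flux R u c x / a x) * k x = flux R u c x * k x" by simp
  qed
  also have "\<dots> = (LINT x|lebO. c * k x + (R x * k x + prim (\<lambda>t. d\<^sub>0 t * u t) x * k x))"
    unfolding L2_inner_def flux_def by (simp add: algebra_simps)
  also have "\<dots> = L2_inner R k + (LINT x|lebO. prim (\<lambda>t. d\<^sub>0 t * u t) x * k x)"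
    using k k0 L2_mult_integrable[OF Linf_L2[OF R] k(1)] prim_mult_integrable[OF Linf_integrable[OF du] k(2)]
    by (simp add: L2_inner_def)
  also have "(LINT x|lebO. prim (\<lambda>t. d\<^sub>0 t * u t) x * k x) = - (LINT x|lebO. (d\<^sub>0 x * u x) * prim k x)"
    using prim_by_parts[OF Linf_integrable[OF du] k(2)] k0 by simp
  also have "(LINT x|lebO. (d\<^sub>0 x * u x) * prim k x) = L2_inner (\<lambda>x. d\<^sub>0 x * u x) w"
    unfolding L2_inner_def[symmetric, of "\<lambda>x. d\<^sub>0 x * u x" "prim k"]
    by (rule L2_inner_cong) (use w du prim_Linf[OF k(2)] in \<open>auto simp: ac0_def intro: Linf_measurable elim: eventually_mono\<close>)
  finally show ?thesis by (simp add: form_def)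
qed

text \<open>The energy identity bounds the solution, and the solution bounds the flux up to its constant.\<close>

lemma bvp_bounds:
  assumes u: "bvp R u c" and R: "R \<in> Linf" and \<rho>: "\<And>x. x \<in> \<Omega> \<Longrightarrow> \<bar>R x\<bar> \<le> \<rho>"
  shows bvp_sup: "x \<in> {0..1} \<Longrightarrow> \<bar>u x\<bar> \<le> \<rho> / \<nu>"
    and bvp_flux: "x \<in> \<Omega> \<Longrightarrow> \<bar>flux R u c x\<bar> \<le> 2 * \<rho> * (1 + D / \<nu>)"
proof -
  define g where "g s = flux R u c s / a s" for s
  note ac = bvp_ac0[OF u R, folded g_def[abs_def]]
  have gL: "g \<in> L2" using ac(2) by (rule Linf_L2)
  have \<rho>0: "\<rho> \<ge> 0" using \<rho>[of "1/2"] by auto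
  have RL: "R \<in> L2" using R by (rule Linf_L2)
  have "\<nu> * (norm_L2 g)\<^sup>2 \<le> L2_inner R g"
    using form_coercive[OF ac(1)] bvp_weak[OF u R ac(1)] by (simp add: g_def[abs_def])
  also have "\<dots> \<le> norm_L2 R * norm_L2 g" using L2_inner_CS[OF RL gL] by linarith
  also have "norm_L2 R \<le> \<rho>" by (rule norm_L2_bounded) (use R \<rho> \<rho>0 in \<open>auto intro!: Linf_measurable AE_lebO_I\<close>)
  finally have "\<nu> * (norm_L2 g)\<^sup>2 \<le> \<rho> * norm_L2 g" by (simp add: mult_right_mono)
  then have ng: "norm_L2 g \<le> \<rho> / \<nu>"
  proof (cases "norm_L2 g = 0")
    case False
    then have "norm_L2 g > 0" using norm_L2_nonneg[of g] by linarith
    moreover assume "\<nu> * (norm_L2 g)\<^sup>2 \<le> \<rho> * norm_L2 g"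
    ultimately have "\<nu> * norm_L2 g \<le> \<rho>" by (simp add: power2_eq_square mult.assoc[symmetric])
    then show ?thesis using nu by (simp add: field_simps)
  qed (use nu \<rho>0 in simp)
  show su: "\<bar>u x\<bar> \<le> \<rho> / \<nu>" if "x \<in> {0..1}" for x
    using prim_le_L2[OF gL, of x] that u ng unfolding bvp_def g_def[abs_def, symmetric] by force
  have uc: "continuous_on {0..1} u" using u by (simp add: bvp_def)
  have du: "\<bar>prim (\<lambda>t. d\<^sub>0 t * u t) x\<bar> \<le> \<rho> * (D / \<nu>)" if "x \<in> {0..1}" for x
  proof -
    have "\<bar>prim (\<lambda>t. d\<^sub>0 t * u t) x\<bar> \<le> D * (\<rho> / \<nu>) * x"
      by (rule prim_abs_bound) (use that su uc d0_mult_bound[OF uc, of "\<rho> / \<nu>"] in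
        \<open>auto intro!: Linf_integrable d0_mult_Linf elim: eventually_mono\<close>)
    also have "\<dots> \<le> D * (\<rho> / \<nu>) * 1" using that D \<rho>0 nu by (intro mult_left_mono) auto
    finally show ?thesis by (simp add: mult_ac)
  qed
  define r where "r x = R x + prim (\<lambda>t. d\<^sub>0 t * u t) x" for x
  have r: "\<bar>r x\<bar> \<le> \<rho> * (1 + D / \<nu>)" if "x \<in> \<Omega>" for x
    using du[of x] \<rho>[OF that] that unfolding r_def by (simp add: distrib_left)
  have rL: "r \<in> Linf" unfolding r_def[abs_def]
    by (intro Linf_add R prim_Linf Linf_integrable d0_mult_Linf uc)
  define I where "I = prim (\<lambda>s. 1 / a s) 1"
  have I: "I > 0"
  proof -
    have "0 \<le> I" unfolding I_def by (rule prim_nonneg) (use a_pos inv_a_Linf in \<open>auto intro!: Linf_integrable AE_lebO_I less_imp_le\<close>)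
    moreover have "I \<noteq> 0" unfolding I_def
      using integral_eq_0_iff[OF inv_a_continuous] a_pos by (force simp: prim_def less_imp_le)
    ultimately show ?thesis by simp
  qed
  \<comment> \<open>The constant of integration is minus a weighted mean of the remaining flux.\<close>
  have c: "\<bar>c\<bar> \<le> \<rho> * (1 + D / \<nu>)"
  proof -
    have "0 = prim g 1" using ac(1) by (simp add: ac0_def)
    also have "\<dots> = prim (\<lambda>s. c * (1 / a s) + r s / a s) 1"
      by (simp add: g_def[abs_def] flux_def r_def add_divide_distrib add_ac)
    also have "\<dots> = c * I + prim (\<lambda>s. r s / a s) 1"
      unfolding I_def prim_cmult[symmetric]
      by (rule prim_add) (intro Linf_integrable Linf_cmult inv_a_Linf div_a_Linf rL order_refl)+
    finally have "\<bar>c\<bar> * I = \<bar>prim (\<lambda>s. r s / a s) 1\<bar>"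
      using I by (metis abs_minus_cancel abs_mult abs_of_pos add.commute eq_neg_iff_add_eq_0)
    also have "\<dots> \<le> prim (\<lambda>s. (\<rho> * (1 + D / \<nu>)) * (1 / a s)) 1"
    proof (rule prim_abs_mono)
      show "AE s in lebO. s < 1 \<longrightarrow> \<bar>r s / a s\<bar> \<le> (\<rho> * (1 + D / \<nu>)) * (1 / a s)"
      proof (intro AE_lebO_I impI)
        fix s :: real assume s: "s \<in> \<Omega>"
        then have "a s > 0" using a_pos by auto
        then show "\<bar>r s / a s\<bar> \<le> (\<rho> * (1 + D / \<nu>)) * (1 / a s)"
          using r[OF s] by (simp add: abs_divide divide_right_mono)
      qed
    qed (intro Linf_integrable Linf_cmult inv_a_Linf div_a_Linf rL zero_le_one order_refl)+
    also have "\<dots> = \<rho> * (1 + D / \<nu>) * I" unfolding I_def by (rule prim_cmult)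
    finally show ?thesis using I by simp
  qed
  show "\<bar>flux R u c x\<bar> \<le> 2 * \<rho> * (1 + D / \<nu>)" if "x \<in> \<Omega>"
    using c r[OF that] unfolding flux_def r_def by linarith
qed

lemma bvp_deriv_Lipschitz:
  assumes u: "bvp R u c" and R: "R \<in> Linf" and \<rho>: "\<And>x. x \<in> \<Omega> \<Longrightarrow> \<bar>R x\<bar> \<le> \<rho>"
    and st: "0 \<le> s" "t \<le> 1" and lip: "\<And>x y. x \<in> {s<..<t} \<Longrightarrow> y \<in> {s<..<t} \<Longrightarrow> x \<le> y \<Longrightarrow> \<bar>R y - R x\<bar> \<le> r * (y - x)"
    and xy: "x \<in> {s<..<t}" "y \<in> {s<..<t}" "x \<le> y"
  shows "\<bar>flux R u c y / a y - flux R u c x / a x\<bar>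
      \<le> ((r + D * (\<rho> / \<nu>)) / \<nu> + 2 * \<rho> * (1 + D / \<nu>) * L / \<nu>\<^sup>2) * (y - x)"
proof -
  have xyO: "x \<in> \<Omega>" "y \<in> \<Omega>" "x \<in> {0..1}" "y \<in> {0..1}" using xy st by auto
  have uc: "continuous_on {0..1} u" using u by (simp add: bvp_def)
  have "\<bar>prim (\<lambda>t. d\<^sub>0 t * u t) y - prim (\<lambda>t. d\<^sub>0 t * u t) x\<bar> \<le> D * (\<rho> / \<nu>) * (y - x)"
    by (rule prim_Lipschitz) (use xyO xy(3) bvp_sup[OF u R \<rho>] d0_mult_bound[OF uc, of "\<rho> / \<nu>"]
        Linf_measurable[OF d0_mult_Linf[OF uc]] in auto)
  then have 1: "\<bar>flux R u c y - flux R u c x\<bar> \<le> (r + D * (\<rho> / \<nu>)) * (y - x)"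
    using lip[OF xy] unfolding flux_def by (simp add: distrib_right)
  have ax: "a x \<ge> \<nu>" "a y \<ge> \<nu>" using a_ge xyO by auto
  have la: "\<bar>a x - a y\<bar> \<le> L * (y - x)"
    using lipschitz_onD[OF a_lip xyO(3,4)] xy(3) by (simp add: dist_real_def)
  have eq: "flux R u c y / a y - flux R u c x / a x
      = (flux R u c y - flux R u c x) / a y + flux R u c x * ((a x - a y) / (a x * a y))"
    using ax nu by (simp add: field_simps)
  have "\<bar>flux R u c y / a y - flux R u c x / a x\<bar>
      \<le> \<bar>flux R u c y - flux R u c x\<bar> / a y + \<bar>flux R u c x\<bar> * (\<bar>a x - a y\<bar> / (a x * a y))"
    unfolding eq using ax nu by (intro order_trans[OF abs_triangle_ineq]) (simp add: abs_mult abs_divide)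
  also have "\<dots> \<le> (r + D * (\<rho> / \<nu>)) * (y - x) / \<nu> + 2 * \<rho> * (1 + D / \<nu>) * (L * (y - x) / (\<nu> * \<nu>))"
  proof (intro add_mono mult_mono)
    have "0 \<le> \<bar>flux R u c y - flux R u c x\<bar>" by simp
    then show "\<bar>flux R u c y - flux R u c x\<bar> / a y \<le> (r + D * (\<rho> / \<nu>)) * (y - x) / \<nu>"
      using 1 ax nu by (intro frac_le) auto
    show "\<bar>flux R u c x\<bar> \<le> 2 * \<rho> * (1 + D / \<nu>)" by (rule bvp_flux[OF u R \<rho> xyO(1)])
    then show "0 \<le> 2 * \<rho> * (1 + D / \<nu>)" by linarith
    show "\<bar>a x - a y\<bar> / (a x * a y) \<le> L * (y - x) / (\<nu> * \<nu>)"
      using la ax nu by (intro frac_le mult_mono) (auto intro: order_trans[OF abs_ge_zero la])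
  qed (use ax nu in auto)
  finally show ?thesis by (simp add: power2_eq_square distrib_right mult.assoc)
qed

subsection \<open>Solutions in subspaces\<close>

lemma bform_linear:
  assumes "v \<in> H10" "v' \<in> H10" "w \<in> H10"
  shows bform_add: "bform a d\<^sub>0 (\<lambda>x. v x + v' x) w = bform a d\<^sub>0 v w + bform a d\<^sub>0 v' w"
    and bform_diff: "bform a d\<^sub>0 (\<lambda>x. v x - v' x) w = bform a d\<^sub>0 v w - bform a d\<^sub>0 v' w"
    and bform_cmult: "bform a d\<^sub>0 (\<lambda>x. t * v x) w = t * bform a d\<^sub>0 v w"
    and bform_commute: "bform a d\<^sub>0 v w = bform a d\<^sub>0 w v"
proof -
  obtain g g' k where ac: "ac0 v g" "ac0 v' g'" "ac0 w k" using assms by (elim H10_ac0)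
  show "bform a d\<^sub>0 (\<lambda>x. v x + v' x) w = bform a d\<^sub>0 v w + bform a d\<^sub>0 v' w"
    by (simp add: bform_eq[OF ac0_add[OF ac(1,2)] ac(3)] bform_eq[OF ac(1,3)] bform_eq[OF ac(2,3)] form_add[OF ac])
  show "bform a d\<^sub>0 (\<lambda>x. v x - v' x) w = bform a d\<^sub>0 v w - bform a d\<^sub>0 v' w"
    by (simp add: bform_eq[OF ac0_diff[OF ac(1,2)] ac(3)] bform_eq[OF ac(1,3)] bform_eq[OF ac(2,3)] form_diff[OF ac])
  show "bform a d\<^sub>0 (\<lambda>x. t * v x) w = t * bform a d\<^sub>0 v w"
    by (simp add: bform_eq[OF ac0_cmult[OF ac(1)] ac(3)] bform_eq[OF ac(1,3)] form_cmult)
  show "bform a d\<^sub>0 v w = bform a d\<^sub>0 w v"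
    by (simp add: bform_eq[OF ac(1,3)] bform_eq[OF ac(3,1)] form_commute)
qed

lemma bform_pos:
  assumes "v \<in> H10" "bform a d\<^sub>0 v v \<le> 0" shows "AE x in lebO. v x = 0"
proof -
  obtain g where g: "ac0 v g" using H10_ac0[OF assms(1)] .
  have "\<nu> * (norm_L2 g)\<^sup>2 \<le> 0" using form_coercive[OF g] bform_eq[OF g g] assms(2) by simp
  then have "norm_L2 g = 0" using nu by (simp add: mult_le_0_iff)
  then have "norm_L2 v = 0" using ac0_norm_le[OF g] by (simp add: order_antisym)
  then show ?thesis using norm_L2_zero_imp ac0_L2[OF g] by blast
qed

definition is_sol :: "(real \<Rightarrow> real) set \<Rightarrow> (real \<Rightarrow> real) \<Rightarrow> (real \<Rightarrow> real) \<Rightarrow> bool"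
  where "is_sol W f u \<longleftrightarrow> u \<in> W \<and> (\<forall>w\<in>W. bform a d\<^sub>0 u w = L2_inner f w)"

lemma bvp_is_sol:
  assumes f: "f \<in> Linf" and u: "bvp (\<lambda>x. - prim f x) u c" shows "is_sol H10 f u"
proof -
  have pf: "(\<lambda>x. - prim f x) \<in> Linf"
    using Linf_cmult[OF prim_Linf[OF Linf_integrable[OF f]], of "-1"] by simp
  have "bform a d\<^sub>0 u w = L2_inner f w" if wH: "w \<in> H10" for w
  proof -
    obtain k where w: "ac0 w k" using H10_ac0[OF wH] .
    have k: "integrable lebO k" "(LINT x|lebO. k x) = 0"
      using w L2_integrable[of k] prim_1[of k] by (auto simp: ac0_def)
    have "bform a d\<^sub>0 u w = L2_inner (\<lambda>x. - prim f x) k"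
      using bform_eq[OF bvp_ac0(1)[OF u pf] w] bvp_weak[OF u pf w] by simp
    also have "\<dots> = (LINT x|lebO. f x * prim k x)"
      using prim_by_parts[OF Linf_integrable[OF f] k(1)] k by (simp add: L2_inner_def)
    also have "\<dots> = L2_inner f w" unfolding L2_inner_def[symmetric]
      by (rule L2_inner_cong) (use w f prim_Linf[OF k(1)] in \<open>auto simp: ac0_def intro: Linf_measurable elim: eventually_mono\<close>)
    finally show ?thesis .
  qed
  then show ?thesis using bvp_ac0(3)[OF u pf] by (auto simp: is_sol_def)
qed

lemma is_sol_unique:
  assumes W: "W \<subseteq> H10" "\<And>v w. v \<in> W \<Longrightarrow> w \<in> W \<Longrightarrow> (\<lambda>x. v x - w x) \<in> W"
    and u: "is_sol W f u" and u': "is_sol W f u'"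
  shows "AE x in lebO. u x = u' x"
proof -
  have H: "u \<in> H10" "u' \<in> H10" using u u' W by (auto simp: is_sol_def)
  have e: "(\<lambda>x. u x - u' x) \<in> W" using u u' W(2) by (auto simp: is_sol_def)
  then have "bform a d\<^sub>0 (\<lambda>x. u x - u' x) (\<lambda>x. u x - u' x) = 0"
    using bform_diff[OF H, of "\<lambda>x. u x - u' x"] u u' W(1) by (auto simp: is_sol_def)
  then have "AE x in lebO. u x - u' x = 0"
    using bform_pos[of "\<lambda>x. u x - u' x"] e W(1) by auto
  then show ?thesis by simp
qed

end

section \<open>Finite elements\<close>

subsection \<open>Partitions and step functions\<close>

lemma partition_props:
  assumes "is_partition l x"
  shows partition_ends: "x 0 = 0" "x l = 1" "1 < l"
    and partition_step: "i \<in> {1..l} \<Longrightarrow> x (i - 1) < x i"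
  using assms by (auto simp: is_partition_def)

lemma partition_mono:
  assumes p: "is_partition l x" and "i < j" "j \<le> l" shows "x i < x j"
  using assms(2,3)
proof (induction j)
  case (Suc j)
  have "x j < x (Suc j)" using partition_step[OF p, of "Suc j"] Suc by auto
  moreover have "i = j \<or> x i < x j" using Suc by (cases "i = j") auto
  ultimately show ?case by auto
qed simp

lemma partition_mono_le: "is_partition l x \<Longrightarrow> i \<le> j \<Longrightarrow> j \<le> l \<Longrightarrow> x i \<le> x j"
  using partition_mono[of l x i j] by (cases "i = j") auto

lemma partition_range: assumes "is_partition l x" "i \<le> l" shows "x i \<in> {0..1}"
  using partition_mono_le[OF assms(1), of 0 i] partition_mono_le[OF assms(1), of i l] assms partition_ends[OF assms(1)]
  by auto

lemma partition_piece:
  assumes "is_partition l x" "i \<in> {1..l}"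
  shows "0 \<le> x (i - 1)" "x (i - 1) < x i" "x i \<le> 1" "i - 1 \<le> l"
proof -
  show "i - 1 \<le> l" using assms(2) by auto
  then show "0 \<le> x (i - 1)" "x i \<le> 1"
    using partition_range[OF assms(1), of "i - 1"] partition_range[OF assms(1), of i] assms(2) by auto
  show "x (i - 1) < x i" by (rule partition_step[OF assms])
qed

lemma partition_cover:
  assumes p: "is_partition l x" and t: "t \<in> {0..1}"
  obtains i where "i \<in> {1..l}" "t \<in> {x (i - 1)..x i}"
proof -
  have "\<exists>i\<in>{1..k}. t \<in> {x (i - 1)..x i}" if "1 \<le> k" "k \<le> l" "t \<le> x k" for k
    using that
  proof (induction k rule: nat_induct_at_least)
    case base
    then show ?case using t partition_ends[OF p] by auto
  next
    case (Suc k)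
    show ?case
    proof (cases "t \<le> x k")
      case True
      then have "\<exists>i\<in>{1..k}. t \<in> {x (i - 1)..x i}" using Suc by auto
      then show ?thesis by force
    next
      case False
      then show ?thesis using Suc by (intro bexI[of _ "Suc k"]) auto
    qed
  qed
  from this[of l] show thesis using that t partition_ends[OF p] by auto
qed

lemma mesh_width_ge: assumes "i \<in> {1..l}" shows "x i - x (i - 1) \<le> mesh_width l x"
  unfolding mesh_width_def by (rule Max_ge) (use assms in auto)

lemma mesh_width_pos: assumes "is_partition l x" shows "0 < mesh_width l x"
proof -
  have "1 \<in> {1..l}" using partition_ends[OF assms] by auto
  then show ?thesis using mesh_width_ge[of 1 l x] partition_step[OF assms, of 1] by force
qed

lemma mesh_width_le_1: assumes p: "is_partition l x" shows "mesh_width l x \<le> 1"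
  unfolding mesh_width_def
proof (rule Max.boundedI)
  fix h assume "h \<in> (\<lambda>i. x i - x (i - 1)) ` {1..l}"
  then obtain i where "i \<in> {1..l}" "h = x i - x (i - 1)" by blast
  then show "h \<le> 1" using partition_piece[OF p, of i] by linarith
qed (use partition_ends[OF p] in auto)

definition step_fun :: "nat \<Rightarrow> (nat \<Rightarrow> real) \<Rightarrow> (nat \<Rightarrow> real) \<Rightarrow> real \<Rightarrow> real"
  where "step_fun l x c t = (\<Sum>i\<in>{1..l}. c i * indicator {x (i - 1)<..<x i} t)"

lemma partition_pieces_disjoint:
  assumes p: "is_partition l x" and "i \<in> {1..l}" "j \<in> {1..l}" "t \<in> {x (i - 1)<..<x i}" "t \<in> {x (j - 1)<..<x j}"
  shows "i = j"
proof (rule ccontr)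
  assume "i \<noteq> j"
  then consider "i < j" | "j < i" by linarith
  then show False
  proof cases
    case 1
    then have "i \<le> j - 1" "j - 1 \<le> l" using assms by auto
    then show False using partition_mono_le[OF p, of i "j - 1"] assms(4,5) by fastforce
  next
    case 2
    then have "j \<le> i - 1" "i - 1 \<le> l" using assms by auto
    then show False using partition_mono_le[OF p, of j "i - 1"] assms(4,5) by fastforce
  qed
qed

lemma step_fun_piece:
  assumes p: "is_partition l x" and i: "i \<in> {1..l}" and t: "t \<in> {x (i - 1)<..<x i}"
  shows "step_fun l x c t = c i"
proof -
  have "step_fun l x c t = (\<Sum>j\<in>{i}. c j * indicator {x (j - 1)<..<x j} t)"
    unfolding step_fun_def
  proof (rule sum.mono_neutral_right)
    show "\<forall>j\<in>{1..l} - {i}. c j * indicator {x (j - 1)<..<x j} t = 0"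
      using partition_pieces_disjoint[OF p i _ t] by (auto simp: indicator_def)
  qed (use i in auto)
  then show ?thesis using t by (simp del: sum_mult_indicator)
qed

lemma step_fun_Linf: "step_fun l x c \<in> Linf"
proof -
  have "(\<lambda>t. \<Sum>i\<in>I. c i * indicator {x (i - 1)<..<x i} t) \<in> Linf" if "finite I" for I
    using that
  proof (induction I rule: finite_induct)
    case (insert i I)
    have "indicat_real {x (i - 1)<..<x i} \<in> Linf"
      by (rule LinfI[of _ 1]) (auto simp: indicator_def intro!: lebO_measurable_borel)
    then show ?case unfolding sum.insert[OF insert(1,2)] by (intro Linf_add Linf_cmult insert)
  qed simp
  from this[OF finite_atLeastAtMost] show ?thesis unfolding step_fun_def[abs_def] .
qed

lemma step_fun_integral:
  assumes p: "is_partition l x" and i: "i \<in> {1..l}" and st: "x (i - 1) \<le> s" "s \<le> t" "t \<le> x i"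
  shows "prim (step_fun l x c) t - prim (step_fun l x c) s = c i * (t - s)"
proof -
  have "0 \<le> s" "t \<le> 1" using partition_piece[OF p i] st by linarith+
  then have "prim (step_fun l x c) t - prim (step_fun l x c) s = integral {s..t} (step_fun l x c)"
    by (intro prim_diff Linf_integrable step_fun_Linf st)
  also have "\<dots> = integral {s..t} (\<lambda>_. c i)"
    by (rule integral_spike[of "{x (i - 1), x i}"]) (use step_fun_piece[OF p i] st in auto)
  finally show ?thesis using st by simp
qed

definition slopes :: "(nat \<Rightarrow> real) \<Rightarrow> (nat \<Rightarrow> real) \<Rightarrow> nat \<Rightarrow> real"
  where "slopes x y i = (y i - y (i - 1)) / (x i - x (i - 1))"

text \<open>The piecewise affine interpolant, as the primitive of its slopes. It starts at \<open>0\<close>, so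
  it takes the nodal values \<open>y\<close> if \<open>y 0 = 0\<close>.\<close>

definition interp :: "nat \<Rightarrow> (nat \<Rightarrow> real) \<Rightarrow> (nat \<Rightarrow> real) \<Rightarrow> real \<Rightarrow> real"
  where "interp l x y = prim (step_fun l x (slopes x y))"

lemma interp_node:
  assumes p: "is_partition l x" and y0: "y 0 = 0" and i: "i \<le> l"
  shows "interp l x y (x i) = y i"
  using i
proof (induction i)
  case 0
  then show ?case using partition_ends[OF p] y0 by (simp add: interp_def)
next
  case (Suc i)
  have i: "Suc i \<in> {1..l}" using Suc by auto
  have lt: "x i < x (Suc i)" using partition_step[OF p i] by simp
  have "interp l x y (x (Suc i)) - interp l x y (x i) = slopes x y (Suc i) * (x (Suc i) - x i)"
    unfolding interp_def by (rule step_fun_integral[OF p i]) (use lt in auto)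
  then show ?case using Suc lt by (simp add: slopes_def)
qed

lemma interp_affine:
  assumes p: "is_partition l x" and y0: "y 0 = 0" and i: "i \<in> {1..l}" and t: "t \<in> {x (i - 1)..x i}"
  shows "interp l x y t = y (i - 1) + slopes x y i * (t - x (i - 1))"
proof -
  have "interp l x y t - interp l x y (x (i - 1)) = slopes x y i * (t - x (i - 1))"
    unfolding interp_def by (rule step_fun_integral[OF p i]) (use t in auto)
  moreover have "interp l x y (x (i - 1)) = y (i - 1)" by (rule interp_node[where y=y, OF p y0]) (use i in auto)
  ultimately show ?thesis by simp
qed

lemma interp_continuous: "continuous_on {0..1} (interp l x y)"
  unfolding interp_def by (intro prim_continuous Linf_integrable step_fun_Linf)

lemma interp_FE:
  assumes p: "is_partition l x" and y: "y 0 = 0" "y l = 0"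
  shows "interp l x y \<in> FE_space l x"
proof -
  have "\<exists>b c. \<forall>t\<in>{x (i - 1)<..<x i}. interp l x y t = b * t + c" if "i \<in> {1..l}" for i
  proof (intro exI ballI)
    fix t assume "t \<in> {x (i - 1)<..<x i}"
    then have "interp l x y t = y (i - 1) + slopes x y i * (t - x (i - 1))"
      by (intro interp_affine[where y=y, OF p y(1) that]) auto
    then show "interp l x y t = slopes x y i * t + (y (i - 1) - slopes x y i * x (i - 1))"
      by (simp add: right_diff_distrib)
  qed
  moreover have "interp l x y 0 = 0" "interp l x y 1 = 0"
    using interp_node[where y=y, OF p y(1), of 0] interp_node[where y=y, OF p y(1), of l] y partition_ends[OF p] by auto
  ultimately show ?thesis by (auto simp: FE_space_def interp_continuous)
qed

lemma interp_ac0: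
  assumes p: "is_partition l x" and y: "y 0 = 0" "y l = 0"
  shows "ac0 (interp l x y) (step_fun l x (slopes x y))"
proof -
  have "prim (step_fun l x (slopes x y)) 1 = 0"
    using interp_node[where y=y, OF p y(1), of l] y partition_ends[OF p] by (simp add: interp_def)
  then show ?thesis
    by (auto simp: ac0_def interp_def[abs_def] intro!: Linf_L2 step_fun_Linf Linf_measurable[OF prim_Linf] Linf_integrable)
qed

lemma FE_affine:
  assumes p: "is_partition l x" and v: "v \<in> FE_space l x" and i: "i \<in> {1..l}"
  obtains b c where "\<forall>t\<in>{x (i - 1)..x i}. v t = b * t + c"
proof -
  obtain b c where bc: "\<forall>t\<in>{x (i - 1)<..<x i}. v t = b * t + c"
    using v i unfolding FE_space_def by blast
  have lt: "x (i - 1) < x i" using partition_step[OF p i] .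
  have cl: "closure {x (i - 1)<..<x i} = {x (i - 1)..x i}" using lt by (rule closure_greaterThanLessThan)
  have sub: "{x (i - 1)..x i} \<subseteq> {0..1}"
    using partition_piece[OF p i] by auto
  have cont: "continuous_on {x (i - 1)..x i} (\<lambda>t. v t - (b * t + c))"
    by (intro continuous_intros continuous_on_subset[OF _ sub]) (use v in \<open>auto simp: FE_space_def\<close>)
  have "v t = b * t + c" if "t \<in> {x (i - 1)..x i}" for t
    using continuous_constant_on_closure[of "{x (i - 1)<..<x i}" "\<lambda>t. v t - (b * t + c)" 0 t] cont bc that
    unfolding cl by auto
  then show thesis by (blast intro: that)
qed

lemma FE_eq_interp:
  assumes p: "is_partition l x" and v: "v \<in> FE_space l x" and t: "t \<in> {0..1}"
  shows "v t = interp l x (\<lambda>i. v (x i)) t"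
proof -
  obtain i where i: "i \<in> {1..l}" "t \<in> {x (i - 1)..x i}" using partition_cover[OF p t] .
  obtain b c where "\<forall>t\<in>{x (i - 1)..x i}. v t = b * t + c" using FE_affine[OF p v i(1)] .
  note bc = bspec[OF this]
  have lt: "x (i - 1) < x i" using partition_step[OF p i(1)] .
  have "slopes x (\<lambda>i. v (x i)) i = b"
    using bc[of "x i"] bc[of "x (i - 1)"] lt by (simp add: slopes_def right_diff_distrib[symmetric])
  moreover have "v (x 0) = 0" using v partition_ends[OF p] by (simp add: FE_space_def)
  ultimately show ?thesis
    using interp_affine[OF p _ i, of "\<lambda>i. v (x i)"] bc[OF i(2)] bc[of "x (i - 1)"] lt
    by (simp add: right_diff_distrib)
qed

lemma FE_ends: assumes "is_partition l x" "v \<in> FE_space l x" shows "v (x 0) = 0" "v (x l) = 0"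
  using assms partition_ends[OF assms(1)] by (auto simp: FE_space_def)

lemma FE_ac0:
  assumes p: "is_partition l x" and v: "v \<in> FE_space l x"
  shows "ac0 v (step_fun l x (slopes x (\<lambda>i. v (x i))))"
  using interp_ac0[where y="\<lambda>i. v (x i)", OF p FE_ends[OF p v]] FE_eq_interp[OF p v] v
  unfolding ac0_def interp_def
  by (auto simp: FE_space_def intro!: AE_lebO_I Linf_measurable[OF Linf_continuous])

lemma FE_H10: "is_partition l x \<Longrightarrow> FE_space l x \<subseteq> H10"
  using ac0_H10[OF FE_ac0 step_fun_Linf] by blast

lemma FE_add: assumes "v \<in> FE_space l x" "w \<in> FE_space l x" shows "(\<lambda>t. v t + w t) \<in> FE_space l x"
proof -
  have "\<exists>b c. \<forall>t\<in>{x (i - 1)<..<x i}. v t + w t = b * t + c" if i: "i \<in> {1..l}" for i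
  proof -
    obtain b c where 1: "\<forall>t\<in>{x (i - 1)<..<x i}. v t = b * t + c" using assms(1) i unfolding FE_space_def by blast
    obtain b' c' where 2: "\<forall>t\<in>{x (i - 1)<..<x i}. w t = b' * t + c'" using assms(2) i unfolding FE_space_def by blast
    have "\<forall>t\<in>{x (i - 1)<..<x i}. v t + w t = (b + b') * t + (c + c')" using 1 2 by (simp add: distrib_right)
    then show ?thesis by blast
  qed
  then show ?thesis using assms by (auto simp: FE_space_def intro: continuous_on_add)
qed

lemma FE_cmult: assumes "v \<in> FE_space l x" shows "(\<lambda>t. s * v t) \<in> FE_space l x"
proof -
  have "\<exists>b c. \<forall>t\<in>{x (i - 1)<..<x i}. s * v t = b * t + c" if i: "i \<in> {1..l}" for i
  proof -
    obtain b c where 1: "\<forall>t\<in>{x (i - 1)<..<x i}. v t = b * t + c" using assms i unfolding FE_space_def by blast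
    have "\<forall>t\<in>{x (i - 1)<..<x i}. s * v t = (s * b) * t + (s * c)" using 1 by (simp add: distrib_left mult.assoc)
    then show ?thesis by blast
  qed
  then show ?thesis using assms by (auto simp: FE_space_def intro: continuous_on_mult continuous_on_const)
qed

lemma FE_diff: assumes "v \<in> FE_space l x" "w \<in> FE_space l x" shows "(\<lambda>t. v t - w t) \<in> FE_space l x"
  using FE_add[OF assms(1) FE_cmult[OF assms(2), of "-1"]] by simp

lemma FE_nodal_max:
  assumes p: "is_partition l x" and w: "w \<in> FE_space l x" and m: "\<And>i. i \<le> l \<Longrightarrow> \<bar>w (x i)\<bar> \<le> m" and t: "t \<in> {0..1}"
  shows "\<bar>w t\<bar> \<le> m"
proof -
  obtain i where i: "i \<in> {1..l}" "t \<in> {x (i - 1)..x i}" using partition_cover[OF p t] .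
  obtain b c where "\<forall>t\<in>{x (i - 1)..x i}. w t = b * t + c" using FE_affine[OF p w i(1)] .
  note bc = bspec[OF this]
  have "\<bar>b * x i + c\<bar> \<le> m" "\<bar>b * x (i - 1) + c\<bar> \<le> m"
    using m[of i] m[of "i - 1"] bc[of "x i"] bc[of "x (i - 1)"] i partition_piece[OF p i(1)] by auto
  moreover have "b * t \<le> max (b * x i) (b * x (i - 1))" "min (b * x i) (b * x (i - 1)) \<le> b * t"
    using i(2) by (cases "b \<ge> 0"; auto simp: le_max_iff_disj min_le_iff_disj mult_left_mono mult_left_mono_neg)+
  ultimately show ?thesis using bc[OF i(2)] by (auto simp: max_def min_def split: if_splits)
qed

text \<open>Interpolation error for functions whose derivative is Lipschitz continuous on each element:
  the slope of the interpolant is a mean of the derivative. Jumps of the derivative at the nodes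
  are allowed, as they occur in Green's functions.\<close>

lemma interp_error:
  assumes p: "is_partition l x" and g: "g \<in> Linf" and v: "\<And>t. t \<in> {0..1} \<Longrightarrow> v t = prim g t" "v 1 = 0"
    and \<Lambda>: "\<Lambda> \<ge> 0" and lip: "\<And>i s t. i \<in> {1..l} \<Longrightarrow> s \<in> {x (i - 1)<..<x i} \<Longrightarrow> t \<in> {x (i - 1)<..<x i} \<Longrightarrow> s \<le> t \<Longrightarrow>
        \<bar>g t - g s\<bar> \<le> \<Lambda> * (t - s)"
  defines "y \<equiv> \<lambda>i. v (x i)" and "h \<equiv> mesh_width l x"
  shows "AE t in lebO. \<bar>g t - step_fun l x (slopes x y) t\<bar> \<le> \<Lambda> * h"
    and "t \<in> {0..1} \<Longrightarrow> \<bar>v t - interp l x y t\<bar> \<le> \<Lambda> * h\<^sup>2"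
proof -
  have gi: "integrable lebO g" by (rule Linf_integrable[OF g])
  have y0: "y 0 = 0" using v(1)[of 0] partition_ends[OF p] by (simp add: y_def)
  have piece: "\<bar>g t - step_fun l x (slopes x y) t\<bar> \<le> \<Lambda> * h" if i: "i \<in> {1..l}" and t: "t \<in> {x (i - 1)<..<x i}" for i t
  proof -
    define k where "k = x i - x (i - 1)"
    have k: "k > 0" "k \<le> h" using partition_step[OF p i] mesh_width_ge[OF i, of x] by (auto simp: k_def h_def)
    have r: "x (i - 1) \<in> {0..1}" "x i \<in> {0..1}" using partition_range[OF p] i by auto
    have gi': "g integrable_on {x (i - 1)..x i}" by (rule lebO_int_on[OF gi]) (use r in auto)
    have "norm (integral {x (i - 1)..x i} g - g t * k) \<le> (\<Lambda> * k) * measure lborel {x (i - 1)..x i}"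
    proof (rule has_integral_bound_real[where S="{x (i - 1), x i}" and f="\<lambda>s. g s - g t"])
      have "((\<lambda>s. g s - g t) has_integral (integral {x (i - 1)..x i} g - (x i - x (i - 1)) *\<^sub>R g t)) {x (i - 1)..x i}"
        using has_integral_const_real[of "g t" "x (i - 1)" "x i"] k
        by (intro has_integral_diff integrable_integral gi') (simp add: k_def)
      then show "((\<lambda>s. g s - g t) has_integral (integral {x (i - 1)..x i} g - g t * k)) {x (i - 1)..x i}"
        by (simp add: k_def mult.commute)
      fix s assume s: "s \<in> {x (i - 1)..x i} - {x (i - 1), x i}"
      have "\<bar>g s - g t\<bar> \<le> \<Lambda> * \<bar>s - t\<bar>"
        using lip[OF i, of s t] lip[OF i, of t s] s t by (cases "s \<le> t") (auto simp: abs_minus_commute)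
      also have "\<dots> \<le> \<Lambda> * k" using s t \<Lambda> by (intro mult_left_mono) (auto simp: k_def)
      finally show "norm (g s - g t) \<le> \<Lambda> * k" by simp
    qed (use \<Lambda> k in auto)
    moreover have "integral {x (i - 1)..x i} g = y i - y (i - 1)"
      using prim_diff[OF gi, of "x (i - 1)" "x i"] v(1) r k by (simp add: y_def k_def)
    ultimately have "\<bar>(y i - y (i - 1)) - g t * k\<bar> \<le> \<Lambda> * k * k" using k by (simp add: k_def)
    then have "\<bar>(y i - y (i - 1)) - g t * k\<bar> / k \<le> \<Lambda> * k" using k by (simp add: pos_divide_le_eq)
    then have *: "\<bar>((y i - y (i - 1)) - g t * k) / k\<bar> \<le> \<Lambda> * k"
      unfolding abs_divide abs_of_pos[OF k(1)] .
    have eq: "((y i - y (i - 1)) - g t * k) / k = slopes x y i - g t"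
      using k by (simp add: slopes_def k_def diff_divide_distrib)
    have "\<bar>slopes x y i - g t\<bar> \<le> \<Lambda> * k" using * unfolding eq .
    also have "\<dots> \<le> \<Lambda> * h" using k \<Lambda> by (intro mult_left_mono)
    finally show ?thesis using step_fun_piece[OF p i t] by (simp add: abs_minus_commute)
  qed
  show ae: "AE t in lebO. \<bar>g t - step_fun l x (slopes x y) t\<bar> \<le> \<Lambda> * h"
    using lebO_ae_finite[OF finite_imageI[OF finite_atMost, of x l]] AE_space
  proof eventually_elim
    case (elim t)
    then have t: "t \<in> {0..1}" by auto
    obtain i where i: "i \<in> {1..l}" "t \<in> {x (i - 1)..x i}" using partition_cover[OF p t] .
    then have "t \<noteq> x i" "t \<noteq> x (i - 1)" using elim by auto
    then show ?case using i by (intro piece[OF i(1)]) auto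
  qed
  show "\<bar>v t - interp l x y t\<bar> \<le> \<Lambda> * h\<^sup>2" if t: "t \<in> {0..1}"
  proof -
    obtain i where i: "i \<in> {1..l}" "t \<in> {x (i - 1)..x i}" using partition_cover[OF p t] .
    define e where "e s = g s - step_fun l x (slopes x y) s" for s
    have r: "x (i - 1) \<in> {0..1}" "i - 1 \<le> l" using partition_range[OF p, of "i - 1"] i by auto
    have es: "prim e s = v s - interp l x y s" if "s \<in> {0..1}" for s
      using prim_minus[OF gi Linf_integrable[OF step_fun_Linf], of s] that v(1)[OF that]
      by (simp add: e_def[abs_def] interp_def)
    have "prim e (x (i - 1)) = 0"
      using es[OF r(1)] interp_node[where y=y, OF p y0 r(2)] by (simp add: y_def)
    then have "v t - interp l x y t = prim e t - prim e (x (i - 1))" using es[OF t] by simp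
    also have "\<bar>\<dots>\<bar> \<le> (\<Lambda> * h) * (t - x (i - 1))"
      by (rule prim_Lipschitz) (use ae g step_fun_Linf r i t in \<open>auto simp: e_def[abs_def] intro!: Linf_measurable Linf_diff\<close>)
    also have "\<dots> \<le> (\<Lambda> * h) * h"
      using mesh_width_ge[OF i(1), of x] i(2) \<Lambda> mesh_width_pos[OF p] by (intro mult_left_mono) (auto simp: h_def)
    finally show ?thesis by (simp add: power2_eq_square mult.assoc)
  qed
qed

subsection \<open>Galerkin solutions\<close>

context elliptic
begin

text \<open>Existence by adding one node at a time: a nodal basis function is made orthogonal to the span of the
  preceding ones, and the solution is updated along it.\<close>

lemma Galerkin_exists:
  assumes p: "is_partition l x" and k: "k < l"
    and add: "\<And>v w. v \<in> FE_space l x \<Longrightarrow> w \<in> FE_space l x \<Longrightarrow> F (\<lambda>t. v t + w t) = F v + F w"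
    and cmult: "\<And>c v. v \<in> FE_space l x \<Longrightarrow> F (\<lambda>t. c * v t) = c * F v"
    and zero: "\<And>v. v \<in> FE_space l x \<Longrightarrow> (\<And>t. t \<in> {0..1} \<Longrightarrow> v t = 0) \<Longrightarrow> F v = (0::real)"
  defines "W \<equiv> \<lambda>k. {v \<in> FE_space l x. \<forall>j. k < j \<and> j \<le> l \<longrightarrow> v (x j) = 0}"
  shows "\<exists>u\<in>W k. \<forall>w\<in>W k. bform a d\<^sub>0 u w = F w"
  using k add cmult zero
proof (induction k arbitrary: F)
  case 0
  note zero = 0(4) and cmult = 0(3)
  have p0: "(\<lambda>t. 0) \<in> FE_space l x" by (auto simp: FE_space_def intro: exI[of _ 0])
  have "bform a d\<^sub>0 (\<lambda>t. 0) w = F w" if w: "w \<in> W 0" for w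
  proof -
    have wF: "w \<in> FE_space l x" using w by (simp add: W_def)
    have "w (x i) = 0" if "i \<le> l" for i
      using w that FE_ends[OF p wF] by (cases "i = 0") (auto simp: W_def)
    then have "F w = 0" using FE_nodal_max[OF p wF, of 0] by (intro zero[OF wF]) auto
    moreover have "bform a d\<^sub>0 (\<lambda>t. 0 * w t) w = 0 * bform a d\<^sub>0 w w"
      using bform_cmult[of w w w] FE_H10[OF p] wF by blast
    ultimately show ?thesis by simp
  qed
  then show ?case using p0 by (intro bexI[of _ "\<lambda>t. 0"]) (auto simp: W_def)
next
  case (Suc k)
  note add = Suc.prems(2) and cmult = Suc.prems(3) and zero = Suc.prems(4)
  note H = subsetD[OF FE_H10[OF p]]
  have WF: "v \<in> FE_space l x" if "v \<in> W j" for v j using that by (simp add: W_def)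
  have Wmono: "W k \<subseteq> W (Suc k)" by (auto simp: W_def)
  have Wadd: "(\<lambda>t. v t + w t) \<in> W j" if "v \<in> W j" "w \<in> W j" for v w j using that by (auto simp: W_def FE_add)
  have Wdiff: "(\<lambda>t. v t - w t) \<in> W j" if "v \<in> W j" "w \<in> W j" for v w j using that by (auto simp: W_def FE_diff)
  have Wcmult: "(\<lambda>t. c * v t) \<in> W j" if "v \<in> W j" for v c j using that by (auto simp: W_def FE_cmult)
  define y where "y i = (if i = Suc k then 1 else 0 :: real)" for i
  have y: "y 0 = 0" "y l = 0" using Suc.prems(1) by (auto simp: y_def)
  define w0 where "w0 = interp l x y"
  have w0F: "w0 \<in> FE_space l x" unfolding w0_def by (rule interp_FE[where y=y, OF p y])
  have w0n: "w0 (x i) = y i" if "i \<le> l" for i unfolding w0_def by (rule interp_node[where y=y, OF p y(1) that])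
  have w0W: "w0 \<in> W (Suc k)" using w0F w0n by (auto simp: W_def y_def)
  have "\<exists>r\<in>W k. \<forall>w\<in>W k. bform a d\<^sub>0 r w = bform a d\<^sub>0 w0 w"
  proof (rule Suc.IH)
    fix v assume v: "v \<in> FE_space l x" and v0: "\<And>t. t \<in> {0..1} \<Longrightarrow> v t = 0"
    have "bform a d\<^sub>0 v w0 = 0"
    proof -
      have e: "AE t in lebO. v t = 0" by (rule AE_lebO_I) (use v0 in auto)
      obtain g where g: "ac0 v g" using H10_ac0[OF H[OF v]] .
      have z: "ac0 (\<lambda>t. 0 * v t) (\<lambda>t. 0 * g t)" by (rule ac0_cmult[OF g])
      have "AE t in lebO. g t = 0 * g t" using ac0_unique[OF g z] e by simp
      then have "AE t in lebO. g t = 0" by simp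
      then have "ac0 v (\<lambda>t. 0 * g t)" using z e g by (auto simp: ac0_def prim_cmult elim: eventually_mono)
      obtain g0 where g0: "ac0 w0 g0" using H10_ac0[OF H[OF w0F]] .
      have "bform a d\<^sub>0 v w0 = form v (\<lambda>t. 0 * g t) w0 g0" by (rule bform_eq) fact+
      moreover have "L2_inner (\<lambda>x. d\<^sub>0 x * v x) w0 = (LINT t|lebO. 0)"
        unfolding L2_inner_def
        by (rule integral_cong_AE)
          (use e Linf_measurable[OF ac0_Linf[OF g]] Linf_measurable[OF ac0_Linf[OF g0]] d0_measurable in \<open>auto elim: eventually_mono\<close>)
      ultimately show ?thesis by (simp add: form_def L2_inner_def)
    qed
    then show "bform a d\<^sub>0 w0 v = 0" using bform_commute[OF H[OF v] H[OF v] H[OF w0F]] by simp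
  next
    show "k < l" using Suc.prems(1) by simp
  next
    fix v w assume vw: "v \<in> FE_space l x" "w \<in> FE_space l x"
    show "bform a d\<^sub>0 w0 (\<lambda>t. v t + w t) = bform a d\<^sub>0 w0 v + bform a d\<^sub>0 w0 w"
      using bform_add[OF H[OF vw(1)] H[OF vw(2)] H[OF w0F]]
        bform_commute[OF H[OF w0F] H[OF w0F] H[OF FE_add[OF vw]]]
        bform_commute[OF H[OF w0F] H[OF w0F] H[OF vw(1)]] bform_commute[OF H[OF w0F] H[OF w0F] H[OF vw(2)]] by simp
  next
    fix c v assume v: "v \<in> FE_space l x"
    show "bform a d\<^sub>0 w0 (\<lambda>t. c * v t) = c * bform a d\<^sub>0 w0 v"
      using bform_cmult[OF H[OF v] H[OF v] H[OF w0F]]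
        bform_commute[OF H[OF w0F] H[OF w0F] H[OF FE_cmult[OF v]]]
        bform_commute[OF H[OF w0F] H[OF w0F] H[OF v]] by simp
  qed
  then obtain r where r: "r \<in> W k" "\<And>w. w \<in> W k \<Longrightarrow> bform a d\<^sub>0 r w = bform a d\<^sub>0 w0 w" by blast
  define w1 where "w1 t = w0 t - r t" for t
  have w1W: "w1 \<in> W (Suc k)" unfolding w1_def[abs_def] using w0W r(1) Wmono by (intro Wdiff) auto
  note w1H = H[OF WF[OF w1W]]
  have w1n: "w1 (x (Suc k)) = 1" using w0n[of "Suc k"] r(1) Suc.prems(1) by (simp add: w1_def y_def W_def)
  have orth: "bform a d\<^sub>0 w1 w = 0" if "w \<in> W k" for w
    unfolding w1_def[abs_def] using bform_diff[OF H[OF w0F] H[OF WF[OF r(1)]] H[OF WF[OF that]]] r(2)[OF that] by simp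
  have pos: "bform a d\<^sub>0 w1 w1 \<noteq> 0"
  proof
    assume "bform a d\<^sub>0 w1 w1 = 0"
    then have "AE t in lebO. w1 t = 0" by (intro bform_pos[OF w1H]) simp
    moreover have "continuous_on {0..1} w1" using WF[OF w1W] by (simp add: FE_space_def)
    moreover have "x (Suc k) \<in> {0..1}" by (rule partition_range[OF p]) (use Suc.prems(1) in simp)
    ultimately have "w1 (x (Suc k)) = 0"
      by (intro lebO_ae_eq_continuous[of w1 "\<lambda>_. 0" "x (Suc k)"] continuous_on_const)
    then show False using w1n by simp
  qed
  have "\<exists>u\<in>W k. \<forall>w\<in>W k. bform a d\<^sub>0 u w = F w"
    by (rule Suc.IH[of F, OF Suc_lessD[OF Suc.prems(1)] add cmult zero])
  then obtain u0 where u0: "u0 \<in> W k" "\<And>w. w \<in> W k \<Longrightarrow> bform a d\<^sub>0 u0 w = F w" by blast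
  note u0H = H[OF WF[OF u0(1)]]
  define t0 where "t0 = F w1 / bform a d\<^sub>0 w1 w1"
  define u where "u t = u0 t + t0 * w1 t" for t
  have uW: "u \<in> W (Suc k)" unfolding u_def[abs_def] using u0(1) Wmono w1W by (intro Wadd Wcmult) auto
  have "bform a d\<^sub>0 u w = F w" if w: "w \<in> W (Suc k)" for w
  proof -
    define s where "s = w (x (Suc k))"
    define w' where "w' t = w t - s * w1 t" for t
    have w'W: "w' \<in> W k"
    proof -
      have "w' \<in> W (Suc k)" unfolding w'_def[abs_def] by (intro Wdiff Wcmult w w1W)
      moreover have "w' (x (Suc k)) = 0" by (simp add: w'_def s_def w1n)
      moreover have "w' (x j) = 0" if "k < j" "j \<le> l" for j
        using that calculation by (cases "j = Suc k") (auto simp: W_def)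
      ultimately show ?thesis by (auto simp: W_def)
    qed
    note w'H = H[OF WF[OF w'W]] and sH = H[OF FE_cmult[OF WF[OF w1W]], of s]
    note tH = H[OF FE_cmult[OF WF[OF w1W]], of t0] and uH = H[OF WF[OF uW]]
    have weq: "w = (\<lambda>t. w' t + s * w1 t)" by (simp add: w'_def)
    have B1: "bform a d\<^sub>0 u v = bform a d\<^sub>0 u0 v + t0 * bform a d\<^sub>0 w1 v" if "v \<in> H10" for v
      unfolding u_def[abs_def] using bform_add[OF u0H tH that] bform_cmult[OF w1H w1H that] by simp
    have "bform a d\<^sub>0 u w = bform a d\<^sub>0 w u" using bform_commute[OF uH uH H[OF WF[OF w]]] by simp
    also have "\<dots> = bform a d\<^sub>0 w' u + s * bform a d\<^sub>0 w1 u"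
      unfolding weq using bform_add[OF w'H sH uH] bform_cmult[OF w1H w1H uH] by simp
    also have "bform a d\<^sub>0 w' u = F w'"
      using bform_commute[OF w'H w'H uH] B1[OF w'H] u0(2)[OF w'W] orth[OF w'W] by simp
    also have "bform a d\<^sub>0 w1 u = F w1"
      using bform_commute[OF w1H w1H uH] B1[OF w1H] bform_commute[OF u0H u0H w1H] orth[OF u0(1)] pos by (simp add: t0_def)
    also have "F w' + s * F w1 = F w"
      unfolding weq using add[OF WF[OF w'W] FE_cmult[OF WF[OF w1W]]] cmult[OF WF[OF w1W]] by simp
    finally show ?thesis .
  qed
  then show ?case using uW by blast
qed

lemma FE_sol_exists:
  assumes p: "is_partition l x" and f: "f \<in> Linf" obtains u where "is_sol (FE_space l x) f u"
proof -
  have L: "v \<in> L2" if "v \<in> FE_space l x" for v using ac0_L2[OF FE_ac0[OF p that]] .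
  have l: "l - 1 < l" using partition_ends[OF p] by simp
  have "\<exists>u\<in>{v \<in> FE_space l x. \<forall>j. l - 1 < j \<and> j \<le> l \<longrightarrow> v (x j) = 0}.
      \<forall>w\<in>{v \<in> FE_space l x. \<forall>j. l - 1 < j \<and> j \<le> l \<longrightarrow> v (x j) = 0}. bform a d\<^sub>0 u w = L2_inner f w"
  proof (rule Galerkin_exists[OF p l])
    fix v assume v: "v \<in> FE_space l x" "\<And>t. t \<in> {0..1} \<Longrightarrow> v t = 0"
    have "L2_inner f v = (LINT t|lebO. 0)" unfolding L2_inner_def
      by (rule Bochner_Integration.integral_cong) (use v in auto)
    then show "L2_inner f v = 0" by simp
  qed (use L Linf_L2[OF f] in \<open>auto simp: L2_inner_add_right L2_inner_cmult_right\<close>)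
  moreover have "{v \<in> FE_space l x. \<forall>j. l - 1 < j \<and> j \<le> l \<longrightarrow> v (x j) = 0} = FE_space l x"
  proof -
    have "j = l" if "l - 1 < j" "j \<le> l" for j using that by auto
    then show ?thesis using FE_ends[OF p] by blast
  qed
  ultimately have "\<exists>u\<in>FE_space l x. \<forall>w\<in>FE_space l x. bform a d\<^sub>0 u w = L2_inner f w" by metis
  then show thesis using that by (auto simp: is_sol_def)
qed

subsection \<open>Pointwise error estimate\<close>

text \<open>The energy norm of the error is of first order by Galerkin orthogonality. At a node, the error is
  represented by Green's function, whose kink lies at this node, so that its interpolant
  is of first order as well and the orders add up. Between the nodes, the error is
  that of interpolation.\<close>

lemma FE_error:
  obtains C where "C > 0"
    "\<And>l x f F u c u\<^sub>h t. is_partition l x \<Longrightarrow> f \<in> Linf \<Longrightarrow> AE s in lebO. \<bar>f s\<bar> \<le> F \<Longrightarrow> F \<ge> 0 \<Longrightarrow>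
      bvp (\<lambda>s. - prim f s) u c \<Longrightarrow> is_sol (FE_space l x) f u\<^sub>h \<Longrightarrow> t \<in> {0..1} \<Longrightarrow>
      \<bar>u t - u\<^sub>h t\<bar> \<le> C * F * (mesh_width l x)\<^sup>2"
proof -
  obtain M where M: "M > 0" "\<And>v g w k. ac0 v g \<Longrightarrow> ac0 w k \<Longrightarrow> \<bar>form v g w k\<bar> \<le> M * norm_L2 g * norm_L2 k"
    using form_bounded by blast
  define C0 where "C0 = (D * (1 / \<nu>)) / \<nu> + 2 * (1 + D / \<nu>) * L / \<nu>\<^sup>2"
  define C1 where "C1 = 1 / \<nu> + C0"
  have C0: "C0 \<ge> 0" "C1 > 0" unfolding C1_def C0_def using nu D L_nonneg by (auto intro!: add_nonneg_nonneg add_pos_nonneg)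
  have "\<bar>u t - u\<^sub>h t\<bar> \<le> (C1 + M * M * C1 * C0 / \<nu>) * F * h\<^sup>2"
    if p: "is_partition l x" and f: "f \<in> Linf" "AE s in lebO. \<bar>f s\<bar> \<le> F" "F \<ge> 0"
      and u: "bvp (\<lambda>s. - prim f s) u c" and uh: "is_sol (FE_space l x) f u\<^sub>h" and t: "t \<in> {0..1}"
      and h_def: "h = mesh_width l x"
    for l x f F u c u\<^sub>h t h
  proof -
    have h: "h > 0" unfolding h_def by (rule mesh_width_pos[OF p])
    define R where "R s = - prim f s" for s
    have RL: "R \<in> Linf" unfolding R_def[abs_def]
      using Linf_cmult[OF prim_Linf[OF Linf_integrable[OF f(1)]], of "-1"] by simp
    have uR: "bvp R u c" using u by (simp add: R_def[abs_def])
    have R\<rho>: "\<bar>R s\<bar> \<le> F" if "s \<in> \<Omega>" for s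
    proof -
      have "\<bar>prim f s\<bar> \<le> F * s"
        by (rule prim_abs_bound) (use that f in \<open>auto intro: Linf_integrable elim: eventually_mono\<close>)
      also have "\<dots> \<le> F * 1" using that f(3) by (intro mult_left_mono) auto
      finally show ?thesis by (simp add: R_def)
    qed
    define g where "g s = flux R u c s / a s" for s
    have g: "ac0 u g" "g \<in> Linf" "u \<in> H10" using bvp_ac0[OF uR RL] by (auto simp: g_def[abs_def])
    have uc: "continuous_on {0..1} u" "u 1 = 0" "\<And>s. s \<in> {0..1} \<Longrightarrow> u s = prim g s"
      using uR by (auto simp: bvp_def g_def[abs_def])
    have pc: "0 \<le> x (i - 1)" "x i \<le> 1" if "i \<in> {1..l}" for i
      using partition_range[OF p, of "i - 1"] partition_range[OF p, of i] that by auto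
    have lipg: "\<bar>g s' - g s\<bar> \<le> C1 * F * (s' - s)"
      if i: "i \<in> {1..l}" and s: "s \<in> {x (i - 1)<..<x i}" "s' \<in> {x (i - 1)<..<x i}" "s \<le> s'" for i s s'
    proof -
      have "\<bar>g s' - g s\<bar> \<le> ((F + D * (F / \<nu>)) / \<nu> + 2 * F * (1 + D / \<nu>) * L / \<nu>\<^sup>2) * (s' - s)"
        unfolding g_def
      proof (rule bvp_deriv_Lipschitz[OF uR RL R\<rho> pc(1)[OF i] pc(2)[OF i] _ s])
        fix z z' assume z: "z \<in> {x (i - 1)<..<x i}" "z' \<in> {x (i - 1)<..<x i}" "z \<le> z'"
        have "\<bar>prim f z' - prim f z\<bar> \<le> F * (z' - z)"
          by (rule prim_Lipschitz) (use f z pc[OF i] in \<open>auto intro: Linf_measurable\<close>)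
        then show "\<bar>R z' - R z\<bar> \<le> F * (z' - z)" by (simp add: R_def)
      qed
      also have "(F + D * (F / \<nu>)) / \<nu> + 2 * F * (1 + D / \<nu>) * L / \<nu>\<^sup>2 = C1 * F"
        by (simp add: C1_def C0_def field_simps add_divide_distrib)
      finally show ?thesis .
    qed
    define y where "y i = u (x i)" for i
    have y: "y 0 = 0" "y l = 0" using uc partition_ends[OF p] by (auto simp: y_def)
    define Iu where "Iu = interp l x y"
    define Ig where "Ig = step_fun l x (slopes x y)"
    have C1F: "C1 * F \<ge> 0" using C0 f(3) by simp
    have ie: "AE s in lebO. \<bar>g s - Ig s\<bar> \<le> C1 * F * h" "\<And>s. s \<in> {0..1} \<Longrightarrow> \<bar>u s - Iu s\<bar> \<le> C1 * F * h\<^sup>2"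
      using interp_error[OF p g(2) uc(3,2) C1F lipg] unfolding h_def y_def[abs_def] Iu_def Ig_def by auto
    have IuF: "Iu \<in> FE_space l x" unfolding Iu_def by (rule interp_FE[where y=y, OF p y])
    have IuA: "ac0 Iu Ig" unfolding Iu_def Ig_def by (rule interp_ac0[where y=y, OF p y])
    have IgL: "Ig \<in> Linf" unfolding Ig_def by (rule step_fun_Linf)
    have nIg: "norm_L2 (\<lambda>s. g s - Ig s) \<le> C1 * F * h"
      by (rule norm_L2_bounded) (use ie(1) C1F h g(2) IgL in \<open>auto intro!: Linf_measurable Linf_diff\<close>)
    \<comment> \<open>Galerkin orthogonality\<close>
    have uhF: "u\<^sub>h \<in> FE_space l x" using uh by (simp add: is_sol_def)
    define g\<^sub>h where "g\<^sub>h = step_fun l x (slopes x (\<lambda>i. u\<^sub>h (x i)))"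
    have gh: "ac0 u\<^sub>h g\<^sub>h" unfolding g\<^sub>h_def by (rule FE_ac0[OF p uhF])
    define e where "e s = u s - u\<^sub>h s" for s
    define k where "k s = g s - g\<^sub>h s" for s
    have ek: "ac0 e k" unfolding e_def[abs_def] k_def[abs_def] by (rule ac0_diff[OF g(1) gh])
    have orth: "form e k w w' = 0" if w: "w \<in> FE_space l x" "ac0 w w'" for w w'
    proof -
      have "bform a d\<^sub>0 u w = L2_inner f w" "bform a d\<^sub>0 u\<^sub>h w = L2_inner f w"
        using bvp_is_sol[OF f(1) u] uh w(1) FE_H10[OF p] by (auto simp: is_sol_def)
      then show ?thesis
        using form_diff[OF g(1) gh w(2)] bform_eq[OF g(1) w(2)] bform_eq[OF gh w(2)]
        by (simp add: e_def[abs_def] k_def[abs_def])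
    qed
    have split: "form e k v v' = form e k (\<lambda>s. v s - w s) (\<lambda>s. v' s - w' s)"
      if "ac0 v v'" "w \<in> FE_space l x" "ac0 w w'" for v v' w w'
      using form_diff[OF that(1,3) ek] orth[OF that(2,3)]
      by (simp add: form_commute[of e k])
    have nn: "0 \<le> M * (C1 * F * h) / \<nu>" 
      by (rule divide_nonneg_pos[OF mult_nonneg_nonneg[OF less_imp_le[OF M(1)] mult_nonneg_nonneg[OF C1F less_imp_le[OF h]]] nu])
    have nk: "norm_L2 k \<le> M * (C1 * F * h) / \<nu>"
    proof (cases "norm_L2 k = 0")
      case True
      then show ?thesis using nn by simp
    next
      case False
      then have kp: "norm_L2 k > 0" using norm_L2_nonneg[of k] by linarith
      have "\<nu> * (norm_L2 k)\<^sup>2 \<le> form e k e k" by (rule form_coercive[OF ek])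
      also have "\<dots> = form e k (\<lambda>s. e s - (Iu s - u\<^sub>h s)) (\<lambda>s. k s - (Ig s - g\<^sub>h s))"
        by (rule split[OF ek FE_diff[OF IuF uhF] ac0_diff[OF IuA gh]])
      also have "\<dots> = form e k (\<lambda>s. u s - Iu s) (\<lambda>s. g s - Ig s)" by (simp add: e_def k_def)
      also have "\<dots> \<le> M * norm_L2 k * norm_L2 (\<lambda>s. g s - Ig s)"
        using M(2)[OF ek ac0_diff[OF g(1) IuA]] by linarith
      also have "\<dots> \<le> M * norm_L2 k * (C1 * F * h)" using nIg M(1) by (intro mult_left_mono) auto
      finally have "norm_L2 k * (\<nu> * norm_L2 k) \<le> norm_L2 k * (M * (C1 * F * h))"
        by (simp add: power2_eq_square mult_ac)
      then have "\<nu> * norm_L2 k \<le> M * (C1 * F * h)" using kp by (simp only: mult_le_cancel_left_pos)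
      then show ?thesis using nu by (simp add: pos_le_divide_eq mult.commute)
    qed
    have node: "\<bar>e (x i)\<bar> \<le> M * (M * (C1 * F * h) / \<nu>) * (C0 * h)" if i: "i \<le> l" for i
    proof -
      define H where "H s = - indicat_real {x i<..} s" for s
      have Hm: "H \<in> borel_measurable lebO" unfolding H_def[abs_def] by (rule lebO_measurable_borel) simp
      have HL: "H \<in> Linf" by (rule LinfI[OF Hm, of 1]) (auto simp: H_def indicator_def)
      obtain G b where G: "bvp H G b" using bvp_exists[OF HL] .
      define q where "q s = flux H G b s / a s" for s
      have q: "ac0 G q" "q \<in> Linf" using bvp_ac0[OF G HL] by (auto simp: q_def[abs_def])
      have Gc: "G 1 = 0" "\<And>s. s \<in> {0..1} \<Longrightarrow> G s = prim q s" using G by (auto simp: bvp_def q_def[abs_def])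
      have lipq: "\<bar>q s' - q s\<bar> \<le> C0 * (s' - s)"
        if j: "j \<in> {1..l}" and s: "s \<in> {x (j - 1)<..<x j}" "s' \<in> {x (j - 1)<..<x j}" "s \<le> s'" for j s s'
      proof -
        have "\<bar>q s' - q s\<bar> \<le> ((0 + D * (1 / \<nu>)) / \<nu> + 2 * 1 * (1 + D / \<nu>) * L / \<nu>\<^sup>2) * (s' - s)"
          unfolding q_def
        proof (rule bvp_deriv_Lipschitz[OF G HL _ pc(1)[OF j] pc(2)[OF j] _ s])
          fix z z' assume z: "z \<in> {x (j - 1)<..<x j}" "z' \<in> {x (j - 1)<..<x j}" "z \<le> z'"
          have "x j \<le> x i \<or> x i \<le> x (j - 1)"
            using partition_mono_le[OF p, of j i] partition_mono_le[OF p, of i "j - 1"] i j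
            by (cases "j \<le> i") auto
          then have "H z = H z'" using z by (auto simp: H_def indicator_def)
          then show "\<bar>H z' - H z\<bar> \<le> 0 * (z' - z)" by simp
        qed (auto simp: H_def indicator_def)
        then show ?thesis by (simp add: C0_def)
      qed
      define Y where "Y i = G (x i)" for i
      have Y: "Y 0 = 0" "Y l = 0" using Gc partition_ends[OF p] by (auto simp: Y_def)
      define IG where "IG = interp l x Y"
      define Iq where "Iq = step_fun l x (slopes x Y)"
      have "AE s in lebO. \<bar>q s - Iq s\<bar> \<le> C0 * h"
        using interp_error(1)[OF p q(2) Gc(2,1) C0(1) lipq] unfolding h_def Y_def[abs_def] Iq_def by auto
      moreover have "Iq \<in> Linf" unfolding Iq_def by (rule step_fun_Linf)
      ultimately have nq: "norm_L2 (\<lambda>s. q s - Iq s) \<le> C0 * h"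
        by (intro norm_L2_bounded) (use C0 h q(2) in \<open>auto intro!: Linf_measurable Linf_diff\<close>)
      have IGF: "IG \<in> FE_space l x" unfolding IG_def by (rule interp_FE[where y=Y, OF p Y])
      have IGA: "ac0 IG Iq" unfolding IG_def Iq_def by (rule interp_ac0[where y=Y, OF p Y])
      have ki: "integrable lebO k" "prim k 1 = 0" using ek by (auto simp: ac0_def L2_integrable)
      have xr: "0 \<le> x i" "x i \<le> 1" using partition_range[OF p i] by auto
      have "e (x i) = prim k (x i)"
        using lebO_ae_eq_continuous[of e "prim k" "x i"] ek prim_continuous[OF ki(1)] uc(1) uhF xr
        by (auto simp: e_def[abs_def] ac0_def FE_space_def intro!: continuous_intros)
      also have "\<dots> = L2_inner H k"
        using upper_integral[OF ki(1) xr] prim_1[OF ki(1)] ki(2) by (simp add: L2_inner_def H_def)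
      also have "\<dots> = form G q e k" using bvp_weak[OF G HL ek] by (simp add: q_def[abs_def])
      also have "\<dots> = form e k (\<lambda>s. G s - IG s) (\<lambda>s. q s - Iq s)"
        using split[OF q(1) IGF IGA] by (simp add: form_commute[of G q])
      finally have "\<bar>e (x i)\<bar> \<le> M * norm_L2 k * norm_L2 (\<lambda>s. q s - Iq s)"
        using M(2)[OF ek ac0_diff[OF q(1) IGA]] by simp
      also have "\<dots> \<le> M * (M * (C1 * F * h) / \<nu>) * (C0 * h)"
        using nk nq M(1) C0 h nn by (intro mult_mono mult_nonneg_nonneg) simp_all
      finally show ?thesis .
    qed
    have "\<bar>Iu t - u\<^sub>h t\<bar> \<le> M * (M * (C1 * F * h) / \<nu>) * (C0 * h)"
    proof (rule FE_nodal_max[OF p FE_diff[OF IuF uhF] _ t])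
      fix i assume i: "i \<le> l"
      have "Iu (x i) = u (x i)" unfolding Iu_def using interp_node[where y=y, OF p y(1) i] by (simp add: y_def)
      then show "\<bar>Iu (x i) - u\<^sub>h (x i)\<bar> \<le> M * (M * (C1 * F * h) / \<nu>) * (C0 * h)"
        using node[OF i] by (simp add: e_def)
    qed
    then have "\<bar>u t - u\<^sub>h t\<bar> \<le> C1 * F * h\<^sup>2 + M * (M * (C1 * F * h) / \<nu>) * (C0 * h)"
      using ie(2)[OF t] by linarith
    also have "\<dots> = (C1 + M * M * C1 * C0 / \<nu>) * F * h\<^sup>2"
      using nu by (simp add: field_simps power2_eq_square)
    finally show ?thesis .
  qed
  moreover have "C1 + M * M * C1 * C0 / \<nu> > 0"
    using C0 M(1) nu by (intro add_pos_nonneg divide_nonneg_pos mult_nonneg_nonneg) auto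
  ultimately show thesis using that by blast
qed

end

section \<open>Optimality conditions\<close>

lemma norm_L2_expand:
  assumes f: "f \<in> L2" and g: "g \<in> L2"
  shows "(norm_L2 (\<lambda>x. f x + s * g x))\<^sup>2 = (norm_L2 f)\<^sup>2 + 2 * s * L2_inner f g + s\<^sup>2 * (norm_L2 g)\<^sup>2"
proof -
  have sg: "(\<lambda>x. s * g x) \<in> L2" by (rule L2_cmult[OF g])
  show ?thesis
    unfolding norm_L2_square L2_inner_add[OF f sg L2_add[OF f sg]] L2_inner_add_right[OF f sg f]
      L2_inner_add_right[OF f sg sg] L2_inner_cmult L2_inner_cmult_right L2_inner_commute[of g f]
    by (simp add: power2_eq_square algebra_simps)
qed

lemma norm_H1_ac0: assumes "ac0 e k" shows "norm_L2 k \<le> norm_H1 e" "norm_H1 e \<le> 2 * norm_L2 k"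
proof -
  note w = ac0_weak_deriv[OF assms]
  have 1: "norm_L2 (weak_deriv e) = norm_L2 k"
    by (rule norm_L2_cong[OF weak_deriv_AE[OF w] weak_deriv_measurable[OF w]])
      (use assms in \<open>auto simp: ac0_def intro: L2_measurable\<close>)
  have 2: "norm_L2 e \<le> norm_L2 k"
  proof (rule norm_L2_bounded)
    have "AE x in lebO. e x = prim k x" using assms by (simp add: ac0_def)
    then show "AE x in lebO. \<bar>e x\<bar> \<le> norm_L2 k"
      using AE_space
    proof eventually_elim
      case (elim x)
      then show ?case using prim_le_L2[of k x] assms by (simp add: ac0_def)
    qed
  qed (use assms in \<open>auto simp: ac0_def\<close>)
  show "norm_L2 k \<le> norm_H1 e" unfolding norm_H1_def 1 by (rule real_le_rsqrt) simp
  have "norm_H1 e \<le> norm_L2 e + norm_L2 k"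
    unfolding norm_H1_def 1 by (rule sqrt_sum_squares_le_sum) auto
  then show "norm_H1 e \<le> 2 * norm_L2 k" using 2 by simp
qed

lemma H10_lincomb:
  assumes v: "v \<in> H10" and w: "w \<in> H10" shows "(\<lambda>x. v x + c * w x) \<in> H10"
proof -
  obtain g k where g: "ac0 v g" and k: "ac0 w k" using v w by (elim H10_ac0)
  obtain \<phi> where \<phi>: "\<And>n::nat. \<phi> n \<in> test_funs" and l1: "(\<lambda>n. norm_H1 (\<lambda>x. \<phi> n x - v x)) \<longlonglongrightarrow> 0"
    using v by (auto simp: H10_def)
  obtain \<psi> where \<psi>: "\<And>n::nat. \<psi> n \<in> test_funs" and l2: "(\<lambda>n. norm_H1 (\<lambda>x. \<psi> n x - w x)) \<longlonglongrightarrow> 0"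
    using w by (auto simp: H10_def)
  have ac: "ac0 (\<lambda>x. v x + c * w x) (\<lambda>x. g x + c * k x)" by (intro ac0_add ac0_cmult g k)
  have bd: "norm_H1 (\<lambda>x. (\<phi> n x + c * \<psi> n x) - (v x + c * w x))
      \<le> 2 * (norm_H1 (\<lambda>x. \<phi> n x - v x) + \<bar>c\<bar> * norm_H1 (\<lambda>x. \<psi> n x - w x))" for n
  proof -
    have a1: "ac0 (\<lambda>x. \<phi> n x - v x) (\<lambda>x. deriv (\<phi> n) x - g x)"
      by (intro ac0_diff test_funs_ac0 \<phi> g)
    have a2: "ac0 (\<lambda>x. \<psi> n x - w x) (\<lambda>x. deriv (\<psi> n) x - k x)"
      by (intro ac0_diff test_funs_ac0 \<psi> k)
    have a3: "ac0 (\<lambda>x. (\<phi> n x - v x) + c * (\<psi> n x - w x)) (\<lambda>x. (deriv (\<phi> n) x - g x) + c * (deriv (\<psi> n) x - k x))"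
      by (rule ac0_add[OF a1 ac0_cmult[OF a2]])
    have "norm_H1 (\<lambda>x. (\<phi> n x - v x) + c * (\<psi> n x - w x))
        \<le> 2 * norm_L2 (\<lambda>x. (deriv (\<phi> n) x - g x) + c * (deriv (\<psi> n) x - k x))"
      by (rule norm_H1_ac0(2)[OF a3])
    also have "\<dots> \<le> 2 * (norm_L2 (\<lambda>x. deriv (\<phi> n) x - g x) + norm_L2 (\<lambda>x. c * (deriv (\<psi> n) x - k x)))"
      by (intro mult_left_mono norm_L2_triangle) (use a1 a2 in \<open>auto simp: ac0_def intro: L2_cmult\<close>)
    also have "\<dots> \<le> 2 * (norm_H1 (\<lambda>x. \<phi> n x - v x) + \<bar>c\<bar> * norm_H1 (\<lambda>x. \<psi> n x - w x))"
      unfolding norm_L2_cmult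
      by (intro mult_left_mono add_mono norm_H1_ac0(1)[OF a1] norm_H1_ac0(1)[OF a2]) auto
    finally show ?thesis by (simp add: algebra_simps)
  qed
  have "(\<lambda>n. 2 * (norm_H1 (\<lambda>x. \<phi> n x - v x) + \<bar>c\<bar> * norm_H1 (\<lambda>x. \<psi> n x - w x))) \<longlonglongrightarrow> 2 * (0 + \<bar>c\<bar> * 0)"
    by (intro tendsto_intros l1 l2)
  then have lim: "(\<lambda>n. 2 * (norm_H1 (\<lambda>x. \<phi> n x - v x) + \<bar>c\<bar> * norm_H1 (\<lambda>x. \<psi> n x - w x))) \<longlonglongrightarrow> 0" by simp
  have "(\<lambda>n. norm_H1 (\<lambda>x. (\<phi> n x + c * \<psi> n x) - (v x + c * w x))) \<longlonglongrightarrow> 0"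
  proof (rule tendsto_sandwich[OF _ _ tendsto_const lim])
    show "\<forall>\<^sub>F n in sequentially. 0 \<le> norm_H1 (\<lambda>x. (\<phi> n x + c * \<psi> n x) - (v x + c * w x))"
      by (rule always_eventually) (simp add: norm_H1_def)
    show "\<forall>\<^sub>F n in sequentially. norm_H1 (\<lambda>x. (\<phi> n x + c * \<psi> n x) - (v x + c * w x))
        \<le> 2 * (norm_H1 (\<lambda>x. \<phi> n x - v x) + \<bar>c\<bar> * norm_H1 (\<lambda>x. \<psi> n x - w x))"
      by (rule always_eventually) (use bd in blast)
  qed
  moreover have "(\<lambda>x. \<phi> n x + c * \<psi> n x) \<in> test_funs" for n
    by (intro test_funs_add test_funs_cmult \<phi> \<psi>)
  ultimately have "\<exists>\<phi>. (\<forall>n::nat. \<phi> n \<in> test_funs) \<and> (\<lambda>n. norm_H1 (\<lambda>x. \<phi> n x - (v x + c * w x))) \<longlonglongrightarrow> 0"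
    by (intro exI[of _ "\<lambda>n x. \<phi> n x + c * \<psi> n x"]) auto
  moreover have "(\<lambda>x. v x + c * w x) \<in> H1"
    using ac0_weak_deriv[OF ac] ac0_L2[OF ac] ac by (auto simp: H1_def ac0_def)
  ultimately show ?thesis by (simp add: H10_def)
qed

context elliptic
begin

text \<open>The common frame of the continuous and the discretized problem: what the optimality conditions
  need of the space in which the state equation is solved.\<close>

definition adm :: "(real \<Rightarrow> real) set \<Rightarrow> bool"
  where "adm W \<longleftrightarrow> W \<subseteq> H10 \<and> (\<forall>v\<in>W. \<forall>w\<in>W. \<forall>c. (\<lambda>x. v x + c * w x) \<in> W) \<and> (\<forall>f\<in>Linf. \<exists>u. is_sol W f u)"

lemma neg_prim_Linf: assumes "f \<in> Linf" shows "(\<lambda>x. - prim f x) \<in> Linf"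
  using Linf_cmult[OF prim_Linf[OF Linf_integrable[OF assms]], of "-1"] by simp

lemma adm_H10: "adm H10"
proof -
  have "\<exists>u. is_sol H10 f u" if f: "f \<in> Linf" for f
  proof -
    obtain u c where "bvp (\<lambda>x. - prim f x) u c" using bvp_exists[OF neg_prim_Linf[OF f]] .
    then show ?thesis using bvp_is_sol[OF f] by blast
  qed
  then show ?thesis by (simp add: adm_def H10_lincomb)
qed

lemma adm_FE: assumes "is_partition l x" shows "adm (FE_space l x)"
proof -
  have "\<exists>u. is_sol (FE_space l x) f u" if "f \<in> Linf" for f
    using FE_sol_exists[OF assms that] by metis
  then show ?thesis using FE_H10[OF assms] by (auto simp: adm_def intro: FE_add FE_cmult)
qed

lemma sol_op_is_sol: assumes "adm W" "f \<in> Linf" shows "is_sol W f (sol_op W a d\<^sub>0 f)"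
proof -
  have "\<exists>u. u \<in> W \<and> (\<forall>w\<in>W. bform a d\<^sub>0 u w = L2_inner f w)"
    using assms by (auto simp: adm_def is_sol_def)
  from someI_ex[OF this] show ?thesis by (simp add: is_sol_def sol_op_def)
qed

lemma is_sol_Linf: assumes "adm W" "is_sol W f u" shows "u \<in> Linf"
proof -
  have "u \<in> H10" using assms by (auto simp: adm_def is_sol_def)
  then obtain g where "ac0 u g" by (rule H10_ac0)
  then show ?thesis by (rule ac0_Linf)
qed

lemma is_sol_L2: "adm W \<Longrightarrow> is_sol W f u \<Longrightarrow> u \<in> L2"
  by (intro Linf_L2 is_sol_Linf)

lemma is_sol_lincomb:
  assumes W: "adm W" and u: "is_sol W f u" and u': "is_sol W f' u'" and f: "f \<in> Linf" "f' \<in> Linf"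
  shows "is_sol W (\<lambda>x. f x + c * f' x) (\<lambda>x. u x + c * u' x)"
proof -
  have H: "v \<in> H10" if "v \<in> W" for v using that W by (auto simp: adm_def)
  have uW: "u \<in> W" "u' \<in> W" "(\<lambda>x. u x + c * u' x) \<in> W" using u u' W by (auto simp: is_sol_def adm_def)
  have cH: "(\<lambda>x. c * u' x) \<in> H10" 
  proof -
    have "(\<lambda>x. u' x + (c - 1) * u' x) \<in> H10" by (intro H10_lincomb H uW)
    then show ?thesis by (simp add: left_diff_distrib)
  qed
  have "bform a d\<^sub>0 (\<lambda>x. u x + c * u' x) w = L2_inner (\<lambda>x. f x + c * f' x) w" if w: "w \<in> W" for w
  proof -
    have wL: "w \<in> L2" using H10_ac0[OF H[OF w]] ac0_L2 by metis
    have "bform a d\<^sub>0 (\<lambda>x. u x + c * u' x) w = bform a d\<^sub>0 u w + c * bform a d\<^sub>0 u' w"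
      using bform_add[OF H[OF uW(1)] cH H[OF w]] bform_cmult[OF H[OF uW(2)] H[OF uW(2)] H[OF w]] by simp
    also have "\<dots> = L2_inner (\<lambda>x. f x + c * f' x) w"
      using u u' w wL Linf_L2[OF f(1)] L2_cmult[OF Linf_L2[OF f(2)], of c]
      by (simp add: is_sol_def L2_inner_add L2_inner_cmult)
    finally show ?thesis .
  qed
  then show ?thesis using uW by (simp add: is_sol_def)
qed

lemma is_sol_diff:
  assumes "adm W" "is_sol W f u" "is_sol W f' u'" "f \<in> Linf" "f' \<in> Linf"
  shows "is_sol W (\<lambda>x. f x - f' x) (\<lambda>x. u x - u' x)"
  using is_sol_lincomb[OF assms, of "-1"] by simp

lemma is_sol_sym:
  assumes W: "adm W" and u: "is_sol W f u" and u': "is_sol W f' u'"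
  shows "L2_inner f u' = L2_inner f' u"
proof -
  have "u \<in> H10" "u' \<in> H10" using u u' W by (auto simp: is_sol_def adm_def)
  then have "bform a d\<^sub>0 u u' = bform a d\<^sub>0 u' u" by (intro bform_commute)
  then show ?thesis using u u' by (simp add: is_sol_def)
qed

lemma is_sol_AE_eq:
  assumes W: "adm W" and u: "is_sol W f u" and u': "is_sol W f u'"
  shows "AE x in lebO. u x = u' x"
proof (rule is_sol_unique[OF _ _ u u'])
  show "W \<subseteq> H10" using W by (simp add: adm_def)
  fix v w assume "v \<in> W" "w \<in> W"
  then have "(\<lambda>x. v x + - 1 * w x) \<in> W" using W unfolding adm_def by blast
  then show "(\<lambda>x. v x - w x) \<in> W" by simp
qed

lemma is_sol_energy:
  assumes W: "adm W" and u: "is_sol W f u" and f: "f \<in> L2" and g: "ac0 u g"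
  shows "norm_L2 g \<le> norm_L2 f / \<nu>"
proof (cases "norm_L2 g = 0")
  case True
  then show ?thesis using nu by simp
next
  case False
  then have p: "norm_L2 g > 0" using norm_L2_nonneg[of g] by linarith
  have "\<nu> * (norm_L2 g)\<^sup>2 \<le> bform a d\<^sub>0 u u" using form_coercive[OF g] bform_eq[OF g g] by simp
  also have "\<dots> = L2_inner f u" using u by (simp add: is_sol_def)
  also have "\<dots> \<le> norm_L2 f * norm_L2 u" using L2_inner_CS[OF f ac0_L2[OF g]] by linarith
  also have "\<dots> \<le> norm_L2 f * norm_L2 g" by (intro mult_left_mono ac0_norm_le g) simp
  finally have "norm_L2 g * (\<nu> * norm_L2 g) \<le> norm_L2 g * norm_L2 f" by (simp add: power2_eq_square mult_ac)
  then have "\<nu> * norm_L2 g \<le> norm_L2 f" using p by (simp only: mult_le_cancel_left_pos)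
  then show ?thesis using nu by (simp add: pos_le_divide_eq mult.commute)
qed

end

locale control_problem = elliptic +
  fixes \<alpha> :: real and u\<^sub>d :: "real \<Rightarrow> real"
  assumes alpha: "\<alpha> > 0" and ud: "u\<^sub>d \<in> Linf"
begin

abbreviation "sol W \<equiv> sol_op W a d\<^sub>0"
abbreviation "opt W \<equiv> optimal_control W a d\<^sub>0 u\<^sub>d \<alpha>"

lemma opt_BV: "opt W q \<Longrightarrow> q \<in> BV" by (simp add: optimal_control_def)

text \<open>The directional derivative of the quadratic part of the cost is the pairing with the
  adjoint state.\<close>

lemma first_order:
  assumes W: "adm W" and q: "opt W q" and z: "is_sol W (\<lambda>x. sol W q x - u\<^sub>d x) z" and r: "r \<in> Linf"
    and dir: "\<And>s. 0 < s \<Longrightarrow> s < 1 \<Longrightarrow> (\<lambda>x. q x + s * r x) \<in> BV \<and> norm_deriv_M (\<lambda>x. q x + s * r x) \<le> norm_deriv_M q + s * \<kappa>"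
  shows "0 \<le> L2_inner z r + \<alpha> * \<kappa>"
proof -
  have qL: "q \<in> Linf" using BV_Linf[OF opt_BV[OF q]] .
  define u where "u = sol W q"
  define v where "v = sol W r"
  have u: "is_sol W q u" and v: "is_sol W r v" unfolding u_def v_def by (auto intro: sol_op_is_sol[OF W] qL r)
  have uL: "u \<in> L2" "v \<in> L2" "(\<lambda>x. u x - u\<^sub>d x) \<in> L2" "u \<in> Linf" "v \<in> Linf"
    using is_sol_Linf[OF W u] is_sol_Linf[OF W v] ud by (auto intro: Linf_L2 L2_diff)
  have zr: "L2_inner z r = L2_inner (\<lambda>x. u x - u\<^sub>d x) v"
    using is_sol_sym[OF W z v] by (simp add: u_def L2_inner_commute)
  have key: "0 \<le> (L2_inner z r + \<alpha> * \<kappa>) + s * ((norm_L2 v)\<^sup>2 / 2)" if s: "0 < s" "s < 1" for s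
  proof -
    define qs where "qs x = q x + s * r x" for x
    have qsB: "qs \<in> BV" "norm_deriv_M qs \<le> norm_deriv_M q + s * \<kappa>" using dir[OF s] by (auto simp: qs_def[abs_def])
    have us: "is_sol W qs (\<lambda>x. u x + s * v x)"
      unfolding qs_def[abs_def] by (rule is_sol_lincomb[OF W u v qL r])
    have ss: "is_sol W qs (sol W qs)" by (rule sol_op_is_sol[OF W BV_Linf[OF qsB(1)]])
    have ae: "AE x in lebO. sol W qs x - u\<^sub>d x = (u x - u\<^sub>d x) + s * v x"
      using is_sol_AE_eq[OF W ss us] by eventually_elim simp
    have "(norm_L2 (\<lambda>x. sol W qs x - u\<^sub>d x))\<^sup>2 = (norm_L2 (\<lambda>x. (u x - u\<^sub>d x) + s * v x))\<^sup>2"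
      by (subst norm_L2_cong[OF ae])
        (use is_sol_Linf[OF W ss] uL ud in \<open>auto intro!: Linf_measurable Linf_diff Linf_add Linf_cmult\<close>)
    also have "\<dots> = (norm_L2 (\<lambda>x. u x - u\<^sub>d x))\<^sup>2 + 2 * s * L2_inner z r + s\<^sup>2 * (norm_L2 v)\<^sup>2"
      unfolding zr by (rule norm_L2_expand[OF uL(3,2)])
    finally have n: "(norm_L2 (\<lambda>x. sol W qs x - u\<^sub>d x))\<^sup>2
      = (norm_L2 (\<lambda>x. u x - u\<^sub>d x))\<^sup>2 + 2 * s * L2_inner z r + s\<^sup>2 * (norm_L2 v)\<^sup>2" .
    have "cost W a d\<^sub>0 u\<^sub>d \<alpha> q \<le> cost W a d\<^sub>0 u\<^sub>d \<alpha> qs" using q qsB(1) by (simp add: optimal_control_def)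
    then have "0 \<le> s * L2_inner z r + s\<^sup>2 * (norm_L2 v)\<^sup>2 / 2 + (\<alpha> * norm_deriv_M qs - \<alpha> * norm_deriv_M q)"
      unfolding cost_def n u_def by (simp add: add_divide_distrib)
    also have "\<alpha> * norm_deriv_M qs \<le> \<alpha> * (norm_deriv_M q + s * \<kappa>)"
      using qsB(2) alpha by (intro mult_left_mono) auto
    finally have "0 \<le> s * ((L2_inner z r + \<alpha> * \<kappa>) + s * ((norm_L2 v)\<^sup>2 / 2))"
      by (simp add: algebra_simps power2_eq_square)
    then show ?thesis using s by (simp add: zero_le_mult_iff)
  qed
  have "((\<lambda>s. (L2_inner z r + \<alpha> * \<kappa>) + s * ((norm_L2 v)\<^sup>2 / 2)) \<longlongrightarrow> (L2_inner z r + \<alpha> * \<kappa>) + 0 * ((norm_L2 v)\<^sup>2 / 2)) (at_right 0)"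
    by (intro tendsto_intros)
  moreover have "\<forall>\<^sub>F s in at_right 0. 0 \<le> (L2_inner z r + \<alpha> * \<kappa>) + s * ((norm_L2 v)\<^sup>2 / 2)"
    unfolding eventually_at_right_field by (intro exI[of _ 1] conjI allI impI key) auto
  ultimately have "0 \<le> (L2_inner z r + \<alpha> * \<kappa>) + 0 * ((norm_L2 v)\<^sup>2 / 2)"
    by (rule tendsto_lowerbound) simp
  then show ?thesis by simp
qed

text \<open>The admissible directions are constants, single jumps and multiples of the control itself; along
  each of them the total variation grows at most linearly, with a known rate.\<close>

lemma optimality:
  assumes W: "adm W" and q: "opt W q" and z: "is_sol W (\<lambda>x. sol W q x - u\<^sub>d x) z"
  shows opt_mean: "prim z 1 = 0"
    and opt_bound: "y \<in> {0..1} \<Longrightarrow> \<bar>prim z y\<bar> \<le> \<alpha>"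
    and opt_pairing: "L2_inner z q = - \<alpha> * norm_deriv_M q"
proof -
  note qB = opt_BV[OF q] and qL = BV_Linf[OF opt_BV[OF q]]
  have zL: "z \<in> Linf" by (rule is_sol_Linf[OF W z])
  note zi = Linf_integrable[OF zL]
  have "0 \<le> L2_inner z (\<lambda>x. \<sigma>) + \<alpha> * 0" for \<sigma>
    by (rule first_order[OF W q z]) (use BV_add_const[OF qB] in auto)
  from this[of 1] this[of "-1"] have "(LINT x|lebO. z x) = 0" by (simp add: L2_inner_def)
  then show p1: "prim z 1 = 0" using prim_1[OF zi] by simp
  show "\<bar>prim z y\<bar> \<le> \<alpha>" if y: "y \<in> {0..1}"
  proof (cases "0 < y \<and> y < 1")
    case True
    have Hm: "indicat_real {y<..} \<in> borel_measurable lebO" by (rule lebO_measurable_borel) simp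
    have HL: "indicat_real {y<..} \<in> Linf" by (rule LinfI[OF Hm, of 1]) (auto simp: indicator_def)
    have pz: "L2_inner z (\<lambda>x. \<sigma> * indicator {y<..} x) = - \<sigma> * prim z y" for \<sigma>
      using upper_integral[OF zi, of y] y p1 prim_1[OF zi]
      by (simp add: L2_inner_cmult_right) (simp add: L2_inner_def mult.commute)
    have "0 \<le> L2_inner z (\<lambda>x. \<sigma> * indicator {y<..} x) + \<alpha> * \<bar>\<sigma>\<bar>" for \<sigma>
    proof (rule first_order[OF W q z Linf_cmult[OF HL]])
      fix s :: real assume "0 < s" "s < 1"
      then show "(\<lambda>x. q x + s * (\<sigma> * indicator {y<..} x)) \<in> BV \<and>
          norm_deriv_M (\<lambda>x. q x + s * (\<sigma> * indicator {y<..} x)) \<le> norm_deriv_M q + s * \<bar>\<sigma>\<bar>"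
        using BV_add_jump[OF qB, of y "s * \<sigma>"] True by (simp add: mult.assoc abs_mult)
    qed
    from this[of 1] this[of "-1"] show ?thesis unfolding pz by simp
  next
    case False
    then have "y = 0 \<or> y = 1" using y by auto
    then show ?thesis using p1 alpha by auto
  qed
  have 1: "0 \<le> L2_inner z q + \<alpha> * norm_deriv_M q"
  proof (rule first_order[OF W q z qL])
    fix s :: real assume "0 < s" "s < 1"
    then show "(\<lambda>x. q x + s * q x) \<in> BV \<and> norm_deriv_M (\<lambda>x. q x + s * q x) \<le> norm_deriv_M q + s * norm_deriv_M q"
      using BV_scale[OF qB, of "1 + s"] by (simp add: distrib_right)
  qed
  have 2: "0 \<le> L2_inner z (\<lambda>x. - 1 * q x) + \<alpha> * (- norm_deriv_M q)"
  proof (rule first_order[OF W q z Linf_cmult[OF qL]])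
    fix s :: real assume "0 < s" "s < 1"
    then show "(\<lambda>x. q x + s * (- 1 * q x)) \<in> BV \<and> norm_deriv_M (\<lambda>x. q x + s * (- 1 * q x)) \<le> norm_deriv_M q + s * (- norm_deriv_M q)"
      using BV_scale[OF qB, of "1 - s"] by (simp add: left_diff_distrib)
  qed
  show "L2_inner z q = - \<alpha> * norm_deriv_M q" using 1 2 unfolding L2_inner_cmult_right by simp
qed

lemma opt_variational:
  assumes W: "adm W" and q: "opt W q" and z: "is_sol W (\<lambda>x. sol W q x - u\<^sub>d x) z" and q': "q' \<in> BV"
  shows "- \<alpha> * norm_deriv_M q' \<le> L2_inner z q'"
  using BV_pairing[OF q' is_sol_Linf[OF W z] opt_mean[OF W q z] opt_bound[OF W q z]]
  by (simp add: L2_inner_commute[of q'] abs_le_iff)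

text \<open>Where the primitive of the adjoint state stays away from \<open>\<plusminus>\<alpha>\<close>, it may be perturbed by small
  multiples of test functions without violating the bound, which forces the optimal control to be
  constant there.\<close>

lemma opt_constant:
  assumes W: "adm W" and q: "opt W q" and z: "is_sol W (\<lambda>x. sol W q x - u\<^sub>d x) z"
    and st: "0 \<le> s" "s < t" "t \<le> 1" and less: "\<And>x. x \<in> {s<..<t} \<Longrightarrow> \<bar>prim z x\<bar> < \<alpha>"
  obtains k where "AE x in lebO. x \<in> {s<..<t} \<longrightarrow> q x = k"
proof (rule du_Bois_Reymond[OF st])
  note qB = opt_BV[OF q] and qL = BV_Linf[OF opt_BV[OF q]]
  show "integrable lebO q" by (rule Linf_integrable[OF qL])
  have zL: "z \<in> Linf" by (rule is_sol_Linf[OF W z])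
  note zi = Linf_integrable[OF zL]
  have nonneg: "0 \<le> L2_inner q (deriv \<phi>)" if \<phi>: "\<phi> \<in> test_in s t" for \<phi>
  proof -
    have \<phi>t: "\<phi> \<in> test_funs" by (rule test_in_test_funs[OF st(1,3) \<phi>])
    obtain c d where cd: "s < c" "c \<le> d" "d < t" "\<And>x. x \<notin> {c..d} \<Longrightarrow> \<phi> x = 0"
      using \<phi> unfolding test_in_def by blast
    have cdI: "{c..d} \<subseteq> {0..1}" using cd st by auto
    have "continuous_on {c..d} (\<lambda>x. \<bar>prim z x\<bar>)"
      by (intro continuous_intros continuous_on_subset[OF prim_continuous[OF zi] cdI])
    then obtain x0 where x0: "x0 \<in> {c..d}" "\<And>x. x \<in> {c..d} \<Longrightarrow> \<bar>prim z x\<bar> \<le> \<bar>prim z x0\<bar>"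
      using continuous_attains_sup[of "{c..d}" "\<lambda>x. \<bar>prim z x\<bar>"] cd by auto
    define m where "m = \<bar>prim z x0\<bar>"
    have m: "m < \<alpha>" unfolding m_def using less[of x0] x0(1) cd by auto
    obtain B where B: "B \<ge> 0" "\<And>x. \<bar>\<phi> x\<bar> \<le> B" by (rule test_funs_bounded[OF \<phi>t]) (rule that)
    define \<tau> where "\<tau> = (\<alpha> - m) / (B + 1)"
    have \<tau>: "\<tau> > 0" using m B by (simp add: \<tau>_def)
    have dL: "deriv \<phi> \<in> Linf" by (intro test_funs_Linf test_funs_deriv \<phi>t)
    define g where "g x = z x + \<tau> * deriv \<phi> x" for x
    have gL: "g \<in> Linf" unfolding g_def[abs_def] by (intro Linf_add Linf_cmult zL dL)
    have pg: "prim g x = prim z x + \<tau> * \<phi> x" if "x \<in> {0..1}" for x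
      using prim_add[OF zi Linf_integrable[OF Linf_cmult[OF dL]], of x \<tau>] prim_deriv_test[OF \<phi>t, of x] that
      by (simp add: g_def[abs_def] prim_cmult)
    have "\<bar>prim g x\<bar> \<le> \<alpha>" if x: "x \<in> {0..1}" for x
    proof (cases "x \<in> {c..d}")
      case True
      have "\<bar>\<tau> * \<phi> x\<bar> \<le> \<tau> * (B + 1)" unfolding abs_mult using \<tau> B(2)[of x] by (intro mult_mono) auto
      also have "\<dots> = \<alpha> - m" using B by (simp add: \<tau>_def)
      finally show ?thesis using x0(2)[OF True] pg[OF x] unfolding m_def by linarith
    next
      case False
      then show ?thesis using cd(4) pg[OF x] opt_bound[OF W q z x] by simp
    qed
    moreover have "prim g 1 = 0" using pg[of 1] opt_mean[OF W q z] test_funs_outside[OF \<phi>t, of 1] by simp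
    ultimately have "\<bar>L2_inner q g\<bar> \<le> \<alpha> * norm_deriv_M q" using gL by (intro BV_pairing[OF qB])
    moreover have "L2_inner q g = L2_inner z q + \<tau> * L2_inner q (deriv \<phi>)"
      unfolding g_def[abs_def] using Linf_L2[OF qL] Linf_L2[OF zL] L2_cmult[OF Linf_L2[OF dL], of \<tau>]
      by (simp add: L2_inner_add_right L2_inner_cmult_right L2_inner_commute[of q z])
    ultimately have "0 \<le> \<tau> * L2_inner q (deriv \<phi>)" using opt_pairing[OF W q z] by (simp add: abs_le_iff)
    then show ?thesis using \<tau> by (simp add: zero_le_mult_iff)
  qed
  fix \<phi> assume \<phi>: "\<phi> \<in> test_in s t"
  have "deriv (\<lambda>x. - 1 * \<phi> x) = (\<lambda>x. - 1 * deriv \<phi> x)"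
    using smooth_has_deriv[OF test_in_smooth[OF \<phi>]] by (intro ext DERIV_imp_deriv DERIV_cmult)
  then have "0 \<le> - L2_inner q (deriv \<phi>)"
    using nonneg[OF test_in_cmult[OF \<phi>, of "-1"]] by (simp add: L2_inner_cmult_right[of q "-1", simplified])
  then show "L2_inner q (deriv \<phi>) = 0" using nonneg[OF \<phi>] by simp
qed (rule that)

subsection \<open>Stability of controls\<close>

text \<open>Means of the control against suitable weights are controlled by the state in \<open>L\<^sup>2\<close>, uniformly in the
  control: the coefficient is absorbed by a weight whose flux \<open>a \<phi>'\<close> is a test function.\<close>

lemma local_mean_weight:
  assumes st: "0 \<le> s" "s < t" "t \<le> 1"
  obtains \<phi> C m where "\<phi> \<in> Linf" "C \<ge> 0" "m > 0" "(LINT x|lebO. \<phi> x) = m"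
    "\<And>x. x \<in> \<Omega> \<Longrightarrow> \<phi> x \<ge> 0"
    "\<And>x. x \<in> \<Omega> \<Longrightarrow> x \<le> s + (t - s) / 4 \<or> t - (t - s) / 4 \<le> x \<Longrightarrow> \<phi> x = 0"
    "\<And>f u. is_sol H10 f u \<Longrightarrow> \<bar>L2_inner f \<phi>\<bar> \<le> C * norm_L2 u"
proof -
  define s' where "s' = s + (t - s) / 4"
  define t' where "t' = t - (t - s) / 4"
  define mid where "mid = (s + t) / 2"
  have o: "s < s'" "s' < mid" "mid < t'" "t' < t" using st by (auto simp: s'_def t'_def mid_def field_simps)
  define w1 where "w1 x = bump s' mid x / a x" for x
  define w2 where "w2 x = bump mid t' x / a x" for x
  have wc: "continuous_on {0..1} w1" "continuous_on {0..1} w2"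
    unfolding w1_def[abs_def] w2_def[abs_def]
    by (intro continuous_on_divide smooth_continuous smooth_bump a_continuous; use a_pos in force)+
  note wi = Linf_integrable[OF Linf_continuous[OF wc(1)]] Linf_integrable[OF Linf_continuous[OF wc(2)]]
  have wp: "0 \<le> w1 x" "0 \<le> w2 x" if "x \<in> {0..1}" for x
    using bump_bounds(1) a_pos[OF that] by (auto simp: w1_def w2_def)
  have wz1: "w1 x = 0" if "x \<le> s' \<or> mid \<le> x" for x using that by (simp add: w1_def bump_zero)
  have wz2: "w2 x = 0" if "x \<le> mid \<or> t' \<le> x" for x using that by (simp add: w2_def bump_zero)
  have pos: "prim w 1 > 0" if c: "continuous_on {0..1} w" and p: "\<And>x. x \<in> {0..1} \<Longrightarrow> 0 \<le> w x"
    and x0: "x0 \<in> {0..1}" "w x0 > 0" for w x0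
  proof -
    have "prim w 1 \<ge> 0" unfolding prim_def by (rule integral_nonneg) (use c p integrable_continuous_real in auto)
    moreover have "prim w 1 \<noteq> 0" unfolding prim_def using integral_eq_0_iff[OF c] p x0 by force
    ultimately show ?thesis by simp
  qed
  have I1: "prim w1 1 > 0"
    by (rule pos[OF wc(1) wp(1), of "(s' + mid) / 2"]) (use o st bump_pos[of s' "(s' + mid) / 2" mid] a_pos[of "(s' + mid) / 2"] in \<open>auto simp: w1_def\<close>)
  have I2: "prim w2 1 > 0"
    by (rule pos[OF wc(2) wp(2), of "(mid + t') / 2"]) (use o st bump_pos[of mid "(mid + t') / 2" t'] a_pos[of "(mid + t') / 2"] in \<open>auto simp: w2_def\<close>)
  define \<kappa> where "\<kappa> = prim w1 1 / prim w2 1"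
  have \<kappa>: "\<kappa> > 0" using I1 I2 by (simp add: \<kappa>_def)
  define \<psi> where "\<psi> x = bump s' mid x - \<kappa> * bump mid t' x" for x
  have \<psi>0: "\<psi> x = 0" if "x \<notin> {s'..t'}" for x using that o by (auto simp: \<psi>_def bump_zero)
  have \<psi>t: "\<psi> \<in> test_funs"
  proof -
    have "smooth \<psi>" unfolding \<psi>_def[abs_def] by (intro smooth_diff smooth_cmult smooth_bump)
    moreover have "0 < s'" "s' \<le> t'" "t' < 1" using o st by auto
    ultimately show ?thesis unfolding test_funs_iff using \<psi>0 by blast
  qed
  define g where "g x = w1 x - \<kappa> * w2 x" for x
  have g\<psi>: "a x * g x = \<psi> x" if "x \<in> \<Omega>" for x
    using a_pos[of x] that by (simp add: g_def w1_def w2_def \<psi>_def field_simps)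
  have gc: "continuous_on {0..1} g" unfolding g_def[abs_def] by (intro continuous_intros wc)
  have gL: "g \<in> Linf" by (rule Linf_continuous[OF gc])
  have kwi: "integrable lebO (\<lambda>x. \<kappa> * w2 x)" using wi(2) by simp
  have pg: "prim g x = prim w1 x - \<kappa> * prim w2 x" if "x \<le> 1" for x
    unfolding g_def[abs_def] using prim_minus[OF wi(1) kwi that] by (simp add: prim_cmult)
  define \<phi> where "\<phi> = prim g"
  have g1: "prim g 1 = 0" using pg[of 1] I2 by (simp add: \<kappa>_def)
  have ac: "ac0 \<phi> g" using gL g1 unfolding ac0_def \<phi>_def by (auto intro!: Linf_L2 Linf_measurable[OF prim_Linf] Linf_integrable)
  have \<phi>c: "continuous_on {0..1} \<phi>" unfolding \<phi>_def by (intro prim_continuous Linf_integrable gL)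
  \<comment> \<open>The weight increases up to the midpoint and decreases afterwards.\<close>
  have zero_low: "prim w x = 0" if "\<And>y. y \<in> {0..x} \<Longrightarrow> w y = 0" for w x
    using prim_cong[of x w "\<lambda>_. 0"] that by (simp add: prim_def)
  have zero_high: "prim w x = prim w 1" if "integrable lebO w" "x \<in> {0..1}" "\<And>y. y \<in> {x..1} \<Longrightarrow> w y = 0" for w x
  proof -
    have "prim w 1 - prim w x = integral {x..1} w" by (rule prim_diff) (use that in auto)
    also have "\<dots> = integral {x..1} (\<lambda>_. 0)" by (rule integral_cong) (use that in auto)
    finally show ?thesis by simp
  qed
  have mono: "prim w x \<ge> 0" "prim w x \<le> prim w 1"
    if "integrable lebO w" "\<And>y. y \<in> {0..1} \<Longrightarrow> 0 \<le> w y" "x \<in> {0..1}" for w x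
  proof -
    have "AE y in lebO. 0 \<le> w y" by (rule AE_lebO_I, rule that(2)) auto
    then show "prim w x \<ge> 0" using that(3) by (intro prim_nonneg[OF that(1)]) auto
    have "prim w 1 - prim w x = integral {x..1} w" by (rule prim_diff) (use that in auto)
    moreover have "integral {x..1} w \<ge> 0"
      by (rule integral_nonneg) (use that lebO_int_on[OF that(1), of x 1] in auto)
    ultimately show "prim w x \<le> prim w 1" by simp
  qed
  have \<phi>pos: "\<phi> x \<ge> 0" if x: "x \<in> {0..1}" for x
  proof (cases "x \<le> mid")
    case True
    have "prim w2 x = 0" by (rule zero_low) (use True wz2 in auto)
    then show ?thesis using pg[of x] mono(1)[OF wi(1) wp(1) x] x by (simp add: \<phi>_def)
  next
    case False
    have "prim w1 x = prim w1 1" by (rule zero_high[OF wi(1) x]) (use False wz1 in auto)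
    then have "\<phi> x = \<kappa> * (prim w2 1 - prim w2 x)" using pg[of x] x I2 by (simp add: \<phi>_def \<kappa>_def right_diff_distrib)
    then show ?thesis using \<kappa> mono(2)[OF wi(2) wp(2) x] by simp
  qed
  have \<phi>0: "\<phi> x = 0" if x: "x \<in> {0..1}" "x \<le> s' \<or> t' \<le> x" for x
  proof (cases "x \<le> s'")
    case True
    have "prim w1 x = 0" "prim w2 x = 0" by (rule zero_low, use True wz1 wz2 o in auto)+
    then show ?thesis using pg[of x] x by (simp add: \<phi>_def)
  next
    case False
    then have "t' \<le> x" using x by simp
    then have "prim w1 x = prim w1 1" "prim w2 x = prim w2 1"
      using wz1 wz2 o by (auto intro!: zero_high wi x(1))
    then show ?thesis using pg[of x] x g1 pg[of 1] by (simp add: \<phi>_def)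
  qed
  define m where "m = (LINT x|lebO. \<phi> x)"
  have \<phi>L: "\<phi> \<in> Linf" by (rule Linf_continuous[OF \<phi>c])
  have m: "m > 0"
  proof -
    have midI: "mid \<in> {0..1}" using o st by auto
    have "prim w2 mid = 0" by (rule zero_low) (use wz2 in auto)
    moreover have "prim w1 mid = prim w1 1" by (rule zero_high[OF wi(1) midI]) (use wz1 in auto)
    ultimately have "\<phi> mid > 0" using pg[of mid] midI I1 by (simp add: \<phi>_def)
    then have "prim \<phi> 1 > 0" by (intro pos[OF \<phi>c \<phi>pos midI])
    then show ?thesis unfolding m_def using prim_1[OF Linf_integrable[OF \<phi>L]] by simp
  qed
  define C where "C = norm_L2 (deriv \<psi>) + norm_L2 (\<lambda>x. d\<^sub>0 x * \<phi> x)"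
  have "\<bar>L2_inner f \<phi>\<bar> \<le> C * norm_L2 u" if u: "is_sol H10 f u" for f u
  proof -
    have uH: "u \<in> H10" using u by (simp add: is_sol_def)
    obtain k where k: "ac0 u k" using H10_ac0[OF uH] .
    note l = form_L2[OF k] form_L2[OF ac]
    have d\<psi>: "deriv \<psi> \<in> L2" by (intro Linf_L2 test_funs_Linf test_funs_deriv \<psi>t)
    have "L2_inner f \<phi> = bform a d\<^sub>0 u \<phi>" using u ac0_H10[OF ac gL] by (simp add: is_sol_def)
    also have "\<dots> = form u k \<phi> g" by (rule bform_eq[OF k ac])
    also have "\<dots> = form \<phi> g u k" by (rule form_commute)
    also have "\<dots> = L2_inner \<psi> k + L2_inner (\<lambda>x. d\<^sub>0 x * \<phi> x) u"
    proof -
      have "L2_inner (\<lambda>x. a x * g x) k = L2_inner \<psi> k"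
        unfolding L2_inner_def by (rule Bochner_Integration.integral_cong) (auto simp: g\<psi>)
      then show ?thesis by (simp add: form_def)
    qed
    also have "L2_inner \<psi> k = - L2_inner u (deriv \<psi>)"
      using ac0_weak_deriv[OF k] \<psi>t L2_inner_commute[of \<psi> k] by (simp add: has_weak_deriv_def)
    finally have "\<bar>L2_inner f \<phi>\<bar> \<le> \<bar>L2_inner u (deriv \<psi>)\<bar> + \<bar>L2_inner (\<lambda>x. d\<^sub>0 x * \<phi> x) u\<bar>" by linarith
    also have "\<dots> \<le> norm_L2 u * norm_L2 (deriv \<psi>) + norm_L2 (\<lambda>x. d\<^sub>0 x * \<phi> x) * norm_L2 u"
      by (intro add_mono L2_inner_CS d\<psi> l)
    also have "\<dots> = C * norm_L2 u" by (simp add: C_def algebra_simps)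
    finally show ?thesis .
  qed
  moreover have "C \<ge> 0" by (simp add: C_def)
  moreover have "\<phi> x = 0" if "x \<in> \<Omega>" "x \<le> s + (t - s) / 4 \<or> t - (t - s) / 4 \<le> x" for x
    using \<phi>0[of x] that by (auto simp: s'_def t'_def)
  moreover have "\<phi> x \<ge> 0" if "x \<in> \<Omega>" for x using \<phi>pos[of x] that by auto
  ultimately show thesis using \<phi>L m by (intro that[of \<phi> C m]) (auto simp: m_def)
qed

end

section \<open>The error estimate\<close>

subsection \<open>Points where the multiplier is active\<close>

lemma prim_has_deriv:
  assumes "continuous_on {0..1} z" "x \<in> \<Omega>" shows "(prim z has_real_derivative z x) (at x)"
proof -
  have "((\<lambda>x. integral {0..x} z) has_real_derivative z x) (at x within {0..1})"
    using assms by (intro integral_has_real_derivative) auto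
  then show ?thesis using assms(2) by (simp add: at_within_Icc_at prim_def[abs_def])
qed

lemma prim_extremum:
  assumes c: "continuous_on {0..1} z" and le: "\<And>y. y \<in> {0..1} \<Longrightarrow> \<bar>prim z y\<bar> \<le> \<alpha>"
    and x: "x \<in> \<Omega>" "\<bar>prim z x\<bar> = \<alpha>"
  shows "z x = 0"
proof -
  have d: "0 < min x (1 - x)" using x by auto
  have I: "y \<in> {0..1}" if "\<bar>x - y\<bar> < min x (1 - x)" for y using that by auto
  show ?thesis
  proof (cases "prim z x \<ge> 0")
    case True
    then have "\<forall>y. \<bar>x - y\<bar> < min x (1 - x) \<longrightarrow> prim z y \<le> prim z x"
      using le[OF I] x(2) by (auto simp: abs_le_iff)
    then show ?thesis by (rule DERIV_local_max[OF prim_has_deriv[OF c x(1)] d])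
  next
    case False
    then have "\<forall>y. \<bar>x - y\<bar> < min x (1 - x) \<longrightarrow> prim z x \<le> prim z y"
      using le[OF I] x(2) by (fastforce simp: abs_le_iff)
    then show ?thesis by (rule DERIV_local_min[OF prim_has_deriv[OF c x(1)] d])
  qed
qed

lemma simple_zero:
  assumes "(z has_real_derivative c) (at y)" "c \<noteq> 0" "z y = 0"
  obtains \<kappa> r where "\<kappa> > 0" "r > 0" "\<forall>x. \<bar>x - y\<bar> < r \<longrightarrow> \<kappa> * \<bar>x - y\<bar> \<le> \<bar>z x\<bar>"
proof -
  have "((\<lambda>x. (z x - z y) / (x - y)) \<longlongrightarrow> c) (at y)"
    using assms(1) by (simp add: has_field_derivative_iff)
  then have "\<forall>\<^sub>F x in at y. dist ((z x - z y) / (x - y)) c < \<bar>c\<bar> / 2"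
    by (rule tendstoD) (use assms(2) in simp)
  then obtain r where r: "r > 0" "\<forall>x. x \<noteq> y \<and> dist x y < r \<longrightarrow> dist ((z x - z y) / (x - y)) c < \<bar>c\<bar> / 2"
    by (auto simp: eventually_at)
  have "\<forall>x. \<bar>x - y\<bar> < r \<longrightarrow> \<bar>c\<bar> / 2 * \<bar>x - y\<bar> \<le> \<bar>z x\<bar>"
  proof (intro allI impI)
    fix x assume x: "\<bar>x - y\<bar> < r"
    show "\<bar>c\<bar> / 2 * \<bar>x - y\<bar> \<le> \<bar>z x\<bar>"
    proof (cases "x = y")
      case False
      then have "\<bar>z x / (x - y) - c\<bar> < \<bar>c\<bar> / 2" using r(2) x assms(3) by (simp add: dist_real_def)
      then have "\<bar>c\<bar> / 2 \<le> \<bar>z x / (x - y)\<bar>" by linarith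
      then show ?thesis using False by (simp add: abs_divide pos_le_divide_eq)
    qed simp
  qed
  then show thesis using r(1) assms(2) by (intro that[of "\<bar>c\<bar> / 2" r]) auto
qed

text \<open>The active set of a perturbed multiplier stays close to that of the unperturbed one, at a
  distance proportional to the perturbation of the derivative: away from the active points the bound
  is strict, and near them the derivative has a simple zero there but has to vanish, up to the
  perturbation, at each active point of the perturbed multiplier.\<close>

lemma active_set_stability:
  fixes z :: "real \<Rightarrow> real" and \<alpha> :: real
  defines "Z \<equiv> {x \<in> \<Omega>. \<bar>prim z x\<bar> = \<alpha>}"
  assumes alpha: "\<alpha> > 0" and c: "continuous_on {0..1} z" and z1: "prim z 1 = 0"
    and le: "\<And>y. y \<in> {0..1} \<Longrightarrow> \<bar>prim z y\<bar> \<le> \<alpha>" and fin: "finite Z"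
    and der: "\<And>y. y \<in> Z \<Longrightarrow> \<exists>c. c \<noteq> 0 \<and> (z has_real_derivative c) (at y)"
  obtains \<kappa> \<delta>\<^sub>0 where "\<kappa> > 0" "\<delta>\<^sub>0 > 0"
    "\<forall>\<zeta> \<delta> x. continuous_on {0..1} \<zeta> \<and> (\<forall>y\<in>{0..1}. \<bar>\<zeta> y - z y\<bar> \<le> \<delta> \<and> \<bar>prim \<zeta> y\<bar> \<le> \<alpha>) \<and> \<delta> \<le> \<delta>\<^sub>0 \<and>
      x \<in> \<Omega> \<and> \<bar>prim \<zeta> x\<bar> = \<alpha> \<longrightarrow> (\<exists>y\<in>Z. \<bar>x - y\<bar> \<le> \<delta> / \<kappa>)"
proof -
  have "\<exists>\<kappa> r. \<kappa> > 0 \<and> r > 0 \<and> (\<forall>x. \<bar>x - y\<bar> < r \<longrightarrow> \<kappa> * \<bar>x - y\<bar> \<le> \<bar>z x\<bar>)" if y: "y \<in> Z" for y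
  proof -
    obtain d where d: "d \<noteq> 0" "(z has_real_derivative d) (at y)" using der[OF y] by blast
    have "z y = 0" by (rule prim_extremum[OF c le]) (use y in \<open>auto simp: Z_def\<close>)
    then obtain \<kappa> r where "\<kappa> > 0" "r > 0" "\<forall>x. \<bar>x - y\<bar> < r \<longrightarrow> \<kappa> * \<bar>x - y\<bar> \<le> \<bar>z x\<bar>"
      by (rule simple_zero[OF d(2,1)])
    then show ?thesis by blast
  qed
  then obtain K r where Kr: "\<And>y. y \<in> Z \<Longrightarrow> K y > 0" "\<And>y. y \<in> Z \<Longrightarrow> r y > 0"
    "\<And>y x. y \<in> Z \<Longrightarrow> \<bar>x - y\<bar> < r y \<Longrightarrow> K y * \<bar>x - y\<bar> \<le> \<bar>z x\<bar>" by metis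
  define \<kappa> where "\<kappa> = Min (insert 1 (K ` Z))"
  have \<kappa>: "\<kappa> > 0" "\<And>y. y \<in> Z \<Longrightarrow> \<kappa> \<le> K y" using fin Kr(1) by (auto simp: \<kappa>_def)
  define S where "S = {0..1} - (\<Union>y\<in>Z. ball y (r y))"
  have S: "compact S" unfolding S_def by (intro compact_diff open_UN) auto
  have zi: "integrable lebO z" by (rule Linf_integrable[OF Linf_continuous[OF c]])
  have less: "\<bar>prim z x\<bar> < \<alpha>" if x: "x \<in> S" for x
  proof (rule ccontr)
    assume "\<not> \<bar>prim z x\<bar> < \<alpha>"
    then have eq: "\<bar>prim z x\<bar> = \<alpha>" using le[of x] x by (auto simp: S_def)
    then have "x \<noteq> 0" "x \<noteq> 1" using alpha z1 by auto
    then have "x \<in> Z" using x eq by (auto simp: S_def Z_def)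
    then show False using x Kr(2)[of x] by (auto simp: S_def)
  qed
  obtain m where m: "m < \<alpha>" "\<And>x. x \<in> S \<Longrightarrow> \<bar>prim z x\<bar> \<le> m"
  proof (cases "S = {}")
    case True
    then show thesis using alpha that[of 0] by simp
  next
    case False
    have "continuous_on S (\<lambda>x. \<bar>prim z x\<bar>)"
      by (intro continuous_intros continuous_on_subset[OF prim_continuous[OF zi]]) (auto simp: S_def)
    then obtain x0 where "x0 \<in> S" "\<forall>x\<in>S. \<bar>prim z x\<bar> \<le> \<bar>prim z x0\<bar>"
      using continuous_attains_sup[OF S False] by blast
    then show thesis using that[of "\<bar>prim z x0\<bar>"] less by auto
  qed
  define \<delta>\<^sub>0 where "\<delta>\<^sub>0 = (\<alpha> - m) / 2"
  have \<delta>0: "\<delta>\<^sub>0 > 0" using m by (simp add: \<delta>\<^sub>0_def)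
  have near: "\<exists>y\<in>Z. \<bar>x - y\<bar> \<le> \<delta> / \<kappa>"
    if \<zeta>c: "continuous_on {0..1} \<zeta>" and \<zeta>z: "\<And>y. y \<in> {0..1} \<Longrightarrow> \<bar>\<zeta> y - z y\<bar> \<le> \<delta>" and \<delta>: "\<delta> \<le> \<delta>\<^sub>0"
      and \<zeta>le: "\<And>y. y \<in> {0..1} \<Longrightarrow> \<bar>prim \<zeta> y\<bar> \<le> \<alpha>" and x: "x \<in> \<Omega>" "\<bar>prim \<zeta> x\<bar> = \<alpha>" for \<zeta> \<delta> x
  proof -
    have xI: "x \<in> {0..1}" using x by auto
    have \<zeta>i: "integrable lebO \<zeta>" by (rule Linf_integrable[OF Linf_continuous[OF \<zeta>c]])
    have \<delta>p: "\<delta> \<ge> 0" using \<zeta>z[of 0] by auto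
    have "\<bar>prim (\<lambda>y. \<zeta> y - z y) x\<bar> \<le> \<delta> * x"
      by (rule prim_abs_bound) (use \<zeta>i zi xI \<zeta>z in \<open>auto intro!: AE_lebO_I\<close>)
    also have "\<dots> \<le> \<delta>" using xI \<delta>p by (simp add: mult_left_le)
    finally have "\<bar>prim \<zeta> x - prim z x\<bar> \<le> \<delta>" using prim_minus[OF \<zeta>i zi, of x] xI by simp
    then have "\<bar>prim z x\<bar> > m" using x(2) \<delta> m(1) by (simp add: \<delta>\<^sub>0_def)
    then have "x \<notin> S" using m(2)[of x] by force
    then obtain y where y: "y \<in> Z" "\<bar>x - y\<bar> < r y" using xI by (auto simp: S_def dist_real_def abs_minus_commute)
    have "\<zeta> x = 0" by (rule prim_extremum[OF \<zeta>c \<zeta>le x])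
    then have "\<bar>z x\<bar> \<le> \<delta>" using \<zeta>z[OF xI] by simp
    then have "K y * \<bar>x - y\<bar> \<le> \<delta>" using Kr(3)[OF y] by linarith
    moreover have "\<kappa> * \<bar>x - y\<bar> \<le> K y * \<bar>x - y\<bar>" using \<kappa>(2)[OF y(1)] by (intro mult_right_mono) auto
    ultimately have "\<kappa> * \<bar>x - y\<bar> \<le> \<delta>" by linarith
    then show ?thesis using y(1) \<kappa>(1) by (auto simp: pos_le_divide_eq mult.commute)
  qed
  show thesis
  proof (rule that[OF \<kappa>(1) \<delta>0], intro allI impI)
    fix \<zeta> \<delta> x
    assume "continuous_on {0..1} \<zeta> \<and> (\<forall>y\<in>{0..1}. \<bar>\<zeta> y - z y\<bar> \<le> \<delta> \<and> \<bar>prim \<zeta> y\<bar> \<le> \<alpha>) \<and> \<delta> \<le> \<delta>\<^sub>0 \<and>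
      x \<in> \<Omega> \<and> \<bar>prim \<zeta> x\<bar> = \<alpha>"
    then show "\<exists>y\<in>Z. \<bar>x - y\<bar> \<le> \<delta> / \<kappa>" by (intro near[of \<zeta> \<delta> x]) simp_all
  qed
qed

subsection \<open>Decomposition into intervals\<close>

text \<open>The pairs of neighbouring points of \<open>Z\<close> together with the end points of the interval.\<close>

definition gaps :: "real set \<Rightarrow> (real \<times> real) set"
  where "gaps Z = {(s, t). s \<in> insert 0 (insert 1 Z) \<and> t \<in> insert 0 (insert 1 Z) \<and> s < t \<and> {s<..<t} \<inter> Z = {}}"

lemma gaps_finite: "finite Z \<Longrightarrow> finite (gaps Z)"
  by (rule finite_subset[of _ "insert 0 (insert 1 Z) \<times> insert 0 (insert 1 Z)"]) (auto simp: gaps_def)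

lemma gaps_props:
  assumes "Z \<subseteq> \<Omega>" "(s, t) \<in> gaps Z" shows "0 \<le> s" "s < t" "t \<le> 1" "{s<..<t} \<inter> Z = {}"
  using assms by (force simp: gaps_def)+

lemma gaps_cover:
  assumes fin: "finite Z" and x: "x \<in> \<Omega>" "x \<notin> Z" obtains s t where "(s, t) \<in> gaps Z" "x \<in> {s<..<t}"
proof -
  define P where "P = insert 0 (insert 1 Z)"
  define s where "s = Max {y \<in> P. y < x}"
  define t where "t = Min {y \<in> P. x < y}"
  have f: "finite {y \<in> P. y < x}" "finite {y \<in> P. x < y}" using fin by (auto simp: P_def)
  have ne: "0 \<in> {y \<in> P. y < x}" "1 \<in> {y \<in> P. x < y}" using x by (auto simp: P_def)
  have s: "s \<in> {y \<in> P. y < x}" unfolding s_def using f ne by (intro Max_in) auto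
  have t: "t \<in> {y \<in> P. x < y}" unfolding t_def using f ne by (intro Min_in) auto
  have "{s<..<t} \<inter> Z = {}"
  proof (rule ccontr)
    assume "{s<..<t} \<inter> Z \<noteq> {}"
    then obtain y where y: "y \<in> Z" "s < y" "y < t" by auto
    then have "y \<noteq> x" using x by auto
    then consider "y < x" | "x < y" by linarith
    then show False
    proof cases
      case 1
      then have "y \<le> s" unfolding s_def using y f by (intro Max_ge) (auto simp: P_def)
      then show False using y by simp
    next
      case 2
      then have "t \<le> y" unfolding t_def using y f by (intro Min_le) (auto simp: P_def)
      then show False using y by simp
    qed
  qed
  then show thesis using s t by (intro that[of s t]) (auto simp: gaps_def P_def)
qed

lemma integral_indicator_le:
  assumes "c \<le> d" shows "(LINT x|lebO. indicat_real {c..d} x) \<le> d - c"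
proof -
  have "(LINT x|lebO. indicat_real {c..d} x) = measure lebO ({c..d} \<inter> \<Omega>)"
    by (simp add: Int_commute)
  also have "\<dots> = measure lebesgue ({c..d} \<inter> \<Omega>)"
    by (rule measure_restrict_space) auto
  also have "\<dots> \<le> measure lebesgue {c..d}"
    by (rule measure_mono_fmeasurable) auto
  finally show ?thesis using assms by simp
qed

lemma L1_on_interval:
  assumes r: "r \<in> Linf" "AE x in lebO. \<bar>r x\<bar> \<le> B" and B: "B \<ge> 0" and \<eta>: "\<eta> \<ge> 0" and K: "K \<ge> 0"
    and k: "AE x in lebO. x \<in> {s + \<eta><..<t - \<eta>} \<longrightarrow> \<bar>r x\<bar> \<le> K"
  shows "(LINT x|lebO. indicator {s<..<t} x * \<bar>r x\<bar>) \<le> K + 2 * B * \<eta>"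
proof -
  have m: "indicat_real {s<..<t} \<in> borel_measurable lebO" "indicat_real {u..v} \<in> borel_measurable lebO" for u v
    by (auto intro: lebO_measurable_borel)
  have i: "integrable lebO (indicat_real {u..v})" for u v
    by (rule lebO_integrable_bounded[OF m(2), where B=1]) (auto simp: indicator_def)
  have ri: "integrable lebO (\<lambda>x. indicator {s<..<t} x * \<bar>r x\<bar>)"
    by (rule lebO_integrable_bounded[of _ B]) (use r(2) B m(1) Linf_measurable[OF r(1)] in \<open>auto simp: indicator_def elim: eventually_mono\<close>)
  have "(LINT x|lebO. indicator {s<..<t} x * \<bar>r x\<bar>) \<le> (LINT x|lebO. K + B * (indicat_real {s..s+\<eta>} x + indicat_real {t-\<eta>..t} x))"
  proof (rule integral_mono_AE[OF ri])
    show "integrable lebO (\<lambda>x. K + B * (indicat_real {s..s+\<eta>} x + indicat_real {t-\<eta>..t} x))" using i by simp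
    show "AE x in lebO. indicator {s<..<t} x * \<bar>r x\<bar> \<le> K + B * (indicat_real {s..s+\<eta>} x + indicat_real {t-\<eta>..t} x)"
      using r(2) k
    proof eventually_elim
      case (elim x)
      then show ?case using K B \<eta> by (auto simp: indicator_def)
    qed
  qed
  also have "\<dots> = K + B * ((LINT x|lebO. indicat_real {s..s+\<eta>} x) + (LINT x|lebO. indicat_real {t-\<eta>..t} x))"
    using i by (simp del: integral_indicator)
  also have "\<dots> \<le> K + B * (\<eta> + \<eta>)"
    using integral_indicator_le[of s "s + \<eta>"] integral_indicator_le[of "t - \<eta>" t] \<eta> B
    by (intro add_left_mono mult_left_mono add_mono) auto
  finally show ?thesis by simp
qed

lemma L1_by_gaps:
  assumes r: "r \<in> Linf" and Z: "finite Z"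
  shows "(LINT x|lebO. \<bar>r x\<bar>) \<le> (\<Sum>(s, t)\<in>gaps Z. (LINT x|lebO. indicator {s<..<t} x * \<bar>r x\<bar>))"
proof -
  note fin = gaps_finite[OF Z]
  obtain B where B: "B \<ge> 0" "AE x in lebO. \<bar>r x\<bar> \<le> B" using r by (rule LinfE)
  have m: "indicat_real {s<..<t} \<in> borel_measurable lebO" for s t by (auto intro: lebO_measurable_borel)
  have ri: "integrable lebO (\<lambda>x. indicator {s<..<t} x * \<bar>r x\<bar>)" for s t
    by (rule lebO_integrable_bounded[of _ B]) (use B m Linf_measurable[OF r] in \<open>auto simp: indicator_def elim: eventually_mono\<close>)
  have "(LINT x|lebO. \<bar>r x\<bar>) \<le> (LINT x|lebO. (\<Sum>(s, t)\<in>gaps Z. indicator {s<..<t} x * \<bar>r x\<bar>))"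
  proof (rule integral_mono_AE)
    show "integrable lebO (\<lambda>x. \<Sum>(s, t)\<in>gaps Z. indicator {s<..<t} x * \<bar>r x\<bar>)"
      unfolding split_beta by (rule Bochner_Integration.integrable_sum) (rule ri)
    show "AE x in lebO. \<bar>r x\<bar> \<le> (\<Sum>(s, t)\<in>gaps Z. indicator {s<..<t} x * \<bar>r x\<bar>)"
      using lebO_ae_finite[OF Z] AE_space
    proof eventually_elim
      case (elim x)
      then obtain s t where st: "(s, t) \<in> gaps Z" "x \<in> {s<..<t}" using gaps_cover[OF Z, of x] by auto
      have "\<bar>r x\<bar> = (case (s, t) of (s, t) \<Rightarrow> indicator {s<..<t} x * \<bar>r x\<bar>)" using st(2) by simp
      also have "\<dots> \<le> (\<Sum>(s, t)\<in>gaps Z. indicator {s<..<t} x * \<bar>r x\<bar>)"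
        by (rule member_le_sum[OF st(1) _ fin]) (auto split: prod.split)
      finally show ?case .
    qed
  qed (use Linf_integrable[OF r] in auto)
  also have "\<dots> = (\<Sum>(s, t)\<in>gaps Z. (LINT x|lebO. indicator {s<..<t} x * \<bar>r x\<bar>))"
    unfolding split_beta by (rule Bochner_Integration.integral_sum) (rule ri)
  finally show ?thesis .
qed

subsection \<open>A priori bounds\<close>

lemma continuous_AE_bound:
  assumes c: "continuous_on {0..1} f" and b: "AE x in lebO. \<bar>f x\<bar> \<le> B" and B: "B \<ge> 0" and x: "x \<in> {0..1::real}"
  shows "\<bar>f x\<bar> \<le> (B::real)"
proof -
  have "AE x in lebO. f x = max (- B) (min B (f x))"
    using b by eventually_elim auto
  then have "f x = max (- B) (min B (f x))"
    using x by (intro lebO_ae_eq_continuous[of f "\<lambda>x. max (- B) (min B (f x))"] c continuous_intros)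
  then show ?thesis using B by auto
qed

lemma quadratic_bound:
  fixes e b d :: real
  assumes "e\<^sup>2 \<le> b * e + d" "e \<ge> 0" "b \<ge> 0" "d \<ge> 0" shows "e \<le> b + sqrt d"
proof (rule ccontr)
  assume "\<not> e \<le> b + sqrt d"
  then have 1: "sqrt d < e - b" by simp
  have "0 \<le> sqrt d" using assms by simp
  then have "d < (e - b)\<^sup>2" using 1 real_sqrt_pow2[OF assms(4)] power_strict_mono[of "sqrt d" "e - b" 2] by linarith
  also have "(e - b)\<^sup>2 = (e - b) * (e - b)" by (simp add: power2_eq_square)
  also have "\<dots> \<le> e * (e - b)" using 1 \<open>0 \<le> sqrt d\<close> assms(3) by (intro mult_right_mono) linarith+
  finally show False using assms(1) by (simp add: power2_eq_square algebra_simps)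
qed

context elliptic
begin

lemma FE_error_AE:
  obtains C where "C > 0"
    "\<And>l x f F u u\<^sub>h. is_partition l x \<Longrightarrow> f \<in> Linf \<Longrightarrow> AE s in lebO. \<bar>f s\<bar> \<le> F \<Longrightarrow> F \<ge> 0 \<Longrightarrow>
      is_sol H10 f u \<Longrightarrow> is_sol (FE_space l x) f u\<^sub>h \<Longrightarrow>
      AE t in lebO. \<bar>u t - u\<^sub>h t\<bar> \<le> C * F * (mesh_width l x)\<^sup>2"
proof -
  obtain C where C: "C > 0"
    "\<And>l x f F u c u\<^sub>h t. is_partition l x \<Longrightarrow> f \<in> Linf \<Longrightarrow> AE s in lebO. \<bar>f s\<bar> \<le> F \<Longrightarrow> F \<ge> 0 \<Longrightarrow>
      bvp (\<lambda>s. - prim f s) u c \<Longrightarrow> is_sol (FE_space l x) f u\<^sub>h \<Longrightarrow> t \<in> {0..1} \<Longrightarrow>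
      \<bar>u t - u\<^sub>h t\<bar> \<le> C * F * (mesh_width l x)\<^sup>2"
    using FE_error by blast
  show thesis
  proof (rule that[OF C(1)])
    fix l x f F u u\<^sub>h
    assume p: "is_partition l x" and f: "f \<in> Linf" "AE s in lebO. \<bar>f s\<bar> \<le> F" "F \<ge> 0"
      and u: "is_sol H10 f u" and uh: "is_sol (FE_space l x) f u\<^sub>h"
    obtain v c where v: "bvp (\<lambda>s. - prim f s) v c" using bvp_exists[OF neg_prim_Linf[OF f(1)]] .
    have "AE t in lebO. u t = v t" by (rule is_sol_AE_eq[OF adm_H10 u bvp_is_sol[OF f(1) v]])
    moreover have "AE t in lebO. \<bar>v t - u\<^sub>h t\<bar> \<le> C * F * (mesh_width l x)\<^sup>2"
      by (rule AE_lebO_I, rule C(2)[OF p f v uh]) auto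
    ultimately show "AE t in lebO. \<bar>u t - u\<^sub>h t\<bar> \<le> C * F * (mesh_width l x)\<^sup>2" by eventually_elim simp
  qed
qed

end

context control_problem
begin

text \<open>Comparison with the control zero bounds the total variation and the discrete state. The mean of
  the control is recovered from the continuous state, whose distance to the discrete one is \<open>h\<^sup>2\<close> times a bound of the control;
  this is absorbed for small \<open>h\<close>.\<close>

lemma control_bound:
  obtains Q h\<^sub>1 where "Q \<ge> 0" "h\<^sub>1 > 0"
    "\<And>l x q. is_partition l x \<Longrightarrow> mesh_width l x \<le> h\<^sub>1 \<Longrightarrow> opt (FE_space l x) q \<Longrightarrow> AE t in lebO. \<bar>q t\<bar> \<le> Q"
proof -
  obtain CE where CE: "CE > 0"
    "\<And>l x f F u u\<^sub>h. is_partition l x \<Longrightarrow> f \<in> Linf \<Longrightarrow> AE s in lebO. \<bar>f s\<bar> \<le> F \<Longrightarrow> F \<ge> 0 \<Longrightarrow>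
      is_sol H10 f u \<Longrightarrow> is_sol (FE_space l x) f u\<^sub>h \<Longrightarrow>
      AE t in lebO. \<bar>u t - u\<^sub>h t\<bar> \<le> CE * F * (mesh_width l x)\<^sup>2"
    using FE_error_AE by blast
  obtain \<phi> C m where \<phi>: "\<phi> \<in> Linf" "C \<ge> 0" "m > 0" "(LINT x|lebO. \<phi> x) = m" "\<And>x. x \<in> \<Omega> \<Longrightarrow> \<phi> x \<ge> 0"
    and \<phi>0: "\<And>x. x \<in> \<Omega> \<Longrightarrow> x \<le> 0 + (1 - 0) / 4 \<or> 1 - (1 - 0) / 4 \<le> x \<Longrightarrow> \<phi> x = 0"
    and \<phi>C: "\<And>f u. is_sol H10 f u \<Longrightarrow> \<bar>L2_inner f \<phi>\<bar> \<le> C * norm_L2 u"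
    by (rule local_mean_weight[of 0 1]) auto
  define n where "n = norm_L2 u\<^sub>d"
  define T where "T = n\<^sup>2 / (2 * \<alpha>)"
  have nT: "n \<ge> 0" "T \<ge> 0" using alpha by (auto simp: n_def T_def)
  define h\<^sub>1 where "h\<^sub>1 = min 1 (sqrt (m / (2 * C * CE + 1)))"
  have cc: "2 * C * CE + 1 > 0" using \<phi>(2) CE(1) by (simp add: add_nonneg_pos)
  have h1: "h\<^sub>1 > 0" using \<phi>(3) cc by (simp add: h\<^sub>1_def)
  define Qk where "Qk = 2 / m * (T * m + C * (2 * n + CE * T))"
  have Qk: "Qk \<ge> 0" unfolding Qk_def using nT \<phi> CE by (intro mult_nonneg_nonneg add_nonneg_nonneg) auto
  have "AE t in lebO. \<bar>q t\<bar> \<le> Qk + T"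
    if p: "is_partition l x" and h: "mesh_width l x \<le> h\<^sub>1" and q: "opt (FE_space l x) q" for l x q
  proof -
    let ?W = "FE_space l x" and ?h = "mesh_width l x"
    note W = adm_FE[OF p]
    note qB = opt_BV[OF q] and qL = BV_Linf[OF opt_BV[OF q]]
    define u where "u = sol ?W q"
    have u: "is_sol ?W q u" unfolding u_def by (rule sol_op_is_sol[OF W qL])
    have uL: "u \<in> L2" "(\<lambda>x. u x - u\<^sub>d x) \<in> L2" using is_sol_L2[OF W u] ud by (auto intro: L2_diff Linf_L2)
    \<comment> \<open>Comparison with the control zero.\<close>
    have "norm_L2 (\<lambda>x. sol ?W (\<lambda>x. 0) x - u\<^sub>d x) = n"
    proof -
      have s0: "is_sol ?W (\<lambda>x. 0) (sol ?W (\<lambda>x. 0))" by (rule sol_op_is_sol[OF W Linf_const])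
      have "is_sol ?W (\<lambda>x. 0) (\<lambda>x. 0)" using is_sol_diff[OF W s0 s0] by simp
      from is_sol_AE_eq[OF W s0 this] have "AE x in lebO. sol ?W (\<lambda>x. 0) x - u\<^sub>d x = 0 - u\<^sub>d x"
        by eventually_elim simp
      then have "norm_L2 (\<lambda>x. sol ?W (\<lambda>x. 0) x - u\<^sub>d x) = norm_L2 (\<lambda>x. 0 - u\<^sub>d x)"
        by (rule norm_L2_cong) (use is_sol_Linf[OF W s0] ud in \<open>auto intro!: Linf_measurable Linf_diff Linf_const\<close>)
      then show ?thesis unfolding n_def norm_L2_minus[of "\<lambda>x. 0"] by simp
    qed
    then have "(norm_L2 (\<lambda>x. u x - u\<^sub>d x))\<^sup>2 / 2 + \<alpha> * norm_deriv_M q \<le> n\<^sup>2 / 2"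
      using q BV_zero unfolding optimal_control_def cost_def u_def by fastforce
    moreover have "0 \<le> \<alpha> * norm_deriv_M q" using norm_deriv_M_nonneg[OF qB] alpha by simp
    ultimately have 1: "(norm_L2 (\<lambda>x. u x - u\<^sub>d x))\<^sup>2 \<le> n\<^sup>2" and 2: "\<alpha> * norm_deriv_M q \<le> n\<^sup>2 / 2"
      using zero_le_power2[of "norm_L2 (\<lambda>x. u x - u\<^sub>d x)"] by linarith+
    have NT: "norm_deriv_M q \<le> T" using 2 alpha by (simp add: T_def field_simps)
    have "norm_L2 (\<lambda>x. u x - u\<^sub>d x) \<le> n" using 1 nT(1) by (rule power2_le_imp_le)
    then have un: "norm_L2 u \<le> 2 * n"
      using norm_L2_triangle[OF uL(2) Linf_L2[OF ud]] by (simp add: n_def)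
    obtain k where k: "AE t in lebO. \<bar>q t - k\<bar> \<le> norm_deriv_M q" using BV_oscillation[OF qB] .
    then have kT: "AE t in lebO. \<bar>q t - k\<bar> \<le> T" by eventually_elim (use NT in linarith)
    then have qF: "AE t in lebO. \<bar>q t\<bar> \<le> \<bar>k\<bar> + T" by eventually_elim linarith
    obtain U where U: "is_sol H10 q U" using sol_op_is_sol[OF adm_H10 qL] by blast
    have "norm_L2 (\<lambda>t. U t - u t) \<le> CE * (\<bar>k\<bar> + T) * ?h\<^sup>2"
      by (rule norm_L2_bounded)
        (use CE(2)[OF p qL qF _ U u] nT CE(1) is_sol_Linf[OF W u] is_sol_Linf[OF adm_H10 U] in \<open>auto intro!: Linf_measurable Linf_diff\<close>)
    moreover have "norm_L2 U \<le> norm_L2 (\<lambda>t. U t - u t) + norm_L2 u"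
      using norm_L2_triangle[OF L2_diff[OF is_sol_L2[OF adm_H10 U] uL(1)] uL(1)] by simp
    ultimately have Un: "norm_L2 U \<le> 2 * n + CE * (\<bar>k\<bar> + T) * ?h\<^sup>2" using un by linarith
    have hm: "?h > 0" "?h\<^sup>2 \<le> 1" "?h\<^sup>2 * (2 * C * CE) \<le> m"
    proof -
      show h0: "?h > 0" by (rule mesh_width_pos[OF p])
      show "?h\<^sup>2 \<le> 1" using h0 mesh_width_le_1[OF p] by (simp add: power_le_one)
      have "?h \<le> sqrt (m / (2 * C * CE + 1))" using h by (simp add: h\<^sub>1_def)
      then have "?h\<^sup>2 \<le> (sqrt (m / (2 * C * CE + 1)))\<^sup>2" using h0 by (intro power_mono) auto
      also have "\<dots> = m / (2 * C * CE + 1)" using \<phi>(3) cc by simp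
      finally have "?h\<^sup>2 * (2 * C * CE + 1) \<le> m" using cc by (simp add: pos_le_divide_eq)
      then show "?h\<^sup>2 * (2 * C * CE) \<le> m" 
        using zero_le_power2[of ?h] unfolding distrib_left mult_1_right by linarith
    qed
    have "\<bar>k\<bar> * m \<le> T * m + \<bar>L2_inner q \<phi>\<bar>"
    proof -
      have i: "integrable lebO (\<lambda>x. (q x - k) * \<phi> x)" "integrable lebO (\<lambda>x. k * \<phi> x)" "integrable lebO (\<lambda>x. T * \<phi> x)"
        using \<phi>(1) qL by (auto intro!: Linf_integrable Linf_mult Linf_diff)
      have "L2_inner q \<phi> = (LINT x|lebO. (q x - k) * \<phi> x + k * \<phi> x)" by (simp add: L2_inner_def algebra_simps)
      also have "\<dots> = (LINT x|lebO. (q x - k) * \<phi> x) + k * m" using i \<phi>(4) by simp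
      finally have eq: "k * m = L2_inner q \<phi> - (LINT x|lebO. (q x - k) * \<phi> x)" by simp
      have "\<bar>LINT x|lebO. (q x - k) * \<phi> x\<bar> \<le> (LINT x|lebO. \<bar>(q x - k) * \<phi> x\<bar>)" by (rule integral_abs_bound)
      also have "\<dots> \<le> (LINT x|lebO. T * \<phi> x)"
      proof (rule integral_mono_AE)
        show "AE x in lebO. \<bar>(q x - k) * \<phi> x\<bar> \<le> T * \<phi> x"
          using kT AE_space by eventually_elim (use \<phi>(5) in \<open>auto simp: abs_mult intro!: mult_right_mono\<close>)
      qed (use i in auto)
      also have "\<dots> = T * m" using \<phi>(4) by simp
      finally have "\<bar>k * m\<bar> \<le> \<bar>L2_inner q \<phi>\<bar> + T * m" unfolding eq by linarith
      then show ?thesis using \<phi>(3) by (simp add: abs_mult)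
    qed
    also have "\<bar>L2_inner q \<phi>\<bar> \<le> C * (2 * n + CE * (\<bar>k\<bar> + T) * ?h\<^sup>2)"
      using \<phi>C[OF U] mult_left_mono[OF Un \<phi>(2)] by linarith
    also have "C * (2 * n + CE * (\<bar>k\<bar> + T) * ?h\<^sup>2) = C * (2 * n) + \<bar>k\<bar> * (?h\<^sup>2 * (2 * C * CE)) / 2 + C * CE * T * ?h\<^sup>2"
      by (simp add: field_simps)
    also have "\<dots> \<le> C * (2 * n) + \<bar>k\<bar> * m / 2 + C * CE * T * 1"
      using hm \<phi>(2) CE(1) nT by (intro add_mono mult_left_mono divide_right_mono) auto
    finally have "\<bar>k\<bar> * m / 2 \<le> T * m + C * (2 * n + CE * T)" by (simp add: algebra_simps)
    then have "\<bar>k\<bar> \<le> Qk" using \<phi>(3) by (simp add: Qk_def field_simps)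
    with qF show ?thesis by (auto elim!: eventually_mono)
  qed
  then show thesis using Qk nT h1 by (intro that[of "Qk + T" h\<^sub>1]) auto
qed

subsection \<open>Convergence of the states\<close>

text \<open>Adding the two variational inequalities, each tested with the other control.\<close>

lemma basic_estimate:
  fixes l x q\<^sub>h q
  defines "W \<equiv> FE_space l x" and "h \<equiv> mesh_width l x"
  assumes p: "is_partition l x" and q: "opt H10 q" and qh: "opt W q\<^sub>h"
    and z: "is_sol H10 (\<lambda>x. sol H10 q x - u\<^sub>d x) z"
    and e1: "norm_L2 (\<lambda>t. sol H10 q t - sol W q t) \<le> E1"
    and e2: "AE t in lebO. \<bar>z t - sol W (\<lambda>x. sol H10 q x - u\<^sub>d x) t\<bar> \<le> E2"
  shows "(norm_L2 (\<lambda>t. sol W q\<^sub>h t - sol H10 q t))\<^sup>2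
    \<le> E1 * norm_L2 (\<lambda>t. sol W q\<^sub>h t - sol H10 q t) + E2 * (LINT t|lebO. \<bar>q\<^sub>h t - q t\<bar>)"
proof -
  note W = adm_FE[OF p, folded W_def]
  note qL = BV_Linf[OF opt_BV[OF q]] and qhL = BV_Linf[OF opt_BV[OF qh]]
  define u where "u = sol H10 q"
  define u\<^sub>h where "u\<^sub>h = sol W q\<^sub>h"
  define v\<^sub>h where "v\<^sub>h = sol W q"
  have u: "is_sol H10 q u" unfolding u_def by (rule sol_op_is_sol[OF adm_H10 qL])
  have uh: "is_sol W q\<^sub>h u\<^sub>h" unfolding u\<^sub>h_def by (rule sol_op_is_sol[OF W qhL])
  have vh: "is_sol W q v\<^sub>h" unfolding v\<^sub>h_def by (rule sol_op_is_sol[OF W qL])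
  have L: "u \<in> Linf" "u\<^sub>h \<in> Linf" "v\<^sub>h \<in> Linf"
    by (rule is_sol_Linf[OF adm_H10 u] is_sol_Linf[OF W uh] is_sol_Linf[OF W vh])+
  have dL: "(\<lambda>x. u x - u\<^sub>d x) \<in> Linf" "(\<lambda>x. u\<^sub>h x - u\<^sub>d x) \<in> Linf" by (intro Linf_diff L ud)+
  define zt where "zt = sol W (\<lambda>x. u x - u\<^sub>d x)"
  define zh where "zh = sol W (\<lambda>x. u\<^sub>h x - u\<^sub>d x)"
  have zt: "is_sol W (\<lambda>x. u x - u\<^sub>d x) zt" unfolding zt_def by (rule sol_op_is_sol[OF W dL(1)])
  have zh: "is_sol W (\<lambda>x. u\<^sub>h x - u\<^sub>d x) zh" unfolding zh_def by (rule sol_op_is_sol[OF W dL(2)])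
  have zL: "z \<in> Linf" "zt \<in> Linf" "zh \<in> Linf"
    by (rule is_sol_Linf[OF adm_H10 z] is_sol_Linf[OF W zt] is_sol_Linf[OF W zh])+
  note two = L[THEN Linf_L2] zL[THEN Linf_L2] qL[THEN Linf_L2] qhL[THEN Linf_L2]
  define r where "r t = q\<^sub>h t - q t" for t
  have rL: "r \<in> Linf" unfolding r_def[abs_def] by (intro Linf_diff qL qhL)
  define \<epsilon> where "\<epsilon> t = u\<^sub>h t - u t" for t
  have \<epsilon>2: "\<epsilon> \<in> L2" unfolding \<epsilon>_def[abs_def] by (intro L2_diff two)
  have "L2_inner zh r \<le> L2_inner z r"
  proof -
    have "- \<alpha> * norm_deriv_M q\<^sub>h \<le> L2_inner z q\<^sub>h" by (rule opt_variational[OF adm_H10 q z opt_BV[OF qh]])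
    moreover have "L2_inner z q = - \<alpha> * norm_deriv_M q" by (rule opt_pairing[OF adm_H10 q z])
    moreover have "- \<alpha> * norm_deriv_M q \<le> L2_inner zh q"
      by (rule opt_variational[OF W qh zh[unfolded u\<^sub>h_def] opt_BV[OF q]])
    moreover have "L2_inner zh q\<^sub>h = - \<alpha> * norm_deriv_M q\<^sub>h" by (rule opt_pairing[OF W qh zh[unfolded u\<^sub>h_def]])
    moreover have "L2_inner zh r = L2_inner zh q\<^sub>h - L2_inner zh q" "L2_inner z r = L2_inner z q\<^sub>h - L2_inner z q"
      unfolding r_def[abs_def] using two by (auto intro!: L2_inner_diff_right)
    ultimately show ?thesis by linarith
  qed
  moreover have "L2_inner zh r - L2_inner zt r = L2_inner \<epsilon> \<epsilon> + L2_inner \<epsilon> (\<lambda>t. u t - v\<^sub>h t)"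
  proof -
    have 1: "is_sol W \<epsilon> (\<lambda>t. zh t - zt t)"
      using is_sol_diff[OF W zh zt dL(2,1)] by (simp add: \<epsilon>_def[abs_def])
    have 2: "is_sol W r (\<lambda>t. u\<^sub>h t - v\<^sub>h t)"
      using is_sol_diff[OF W uh vh qhL qL] by (simp add: r_def[abs_def])
    have "L2_inner zh r - L2_inner zt r = L2_inner r (\<lambda>t. zh t - zt t)"
      using L2_inner_diff[OF two(6,5) Linf_L2[OF rL]] by (simp add: L2_inner_commute[of r])
    also have "\<dots> = L2_inner \<epsilon> (\<lambda>t. u\<^sub>h t - v\<^sub>h t)" by (rule is_sol_sym[OF W 2 1])
    also have "(\<lambda>t. u\<^sub>h t - v\<^sub>h t) = (\<lambda>t. \<epsilon> t + (u t - v\<^sub>h t))" by (simp add: \<epsilon>_def)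
    also have "L2_inner \<epsilon> \<dots> = L2_inner \<epsilon> \<epsilon> + L2_inner \<epsilon> (\<lambda>t. u t - v\<^sub>h t)"
      by (rule L2_inner_add_right) (use \<epsilon>2 two in \<open>auto intro: L2_diff\<close>)
    finally show ?thesis .
  qed
  moreover have "- L2_inner \<epsilon> (\<lambda>t. u t - v\<^sub>h t) \<le> E1 * norm_L2 \<epsilon>"
  proof -
    have "\<bar>L2_inner \<epsilon> (\<lambda>t. u t - v\<^sub>h t)\<bar> \<le> norm_L2 \<epsilon> * norm_L2 (\<lambda>t. u t - v\<^sub>h t)"
      by (rule L2_inner_CS[OF \<epsilon>2]) (use two in \<open>auto intro: L2_diff\<close>)
    also have "\<dots> \<le> norm_L2 \<epsilon> * E1" using e1 by (intro mult_left_mono) (auto simp: u_def v\<^sub>h_def)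
    finally show ?thesis by (simp add: mult.commute abs_le_iff)
  qed
  moreover have "L2_inner z r - L2_inner zt r \<le> E2 * (LINT t|lebO. \<bar>r t\<bar>)"
  proof -
    have i: "integrable lebO (\<lambda>t. (z t - zt t) * r t)" "integrable lebO (\<lambda>t. E2 * \<bar>r t\<bar>)"
      using zL rL by (auto intro!: Linf_integrable Linf_mult Linf_diff integrable_mult_right integrable_abs)
    have "L2_inner z r - L2_inner zt r = (LINT t|lebO. (z t - zt t) * r t)"
      using L2_inner_diff[OF two(4,5) Linf_L2[OF rL]] by (simp add: L2_inner_def)
    also have "\<dots> \<le> (LINT t|lebO. E2 * \<bar>r t\<bar>)"
    proof (rule integral_mono_AE[OF i])
      show "AE t in lebO. (z t - zt t) * r t \<le> E2 * \<bar>r t\<bar>"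
        using e2
      proof eventually_elim
        case (elim t)
        have "(z t - zt t) * r t \<le> \<bar>z t - zt t\<bar> * \<bar>r t\<bar>" unfolding abs_mult[symmetric] by (rule abs_ge_self)
        also have "\<dots> \<le> E2 * \<bar>r t\<bar>" using elim by (intro mult_right_mono) (auto simp: zt_def u_def)
        finally show ?case .
      qed
    qed
    finally show ?thesis by simp
  qed
  ultimately have "L2_inner \<epsilon> \<epsilon> \<le> E1 * norm_L2 \<epsilon> + E2 * (LINT t|lebO. \<bar>r t\<bar>)" by linarith
  then show ?thesis unfolding norm_L2_square[symmetric] \<epsilon>_def[abs_def] r_def u_def u\<^sub>h_def .
qed

text \<open>With a weight supported where the right-hand side is constant, its mean is a multiple of this
  constant.\<close>

lemma local_constant_bound:
  assumes st: "0 \<le> s" "s < t" "t \<le> 1"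
  obtains c where "c \<ge> 0"
    "\<And>f u k. f \<in> Linf \<Longrightarrow> is_sol H10 f u \<Longrightarrow>
      AE x in lebO. x \<in> {s + (t - s) / 4<..<t - (t - s) / 4} \<longrightarrow> f x = k \<Longrightarrow> \<bar>k\<bar> \<le> c * norm_L2 u"
proof -
  obtain \<phi> C m where \<phi>: "\<phi> \<in> Linf" "C \<ge> 0" "m > 0" "(LINT x|lebO. \<phi> x) = m" "\<And>x. x \<in> \<Omega> \<Longrightarrow> \<phi> x \<ge> 0"
    and \<phi>0: "\<And>x. x \<in> \<Omega> \<Longrightarrow> x \<le> s + (t - s) / 4 \<or> t - (t - s) / 4 \<le> x \<Longrightarrow> \<phi> x = 0"
    and \<phi>C: "\<And>f u. is_sol H10 f u \<Longrightarrow> \<bar>L2_inner f \<phi>\<bar> \<le> C * norm_L2 u"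
    by (rule local_mean_weight[OF st]) (rule that)
  have "\<bar>k\<bar> \<le> C / m * norm_L2 u"
    if f: "f \<in> Linf" and u: "is_sol H10 f u"
      and k: "AE x in lebO. x \<in> {s + (t - s) / 4<..<t - (t - s) / 4} \<longrightarrow> f x = k" for f u k
  proof -
    have "L2_inner f \<phi> = (LINT x|lebO. k * \<phi> x)"
      unfolding L2_inner_def
    proof (rule integral_cong_AE)
      show "AE x in lebO. f x * \<phi> x = k * \<phi> x"
        using k AE_space
      proof eventually_elim
        case (elim x)
        show ?case
        proof (cases "x \<in> {s + (t - s) / 4<..<t - (t - s) / 4}")
          case True
          then show ?thesis using elim by simp
        next
          case False
          then have "\<phi> x = 0" using \<phi>0[of x] elim by auto
          then show ?thesis by simp
        qed
      qed
    qed (use f \<phi>(1) in \<open>auto intro: Linf_measurable Linf_mult Linf_cmult\<close>)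
    also have "\<dots> = k * m" using \<phi>(4) by simp
    finally have "\<bar>k\<bar> * m \<le> C * norm_L2 u" using \<phi>C[OF u] \<phi>(3) by (simp add: abs_mult)
    then show ?thesis using \<phi>(3) by (simp add: field_simps)
  qed
  then show thesis using \<phi>(2,3) by (intro that[of "C / m"]) auto
qed

lemma continuous_flux:
  assumes "bvp (\<lambda>x. - prim f x) u c" "f \<in> Linf"
  shows "continuous_on {0..1} (\<lambda>s. flux (\<lambda>x. - prim f x) u c s / a s)"
proof -
  have "continuous_on {0..1} u" using assms(1) by (simp add: bvp_def)
  moreover have "\<forall>s\<in>{0..1}. a s \<noteq> 0" using a_pos by force
  ultimately show ?thesis unfolding flux_def
    by (intro continuous_intros prim_continuous Linf_integrable d0_mult_Linf assms a_continuous)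
qed

lemma adjoint_is_sol:
  assumes "adjoint_state a d\<^sub>0 u\<^sub>d u z"
  shows "is_sol H10 (\<lambda>x. u x - u\<^sub>d x) z"
proof -
  have z: "z \<in> H10" "\<And>w. w \<in> H10 \<Longrightarrow> bform a d\<^sub>0 w z = L2_inner w (\<lambda>x. u x - u\<^sub>d x)"
    using assms by (auto simp: adjoint_state_def)
  have "bform a d\<^sub>0 z w = L2_inner (\<lambda>x. u x - u\<^sub>d x) w" if w: "w \<in> H10" for w
    using bform_commute[OF z(1) z(1) w] z(2)[OF w] by (simp add: L2_inner_commute)
  then show ?thesis using z(1) by (simp add: is_sol_def)
qed

text \<open>The classical solution of the integrated equation has a continuous derivative, and a continuous
  representative agrees with it everywhere.\<close>

lemma is_sol_differentiable:
  assumes f: "f \<in> Linf" and z: "is_sol H10 f z" and c: "continuous_on {0..1} z" and y: "y \<in> \<Omega>"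
  shows "(z has_real_derivative deriv z y) (at y)"
proof -
  obtain v b where v: "bvp (\<lambda>x. - prim f x) v b" using bvp_exists[OF neg_prim_Linf[OF f]] .
  define g where "g s = flux (\<lambda>x. - prim f x) v b s / a s" for s
  have gc: "continuous_on {0..1} g" unfolding g_def[abs_def] by (rule continuous_flux[OF v f])
  have vc: "continuous_on {0..1} v" "\<And>x. x \<in> {0..1} \<Longrightarrow> v x = prim g x"
    using v by (auto simp: bvp_def g_def[abs_def])
  have "AE x in lebO. z x = v x" by (rule is_sol_AE_eq[OF adm_H10 z bvp_is_sol[OF f v]])
  then have zv: "z x = prim g x" if "x \<in> {0..1}" for x
    using lebO_ae_eq_continuous[OF c vc(1) _ that] vc(2)[OF that] by simp
  have "(z has_real_derivative g y) (at y)"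
    by (rule has_field_derivative_transform_within_open[OF prim_has_deriv[OF gc y], of \<Omega>])
      (use y zv in auto)
  then show ?thesis by (metis DERIV_imp_deriv)
qed

lemma is_sol_FE_sup:
  assumes p: "is_partition l x" and f: "f \<in> L2" and w: "is_sol (FE_space l x) f w" and t: "t \<in> {0..1}"
  shows "\<bar>w t\<bar> \<le> norm_L2 f / \<nu>"
proof -
  have wF: "w \<in> FE_space l x" using w by (simp add: is_sol_def)
  obtain g where g: "ac0 w g" using FE_ac0[OF p wF] by blast
  then have gL: "g \<in> L2" by (simp add: ac0_def)
  have "w t = prim g t"
    by (rule lebO_ae_eq_continuous[OF _ prim_continuous[OF L2_integrable[OF gL]] _ t])
      (use wF g in \<open>auto simp: FE_space_def ac0_def\<close>)
  then have "\<bar>w t\<bar> \<le> norm_L2 g" using prim_le_L2[OF gL, of t] t by simp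
  also have "\<dots> \<le> norm_L2 f / \<nu>" by (rule is_sol_energy[OF adm_FE[OF p] w f g])
  finally show ?thesis .
qed

text \<open>The constants: \<open>c1\<close> and \<open>c2\<close> are those of the finite element error for the optimal control and for the adjoint
  equation, \<open>c3\<close> that of the first order estimate, \<open>c5\<close> bounds the uniform difference of the adjoint states by \<open>c5 h\<close>,
  and \<open>c7\<close> belongs to the \<open>L\<^sup>1\<close> estimate of the controls. For \<open>h \<le> h\<^sub>0\<close> the neighbourhoods of the active
  points take up at most a quarter of each gap at either end.\<close>

lemma state_error:
  assumes q: "opt H10 q" and adj: "adjoint_state a d\<^sub>0 u\<^sub>d (sol H10 q) z"
    and fin: "finite {x \<in> \<Omega>. \<bar>prim z x\<bar> = \<alpha>}"
    and der: "\<And>x. x \<in> \<Omega> \<Longrightarrow> \<bar>prim z x\<bar> = \<alpha> \<Longrightarrow> deriv z x \<noteq> 0"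
  obtains C h\<^sub>0 where "C > 0" "h\<^sub>0 > 0"
    "\<And>l x q\<^sub>h. is_partition l x \<Longrightarrow> mesh_width l x \<le> h\<^sub>0 \<Longrightarrow> opt (FE_space l x) q\<^sub>h \<Longrightarrow>
      norm_L2 (\<lambda>t. sol (FE_space l x) q\<^sub>h t - sol H10 q t) \<le> C * (mesh_width l x)\<^sup>2"
proof -
  note qL = BV_Linf[OF opt_BV[OF q]]
  define u where "u = sol H10 q"
  have u: "is_sol H10 q u" unfolding u_def by (rule sol_op_is_sol[OF adm_H10 qL])
  have uL: "u \<in> Linf" by (rule is_sol_Linf[OF adm_H10 u])
  have dL: "(\<lambda>x. u x - u\<^sub>d x) \<in> Linf" by (intro Linf_diff uL ud)
  have z: "is_sol H10 (\<lambda>x. u x - u\<^sub>d x) z" using adjoint_is_sol[OF adj] by (simp add: u_def)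
  note z' = z[unfolded u_def]
  have zc: "continuous_on {0..1} z" using adj by (simp add: adjoint_state_def)
  define Z where "Z = {x \<in> \<Omega>. \<bar>prim z x\<bar> = \<alpha>}"
  have Z: "finite Z" "Z \<subseteq> \<Omega>" using fin by (auto simp: Z_def)
  have derZ: "\<exists>c. c \<noteq> 0 \<and> (z has_real_derivative c) (at y)" if "y \<in> {x \<in> \<Omega>. \<bar>prim z x\<bar> = \<alpha>}" for y
    using is_sol_differentiable[OF dL z zc, of y] der[of y] that by auto
  obtain \<kappa> \<delta>\<^sub>0 where \<kappa>: "\<kappa> > 0" and \<delta>0: "\<delta>\<^sub>0 > 0" and active:
    "\<forall>\<zeta> \<delta> x. continuous_on {0..1} \<zeta> \<and> (\<forall>y\<in>{0..1}. \<bar>\<zeta> y - z y\<bar> \<le> \<delta> \<and> \<bar>prim \<zeta> y\<bar> \<le> \<alpha>) \<and> \<delta> \<le> \<delta>\<^sub>0 \<and>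
      x \<in> \<Omega> \<and> \<bar>prim \<zeta> x\<bar> = \<alpha> \<longrightarrow> (\<exists>y\<in>Z. \<bar>x - y\<bar> \<le> \<delta> / \<kappa>)"
    unfolding Z_def
    by (rule active_set_stability[OF alpha zc opt_mean[OF adm_H10 q z'] opt_bound[OF adm_H10 q z'] fin derZ], assumption+)
  define J where "J = gaps Z"
  have J: "finite J" unfolding J_def by (rule gaps_finite[OF Z(1)])
  define \<gamma> where "\<gamma> = Min (insert 1 ((\<lambda>p. snd p - fst p) ` J))"
  have \<gamma>: "\<gamma> > 0" "\<And>p. p \<in> J \<Longrightarrow> \<gamma> \<le> snd p - fst p"
  proof -
    have "snd p - fst p > 0" if "p \<in> J" for p
      using gaps_props(2)[OF Z(2), of "fst p" "snd p"] that by (simp add: J_def)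
    then show "\<gamma> > 0" using J by (auto simp: \<gamma>_def)
  qed (use J in \<open>auto simp: \<gamma>_def\<close>)
  have "\<exists>c. c \<ge> 0 \<and> (\<forall>f u k. f \<in> Linf \<longrightarrow> is_sol H10 f u \<longrightarrow>
      (AE x in lebO. x \<in> {fst p + (snd p - fst p) / 4<..<snd p - (snd p - fst p) / 4} \<longrightarrow> f x = k) \<longrightarrow> \<bar>k\<bar> \<le> c * norm_L2 u)"
    if "p \<in> J" for p
  proof -
    have "0 \<le> fst p" "fst p < snd p" "snd p \<le> 1"
      using gaps_props[OF Z(2), of "fst p" "snd p"] that by (auto simp: J_def)
    then obtain c where "c \<ge> 0" "\<And>f u k. f \<in> Linf \<Longrightarrow> is_sol H10 f u \<Longrightarrow>
        AE x in lebO. x \<in> {fst p + (snd p - fst p) / 4<..<snd p - (snd p - fst p) / 4} \<longrightarrow> f x = k \<Longrightarrow> \<bar>k\<bar> \<le> c * norm_L2 u"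
      by (rule local_constant_bound) (rule that)
    then show ?thesis by (intro exI[of _ c]) simp
  qed
  then have "\<forall>p\<in>J. \<exists>c. c \<ge> 0 \<and> (\<forall>f u k. f \<in> Linf \<longrightarrow> is_sol H10 f u \<longrightarrow>
      (AE x in lebO. x \<in> {fst p + (snd p - fst p) / 4<..<snd p - (snd p - fst p) / 4} \<longrightarrow> f x = k) \<longrightarrow> \<bar>k\<bar> \<le> c * norm_L2 u)"
    by (rule ballI)
  from bchoice[OF this] obtain cf where cf0: "\<forall>p\<in>J. cf p \<ge> 0 \<and> (\<forall>f u k. f \<in> Linf \<longrightarrow> is_sol H10 f u \<longrightarrow>
      (AE x in lebO. x \<in> {fst p + (snd p - fst p) / 4<..<snd p - (snd p - fst p) / 4} \<longrightarrow> f x = k) \<longrightarrow> \<bar>k\<bar> \<le> cf p * norm_L2 u)"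
    by (elim exE)
  have cf: "\<And>p. p \<in> J \<Longrightarrow> cf p \<ge> 0"
    "\<And>p f u k. p \<in> J \<Longrightarrow> f \<in> Linf \<Longrightarrow> is_sol H10 f u \<Longrightarrow>
      AE x in lebO. x \<in> {fst p + (snd p - fst p) / 4<..<snd p - (snd p - fst p) / 4} \<longrightarrow> f x = k \<Longrightarrow> \<bar>k\<bar> \<le> cf p * norm_L2 u"
    using cf0 by (simp, simp)
  obtain CE where CE: "CE > 0"
    "\<And>l x f F u u\<^sub>h. is_partition l x \<Longrightarrow> f \<in> Linf \<Longrightarrow> AE s in lebO. \<bar>f s\<bar> \<le> F \<Longrightarrow> F \<ge> 0 \<Longrightarrow>
      is_sol H10 f u \<Longrightarrow> is_sol (FE_space l x) f u\<^sub>h \<Longrightarrow>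
      AE t in lebO. \<bar>u t - u\<^sub>h t\<bar> \<le> CE * F * (mesh_width l x)\<^sup>2"
    using FE_error_AE by blast
  obtain Q h\<^sub>1 where Q: "Q \<ge> 0" and h1: "h\<^sub>1 > 0" and Qb:
    "\<And>l x q. is_partition l x \<Longrightarrow> mesh_width l x \<le> h\<^sub>1 \<Longrightarrow> opt (FE_space l x) q \<Longrightarrow> AE t in lebO. \<bar>q t\<bar> \<le> Q"
    using control_bound by blast
  obtain F where F: "F \<ge> 0" "AE t in lebO. \<bar>q t\<bar> \<le> F" using qL by (rule LinfE)
  obtain G where G: "G \<ge> 0" "AE t in lebO. \<bar>u t - u\<^sub>d t\<bar> \<le> G" using dL by (rule LinfE)
  define B where "B = Q + F"
  have B: "B \<ge> 0" using Q F by (simp add: B_def)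
  define c1 where "c1 = CE * F"
  define c2 where "c2 = CE * G"
  have c12: "c1 \<ge> 0" "c2 \<ge> 0" using CE(1) F(1) G(1) by (auto simp: c1_def c2_def)
  define c3 where "c3 = c1 + sqrt (c2 * B)"
  define c5 where "c5 = c2 + c3 / \<nu> + 1"
  have c35: "c3 \<ge> 0" "c5 > 0" using c12 B nu by (auto simp: c3_def c5_def intro!: add_nonneg_pos)
  define c7 where "c7 = (\<Sum>p\<in>J. cf p * (CE * Q + 1) + 2 * B * ((c2 + 1 / \<nu>) / \<kappa>))"
  have c7: "c7 \<ge> 0" unfolding c7_def
    using cf(1) CE(1) Q B c12 nu \<kappa> by (intro sum_nonneg add_nonneg_nonneg mult_nonneg_nonneg divide_nonneg_pos) auto
  define C where "C = c1 + c2 * c7 + sqrt (c2 * c7) + 1"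
  have C: "C > 0" unfolding C_def using c12 c7 by (intro add_nonneg_pos add_nonneg_nonneg) auto
  define h\<^sub>0 where "h\<^sub>0 = min h\<^sub>1 (min (\<delta>\<^sub>0 / c5) (\<kappa> * \<gamma> / (4 * c5)))"
  have h0: "h\<^sub>0 > 0" using h1 \<delta>0 c35 \<kappa> \<gamma> by (simp add: h\<^sub>0_def)
  have "norm_L2 (\<lambda>t. sol (FE_space l x) q\<^sub>h t - sol H10 q t) \<le> C * (mesh_width l x)\<^sup>2"
    if p: "is_partition l x" and hh: "mesh_width l x \<le> h\<^sub>0" and qh: "opt (FE_space l x) q\<^sub>h" for l x q\<^sub>h
  proof -
    define W where "W = FE_space l x"
    define h where "h = mesh_width l x"
    have h: "h > 0" "h \<le> 1" "h \<le> h\<^sub>1" "c5 * h \<le> \<delta>\<^sub>0" "c5 * h \<le> \<kappa> * \<gamma> / 4"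
      using mesh_width_pos[OF p] mesh_width_le_1[OF p] hh c35 by (auto simp: h_def h\<^sub>0_def field_simps)
    have hsq: "h\<^sup>2 \<le> h" using h by (simp add: power2_eq_square mult_left_le)
    note W = adm_FE[OF p, folded W_def] and qh' = qh[folded W_def]
    note qhL = BV_Linf[OF opt_BV[OF qh]]
    have qhQ: "AE t in lebO. \<bar>q\<^sub>h t\<bar> \<le> Q" using Qb[OF p _ qh] h(3) by (simp add: h_def)
    define u\<^sub>h where "u\<^sub>h = sol W q\<^sub>h"
    have uh: "is_sol W q\<^sub>h u\<^sub>h" unfolding u\<^sub>h_def by (rule sol_op_is_sol[OF W qhL])
    have uhL: "u\<^sub>h \<in> Linf" by (rule is_sol_Linf[OF W uh])
    have dhL: "(\<lambda>x. u\<^sub>h x - u\<^sub>d x) \<in> Linf" by (intro Linf_diff uhL ud)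
    define v\<^sub>h where "v\<^sub>h = sol W q"
    have vh: "is_sol W q v\<^sub>h" unfolding v\<^sub>h_def by (rule sol_op_is_sol[OF W qL])
    define zt where "zt = sol W (\<lambda>x. u x - u\<^sub>d x)"
    define zh where "zh = sol W (\<lambda>x. u\<^sub>h x - u\<^sub>d x)"
    have zt: "is_sol W (\<lambda>x. u x - u\<^sub>d x) zt" unfolding zt_def by (rule sol_op_is_sol[OF W dL])
    have zh: "is_sol W (\<lambda>x. u\<^sub>h x - u\<^sub>d x) zh" unfolding zh_def by (rule sol_op_is_sol[OF W dhL])
    define e where "e = norm_L2 (\<lambda>t. u\<^sub>h t - u t)"
    have e: "e \<ge> 0" by (simp add: e_def)
    define r where "r t = q\<^sub>h t - q t" for t
    have rL: "r \<in> Linf" unfolding r_def[abs_def] by (intro Linf_diff qL qhL)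
    have rB: "AE t in lebO. \<bar>r t\<bar> \<le> B" using qhQ F(2) by eventually_elim (auto simp: r_def B_def)
    define R where "R = (LINT t|lebO. \<bar>r t\<bar>)"
    have "R \<le> (LINT t|lebO. B)" unfolding R_def
      by (rule integral_mono_AE) (use Linf_integrable[OF rL] rB in auto)
    then have RB: "R \<le> B" by simp
    have n1: "norm_L2 (\<lambda>t. u t - v\<^sub>h t) \<le> c1 * h\<^sup>2"
      unfolding c1_def
      by (rule norm_L2_bounded)
        (use CE(2)[OF p qL F(2,1) u vh[unfolded W_def]] CE(1) F(1) uL is_sol_Linf[OF W vh] in
          \<open>auto simp: h_def intro!: Linf_measurable Linf_diff\<close>)
    have n2: "AE t in lebO. \<bar>z t - zt t\<bar> \<le> c2 * h\<^sup>2"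
      using CE(2)[OF p dL G(2,1) z zt[unfolded W_def]] by (simp add: c2_def h_def)
    have basic: "e\<^sup>2 \<le> c1 * h\<^sup>2 * e + c2 * h\<^sup>2 * R"
      using basic_estimate[OF p q qh z', of "c1 * h\<^sup>2" "c2 * h\<^sup>2"] n1 n2
      unfolding e_def R_def r_def u\<^sub>h_def v\<^sub>h_def zt_def u_def W_def by simp
    \<comment> \<open>A first, suboptimal rate from the boundedness of the controls.\<close>
    have e_h: "e \<le> c3 * h"
    proof -
      have "e\<^sup>2 \<le> c1 * h\<^sup>2 * e + c2 * h\<^sup>2 * B"
        using basic mult_left_mono[OF RB, of "c2 * h\<^sup>2"] c12 by simp
      then have "e \<le> c1 * h\<^sup>2 + sqrt (c2 * h\<^sup>2 * B)" using c12 B e by (intro quadratic_bound) auto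
      also have "sqrt (c2 * h\<^sup>2 * B) = sqrt (c2 * B) * h" using h by (simp add: real_sqrt_mult)
      also have "c1 * h\<^sup>2 + sqrt (c2 * B) * h \<le> c1 * h + sqrt (c2 * B) * h" using hsq c12 by (simp add: mult_left_mono)
      finally show ?thesis by (simp add: c3_def distrib_right)
    qed
    define \<delta> where "\<delta> = c2 * h\<^sup>2 + e / \<nu>"
    have \<delta>p: "\<delta> \<ge> 0" using c12 e nu by (simp add: \<delta>_def)
    have "\<delta> \<le> c2 * h + c3 * h / \<nu>"
      unfolding \<delta>_def using hsq c12 e_h nu by (intro add_mono mult_left_mono divide_right_mono) auto
    also have "\<dots> \<le> c5 * h" using h by (simp add: c5_def distrib_right)
    finally have \<delta>h: "\<delta> \<le> c5 * h" .
    have zhF: "zh \<in> FE_space l x" "zt \<in> FE_space l x" using zh zt by (auto simp: is_sol_def W_def)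
    have zhc: "continuous_on {0..1} zh" "continuous_on {0..1} zt" using zhF by (auto simp: FE_space_def)
    have zz: "\<bar>zh y - z y\<bar> \<le> \<delta>" if y: "y \<in> {0..1}" for y
    proof -
      have "\<bar>z y - zt y\<bar> \<le> c2 * h\<^sup>2"
        by (rule continuous_AE_bound[OF _ n2 _ y]) (use zc zhc c12 in \<open>auto intro!: continuous_intros\<close>)
      moreover have "\<bar>zh y - zt y\<bar> \<le> e / \<nu>"
      proof -
        have "is_sol (FE_space l x) (\<lambda>x. u\<^sub>h x - u x) (\<lambda>x. zh x - zt x)"
          using is_sol_diff[OF W zh zt dhL dL] by (simp add: W_def)
        from is_sol_FE_sup[OF p Linf_L2[OF Linf_diff[OF uhL uL]] this y]
        show ?thesis by (simp add: e_def)
      qed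
      ultimately show ?thesis unfolding \<delta>_def by linarith
    qed
    define \<eta> where "\<eta> = \<delta> / \<kappa>"
    have \<eta>: "\<eta> \<ge> 0" "\<eta> \<le> \<gamma> / 4" using \<delta>p \<kappa> \<delta>h h(5) by (auto simp: \<eta>_def pos_divide_le_eq mult.commute)
    note zh' = zh[unfolded u\<^sub>h_def]
    have near: "\<exists>y\<in>Z. \<bar>s - y\<bar> \<le> \<eta>" if "s \<in> \<Omega>" "\<bar>prim zh s\<bar> = \<alpha>" for s
      unfolding \<eta>_def
      by (rule active[rule_format]) (use zhc(1) zz \<delta>h h(4) opt_bound[OF W qh' zh'] that in auto)
    define U where "U = sol H10 q\<^sub>h"
    have U: "is_sol H10 q\<^sub>h U" unfolding U_def by (rule sol_op_is_sol[OF adm_H10 qhL])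
    have rU: "is_sol H10 r (\<lambda>t. U t - u t)" using is_sol_diff[OF adm_H10 U u qhL qL] by (simp add: r_def[abs_def])
    have nU: "norm_L2 (\<lambda>t. U t - u t) \<le> CE * Q * h\<^sup>2 + e"
    proof -
      have "norm_L2 (\<lambda>t. U t - u\<^sub>h t) \<le> CE * Q * h\<^sup>2"
        by (rule norm_L2_bounded)
          (use CE(2)[OF p qhL qhQ Q U uh[unfolded W_def]] CE(1) Q uhL is_sol_Linf[OF adm_H10 U] in
            \<open>auto simp: h_def intro!: Linf_measurable Linf_diff\<close>)
      moreover have "norm_L2 (\<lambda>t. (U t - u\<^sub>h t) + (u\<^sub>h t - u t)) \<le> norm_L2 (\<lambda>t. U t - u\<^sub>h t) + norm_L2 (\<lambda>t. u\<^sub>h t - u t)"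
        by (rule norm_L2_triangle) (use uhL uL is_sol_Linf[OF adm_H10 U] in \<open>auto intro!: Linf_L2 Linf_diff\<close>)
      ultimately show ?thesis by (simp add: e_def)
    qed
    \<comment> \<open>Between neighbouring active points the two controls differ by a small constant, up to the
      neighbourhoods to which the jumps are confined.\<close>
    have piece: "(LINT t|lebO. indicator {s<..<s'} t * \<bar>r t\<bar>) \<le> (cf (s, s') * (CE * Q + 1) + 2 * B * ((c2 + 1 / \<nu>) / \<kappa>)) * (h\<^sup>2 + e)"
      if ss: "(s, s') \<in> J" for s s'
    proof -
      have g: "0 \<le> s" "s < s'" "s' \<le> 1" "{s<..<s'} \<inter> Z = {}" using gaps_props[OF Z(2), of s s'] ss by (auto simp: J_def)
      have \<eta>s: "\<eta> \<le> (s' - s) / 4" using \<eta>(2) \<gamma>(2)[OF ss] by simp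
      obtain kq where kq: "AE t in lebO. t \<in> {s<..<s'} \<longrightarrow> q t = kq"
      proof (rule opt_constant[OF adm_H10 q z' g(1-3)])
        fix t assume t: "t \<in> {s<..<s'}"
        then have "t \<in> \<Omega>" "t \<notin> Z" using g by auto
        then show "\<bar>prim z t\<bar> < \<alpha>" using opt_bound[OF adm_H10 q z', of t] by (force simp: Z_def)
      qed (rule that)
      have g': "0 \<le> s + \<eta>" "s + \<eta> < s' - \<eta>" "s' - \<eta> \<le> 1" using g \<eta>(1) \<eta>s by auto
      obtain kh where kh: "AE t in lebO. t \<in> {s + \<eta><..<s' - \<eta>} \<longrightarrow> q\<^sub>h t = kh"
      proof (rule opt_constant[OF W qh' zh' g'])
        fix t assume t: "t \<in> {s + \<eta><..<s' - \<eta>}"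
        then have tO: "t \<in> \<Omega>" using g' by auto
        have "\<bar>prim zh t\<bar> \<noteq> \<alpha>"
        proof
          assume "\<bar>prim zh t\<bar> = \<alpha>"
          then obtain y where y: "y \<in> Z" "\<bar>t - y\<bar> \<le> \<eta>" using near[OF tO] by blast
          then have "y \<in> {s<..<s'}" using t by auto
          then show False using y(1) g(4) by auto
        qed
        moreover have "\<bar>prim zh t\<bar> \<le> \<alpha>" using tO by (intro opt_bound[OF W qh' zh']) auto
        ultimately show "\<bar>prim zh t\<bar> < \<alpha>" by simp
      qed (rule that)
      have rk: "AE t in lebO. t \<in> {s + \<eta><..<s' - \<eta>} \<longrightarrow> r t = kh - kq"
        using kq kh by eventually_elim (use \<eta>(1) in \<open>auto simp: r_def\<close>)
      then have "AE t in lebO. t \<in> {s + (s' - s) / 4<..<s' - (s' - s) / 4} \<longrightarrow> r t = kh - kq"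
      proof eventually_elim
        case (elim t)
        show ?case
        proof
          assume "t \<in> {s + (s' - s) / 4<..<s' - (s' - s) / 4}"
          then have "s + (s' - s) / 4 < t" "t < s' - (s' - s) / 4" by auto
          then have "s + \<eta> < t" "t < s' - \<eta>" using \<eta>s by linarith+
          then show "r t = kh - kq" using elim by simp
        qed
      qed
      then have k: "\<bar>kh - kq\<bar> \<le> cf (s, s') * (CE * Q * h\<^sup>2 + e)"
        using cf(2)[OF ss rL rU, of "kh - kq"] mult_left_mono[OF nU cf(1)[OF ss]] by simp
      have "(LINT t|lebO. indicator {s<..<s'} t * \<bar>r t\<bar>) \<le> cf (s, s') * (CE * Q * h\<^sup>2 + e) + 2 * B * \<eta>"
      proof (rule L1_on_interval[OF rL rB B \<eta>(1)])
        show "0 \<le> cf (s, s') * (CE * Q * h\<^sup>2 + e)" using k by linarith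
        show "AE t in lebO. t \<in> {s + \<eta><..<s' - \<eta>} \<longrightarrow> \<bar>r t\<bar> \<le> cf (s, s') * (CE * Q * h\<^sup>2 + e)"
          using rk by eventually_elim (use k in auto)
      qed
      also have "\<dots> \<le> cf (s, s') * ((CE * Q + 1) * (h\<^sup>2 + e)) + 2 * B * ((c2 + 1 / \<nu>) / \<kappa> * (h\<^sup>2 + e))"
      proof (intro add_mono mult_left_mono)
        show "CE * Q * h\<^sup>2 + e \<le> (CE * Q + 1) * (h\<^sup>2 + e)" using CE(1) Q e by (simp add: algebra_simps)
        have "\<delta> \<le> (c2 + 1 / \<nu>) * (h\<^sup>2 + e)" using c12 e nu by (simp add: \<delta>_def algebra_simps)
        then show "\<eta> \<le> (c2 + 1 / \<nu>) / \<kappa> * (h\<^sup>2 + e)"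
          using \<kappa> by (simp add: \<eta>_def divide_right_mono)
      qed (use cf(1)[OF ss] B in auto)
      finally show ?thesis by (simp add: distrib_right mult.assoc)
    qed
    have "R \<le> (\<Sum>(s, s')\<in>J. (LINT t|lebO. indicator {s<..<s'} t * \<bar>r t\<bar>))"
      unfolding R_def J_def by (rule L1_by_gaps[OF rL Z(1)])
    also have "\<dots> \<le> (\<Sum>p\<in>J. (cf p * (CE * Q + 1) + 2 * B * ((c2 + 1 / \<nu>) / \<kappa>)) * (h\<^sup>2 + e))"
      by (rule sum_mono) (use piece in auto)
    also have "\<dots> = c7 * (h\<^sup>2 + e)" by (simp add: c7_def sum_distrib_right)
    finally have R: "R \<le> c7 * (h\<^sup>2 + e)" .
    have "e\<^sup>2 \<le> c1 * h\<^sup>2 * e + c2 * h\<^sup>2 * (c7 * (h\<^sup>2 + e))"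
      using basic mult_left_mono[OF R, of "c2 * h\<^sup>2"] c12 by simp
    also have "\<dots> = ((c1 + c2 * c7) * h\<^sup>2) * e + c2 * c7 * (h\<^sup>2)\<^sup>2"
      by (simp add: algebra_simps power2_eq_square)
    finally have "e \<le> (c1 + c2 * c7) * h\<^sup>2 + sqrt (c2 * c7 * (h\<^sup>2)\<^sup>2)"
      using e c12 c7 by (intro quadratic_bound) auto
    also have "sqrt (c2 * c7 * (h\<^sup>2)\<^sup>2) = sqrt (c2 * c7) * h\<^sup>2" unfolding real_sqrt_mult real_sqrt_abs by simp
    also have "(c1 + c2 * c7) * h\<^sup>2 + sqrt (c2 * c7) * h\<^sup>2 \<le> C * h\<^sup>2" by (simp add: C_def distrib_right)
    finally show ?thesis by (simp add: e_def u\<^sub>h_def W_def u_def h_def)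
  qed
  then show thesis using that[OF C h0] by blast
qed

end

theorem theorem4p10:
  fixes \<alpha> \<nu> :: real and a d\<^sub>0 u\<^sub>d q_bar u_bar z_bar \<Phi>_bar :: "real \<Rightarrow> real"
  assumes "\<alpha> > 0"
    and "u\<^sub>d \<in> Linf"
    and "\<exists>L. L-lipschitz_on {0..1} a"
    and "\<nu> > 0" and "\<forall>x\<in>{0..1}. a x \<ge> \<nu>"
    and "d\<^sub>0 \<in> Linf" and "AE x in lebesgue_on \<Omega>. d\<^sub>0 x \<ge> 0"
    and "optimal_control H10 a d\<^sub>0 u\<^sub>d \<alpha> q_bar"
    and "u_bar = sol_op H10 a d\<^sub>0 q_bar"
    and "adjoint_state a d\<^sub>0 u\<^sub>d u_bar z_bar"
    and "\<forall>x\<in>{0..1}. \<Phi>_bar x = integral {0..x} z_bar"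
    and "finite {x \<in> \<Omega>. \<bar>\<Phi>_bar x\<bar> = \<alpha>}"
    and "\<forall>x \<in> {x \<in> \<Omega>. \<bar>\<Phi>_bar x\<bar> = \<alpha>}. deriv z_bar x \<noteq> 0"
  shows "\<exists>C h\<^sub>0 :: real. C > 0 \<and> h\<^sub>0 > 0 \<and>
    (\<forall>(l::nat) (x :: nat \<Rightarrow> real) q_h.
      is_partition l x \<and> mesh_width l x \<le> h\<^sub>0 \<and>
      optimal_control (FE_space l x) a d\<^sub>0 u\<^sub>d \<alpha> q_h \<longrightarrow>
      norm_L2 (\<lambda>t. sol_op (FE_space l x) a d\<^sub>0 q_h t - u_bar t) \<le> C * (mesh_width l x)\<^sup>2)"
proof -
  obtain L where L: "L-lipschitz_on {0..1} a" using assms(3) by blast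
  obtain D where D: "D \<ge> 0" "AE x in lebO. \<bar>d\<^sub>0 x\<bar> \<le> D" using assms(6) by (rule LinfE)
  interpret control_problem a d\<^sub>0 \<nu> L D \<alpha> u\<^sub>d
    by standard (use assms L D Linf_measurable[OF assms(6)] in auto)
  have \<Phi>: "\<Phi>_bar x = prim z_bar x" if "x \<in> \<Omega>" for x
    using assms(11) that by (simp add: prim_def)
  then have eq: "{x \<in> \<Omega>. \<bar>\<Phi>_bar x\<bar> = \<alpha>} = {x \<in> \<Omega>. \<bar>prim z_bar x\<bar> = \<alpha>}" by auto
  have adj: "adjoint_state a d\<^sub>0 u\<^sub>d (sol_op H10 a d\<^sub>0 q_bar) z_bar" using assms(9,10) by simp
  have fin: "finite {x \<in> \<Omega>. \<bar>prim z_bar x\<bar> = \<alpha>}" using assms(12) unfolding eq .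
  have der: "deriv z_bar x \<noteq> 0" if "x \<in> \<Omega>" "\<bar>prim z_bar x\<bar> = \<alpha>" for x
    using assms(13) that unfolding eq by blast
  obtain C h\<^sub>0 where "C > 0" "h\<^sub>0 > 0"
    "\<And>l x q\<^sub>h. is_partition l x \<Longrightarrow> mesh_width l x \<le> h\<^sub>0 \<Longrightarrow> optimal_control (FE_space l x) a d\<^sub>0 u\<^sub>d \<alpha> q\<^sub>h \<Longrightarrow>
      norm_L2 (\<lambda>t. sol_op (FE_space l x) a d\<^sub>0 q\<^sub>h t - sol_op H10 a d\<^sub>0 q_bar t) \<le> C * (mesh_width l x)\<^sup>2"
    by (rule state_error[OF assms(8) adj fin der], assumption+, rule that)
  then show ?thesis unfolding assms(9) by blast
qed

end
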